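(* Suppose $R$ is a ring with CL-FFRT. Let $f\in R$ be a nonzerodivisor, $I\subseteq R$ be an ideal, and $i\ge 0$ be an integer. Then the local cohomology module $H^i_I(R/fR)$ has closed support, i.e. $\operatorname{Supp}_R\big(H^i_I(R/fR)\big)$ is a closed subset of $\operatorname{Spec}(R)$.
   Context: Let $p$ be a prime. For a commutative ring $R$ of characteristic $p$, an $R$-module $M$ and $e\ge 0$, $F^e_*M$ denotes the abelian group $M$ with the $R$-module structure $x\cdot u=x^{p^e}u$. A commutative ring $R$ of characteristic $p$ is $F$-finite if it is Noetherian and $F_*R=F^1_*R$ is a finitely generated $R$-module. For a complete Noetherian local ring $S$ and a finitely generated $S$-module $M$, $\mathcal{J}(M)$ denotes the finite set of isomorphism classes of indecomposable $S$-modules occurring in the (Krull–Schmidt) decomposition of $M$ into indecomposables. A complete local $F$-finite ring $S$ has FFRT (finite $F$-representation type) if $\bigcup_{e\ge 0}\mathcal{J}(F^e_*S)$ is finite. A ring $R$ has CL-FFRT (complete local finite $F$-representation type) if it is $F$-finite and for every prime $\mathfrak p\subseteq R$ the completion $\widehat{R}_{\mathfrak p}$ of the local ring $R_{\mathfrak p}$ has FFRT. $H^i_I(-)$ denotes the $i$-th local cohomology functor with support in $I$, and $\operatorname{Supp}_R(M)=\{\mathfrak p\in\operatorname{Spec}(R) : M_{\mathfrak p}\ne 0\}$. *)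

theory Defs
  imports
    "HOL-Algebra.Module"
    "HOL-Algebra.QuotRing"
    "HOL-Algebra.Ideal_Product"
    "HOL-Algebra.Ring_Divisibility"
    "HOL-Analysis.Abstract_Topology"
    "HOL-Computational_Algebra.Primes"
begin

section \<open>Modules\<close>

text \<open>
  The record \<open>('a, 'b) module\<close> extends the ring record. In a module the fields \<open>mult\<close> and
  \<open>one\<close> carry no information: neither the locale \<open>module\<close> nor anything below looks at them,
  and they are left \<open>undefined\<close> where there is no natural choice.
\<close>

definition module_hom ::
    "('a, 'r) ring_scheme \<Rightarrow> ('a, 'b, 'm) module_scheme \<Rightarrow> ('a, 'c, 'n) module_scheme \<Rightarrow> ('b \<Rightarrow> 'c) set" where
  "module_hom R M N = {h \<in> carrier M \<rightarrow> carrier N.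
     (\<forall>x\<in>carrier M. \<forall>y\<in>carrier M. h (x \<oplus>\<^bsub>M\<^esub> y) = h x \<oplus>\<^bsub>N\<^esub> h y) \<and>
     (\<forall>a\<in>carrier R. \<forall>x\<in>carrier M. h (a \<odot>\<^bsub>M\<^esub> x) = a \<odot>\<^bsub>N\<^esub> h x)}"

definition module_iso ::
    "('a, 'r) ring_scheme \<Rightarrow> ('a, 'b, 'm) module_scheme \<Rightarrow> ('a, 'c, 'n) module_scheme \<Rightarrow> bool" where
  "module_iso R M N \<longleftrightarrow> (\<exists>h\<in>module_hom R M N. bij_betw h (carrier M) (carrier N))"

definition self_module :: "('a, 'r) ring_scheme \<Rightarrow> ('a, 'a) module" where
  "self_module R = \<lparr>carrier = carrier R, monoid.mult = monoid.mult R, one = one R, zero = zero R, add = add R,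
     smult = monoid.mult R\<rparr>"

definition quotient_module :: "('a, 'b, 'm) module_scheme \<Rightarrow> 'b set \<Rightarrow> ('a, 'b set) module" where
  "quotient_module M N = \<lparr>carrier = a_rcosets\<^bsub>M\<^esub> N, monoid.mult = undefined, one = undefined, zero = N,
     add = set_add M, smult = (\<lambda>a C. \<Union>x\<in>C. N +>\<^bsub>M\<^esub> (a \<odot>\<^bsub>M\<^esub> x))\<rparr>"

definition fg_module :: "('a, 'r) ring_scheme \<Rightarrow> ('a, 'b, 'm) module_scheme \<Rightarrow> bool" where
  "fg_module R M \<longleftrightarrow> (\<exists>A\<subseteq>carrier M. finite A \<and>
     (\<forall>N. submodule N R M \<and> A \<subseteq> N \<longrightarrow> N = carrier M))"

definition indecomposable_module :: "('a, 'r) ring_scheme \<Rightarrow> ('a, 'b, 'm) module_scheme \<Rightarrow> bool" where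
  "indecomposable_module R M \<longleftrightarrow> carrier M \<noteq> {\<zero>\<^bsub>M\<^esub>} \<and>
     (\<forall>K L. submodule K R M \<and> submodule L R M \<and> K <+>\<^bsub>M\<^esub> L = carrier M \<and> K \<inter> L = {\<zero>\<^bsub>M\<^esub>}
        \<longrightarrow> K = {\<zero>\<^bsub>M\<^esub>} \<or> L = {\<zero>\<^bsub>M\<^esub>})"

text \<open>\<open>M\<close> is the internal direct sum of its indecomposable submodules \<open>N 0, \<dots>, N (n - 1)\<close>.\<close>

definition indecomposable_decomposition ::
    "('a, 'r) ring_scheme \<Rightarrow> ('a, 'b, 'm) module_scheme \<Rightarrow> nat \<Rightarrow> (nat \<Rightarrow> 'b set) \<Rightarrow> bool" where
  "indecomposable_decomposition R M n N \<longleftrightarrow>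
     (\<forall>k<n. submodule (N k) R M \<and> indecomposable_module R (M\<lparr>carrier := N k\<rparr>)) \<and>
     bij_betw (\<lambda>x. finsum M x {..<n}) (Pi\<^sub>E {..<n} N) (carrier M)"

text \<open>
  Isomorphism classes are taken among the modules living on a fixed type of elements. This loses
  nothing below, since all the modules \<open>F\<^sup>e\<^sub>* S\<close> and their submodules live on the type of \<open>S\<close>.
\<close>

definition iso_class :: "('a, 'r) ring_scheme \<Rightarrow> ('a, 'b) module \<Rightarrow> ('a, 'b) module set" where
  "iso_class R M = {L. module R L \<and> module_iso R M L}"

definition indec_classes :: "('a, 'r) ring_scheme \<Rightarrow> ('a, 'b) module \<Rightarrow> ('a, 'b) module set set" where
  "indec_classes R M = {iso_class R (M\<lparr>carrier := N k\<rparr>) | N n k.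
     indecomposable_decomposition R M n N \<and> k < n}"


section \<open>Spectrum, localization, support\<close>

definition spec :: "('a, 'r) ring_scheme \<Rightarrow> 'a set set" where
  "spec R = {P. primeideal P R}"

definition zero_locus :: "('a, 'r) ring_scheme \<Rightarrow> 'a set \<Rightarrow> 'a set set" where
  "zero_locus R E = {P \<in> spec R. E \<subseteq> P}"

definition zariski :: "('a, 'r) ring_scheme \<Rightarrow> 'a set topology" where
  "zariski R = topology (\<lambda>U. \<exists>E\<subseteq>carrier R. U = spec R - zero_locus R E)"

text \<open>The fraction \<open>m/s\<close>, as the set of all pairs equivalent to \<open>(m, s)\<close>; denominators outside \<open>P\<close>.\<close>

definition fraction ::
    "('a, 'r) ring_scheme \<Rightarrow> 'a set \<Rightarrow> ('a, 'b, 'm) module_scheme \<Rightarrow> 'b \<Rightarrow> 'a \<Rightarrow> ('b \<times> 'a) set" where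
  "fraction R P M m s = {(m', s'). m' \<in> carrier M \<and> s' \<in> carrier R - P \<and>
     (\<exists>t\<in>carrier R - P. t \<odot>\<^bsub>M\<^esub> (s' \<odot>\<^bsub>M\<^esub> m) = t \<odot>\<^bsub>M\<^esub> (s \<odot>\<^bsub>M\<^esub> m'))}"

definition localized_ring :: "('a, 'r) ring_scheme \<Rightarrow> 'a set \<Rightarrow> ('a \<times> 'a) set ring" where
  "localized_ring R P = (let fr = fraction R P (self_module R) in
     \<lparr>carrier = {fr a s | a s. a \<in> carrier R \<and> s \<in> carrier R - P},
      monoid.mult = (\<lambda>X Y. \<Union>(a, s)\<in>X. \<Union>(b, t)\<in>Y. fr (a \<otimes>\<^bsub>R\<^esub> b) (s \<otimes>\<^bsub>R\<^esub> t)),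
      one = fr \<one>\<^bsub>R\<^esub> \<one>\<^bsub>R\<^esub>,
      zero = fr \<zero>\<^bsub>R\<^esub> \<one>\<^bsub>R\<^esub>,
      add = (\<lambda>X Y. \<Union>(a, s)\<in>X. \<Union>(b, t)\<in>Y.
               fr ((t \<otimes>\<^bsub>R\<^esub> a) \<oplus>\<^bsub>R\<^esub> (s \<otimes>\<^bsub>R\<^esub> b)) (s \<otimes>\<^bsub>R\<^esub> t))\<rparr>)"

definition localized_max_ideal :: "('a, 'r) ring_scheme \<Rightarrow> 'a set \<Rightarrow> ('a \<times> 'a) set set" where
  "localized_max_ideal R P =
     {fraction R P (self_module R) a s | a s. a \<in> P \<and> s \<in> carrier R - P}"

text \<open>The localization of \<open>M\<close> at \<open>P\<close>, as a module over \<open>localized_ring R P\<close>.\<close>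

definition localized_module ::
    "('a, 'r) ring_scheme \<Rightarrow> 'a set \<Rightarrow> ('a, 'b, 'm) module_scheme
       \<Rightarrow> (('a \<times> 'a) set, ('b \<times> 'a) set) module" where
  "localized_module R P M = (let fr = fraction R P M in
     \<lparr>carrier = {fr m s | m s. m \<in> carrier M \<and> s \<in> carrier R - P},
      monoid.mult = undefined,
      one = undefined,
      zero = fr \<zero>\<^bsub>M\<^esub> \<one>\<^bsub>R\<^esub>,
      add = (\<lambda>X Y. \<Union>(m, s)\<in>X. \<Union>(n, t)\<in>Y.
               fr ((t \<odot>\<^bsub>M\<^esub> m) \<oplus>\<^bsub>M\<^esub> (s \<odot>\<^bsub>M\<^esub> n)) (s \<otimes>\<^bsub>R\<^esub> t)),
      smult = (\<lambda>A Y. \<Union>(a, s)\<in>A. \<Union>(n, t)\<in>Y. fr (a \<odot>\<^bsub>M\<^esub> n) (s \<otimes>\<^bsub>R\<^esub> t))\<rparr>)"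

definition supp :: "('a, 'r) ring_scheme \<Rightarrow> ('a, 'b, 'm) module_scheme \<Rightarrow> 'a set set" where
  "supp R M = {P \<in> spec R.
     carrier (localized_module R P M) \<noteq> {\<zero>\<^bsub>localized_module R P M\<^esub>}}"


section \<open>Completion\<close>

text \<open>The power in the monoid of ideals under the ideal product; in particular \<open>I\<^sup>0 = R\<close>.\<close>

definition ideal_pow :: "('a, 'r) ring_scheme \<Rightarrow> 'a set \<Rightarrow> nat \<Rightarrow> 'a set" where
  "ideal_pow R I n = I [^]\<^bsub>ideals_set R\<^esub> n"

text \<open>
  The inverse limit of the rings \<open>A Quot I\<^sup>n\<close>. A coset of \<open>I\<^sup>n\<^sup>+\<^sup>1\<close> is mapped to the coset of \<open>I\<^sup>n\<close>
  containing it, so compatibility of a sequence of cosets is inclusion.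
\<close>

definition completion :: "('a, 'r) ring_scheme \<Rightarrow> 'a set \<Rightarrow> (nat \<Rightarrow> 'a set) ring" where
  "completion A I = (let Q = (\<lambda>n. A Quot (ideal_pow A I n)) in
     \<lparr>carrier = {x. (\<forall>n. x n \<in> carrier (Q n)) \<and> (\<forall>n. x (Suc n) \<subseteq> x n)},
      monoid.mult = (\<lambda>x y n. x n \<otimes>\<^bsub>Q n\<^esub> y n),
      one = (\<lambda>n. \<one>\<^bsub>Q n\<^esub>),
      zero = (\<lambda>n. \<zero>\<^bsub>Q n\<^esub>),
      add = (\<lambda>x y n. x n \<oplus>\<^bsub>Q n\<^esub> y n)\<rparr>)"

definition completed_local_ring ::
    "('a, 'r) ring_scheme \<Rightarrow> 'a set \<Rightarrow> (nat \<Rightarrow> ('a \<times> 'a) set set) ring" where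
  "completed_local_ring R P = completion (localized_ring R P) (localized_max_ideal R P)"


section \<open>Frobenius and finite representation type\<close>

definition has_characteristic :: "('a, 'r) ring_scheme \<Rightarrow> nat \<Rightarrow> bool" where
  "has_characteristic R c \<longleftrightarrow> (\<forall>k::nat. [k] \<cdot>\<^bsub>R\<^esub> \<one>\<^bsub>R\<^esub> = \<zero>\<^bsub>R\<^esub> \<longleftrightarrow> c dvd k)"

definition frobenius_pushforward ::
    "nat \<Rightarrow> nat \<Rightarrow> ('a, 'r) ring_scheme \<Rightarrow> ('a, 'b) module \<Rightarrow> ('a, 'b) module" where
  "frobenius_pushforward p e R M = M\<lparr>smult := (\<lambda>x u. (x [^]\<^bsub>R\<^esub> (p ^ e)) \<odot>\<^bsub>M\<^esub> u)\<rparr>"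

definition F_finite :: "nat \<Rightarrow> ('a, 'r) ring_scheme \<Rightarrow> bool" where
  "F_finite p R \<longleftrightarrow> cring R \<and> has_characteristic R p \<and> noetherian_ring R \<and>
     fg_module R (frobenius_pushforward p 1 R (self_module R))"

text \<open>
  Meant for complete local F-finite rings \<open>S\<close> only. The completed local rings of an F-finite ring
  are of this kind automatically.
\<close>

definition FFRT :: "nat \<Rightarrow> ('a, 'r) ring_scheme \<Rightarrow> bool" where
  "FFRT p S \<longleftrightarrow> finite (\<Union>e. indec_classes S (frobenius_pushforward p e S (self_module S)))"

definition CL_FFRT :: "nat \<Rightarrow> ('a, 'r) ring_scheme \<Rightarrow> bool" where
  "CL_FFRT p R \<longleftrightarrow> F_finite p R \<and> (\<forall>P\<in>spec R. FFRT p (completed_local_ring R P))"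


section \<open>Local cohomology\<close>

text \<open>
  Extension of homomorphisms along injections, tested on the modules whose elements have the type
  of the ring elements. These include all inclusions of ideals \<open>J \<subseteq> R\<close>, so by Baer's criterion
  the property implies extension along arbitrary injections, between modules on any type.
\<close>

definition injective_module :: "('a, 'r) ring_scheme \<Rightarrow> ('a, 'b) module \<Rightarrow> bool" where
  "injective_module R E \<longleftrightarrow> module R E \<and>
     (\<forall>(A :: ('a, 'a) module) (B :: ('a, 'a) module) g h.
        module R A \<and> module R B \<and> g \<in> module_hom R A B \<and> inj_on g (carrier A) \<and>
        h \<in> module_hom R A E
        \<longrightarrow> (\<exists>k\<in>module_hom R B E. \<forall>x\<in>carrier A. k (g x) = h x))"

text \<open>\<open>0 \<rightarrow> M \<rightarrow> E 0 \<rightarrow> E 1 \<rightarrow> \<dots>\<close> is exact, with augmentation \<open>\<epsilon>\<close>, differentials \<open>d n\<close>, all \<open>E n\<close> injective.\<close>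

definition injective_resolution ::
    "('a, 'r) ring_scheme \<Rightarrow> ('a, 'c) module \<Rightarrow> ('c \<Rightarrow> 'b) \<Rightarrow> (nat \<Rightarrow> ('a, 'b) module)
       \<Rightarrow> (nat \<Rightarrow> 'b \<Rightarrow> 'b) \<Rightarrow> bool" where
  "injective_resolution R M \<epsilon> E d \<longleftrightarrow>
     module R M \<and> (\<forall>n. injective_module R (E n)) \<and>
     \<epsilon> \<in> module_hom R M (E 0) \<and> (\<forall>n. d n \<in> module_hom R (E n) (E (Suc n))) \<and>
     inj_on \<epsilon> (carrier M) \<and>
     \<epsilon> ` carrier M = {x \<in> carrier (E 0). d 0 x = \<zero>\<^bsub>E 1\<^esub>} \<and>
     (\<forall>n. d n ` carrier (E n) = {x \<in> carrier (E (Suc n)). d (Suc n) x = \<zero>\<^bsub>E (Suc (Suc n))\<^esub>})"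

text \<open>The \<open>I\<close>-torsion functor, on objects (as a subset of \<open>M\<close>).\<close>

definition torsion_part ::
    "('a, 'r) ring_scheme \<Rightarrow> 'a set \<Rightarrow> ('a, 'b, 'm) module_scheme \<Rightarrow> 'b set" where
  "torsion_part R I M = {x \<in> carrier M. \<exists>n. \<forall>a\<in>ideal_pow R I n. a \<odot>\<^bsub>M\<^esub> x = \<zero>\<^bsub>M\<^esub>}"

definition torsion_cocycles ::
    "('a, 'r) ring_scheme \<Rightarrow> 'a set \<Rightarrow> (nat \<Rightarrow> ('a, 'b) module) \<Rightarrow> (nat \<Rightarrow> 'b \<Rightarrow> 'b) \<Rightarrow> nat \<Rightarrow> 'b set" where
  "torsion_cocycles R I E d i = {x \<in> torsion_part R I (E i). d i x = \<zero>\<^bsub>E (Suc i)\<^esub>}"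

primrec torsion_coboundaries ::
    "('a, 'r) ring_scheme \<Rightarrow> 'a set \<Rightarrow> (nat \<Rightarrow> ('a, 'b) module) \<Rightarrow> (nat \<Rightarrow> 'b \<Rightarrow> 'b) \<Rightarrow> nat \<Rightarrow> 'b set" where
  "torsion_coboundaries R I E d 0 = {\<zero>\<^bsub>E 0\<^esub>}"
| "torsion_coboundaries R I E d (Suc j) = d j ` torsion_part R I (E j)"

text \<open>
  The \<open>i\<close>-th cohomology of the \<open>I\<close>-torsion of the complex \<open>E\<close>: the \<open>i\<close>-th local cohomology of \<open>M\<close>
  with support in \<open>I\<close>, computed from an injective resolution \<open>E\<close> of \<open>M\<close>.
\<close>

definition local_cohomology ::
    "('a, 'r) ring_scheme \<Rightarrow> 'a set \<Rightarrow> nat \<Rightarrow> (nat \<Rightarrow> ('a, 'b) module) \<Rightarrow> (nat \<Rightarrow> 'b \<Rightarrow> 'b)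
       \<Rightarrow> ('a, 'b set) module" where
  "local_cohomology R I i E d =
     quotient_module (E i\<lparr>carrier := torsion_cocycles R I E d i\<rparr>) (torsion_coboundaries R I E d i)"


section \<open>The Zariski topology\<close>

lemma istopology_zariski:
  assumes "cring R"
  shows "istopology (\<lambda>U. \<exists>E\<subseteq>carrier R. U = spec R - zero_locus R E)"
proof -
  interpret cring R by fact
  have inter: "\<exists>E\<subseteq>carrier R. S \<inter> T = spec R - zero_locus R E"
    if "A \<subseteq> carrier R" "S = spec R - zero_locus R A"
       "B \<subseteq> carrier R" "T = spec R - zero_locus R B" for S T A B
  proof (intro exI conjI)
    let ?E = "{a \<otimes>\<^bsub>R\<^esub> b | a b. a \<in> A \<and> b \<in> B}"
    show "?E \<subseteq> carrier R" using that by auto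
    have "A \<subseteq> P \<or> B \<subseteq> P" if P: "primeideal P R" and E: "?E \<subseteq> P" for P
    proof (rule ccontr)
      assume "\<not> (A \<subseteq> P \<or> B \<subseteq> P)"
      then obtain a b where "a \<in> A" "a \<notin> P" "b \<in> B" "b \<notin> P" by blast
      moreover from this have "a \<otimes>\<^bsub>R\<^esub> b \<in> P" using E by blast
      ultimately show False
        using primeideal.I_prime[OF P] \<open>A \<subseteq> carrier R\<close> \<open>B \<subseteq> carrier R\<close> by blast
    qed
    moreover have "?E \<subseteq> P" if P: "primeideal P R" and AB: "A \<subseteq> P \<or> B \<subseteq> P" for P
      using AB ideal.I_l_closed[OF primeideal.axioms(1)[OF P]]
        ideal.I_r_closed[OF primeideal.axioms(1)[OF P]] \<open>A \<subseteq> carrier R\<close> \<open>B \<subseteq> carrier R\<close>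
      by blast
    ultimately have "zero_locus R ?E = zero_locus R A \<union> zero_locus R B"
      unfolding zero_locus_def spec_def by blast
    then show "S \<inter> T = spec R - zero_locus R ?E" using that by blast
  qed
  have union: "\<exists>E\<subseteq>carrier R. \<Union>K = spec R - zero_locus R E"
    if K: "\<forall>U\<in>K. \<exists>E\<subseteq>carrier R. U = spec R - zero_locus R E" for K
  proof -
    obtain e where e: "\<And>U. U \<in> K \<Longrightarrow> e U \<subseteq> carrier R \<and> U = spec R - zero_locus R (e U)"
      using bchoice[OF K] by blast
    have "P \<in> \<Union>K \<longleftrightarrow> P \<in> spec R - zero_locus R (\<Union>(e ` K))" for P
      using e unfolding zero_locus_def by blast
    then show ?thesis using e by (intro exI[of _ "\<Union>(e ` K)"]) blast
  qed
  show ?thesis unfolding istopology_def using inter union by blast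
qed

lemma closedin_zariski_iff:
  assumes "cring R"
  shows "closedin (zariski R) C \<longleftrightarrow> (\<exists>E\<subseteq>carrier R. C = zero_locus R E)"
proof -
  interpret cring R by fact
  have open_iff: "openin (zariski R) U \<longleftrightarrow> (\<exists>E\<subseteq>carrier R. U = spec R - zero_locus R E)" for U
    unfolding zariski_def using istopology_zariski[OF assms] by (simp add: topology_inverse')
  have "zero_locus R {\<one>\<^bsub>R\<^esub>} = {}"
    unfolding zero_locus_def spec_def
    using ideal.one_imp_carrier primeideal.I_notcarr primeideal.axioms(1) by fastforce
  then have "openin (zariski R) (spec R)"
    unfolding open_iff by (intro exI[of _ "{\<one>\<^bsub>R\<^esub>}"]) auto
  then have top: "topspace (zariski R) = spec R"
    unfolding topspace_def using open_iff by blast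
  have sub: "zero_locus R E \<subseteq> spec R" for E unfolding zero_locus_def by blast
  show ?thesis unfolding closedin_def top open_iff using sub by (metis Diff_Diff_Int Diff_subset inf.absorb_iff2)
qed

end

theory Submission
  imports Defs
begin

text \<open>
  Multiplication by $f$ gives the long exact sequence of $0 \to R \to R \to R/fR \to 0$, so
  $H^i_I(R/fR)$ vanishes at a prime $P$ if and only if $f$ is surjective on $H^i_I(R)_P$ and injective on
  $H^{i+1}_I(R)_P$; both have to be shown to be open conditions on $P$. Local cohomology is the colimit over $e$
  of the Koszul cohomology on $x_1^{p^e},\dots,x_n^{p^e}$. Finite representation type, after descent from the
  completion to $R_P$ and to $R$, provides $e_0$, $s \notin P$ and $R$-linear maps
  $\psi_k : F^{e_0+1}_*R \to F^{\epsilon_k}_*R$ and $\varphi_k$ back, with $\epsilon_k \le e_0$ and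
  $\sum_k \varphi_k\psi_k = s$. Through them a condition on cocycles of any level $e$ reduces to the levels
  up to $e_0$, and on these finitely many Noetherian modules one element outside $P$ suffices.
\<close>

section \<open>Modules and their submodules\<close>

text \<open>The obstacle is uniformity. At P every cocycle has its own multiplier, and one
  multiplier serves a whole level because the cochains of a level form a Noetherian module; but
  there are infinitely many levels. They are linked because the Koszul complex of R on the p^e-th
  powers is the one of F^e_*R on x_1,...,x_n, so linear maps between Frobenius pushforwards carry
  cocycles from level to level. The descent yields only g^m with m depending on the cocycle, which
  is enough: a prime avoiding g avoids every g^m. Twisted maps respect divisibility by f only up to
  powers; so surjectivity is studied for f^(p^e0) and injectivity on classes killed by some power of
  f, which amounts to the same locally. Splittings descend from the completion by approximation:
  over R_P the approximate maps compose to an endomorphism close to the identity, which is bijective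
  by Nakayama. Local cohomology is compared with the Koszul colimit by dimension shifting, once
  injective modules are known to be acyclic for it.\<close>

lemma module_hom_closed: "h \<in> module_hom R M N \<Longrightarrow> x \<in> carrier M \<Longrightarrow> h x \<in> carrier N"
  by (auto simp: module_hom_def)

lemma module_hom_add:
  "h \<in> module_hom R M N \<Longrightarrow> x \<in> carrier M \<Longrightarrow> y \<in> carrier M \<Longrightarrow> h (x \<oplus>\<^bsub>M\<^esub> y) = h x \<oplus>\<^bsub>N\<^esub> h y"
  by (auto simp: module_hom_def)

lemma module_hom_smult:
  "h \<in> module_hom R M N \<Longrightarrow> a \<in> carrier R \<Longrightarrow> x \<in> carrier M \<Longrightarrow> h (a \<odot>\<^bsub>M\<^esub> x) = a \<odot>\<^bsub>N\<^esub> h x"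
  by (auto simp: module_hom_def)

lemma module_homI:
  assumes "\<And>x. x \<in> carrier M \<Longrightarrow> h x \<in> carrier N"
    and "\<And>x y. x \<in> carrier M \<Longrightarrow> y \<in> carrier M \<Longrightarrow> h (x \<oplus>\<^bsub>M\<^esub> y) = h x \<oplus>\<^bsub>N\<^esub> h y"
    and "\<And>a x. a \<in> carrier R \<Longrightarrow> x \<in> carrier M \<Longrightarrow> h (a \<odot>\<^bsub>M\<^esub> x) = a \<odot>\<^bsub>N\<^esub> h x"
  shows "h \<in> module_hom R M N"
  using assms by (auto simp: module_hom_def)

lemma module_hom_comp:
  "h \<in> module_hom R M N \<Longrightarrow> k \<in> module_hom R N L \<Longrightarrow> (\<lambda>x. k (h x)) \<in> module_hom R M L"
  by (auto simp: module_hom_def Pi_def)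

lemma module_hom_zero:
  assumes "module R M" "module R N" "h \<in> module_hom R M N"
  shows "h \<zero>\<^bsub>M\<^esub> = \<zero>\<^bsub>N\<^esub>"
proof -
  interpret M: module R M by fact
  interpret N: module R N by fact
  have "h (\<zero>\<^bsub>R\<^esub> \<odot>\<^bsub>M\<^esub> \<zero>\<^bsub>M\<^esub>) = \<zero>\<^bsub>R\<^esub> \<odot>\<^bsub>N\<^esub> h \<zero>\<^bsub>M\<^esub>"
    by (rule module_hom_smult[OF assms(3)]) auto
  then show ?thesis using module_hom_closed[OF assms(3), of "\<zero>\<^bsub>M\<^esub>"] by simp
qed

lemma module_hom_neg:
  assumes "module R M" "module R N" "h \<in> module_hom R M N" "x \<in> carrier M"
  shows "h (\<ominus>\<^bsub>M\<^esub> x) = \<ominus>\<^bsub>N\<^esub> h x"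
proof -
  interpret M: module R M by fact
  interpret N: module R N by fact
  have "h (\<ominus>\<^bsub>M\<^esub> x) \<oplus>\<^bsub>N\<^esub> h x = h (\<ominus>\<^bsub>M\<^esub> x \<oplus>\<^bsub>M\<^esub> x)"
    using assms by (simp add: module_hom_add)
  also have "\<dots> = \<zero>\<^bsub>N\<^esub>" using assms by (simp add: M.M.l_neg module_hom_zero)
  finally show ?thesis
    using assms N.M.minus_equality module_hom_closed by (metis M.M.a_inv_closed)
qed

lemma module_hom_minus:
  assumes "module R M" "module R N" "h \<in> module_hom R M N" "x \<in> carrier M" "y \<in> carrier M"
  shows "h (x \<ominus>\<^bsub>M\<^esub> y) = h x \<ominus>\<^bsub>N\<^esub> h y"
proof -
  interpret M: module R M by fact
  show ?thesis using assms by (simp add: a_minus_def module_hom_add module_hom_neg)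
qed

text \<open>Closure under negatives comes from multiplication by -1, so later checks of submodules
  can leave it out.\<close>

lemma (in module) submodule_iff:
  "submodule H R M \<longleftrightarrow> H \<subseteq> carrier M \<and> \<zero>\<^bsub>M\<^esub> \<in> H \<and> (\<forall>x\<in>H. \<forall>y\<in>H. x \<oplus>\<^bsub>M\<^esub> y \<in> H) \<and>
     (\<forall>a\<in>carrier R. \<forall>x\<in>H. a \<odot>\<^bsub>M\<^esub> x \<in> H)"
proof
  assume H: "submodule H R M"
  then obtain x where x: "x \<in> H" using submoduleE(2) by blast
  then have "\<zero> \<odot>\<^bsub>M\<^esub> x \<in> H" using submoduleE(4)[OF H] by auto
  moreover have "x \<in> carrier M" using x submoduleE(1)[OF H] by auto
  ultimately show "H \<subseteq> carrier M \<and> \<zero>\<^bsub>M\<^esub> \<in> H \<and> (\<forall>x\<in>H. \<forall>y\<in>H. x \<oplus>\<^bsub>M\<^esub> y \<in> H) \<and>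
     (\<forall>a\<in>carrier R. \<forall>x\<in>H. a \<odot>\<^bsub>M\<^esub> x \<in> H)"
    using submoduleE[OF H] by auto
next
  assume H: "H \<subseteq> carrier M \<and> \<zero>\<^bsub>M\<^esub> \<in> H \<and> (\<forall>x\<in>H. \<forall>y\<in>H. x \<oplus>\<^bsub>M\<^esub> y \<in> H) \<and>
     (\<forall>a\<in>carrier R. \<forall>x\<in>H. a \<odot>\<^bsub>M\<^esub> x \<in> H)"
  show "submodule H R M"
  proof (rule submoduleI)
    fix a assume a: "a \<in> H"
    then have "(\<ominus> \<one>) \<odot>\<^bsub>M\<^esub> a \<in> H" using H by blast
    then show "\<ominus>\<^bsub>M\<^esub> a \<in> H" using a H smult_l_minus[of \<one> a] by (metis R.one_closed smult_one subsetD)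
  qed (use H in auto)
qed

lemma (in module) submodule_minus:
  "submodule H R M \<Longrightarrow> x \<in> H \<Longrightarrow> y \<in> H \<Longrightarrow> x \<ominus>\<^bsub>M\<^esub> y \<in> H"
  unfolding a_minus_def using submoduleE(3,5) by blast

lemma (in module) smult_minus:
  "a \<in> carrier R \<Longrightarrow> x \<in> carrier M \<Longrightarrow> y \<in> carrier M \<Longrightarrow> a \<odot>\<^bsub>M\<^esub> (x \<ominus>\<^bsub>M\<^esub> y) = a \<odot>\<^bsub>M\<^esub> x \<ominus>\<^bsub>M\<^esub> a \<odot>\<^bsub>M\<^esub> y"
  by (simp add: a_minus_def smult_r_distr smult_r_minus)

lemma (in abelian_group) minus_eq_zero_iff:
  "x \<in> carrier G \<Longrightarrow> y \<in> carrier G \<Longrightarrow> x \<ominus> y = \<zero> \<longleftrightarrow> x = y"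
  by (metis add.inv_closed add.inv_solve_right a_minus_def l_zero r_neg zero_closed)

section \<open>Images, preimages, sums and colons of submodules\<close>

lemma submodule_image:
  assumes "module R M" "module R N" "h \<in> module_hom R M N" "submodule U R M"
  shows "submodule (h ` U) R N"
proof -
  interpret M: module R M by fact
  interpret N: module R N by fact
  note U = assms(4)[unfolded M.submodule_iff]
  have "h x \<oplus>\<^bsub>N\<^esub> h y \<in> h ` U" if "x \<in> U" "y \<in> U" for x y
    using that U module_hom_add[OF assms(3), of x y] by (auto simp: subset_iff intro!: image_eqI[of _ h "x \<oplus>\<^bsub>M\<^esub> y"])
  moreover have "a \<odot>\<^bsub>N\<^esub> h x \<in> h ` U" if "x \<in> U" "a \<in> carrier R" for x a
    using that U module_hom_smult[OF assms(3), of a x] by (auto simp: subset_iff intro!: image_eqI[of _ h "a \<odot>\<^bsub>M\<^esub> x"])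
  moreover have "\<zero>\<^bsub>N\<^esub> \<in> h ` U" using U module_hom_zero[OF assms(1-3)] by (metis imageI)
  ultimately show ?thesis
    unfolding N.submodule_iff using U module_hom_closed[OF assms(3)] by auto
qed

lemma submodule_vimage:
  assumes "module R M" "module R N" "h \<in> module_hom R M N" "submodule V R N"
  shows "submodule {x \<in> carrier M. h x \<in> V} R M"
proof -
  interpret M: module R M by fact
  interpret N: module R N by fact
  show ?thesis
    using assms(4) unfolding M.submodule_iff N.submodule_iff
    by (auto simp: module_hom_zero[OF assms(1-3)] module_hom_add[OF assms(3)] module_hom_smult[OF assms(3)])
qed

lemma (in module) submodule_Int:
  "submodule U R M \<Longrightarrow> submodule V R M \<Longrightarrow> submodule (U \<inter> V) R M"
  unfolding submodule_iff by blast

lemma (in module) submodule_sum: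
  assumes "submodule U R M" "submodule V R M"
  shows "submodule {u \<oplus>\<^bsub>M\<^esub> v | u v. u \<in> U \<and> v \<in> V} R M" (is "submodule ?S R M")
proof -
  note U = assms(1)[unfolded submodule_iff] and V = assms(2)[unfolded submodule_iff]
  have "\<zero>\<^bsub>M\<^esub> \<in> ?S" using U V by (intro CollectI exI[of _ "\<zero>\<^bsub>M\<^esub>"]) auto
  moreover have "x \<oplus>\<^bsub>M\<^esub> y \<in> ?S" if xy: "x \<in> ?S" "y \<in> ?S" for x y
  proof -
    obtain u v u' v' where e: "x = u \<oplus>\<^bsub>M\<^esub> v" "y = u' \<oplus>\<^bsub>M\<^esub> v'" "u \<in> U" "u' \<in> U" "v \<in> V" "v' \<in> V"
      using xy by blast
    then have "x \<oplus>\<^bsub>M\<^esub> y = (u \<oplus>\<^bsub>M\<^esub> u') \<oplus>\<^bsub>M\<^esub> (v \<oplus>\<^bsub>M\<^esub> v')"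
      using U V M.add.m_assoc M.add.m_comm by (smt (verit) M.add.m_closed M.add.m_lcomm subsetD)
    then show ?thesis using e U V by blast
  qed
  moreover have "a \<odot>\<^bsub>M\<^esub> x \<in> ?S" if ax: "a \<in> carrier R" "x \<in> ?S" for a x
  proof -
    obtain u v where e: "x = u \<oplus>\<^bsub>M\<^esub> v" "u \<in> U" "v \<in> V" using ax by blast
    then have "a \<odot>\<^bsub>M\<^esub> x = a \<odot>\<^bsub>M\<^esub> u \<oplus>\<^bsub>M\<^esub> a \<odot>\<^bsub>M\<^esub> v" using ax(1) U V smult_r_distr[of a u v] by auto
    then show ?thesis using e U V ax by blast
  qed
  moreover have "?S \<subseteq> carrier M" using U V by auto
  ultimately show ?thesis unfolding submodule_iff by auto
qed

lemma (in module) submodule_cyclic: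
  assumes "x \<in> carrier M"
  shows "submodule {a \<odot>\<^bsub>M\<^esub> x | a. a \<in> carrier R} R M"
  unfolding submodule_iff
proof (intro conjI ballI)
  show "\<zero>\<^bsub>M\<^esub> \<in> {a \<odot>\<^bsub>M\<^esub> x |a. a \<in> carrier R}" using assms smult_l_null by (metis (mono_tags, lifting) R.zero_closed mem_Collect_eq)
next
  fix u v assume "u \<in> {a \<odot>\<^bsub>M\<^esub> x |a. a \<in> carrier R}" "v \<in> {a \<odot>\<^bsub>M\<^esub> x |a. a \<in> carrier R}"
  then show "u \<oplus>\<^bsub>M\<^esub> v \<in> {a \<odot>\<^bsub>M\<^esub> x |a. a \<in> carrier R}"
    using assms smult_l_distr by (auto) (metis R.add.m_closed)
next
  fix b u assume "b \<in> carrier R" "u \<in> {a \<odot>\<^bsub>M\<^esub> x |a. a \<in> carrier R}"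
  then show "b \<odot>\<^bsub>M\<^esub> u \<in> {a \<odot>\<^bsub>M\<^esub> x |a. a \<in> carrier R}"
    using assms smult_assoc1 by (auto) (metis R.m_closed)
qed (use assms in auto)

lemma (in module) submodule_colon:
  assumes "submodule U R M" "a \<in> carrier R"
  shows "submodule {x \<in> carrier M. a \<odot>\<^bsub>M\<^esub> x \<in> U} R M"
proof -
  have "a \<odot>\<^bsub>M\<^esub> (b \<odot>\<^bsub>M\<^esub> x) = b \<odot>\<^bsub>M\<^esub> (a \<odot>\<^bsub>M\<^esub> x)" if "b \<in> carrier R" "x \<in> carrier M" for b x
    using that assms(2) by (metis m_comm smult_assoc1)
  then show ?thesis using assms unfolding submodule_iff by (auto simp: smult_r_distr)
qed

section \<open>Noetherian modules\<close>

text \<open>Generation is tested against all submodules containing G. This spares linear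
  combinations: the proofs on Noetherian modules only handle images and preimages of
  submodules.\<close>

definition fg_sub :: "('a, 'r) ring_scheme \<Rightarrow> ('a, 'b, 'm) module_scheme \<Rightarrow> 'b set \<Rightarrow> bool" where
  "fg_sub R M U \<longleftrightarrow> (\<exists>G\<subseteq>U. finite G \<and> (\<forall>V. submodule V R M \<and> G \<subseteq> V \<longrightarrow> U \<subseteq> V))"

definition noeth :: "('a, 'r) ring_scheme \<Rightarrow> ('a, 'b, 'm) module_scheme \<Rightarrow> bool" where
  "noeth R M \<longleftrightarrow> module R M \<and> (\<forall>U. submodule U R M \<longrightarrow> fg_sub R M U)"

text \<open>Generators of the image of U under \<open>h\<close> are lifted to U and joined with the
  \<open>j\<close>-images of generators of the preimage of U. If V contains all of them, an element
  of U agrees modulo the kernel of \<open>h\<close> with an element of V \<inter> U, and the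
  difference comes from L.\<close>

lemma noeth_ext:
  assumes M: "module R M" and N: "noeth R N" and L: "noeth R L"
    and h: "h \<in> module_hom R M N" and j: "j \<in> module_hom R L M"
    and ker: "\<And>x. x \<in> carrier M \<Longrightarrow> h x = \<zero>\<^bsub>N\<^esub> \<Longrightarrow> x \<in> j ` carrier L"
  shows "noeth R M"
proof -
  have Nm: "module R N" and Lm: "module R L" using N L by (auto simp: noeth_def)
  interpret M: module R M by fact
  interpret N: module R N by fact
  interpret L: module R L by fact
  have "fg_sub R M U" if U: "submodule U R M" for U
  proof -
    have sub: "U \<subseteq> carrier M" using U M.submoduleE by blast
    obtain G1 where G1: "G1 \<subseteq> h ` U" "finite G1" "\<And>V. submodule V R N \<Longrightarrow> G1 \<subseteq> V \<Longrightarrow> h ` U \<subseteq> V"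
      using N submodule_image[OF M Nm h U] unfolding noeth_def fg_sub_def by meson
    obtain G2 where G2: "G2 \<subseteq> {x \<in> carrier L. j x \<in> U}" "finite G2"
      "\<And>V. submodule V R L \<Longrightarrow> G2 \<subseteq> V \<Longrightarrow> {x \<in> carrier L. j x \<in> U} \<subseteq> V"
      using L submodule_vimage[OF Lm M j U] unfolding noeth_def fg_sub_def by meson
    obtain G3 where G3: "G3 \<subseteq> U" "finite G3" "G1 = h ` G3"
      using finite_subset_image[OF G1(2,1)] by blast
    have "U \<subseteq> V" if V: "submodule V R M" and G: "G3 \<union> j ` G2 \<subseteq> V" for V
    proof
      fix u assume u: "u \<in> U"
      have VU: "submodule (V \<inter> U) R M" using M.submodule_Int V U by blast
      \<comment> \<open>V is replaced by V \<inter> U so that the comparison element v lies in U as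
        well; only then is u - v in U.\<close>
      have "h ` U \<subseteq> h ` (V \<inter> U)"
        using G1(3)[OF submodule_image[OF M Nm h VU]] G3 G by blast
      then obtain v where v: "v \<in> V" "v \<in> U" "h u = h v" using u by blast
      have c: "u \<in> carrier M" "v \<in> carrier M" using u v sub by auto
      have "h (u \<ominus>\<^bsub>M\<^esub> v) = \<zero>\<^bsub>N\<^esub>"
        using module_hom_minus[OF M Nm h c] v module_hom_closed[OF h] c
        by (simp add: N.minus_eq_zero_iff)
      then obtain w where w: "w \<in> carrier L" "u \<ominus>\<^bsub>M\<^esub> v = j w" using ker c by (meson M.M.minus_closed imageE)
      have "u \<ominus>\<^bsub>M\<^esub> v \<in> U" using M.submodule_minus U u v by blast
      then have "w \<in> {x \<in> carrier L. j x \<in> U}" using w by auto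
      moreover have "{x \<in> carrier L. j x \<in> U} \<subseteq> {x \<in> carrier L. j x \<in> V}"
        using G2(3)[OF submodule_vimage[OF Lm M j V]] G G2(1) by blast
      ultimately have "u \<ominus>\<^bsub>M\<^esub> v \<in> V" using w by auto
      then have "(u \<ominus>\<^bsub>M\<^esub> v) \<oplus>\<^bsub>M\<^esub> v \<in> V" using M.submoduleE(5) V v by blast
      then show "u \<in> V" using c by (simp add: a_minus_def M.add.m_assoc M.M.l_neg)
    qed
    moreover have "G3 \<union> j ` G2 \<subseteq> U" "finite (G3 \<union> j ` G2)" using G3 G2 by auto
    ultimately show ?thesis unfolding fg_sub_def by blast
  qed
  then show ?thesis using M unfolding noeth_def by blast
qed

lemma noeth_surj:
  assumes L: "noeth R L" and M: "module R M" and j: "j \<in> module_hom R L M"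
    and surj: "carrier M \<subseteq> j ` carrier L"
  shows "noeth R M"
proof -
  have Lm: "module R L" using L by (auto simp: noeth_def)
  interpret M: module R M by fact
  have "fg_sub R M U" if U: "submodule U R M" for U
  proof -
    obtain G2 where G2: "G2 \<subseteq> {x \<in> carrier L. j x \<in> U}" "finite G2"
      "\<And>V. submodule V R L \<Longrightarrow> G2 \<subseteq> V \<Longrightarrow> {x \<in> carrier L. j x \<in> U} \<subseteq> V"
      using L submodule_vimage[OF Lm M j U] unfolding noeth_def fg_sub_def by meson
    have "U \<subseteq> V" if V: "submodule V R M" and G: "j ` G2 \<subseteq> V" for V
    proof -
      have "{x \<in> carrier L. j x \<in> U} \<subseteq> {x \<in> carrier L. j x \<in> V}"
        using G2(3)[OF submodule_vimage[OF Lm M j V]] G G2(1) by blast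
      then show ?thesis using surj M.submoduleE(1)[OF U] by blast
    qed
    then show ?thesis unfolding fg_sub_def using G2 by (intro exI[of _ "j ` G2"]) auto
  qed
  then show ?thesis using M unfolding noeth_def by blast
qed

text \<open>Zorn: the union of a chain is a submodule, its finitely many generators already lie in
  one member, and that member is the union.\<close>

lemma noeth_maximal:
  assumes N: "noeth R M" and F: "\<F> \<noteq> {}" and sub: "\<And>U. U \<in> \<F> \<Longrightarrow> submodule U R M"
  obtains U where "U \<in> \<F>" "\<And>V. V \<in> \<F> \<Longrightarrow> U \<subseteq> V \<Longrightarrow> V = U"
proof -
  interpret M: module R M using N by (auto simp: noeth_def)
  have "\<Union>C \<in> \<F>" if C: "C \<noteq> {}" "subset.chain \<F> C" for C
  proof -
    have CF: "C \<subseteq> \<F>" and lin: "\<And>x y. x \<in> C \<Longrightarrow> y \<in> C \<Longrightarrow> x \<subseteq> y \<or> y \<subseteq> x"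
      using C(2) by (auto simp: subset_chain_def)
    have S: "submodule (\<Union>C) R M"
      unfolding M.submodule_iff
    proof (intro conjI ballI)
      show "\<Union>C \<subseteq> carrier M" "\<zero>\<^bsub>M\<^esub> \<in> \<Union>C"
        using CF sub C(1) unfolding M.submodule_iff by blast+
      show "a \<odot>\<^bsub>M\<^esub> x \<in> \<Union>C" if "a \<in> carrier R" "x \<in> \<Union>C" for a x
        using that CF sub unfolding M.submodule_iff by blast
      show "x \<oplus>\<^bsub>M\<^esub> y \<in> \<Union>C" if xy: "x \<in> \<Union>C" "y \<in> \<Union>C" for x y
      proof -
        obtain X where "X \<in> C" "x \<in> X" using xy by blast
        moreover obtain Y where "Y \<in> C" "y \<in> Y" using xy by blast
        ultimately obtain Z where "Z \<in> C" "x \<in> Z" "y \<in> Z" using lin by blast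
        then show ?thesis using CF sub M.submoduleE(5) by blast
      qed
    qed
    then obtain G where G: "G \<subseteq> \<Union>C" "finite G" "\<And>V. submodule V R M \<Longrightarrow> G \<subseteq> V \<Longrightarrow> \<Union>C \<subseteq> V"
      using N unfolding noeth_def fg_sub_def by meson
    have "\<exists>X\<in>C. G \<subseteq> X" using G(2,1)
    proof (induction G)
      case empty then show ?case using C by auto
    next
      case (insert g G)
      then obtain X Y where "X \<in> C" "G \<subseteq> X" "Y \<in> C" "g \<in> Y" by auto
      then show ?case using lin by (metis insert_subset subsetD subset_trans)
    qed
    then obtain X where X: "X \<in> C" "G \<subseteq> X" by blast
    then have "\<Union>C = X" using G(3) sub CF by blast
    then show ?thesis using X CF by auto
  qed
  then obtain U where "U \<in> \<F>" "\<forall>V\<in>\<F>. U \<subseteq> V \<longrightarrow> V = U"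
    using subset_Zorn_nonempty[OF F] by metis
  then show thesis using that by blast
qed

text \<open>Functions are zero outside X, so all operations are pointwise on the whole index type
  and enlarging X is literally an inclusion. Free modules, vectors indexed by relations and Koszul
  cochains are all instances.\<close>

definition fun_mod :: "('a, 'b, 'm) module_scheme \<Rightarrow> 'i set \<Rightarrow> ('a, 'i \<Rightarrow> 'b) module" where
  "fun_mod M X = \<lparr>carrier = {c. (\<forall>i\<in>X. c i \<in> carrier M) \<and> (\<forall>i. i \<notin> X \<longrightarrow> c i = \<zero>\<^bsub>M\<^esub>)},
     monoid.mult = undefined, one = undefined, zero = (\<lambda>_. \<zero>\<^bsub>M\<^esub>),
     add = (\<lambda>c c' i. c i \<oplus>\<^bsub>M\<^esub> c' i), smult = (\<lambda>a c i. a \<odot>\<^bsub>M\<^esub> c i)\<rparr>"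

abbreviation free_mod where "free_mod R \<equiv> fun_mod (self_module R)"

lemma fun_mod_simps [simp]:
  "carrier (fun_mod M X) = {c. (\<forall>i\<in>X. c i \<in> carrier M) \<and> (\<forall>i. i \<notin> X \<longrightarrow> c i = \<zero>\<^bsub>M\<^esub>)}"
  "\<zero>\<^bsub>fun_mod M X\<^esub> = (\<lambda>_. \<zero>\<^bsub>M\<^esub>)"
  "c \<oplus>\<^bsub>fun_mod M X\<^esub> c' = (\<lambda>i. c i \<oplus>\<^bsub>M\<^esub> c' i)"
  "a \<odot>\<^bsub>fun_mod M X\<^esub> c = (\<lambda>i. a \<odot>\<^bsub>M\<^esub> c i)"
  by (auto simp: fun_mod_def)

lemma fun_mod_closed: "module R M \<Longrightarrow> c \<in> carrier (fun_mod M X) \<Longrightarrow> c i \<in> carrier M"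
  using abelian_monoid.zero_closed[of M] by (cases "i \<in> X") (auto simp: module_def abelian_group_def)

lemma module_fun_mod:
  assumes "module R M" shows "module R (fun_mod M X)"
proof -
  interpret M: module R M by fact
  have cl: "c i \<in> carrier M" if "c \<in> carrier (fun_mod M X)" for c i
    using fun_mod_closed[OF assms that] .
  have zero: "c i = \<zero>\<^bsub>M\<^esub>" if "c \<in> carrier (fun_mod M X)" "i \<notin> X" for c i
    using that by simp
  have memI: "c \<in> carrier (fun_mod M X)" if "\<And>i. c i \<in> carrier M" "\<And>i. i \<notin> X \<Longrightarrow> c i = \<zero>\<^bsub>M\<^esub>" for c
    using that by simp
  note s = fun_mod_simps(2-4)
  show ?thesis
  proof (rule moduleI)
    show "abelian_group (fun_mod M X)"
    proof (rule abelian_groupI, unfold s)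
      fix c assume c: "c \<in> carrier (fun_mod M X)"
      have "(\<lambda>i. \<ominus>\<^bsub>M\<^esub> c i) \<in> carrier (fun_mod M X)"
        by (rule memI) (simp_all add: cl[OF c] zero[OF c])
      then show "\<exists>c'\<in>carrier (fun_mod M X). (\<lambda>i. c' i \<oplus>\<^bsub>M\<^esub> c i) = (\<lambda>_. \<zero>\<^bsub>M\<^esub>)"
        by (rule bexI[rotated]) (simp add: M.M.l_neg cl[OF c])
      show "(\<lambda>i. \<zero>\<^bsub>M\<^esub> \<oplus>\<^bsub>M\<^esub> c i) = c" by (simp add: cl[OF c])
      fix c' assume c': "c' \<in> carrier (fun_mod M X)"
      show "(\<lambda>i. c i \<oplus>\<^bsub>M\<^esub> c' i) \<in> carrier (fun_mod M X)"
        by (rule memI) (simp_all add: cl[OF c] cl[OF c'] zero[OF c] zero[OF c'])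
      show "(\<lambda>i. c i \<oplus>\<^bsub>M\<^esub> c' i) = (\<lambda>i. c' i \<oplus>\<^bsub>M\<^esub> c i)"
        by (simp add: M.M.a_comm cl[OF c] cl[OF c'])
      fix c'' assume c'': "c'' \<in> carrier (fun_mod M X)"
      show "(\<lambda>i. c i \<oplus>\<^bsub>M\<^esub> c' i \<oplus>\<^bsub>M\<^esub> c'' i) = (\<lambda>i. c i \<oplus>\<^bsub>M\<^esub> (c' i \<oplus>\<^bsub>M\<^esub> c'' i))"
        by (simp add: M.M.a_assoc cl[OF c] cl[OF c'] cl[OF c''])
    qed (rule memI, simp_all)
  next
    fix a c assume a: "a \<in> carrier R" and c: "c \<in> carrier (fun_mod M X)"
    show "a \<odot>\<^bsub>fun_mod M X\<^esub> c \<in> carrier (fun_mod M X)" unfolding s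
      by (rule memI) (simp_all add: a cl[OF c] zero[OF c])
    fix b assume b: "b \<in> carrier R"
    show "(a \<oplus>\<^bsub>R\<^esub> b) \<odot>\<^bsub>fun_mod M X\<^esub> c = a \<odot>\<^bsub>fun_mod M X\<^esub> c \<oplus>\<^bsub>fun_mod M X\<^esub> b \<odot>\<^bsub>fun_mod M X\<^esub> c"
      "a \<otimes>\<^bsub>R\<^esub> b \<odot>\<^bsub>fun_mod M X\<^esub> c = a \<odot>\<^bsub>fun_mod M X\<^esub> (b \<odot>\<^bsub>fun_mod M X\<^esub> c)"
      unfolding s by (simp_all add: a b cl[OF c] M.smult_l_distr M.smult_assoc1)
  next
    fix a c c' assume a: "a \<in> carrier R" and c: "c \<in> carrier (fun_mod M X)" "c' \<in> carrier (fun_mod M X)"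
    show "a \<odot>\<^bsub>fun_mod M X\<^esub> (c \<oplus>\<^bsub>fun_mod M X\<^esub> c') = a \<odot>\<^bsub>fun_mod M X\<^esub> c \<oplus>\<^bsub>fun_mod M X\<^esub> a \<odot>\<^bsub>fun_mod M X\<^esub> c'"
      unfolding s by (simp add: a cl[OF c(1)] cl[OF c(2)] M.smult_r_distr)
  next
    fix c assume c: "c \<in> carrier (fun_mod M X)"
    show "\<one>\<^bsub>R\<^esub> \<odot>\<^bsub>fun_mod M X\<^esub> c = c" unfolding s by (simp add: cl[OF c])
  qed (rule M.R.is_cring)
qed

lemma fun_mod_neg:
  assumes "module R M" "c \<in> carrier (fun_mod M X)"
  shows "\<ominus>\<^bsub>fun_mod M X\<^esub> c = (\<lambda>i. \<ominus>\<^bsub>M\<^esub> c i)"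
proof -
  interpret M: module R M by fact
  interpret F: module R "fun_mod M X" by (rule module_fun_mod) fact
  note cl = fun_mod_closed[OF assms]
  show ?thesis
  proof (rule F.M.minus_equality)
    show "(\<lambda>i. \<ominus>\<^bsub>M\<^esub> c i) \<oplus>\<^bsub>fun_mod M X\<^esub> c = \<zero>\<^bsub>fun_mod M X\<^esub>" using cl by (simp add: M.M.l_neg)
    show "(\<lambda>i. \<ominus>\<^bsub>M\<^esub> c i) \<in> carrier (fun_mod M X)" using cl assms(2) by simp
  qed fact
qed

lemma fun_mod_minus:
  assumes "module R M" "c \<in> carrier (fun_mod M X)" "c' \<in> carrier (fun_mod M X)"
  shows "c \<ominus>\<^bsub>fun_mod M X\<^esub> c' = (\<lambda>i. c i \<ominus>\<^bsub>M\<^esub> c' i)"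
  using fun_mod_neg[OF assms(1,3)] by (simp add: a_minus_def)

lemma noeth_fun_mod:
  fixes M :: "('a, 'b, 'm) module_scheme" and X :: "'i set"
  assumes "noeth R M" "finite X" shows "noeth R (fun_mod M X)"
proof -
  have Mm: "module R M" using assms by (auto simp: noeth_def)
  interpret M: module R M by fact
  show ?thesis using assms(2)
  proof (induction X)
    case empty
    have eq: "carrier (fun_mod M {}) = {\<lambda>_. \<zero>\<^bsub>M\<^esub>}" by auto
    interpret F: module R "fun_mod M {}" by (rule module_fun_mod) fact
    have "fg_sub R (fun_mod M {}) U" if "submodule U R (fun_mod M {})" for U :: "('i \<Rightarrow> 'b) set"
      unfolding fg_sub_def
    proof (intro exI[of _ "{}"] conjI allI impI)
      fix V :: "('i \<Rightarrow> 'b) set" assume "submodule V R (fun_mod M {}) \<and> {} \<subseteq> V"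
      then have "(\<lambda>_. \<zero>\<^bsub>M\<^esub>) \<in> V" unfolding F.submodule_iff by auto
      then show "U \<subseteq> V" using that unfolding F.submodule_iff eq by blast
    qed auto
    then show ?case unfolding noeth_def using F.module_axioms by blast
  next
    case (insert x X)
    note Xm = module_fun_mod[OF Mm, of X] and Im = module_fun_mod[OF Mm, of "insert x X"]
    have h: "(\<lambda>c. c x) \<in> module_hom R (fun_mod M (insert x X)) M"
      by (rule module_homI) auto
    have j: "(\<lambda>c. c) \<in> module_hom R (fun_mod M X) (fun_mod M (insert x X))"
      by (rule module_homI) (use M.M.zero_closed in fastforce)+
    \<comment> \<open>Evaluation at the new index has the functions on X as its kernel.\<close>
    show ?case
      by (rule noeth_ext[OF Im assms(1) insert.IH h j]) (use insert.hyps in auto)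
  qed
qed

text \<open>The product of multipliers for finitely many generators of U works for all generators,
  and the elements that it sends into W form a submodule. Primality keeps the product outside
  P.\<close>

lemma noeth_uniform_multiplier:
  assumes N: "noeth R M" and U: "submodule U R M" and W: "submodule W R M" and P: "primeideal P R"
    and ex: "\<And>u. u \<in> U \<Longrightarrow> \<exists>t\<in>carrier R - P. t \<odot>\<^bsub>M\<^esub> u \<in> W"
  obtains t where "t \<in> carrier R - P" "\<And>u. u \<in> U \<Longrightarrow> t \<odot>\<^bsub>M\<^esub> u \<in> W"
proof -
  interpret M: module R M using N by (auto simp: noeth_def)
  interpret P: primeideal P R by fact
  note Us = U[unfolded M.submodule_iff] and Ws = W[unfolded M.submodule_iff]
  obtain G where G: "G \<subseteq> U" "finite G" "\<And>V. submodule V R M \<Longrightarrow> G \<subseteq> V \<Longrightarrow> U \<subseteq> V"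
    using N U unfolding noeth_def fg_sub_def by meson
  have "\<exists>t\<in>carrier R - P. \<forall>u\<in>G. t \<odot>\<^bsub>M\<^esub> u \<in> W" using G(2,1)
  proof (induction G)
    case empty
    have "\<one>\<^bsub>R\<^esub> \<in> carrier R - P" using P.I_notcarr P.one_imp_carrier by auto
    then show ?case by blast
  next
    case (insert g G)
    then obtain t where t: "t \<in> carrier R - P" "\<forall>u\<in>G. t \<odot>\<^bsub>M\<^esub> u \<in> W" by auto
    obtain s where s: "s \<in> carrier R - P" "s \<odot>\<^bsub>M\<^esub> g \<in> W" using ex insert.prems by auto
    have "t \<otimes>\<^bsub>R\<^esub> s \<in> carrier R - P" using t s P.I_prime by auto
    moreover have "(t \<otimes>\<^bsub>R\<^esub> s) \<odot>\<^bsub>M\<^esub> u \<in> W" if u: "u \<in> insert g G" for u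
    proof (cases "u = g")
      case True
      have "(t \<otimes>\<^bsub>R\<^esub> s) \<odot>\<^bsub>M\<^esub> g = t \<odot>\<^bsub>M\<^esub> (s \<odot>\<^bsub>M\<^esub> g)"
        using t s insert.prems Us by (intro M.smult_assoc1) auto
      then show ?thesis using True s t Ws by auto
    next
      case False
      have "u \<in> carrier M" using u insert.prems Us by auto
      then have "(t \<otimes>\<^bsub>R\<^esub> s) \<odot>\<^bsub>M\<^esub> u = s \<odot>\<^bsub>M\<^esub> (t \<odot>\<^bsub>M\<^esub> u)"
        using t s by (metis DiffD1 M.R.m_comm M.smult_assoc1)
      then show ?thesis using False u s t Ws by auto
    qed
    ultimately show ?case by blast
  qed
  then obtain t where t: "t \<in> carrier R - P" "\<forall>u\<in>G. t \<odot>\<^bsub>M\<^esub> u \<in> W" by blast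
  have "U \<subseteq> {x \<in> carrier M. t \<odot>\<^bsub>M\<^esub> x \<in> W}"
    by (rule G(3)[OF M.submodule_colon]) (use W t G(1) Us in auto)
  then show thesis using that[OF t(1)] by auto
qed

section \<open>The ring as a module over itself\<close>

lemma module_self_module:
  assumes "cring R" shows "module R (self_module R)"
proof -
  interpret cring R by fact
  have "abelian_group (self_module R)"
    by (rule abelian_groupI) (auto simp: self_module_def a_ac intro: l_neg)
  then show ?thesis
    by (rule moduleI[OF is_cring]) (auto simp: self_module_def l_distr r_distr m_assoc)
qed

lemma self_module_simps [simp]:
  "carrier (self_module R) = carrier R" "zero (self_module R) = zero R" "add (self_module R) = add R"
  "smult (self_module R) = monoid.mult R"
  by (auto simp: self_module_def)

lemma submodule_self_iff_ideal:
  assumes "cring R" shows "submodule I R (self_module R) \<longleftrightarrow> ideal I R"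
proof -
  interpret cring R by fact
  interpret S: module R "self_module R" by (rule module_self_module) fact
  show ?thesis
  proof
    assume I: "submodule I R (self_module R)"
    have comm: "x \<otimes>\<^bsub>R\<^esub> a \<in> I" if "x \<in> I" "a \<in> carrier R" for x a
      using that I[unfolded S.submodule_iff] m_comm[of x a] by auto
    from I have "subgroup I (add_monoid R)"
      unfolding submodule_def self_module_def by (auto simp: subgroup_def a_inv_def m_inv_def)
    then show "ideal I R"
      using I unfolding S.submodule_iff
      by (intro idealI) (auto simp: ring_axioms comm)
  next
    assume "ideal I R"
    then interpret I: ideal I R .
    show "submodule I R (self_module R)" unfolding S.submodule_iff
      using I.a_subset by (auto simp: I.I_l_closed)
  qed
qed

lemma noeth_self_module:
  assumes "cring R" "noetherian_ring R" shows "noeth R (self_module R)"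
proof -
  interpret cring R by fact
  have "fg_sub R (self_module R) U" if "submodule U R (self_module R)" for U
  proof -
    have U: "ideal U R" using that submodule_self_iff_ideal[OF assms(1)] by blast
    then obtain A where A: "A \<subseteq> carrier R" "finite A" "U = Idl\<^bsub>R\<^esub> A"
      using noetherian_ring.finetely_gen[OF assms(2)] by blast
    show ?thesis unfolding fg_sub_def
      using A genideal_self genideal_minimal submodule_self_iff_ideal[OF assms(1)]
      by (intro exI[of _ A]) auto
  qed
  then show ?thesis unfolding noeth_def using module_self_module assms by blast
qed

section \<open>Finite generation, Nakayama, Artin--Rees\<close>

lemma module_hom_finsum:
  assumes M: "module R M" and N: "module R N" and h: "h \<in> module_hom R M N"
    and "finite X" "f \<in> X \<rightarrow> carrier M"
  shows "h (finsum M f X) = finsum N (\<lambda>i. h (f i)) X"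
proof -
  interpret M: module R M by fact
  interpret N: module R N by fact
  show ?thesis using assms(4,5)
  proof (induction X)
    case empty then show ?case using module_hom_zero[OF M N h] by simp
  next
    case (insert x X)
    then have "h (finsum M f (insert x X)) = h (f x \<oplus>\<^bsub>M\<^esub> finsum M f X)" by (simp add: Pi_def)
    also have "\<dots> = h (f x) \<oplus>\<^bsub>N\<^esub> h (finsum M f X)"
      using insert by (intro module_hom_add[OF h]) auto
    finally show ?case using insert module_hom_closed[OF h] by (simp add: Pi_def)
  qed
qed

lemma module_hom_combination:
  assumes M: "module R M" and X: "finite X" and g: "g \<in> X \<rightarrow> carrier M"
  shows "(\<lambda>c. \<Oplus>\<^bsub>M\<^esub>i\<in>X. c i \<odot>\<^bsub>M\<^esub> g i) \<in> module_hom R (free_mod R X) M"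
proof -
  interpret M: module R M by fact
  have Rm: "module R (self_module R)" by (rule module_self_module[OF M.R.is_cring])
  note cl = fun_mod_closed[OF Rm, unfolded self_module_simps]
  have gi: "g i \<in> carrier M" if "i \<in> X" for i using that g by auto
  have cg: "(\<lambda>i. c i \<odot>\<^bsub>M\<^esub> g i) \<in> X \<rightarrow> carrier M" if "c \<in> carrier (free_mod R X)" for c
    using cl[OF that] gi by auto
  show ?thesis
  proof (rule module_homI)
    fix c assume c: "c \<in> carrier (free_mod R X)"
    show "(\<Oplus>\<^bsub>M\<^esub>i\<in>X. c i \<odot>\<^bsub>M\<^esub> g i) \<in> carrier M" using cg[OF c] by (rule M.M.finsum_closed)
    fix a assume a: "a \<in> carrier R"
    show "(\<Oplus>\<^bsub>M\<^esub>i\<in>X. (a \<odot>\<^bsub>free_mod R X\<^esub> c) i \<odot>\<^bsub>M\<^esub> g i) = a \<odot>\<^bsub>M\<^esub> (\<Oplus>\<^bsub>M\<^esub>i\<in>X. c i \<odot>\<^bsub>M\<^esub> g i)"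
      using M.finsum_smult_ldistr[OF X a cg[OF c], symmetric] a cl[OF c] gi
      by (simp add: M.smult_assoc1 cong: M.M.finsum_cong)
  next
    fix c c' assume c: "c \<in> carrier (free_mod R X)" "c' \<in> carrier (free_mod R X)"
    show "(\<Oplus>\<^bsub>M\<^esub>i\<in>X. (c \<oplus>\<^bsub>free_mod R X\<^esub> c') i \<odot>\<^bsub>M\<^esub> g i)
       = (\<Oplus>\<^bsub>M\<^esub>i\<in>X. c i \<odot>\<^bsub>M\<^esub> g i) \<oplus>\<^bsub>M\<^esub> (\<Oplus>\<^bsub>M\<^esub>i\<in>X. c' i \<odot>\<^bsub>M\<^esub> g i)"
      using M.M.finsum_addf[OF cg[OF c(1)] cg[OF c(2)]] cl[OF c(1)] cl[OF c(2)] gi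
      by (simp add: M.smult_l_distr cong: M.M.finsum_cong)
  qed
qed

text \<open>Generators are numbered, so that relations among them are elements of
  \<open>free_mod R {..<r}\<close>.\<close>

definition generates ::
    "('a, 'r) ring_scheme \<Rightarrow> ('a, 'b, 'm) module_scheme \<Rightarrow> (nat \<Rightarrow> 'b) \<Rightarrow> nat \<Rightarrow> bool" where
  "generates R M g r \<longleftrightarrow> g \<in> {..<r} \<rightarrow> carrier M \<and>
     (\<forall>x\<in>carrier M. \<exists>a\<in>carrier (free_mod R {..<r}). x = (\<Oplus>\<^bsub>M\<^esub>i\<in>{..<r}. a i \<odot>\<^bsub>M\<^esub> g i))"

lemma fg_module_generates:
  assumes M: "module R M" and fg: "fg_module R M"
  obtains g r where "generates R M g r"
proof -
  interpret M: module R M by fact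
  have Rm: "module R (self_module R)" by (rule module_self_module[OF M.R.is_cring])
  interpret F: module R "free_mod R {..<(n::nat)}" for n by (rule module_fun_mod[OF Rm])
  obtain G where G: "G \<subseteq> carrier M" "finite G" "\<And>N. submodule N R M \<Longrightarrow> G \<subseteq> N \<Longrightarrow> N = carrier M"
    using fg unfolding fg_module_def by blast
  obtain g :: "nat \<Rightarrow> 'c" and r where g: "G = g ` {i. i < r}"
    using finite_imp_nat_seg_image_inj_on[OF G(2)] by blast
  then have gG: "g \<in> {..<r} \<rightarrow> carrier M" using G(1) by auto
  define h where "h = (\<lambda>c. \<Oplus>\<^bsub>M\<^esub>i\<in>{..<r}. c i \<odot>\<^bsub>M\<^esub> g i)"
  have h: "h \<in> module_hom R (free_mod R {..<r}) M"
    unfolding h_def by (rule module_hom_combination[OF M finite_lessThan gG])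
  have sub: "submodule (h ` carrier (free_mod R {..<r})) R M"
    by (rule submodule_image[OF module_fun_mod[OF Rm] M h F.carrier_is_submodule])
  have "g i \<in> h ` carrier (free_mod R {..<r})" if i: "i < r" for i
  proof -
    let ?c = "\<lambda>j. if j = i then \<one>\<^bsub>R\<^esub> else \<zero>\<^bsub>R\<^esub>"
    have "h ?c = (\<Oplus>\<^bsub>M\<^esub>j\<in>{..<r}. if i = j then g j else \<zero>\<^bsub>M\<^esub>)"
      unfolding h_def by (rule M.M.finsum_cong') (use gG in \<open>auto simp: Pi_def\<close>)
    also have "\<dots> = g i" using i gG by (intro M.M.finsum_singleton) auto
    finally show ?thesis using i by (intro image_eqI[of _ _ ?c]) auto
  qed
  then have "h ` carrier (free_mod R {..<r}) = carrier M"
    using G(3)[OF sub] g by auto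
  then have "\<exists>a\<in>carrier (free_mod R {..<r}). x = h a" if "x \<in> carrier M" for x
    using that by blast
  then have "generates R M g r" unfolding generates_def using gG unfolding h_def by blast
  then show thesis by (rule that)
qed

lemma generates_noeth:
  assumes M: "module R M" and nR: "noetherian_ring R" and g: "generates R M g r"
  shows "noeth R M"
proof -
  interpret M: module R M by fact
  show ?thesis
    by (rule noeth_surj[OF noeth_fun_mod[OF noeth_self_module[OF M.R.is_cring nR], of "{..<r}"] M
          module_hom_combination[OF M finite_lessThan, of g]])
      (use g in \<open>auto simp: generates_def\<close>)
qed

text \<open>A proper submodule X maximal above V has to contain every product a y: otherwise X
  together with a y generates M, so y = x + b a y with x in X, and since 1 - b a is a unit, y lies
  in X. The hypothesis \<open>step\<close> speaks of single products only, which suits the twisted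
  action on Frobenius pushforwards.\<close>

lemma nakayama_noeth:
  assumes N: "noeth R M" and V: "submodule V R M"
    and unit: "\<And>a. a \<in> m \<Longrightarrow> a \<in> carrier R \<and> \<one>\<^bsub>R\<^esub> \<ominus>\<^bsub>R\<^esub> a \<in> Units R"
    and ml: "\<And>a b. a \<in> m \<Longrightarrow> b \<in> carrier R \<Longrightarrow> b \<otimes>\<^bsub>R\<^esub> a \<in> m"
    and step: "\<And>X. submodule X R M \<Longrightarrow> V \<subseteq> X \<Longrightarrow> (\<And>a y. a \<in> m \<Longrightarrow> y \<in> carrier M \<Longrightarrow> a \<odot>\<^bsub>M\<^esub> y \<in> X) \<Longrightarrow> X = carrier M"
  shows "V = carrier M"
proof (rule ccontr)
  assume neq: "V \<noteq> carrier M"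
  interpret M: module R M using N by (auto simp: noeth_def)
  let ?F = "{X. submodule X R M \<and> V \<subseteq> X \<and> X \<noteq> carrier M}"
  obtain X where X: "submodule X R M" "V \<subseteq> X" "X \<noteq> carrier M"
    and max: "\<And>Y. submodule Y R M \<Longrightarrow> X \<subseteq> Y \<Longrightarrow> Y = X \<or> Y = carrier M"
    by (rule noeth_maximal[OF N, of ?F]) (use V neq in blast)+
  note Xs = X(1)[unfolded M.submodule_iff]
  have "a \<odot>\<^bsub>M\<^esub> y \<in> X" if a: "a \<in> m" and y: "y \<in> carrier M" for a y
  proof (rule ccontr)
    assume no: "a \<odot>\<^bsub>M\<^esub> y \<notin> X"
    have aR: "a \<in> carrier R" using unit a by blast
    let ?C = "{b \<odot>\<^bsub>M\<^esub> (a \<odot>\<^bsub>M\<^esub> y) | b. b \<in> carrier R}"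
    let ?Y = "{u \<oplus>\<^bsub>M\<^esub> v | u v. u \<in> X \<and> v \<in> ?C}"
    have C: "submodule ?C R M" using aR y by (intro M.submodule_cyclic) auto
    have Y: "submodule ?Y R M" by (rule M.submodule_sum[OF X(1) C])
    have z: "\<zero>\<^bsub>M\<^esub> \<in> ?C" using C unfolding M.submodule_iff by blast
    have "X \<subseteq> ?Y"
    proof
      fix x assume x: "x \<in> X"
      then have "x = x \<oplus>\<^bsub>M\<^esub> \<zero>\<^bsub>M\<^esub>" using Xs by auto
      then show "x \<in> ?Y" using x z by blast
    qed
    moreover have "a \<odot>\<^bsub>M\<^esub> y \<in> ?Y"
    proof -
      have "a \<odot>\<^bsub>M\<^esub> y = \<zero>\<^bsub>M\<^esub> \<oplus>\<^bsub>M\<^esub> \<one>\<^bsub>R\<^esub> \<odot>\<^bsub>M\<^esub> (a \<odot>\<^bsub>M\<^esub> y)" using aR y by simp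
      then show ?thesis using Xs by blast
    qed
    ultimately have "?Y = carrier M" using max[OF Y] no by blast
    then obtain x b where xb: "x \<in> X" "b \<in> carrier R" "y = x \<oplus>\<^bsub>M\<^esub> b \<odot>\<^bsub>M\<^esub> (a \<odot>\<^bsub>M\<^esub> y)" using y by blast
    let ?u = "\<one>\<^bsub>R\<^esub> \<ominus>\<^bsub>R\<^esub> b \<otimes>\<^bsub>R\<^esub> a"
    have u: "?u \<in> Units R" using unit ml[OF a xb(2)] by blast
    have xc: "x \<in> carrier M" using xb Xs by auto
    have "?u \<odot>\<^bsub>M\<^esub> y = y \<ominus>\<^bsub>M\<^esub> b \<odot>\<^bsub>M\<^esub> (a \<odot>\<^bsub>M\<^esub> y)"
      using aR xb y by (simp add: a_minus_def M.smult_l_distr M.smult_l_minus M.smult_assoc1)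
    also have "\<dots> = x"
    proof -
      have "x = y \<ominus>\<^bsub>M\<^esub> b \<odot>\<^bsub>M\<^esub> (a \<odot>\<^bsub>M\<^esub> y)"
        using xb(3) xc xb(2) aR y
        by (metis M.M.add.inv_solve_right M.smult_closed a_minus_def)
      then show ?thesis by simp
    qed
    finally have "?u \<odot>\<^bsub>M\<^esub> y \<in> X" using xb by simp
    then have "inv\<^bsub>R\<^esub> ?u \<odot>\<^bsub>M\<^esub> (?u \<odot>\<^bsub>M\<^esub> y) \<in> X" using Xs u by auto
    then have "y \<in> X" using u y by (simp add: M.smult_assoc1[symmetric] M.R.Units_closed)
    then show False using no Xs aR by blast
  qed
  then have "X = carrier M" using step[OF X(1,2)] by blast
  then show False using X by simp
qed

lemma module_hom_funpow: "h \<in> module_hom R M M \<Longrightarrow> h ^^ n \<in> module_hom R M M"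
  by (induction n) (auto simp: module_hom_def Pi_def)

text \<open>The kernels of the iterates of \<open>h\<close> stabilize at some n. An element of the
  kernel of \<open>h\<close> is h^n y by surjectivity, so y is killed by h^(n+1), hence by
  h^n.\<close>

lemma noeth_surj_endo_inj:
  assumes N: "noeth R M" and h: "h \<in> module_hom R M M" and surj: "h ` carrier M = carrier M"
  shows "inj_on h (carrier M)"
proof -
  have Mm: "module R M" using N by (auto simp: noeth_def)
  interpret M: module R M by fact
  note hn = module_hom_funpow[OF h]
  let ?K = "\<lambda>n::nat. {x \<in> carrier M. (h ^^ n) x \<in> {\<zero>\<^bsub>M\<^esub>}}"
  have "submodule {\<zero>\<^bsub>M\<^esub>} R M" unfolding M.submodule_iff by auto
  then have K: "submodule (?K n) R M" for n by (rule submodule_vimage[OF Mm Mm hn])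
  obtain U where U: "U \<in> range ?K" "\<And>V. V \<in> range ?K \<Longrightarrow> U \<subseteq> V \<Longrightarrow> V = U"
    using noeth_maximal[OF N, of "range ?K"] K by blast
  then obtain n where n: "U = ?K n" by blast
  have "?K n \<subseteq> ?K (Suc n)" using module_hom_zero[OF Mm Mm h] by auto
  then have eq: "?K (Suc n) = ?K n" using U n by blast
  have sn: "(h ^^ n) ` carrier M = carrier M" for n
  proof (induction n)
    case (Suc n)
    have "(h ^^ Suc n) ` carrier M = h ` ((h ^^ n) ` carrier M)" by (simp add: image_comp)
    then show ?case using Suc surj by simp
  qed simp
  have ker: "x = \<zero>\<^bsub>M\<^esub>" if x: "x \<in> carrier M" "h x = \<zero>\<^bsub>M\<^esub>" for x
  proof -
    obtain y where y: "y \<in> carrier M" "x = (h ^^ n) y" using sn[of n] x by blast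
    then have "y \<in> ?K (Suc n)" using x by simp
    then have "y \<in> ?K n" using eq by blast
    then show ?thesis using y by simp
  qed
  show ?thesis
  proof (rule inj_onI)
    fix x y assume xy: "x \<in> carrier M" "y \<in> carrier M" "h x = h y"
    then have "h (x \<ominus>\<^bsub>M\<^esub> y) = \<zero>\<^bsub>M\<^esub>"
      using module_hom_minus[OF Mm Mm h xy(1,2)] module_hom_closed[OF h] by (simp add: M.minus_eq_zero_iff)
    then show "x = y" using ker xy by (metis M.M.minus_closed M.minus_eq_zero_iff)
  qed
qed

text \<open>A substitute for the Artin--Rees lemma that avoids Rees algebras: \<open>N\<close> is chosen maximal
  with \<open>W \<subseteq> N\<close> and \<open>N \<inter> Y \<subseteq> W\<close>.\<close>

lemma weak_artin_rees:
  assumes nX: "noeth R X" and Y: "submodule Y R X" and W: "submodule W R X" and "W \<subseteq> Y" and mR: "m \<subseteq> carrier R"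
    and pow: "\<And>x. x \<in> m \<Longrightarrow> \<exists>c::nat. \<forall>y\<in>Y. (x [^]\<^bsub>R\<^esub> c) \<odot>\<^bsub>X\<^esub> y \<in> W"
  obtains N where "submodule N R X" "N \<inter> Y \<subseteq> W"
    "\<And>x. x \<in> m \<Longrightarrow> \<exists>n::nat. \<forall>z\<in>carrier X. (x [^]\<^bsub>R\<^esub> n) \<odot>\<^bsub>X\<^esub> z \<in> N"
proof -
  have Xm: "module R X" using nX by (auto simp: noeth_def)
  interpret X: module R X by fact
  let ?F = "{N. submodule N R X \<and> W \<subseteq> N \<and> N \<inter> Y \<subseteq> W}"
  have "W \<in> ?F" using W by blast
  then have "?F \<noteq> {}" by blast
  then obtain N where NF: "N \<in> ?F" and maxF: "\<And>L. L \<in> ?F \<Longrightarrow> N \<subseteq> L \<Longrightarrow> L = N"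
    using noeth_maximal[OF nX, of ?F] by (metis (no_types, lifting) mem_Collect_eq)
  have N: "submodule N R X" "W \<subseteq> N" "N \<inter> Y \<subseteq> W" using NF by auto
  have max: "L = N" if "submodule L R X" "L \<inter> Y \<subseteq> W" "N \<subseteq> L" for L
    using maxF[of L] that N(2) by auto
  note Ns = N(1)[unfolded X.submodule_iff]
  have "\<exists>n::nat. \<forall>z\<in>carrier X. (x [^]\<^bsub>R\<^esub> n) \<odot>\<^bsub>X\<^esub> z \<in> N" if x: "x \<in> m" for x
  proof -
    have xR: "x \<in> carrier R" using x mR by auto
    obtain c :: nat where c: "\<And>y. y \<in> Y \<Longrightarrow> (x [^]\<^bsub>R\<^esub> c) \<odot>\<^bsub>X\<^esub> y \<in> W" using pow x by blast
    let ?C = "\<lambda>n::nat. {z \<in> carrier X. (x [^]\<^bsub>R\<^esub> n) \<odot>\<^bsub>X\<^esub> z \<in> N}"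
    have C: "submodule (?C n) R X" for n using X.submodule_colon[OF N(1)] xR by simp
    \<comment> \<open>A maximal member of the ascending chain N : x^n is fixed; the step from n to c
      + n is then an equality.\<close>
    obtain n where n: "\<And>k. ?C n \<subseteq> ?C k \<Longrightarrow> ?C k = ?C n"
      using noeth_maximal[OF nX, of "range ?C"] C by (smt (verit) UNIV_not_empty image_is_empty rangeE rangeI)
    have pw: "(x [^]\<^bsub>R\<^esub> (k + l)) \<odot>\<^bsub>X\<^esub> z = (x [^]\<^bsub>R\<^esub> k) \<odot>\<^bsub>X\<^esub> ((x [^]\<^bsub>R\<^esub> l) \<odot>\<^bsub>X\<^esub> z)"
      if "z \<in> carrier X" for k l :: nat and z
      using that xR by (simp add: X.R.nat_pow_mult[symmetric] X.smult_assoc1)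
    have "?C n \<subseteq> ?C (c + n)" using pw Ns xR by auto
    then have eq: "?C (c + n) = ?C n" by (rule n)
    let ?f = "\<lambda>z. (x [^]\<^bsub>R\<^esub> n) \<odot>\<^bsub>X\<^esub> z"
    have f: "?f \<in> module_hom R X X"
      using xR by (intro module_homI) (auto simp: X.smult_r_distr X.smult_assoc1[symmetric] X.R.m_comm)
    let ?L = "{u \<oplus>\<^bsub>X\<^esub> v | u v. u \<in> N \<and> v \<in> ?f ` carrier X}"
    have fX: "submodule (?f ` carrier X) R X" by (rule submodule_image[OF Xm Xm f X.carrier_is_submodule])
    have L: "submodule ?L R X" by (rule X.submodule_sum[OF N(1) fX])
    have z0: "\<zero>\<^bsub>X\<^esub> \<in> ?f ` carrier X" using fX unfolding X.submodule_iff by blast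
    have NL: "N \<subseteq> ?L"
    proof
      fix u assume u: "u \<in> N"
      then have "u = u \<oplus>\<^bsub>X\<^esub> \<zero>\<^bsub>X\<^esub>" using Ns by auto
      then show "u \<in> ?L" using u z0 by blast
    qed
    \<comment> \<open>For y = u + x^n z in Y, multiplication by x^c moves y into W, so x^(c + n) z
      lies in N. Then x^n z does too, and y is in N \<inter> Y.\<close>
    have "?L \<inter> Y \<subseteq> W"
    proof
      fix y assume y: "y \<in> ?L \<inter> Y"
      then obtain u z where uz: "u \<in> N" "z \<in> carrier X" "y = u \<oplus>\<^bsub>X\<^esub> ?f z" by blast
      have uc: "u \<in> carrier X" using uz Ns by auto
      have e: "(x [^]\<^bsub>R\<^esub> c) \<odot>\<^bsub>X\<^esub> y = (x [^]\<^bsub>R\<^esub> c) \<odot>\<^bsub>X\<^esub> u \<oplus>\<^bsub>X\<^esub> (x [^]\<^bsub>R\<^esub> (c + n)) \<odot>\<^bsub>X\<^esub> z"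
        using uz uc xR by (simp add: X.smult_r_distr pw)
      have "(x [^]\<^bsub>R\<^esub> (c + n)) \<odot>\<^bsub>X\<^esub> z = (x [^]\<^bsub>R\<^esub> c) \<odot>\<^bsub>X\<^esub> y \<ominus>\<^bsub>X\<^esub> (x [^]\<^bsub>R\<^esub> c) \<odot>\<^bsub>X\<^esub> u"
        unfolding e using uz uc xR by (simp add: a_minus_def X.M.add.m_assoc X.M.add.m_comm X.M.r_neg1 X.M.r_neg2)
      also have "\<dots> \<in> N" using c y N(2) Ns uz xR by (intro X.submodule_minus[OF N(1)]) auto
      finally have "z \<in> ?C (c + n)" using uz by auto
      then have "?f z \<in> N" using eq by auto
      then have "y \<in> N" using uz Ns by auto
      then show "y \<in> W" using y N(3) by auto
    qed
    \<comment> \<open>Maximality of N now absorbs all x^n z.\<close>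
    then have "?L = N" using max L NL by blast
    moreover have "?f z \<in> ?L" if "z \<in> carrier X" for z
    proof -
      have "?f z = \<zero>\<^bsub>X\<^esub> \<oplus>\<^bsub>X\<^esub> ?f z" using that xR by simp
      then show ?thesis using Ns that by blast
    qed
    ultimately show ?thesis by blast
  qed
  then show thesis using that N by blast
qed

section \<open>Powers of ideals\<close>

lemma ideal_pow_0: "ideal_pow R I 0 = carrier R"
  by (simp add: ideal_pow_def ideals_set_def)

lemma ideal_pow_Suc: "ideal_pow R I (Suc n) = ideal_prod R (ideal_pow R I n) I"
  by (simp add: ideal_pow_def) (simp add: ideals_set_def)

lemma (in cring) ideal_ideal_pow: "ideal I R \<Longrightarrow> ideal (ideal_pow R I n) R"
  by (induction n) (auto simp: ideal_pow_0 ideal_pow_Suc oneideal intro: ideal_prod_is_ideal)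

lemma (in cring) ideal_pow_add:
  assumes "ideal I R" shows "ideal_pow R I (k + l) = ideal_prod R (ideal_pow R I k) (ideal_pow R I l)"
proof -
  interpret C: comm_monoid "ideals_set R" by (rule ideals_set_is_comm_monoid)
  have "I \<in> carrier (ideals_set R)" using assms by (simp add: ideals_set_def)
  from C.nat_pow_mult[OF this, of k l] show ?thesis
    unfolding ideal_pow_def by (simp add: ideals_set_def)
qed

lemma (in cring) ideal_pow_antimono:
  assumes "ideal I R" "k \<le> l" shows "ideal_pow R I l \<subseteq> ideal_pow R I k"
proof -
  obtain d where "l = k + d" using assms(2) by (auto simp: le_iff_add)
  then show ?thesis
    using ideal_pow_add[OF assms(1), of k d] ideal_prod_inter[of "ideal_pow R I k" "ideal_pow R I d"] ideal_ideal_pow[OF assms(1)]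
    by auto
qed

lemma (in cring) ideal_pow_mult:
  "ideal I R \<Longrightarrow> x \<in> ideal_pow R I k \<Longrightarrow> y \<in> ideal_pow R I l \<Longrightarrow> x \<otimes> y \<in> ideal_pow R I (k + l)"
  by (simp add: ideal_pow_add ideal_prod.prod)

lemma (in cring) ideal_pow_1: "ideal I R \<Longrightarrow> ideal_pow R I 1 = I"
  using ideal_prod_one[of I] ideal_prod_commute[of I "carrier R"] by (simp add: ideal_pow_Suc ideal_pow_0 oneideal)

lemma (in cring) ideal_pow_elem: "ideal I R \<Longrightarrow> x \<in> I \<Longrightarrow> x [^] (n::nat) \<in> ideal_pow R I n"
proof (induction n)
  case (Suc n)
  then show ?case by (simp add: ideal_pow_Suc ideal_prod.prod)
qed (simp add: ideal_pow_0)

lemma ideal_prod_subset: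
  assumes "ideal J R" "\<And>a b. a \<in> I1 \<Longrightarrow> b \<in> I2 \<Longrightarrow> a \<otimes>\<^bsub>R\<^esub> b \<in> J"
  shows "ideal_prod R I1 I2 \<subseteq> J"
proof
  interpret J: ideal J R by fact
  fix x assume "x \<in> ideal_prod R I1 I2"
  then show "x \<in> J" by induction (auto simp: assms(2))
qed

text \<open>Noetherian induction: for a maximal counterexample J some y outside J has y^2 in J. The
  ideals J + (y) and J : y are strictly larger, so they contain powers of m, and their product lies
  in J.\<close>

lemma (in cring) ideal_pow_subset:
  assumes nR: "noetherian_ring R" and m: "ideal m R" and J0: "ideal J0 R"
    and rad: "\<And>x. x \<in> m \<Longrightarrow> \<exists>n::nat. x [^] n \<in> J0"
  obtains c where "ideal_pow R m c \<subseteq> J0"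
proof -
  interpret m: ideal m R by fact
  have self: "noeth R (self_module R)" by (rule noeth_self_module[OF is_cring nR])
  note sub = submodule_self_iff_ideal[OF is_cring]
  let ?F = "{J. ideal J R \<and> (\<forall>x\<in>m. \<exists>n::nat. x [^] n \<in> J) \<and> (\<nexists>c. ideal_pow R m c \<subseteq> J)}"
  have "?F = {}"
  proof (rule ccontr)
    assume "?F \<noteq> {}"
    then obtain J where JF: "J \<in> ?F" and max: "\<And>L. L \<in> ?F \<Longrightarrow> J \<subseteq> L \<Longrightarrow> L = J"
      by (rule noeth_maximal[OF self]) (auto simp: sub)
    have J: "ideal J R" and Jr: "\<And>x. x \<in> m \<Longrightarrow> \<exists>n::nat. x [^] n \<in> J" and Jn: "\<And>c. \<not> ideal_pow R m c \<subseteq> J"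
      using JF by auto
    interpret J: ideal J R by fact
    have big: "\<exists>c. ideal_pow R m c \<subseteq> L" if "ideal L R" "J \<subseteq> L" "L \<noteq> J" for L
      using max[of L] that Jr by blast
    have "\<not> m \<subseteq> J" using Jn[of 1] ideal_pow_1[OF m] by simp
    then obtain x where x: "x \<in> m" "x \<notin> J" by blast
    have xR: "x \<in> carrier R" using x m.a_subset by auto
    \<comment> \<open>The element y will be the last power of x outside J; its square is a multiple
      of x^n because 2 (n - 1) is at least n.\<close>
    define n where "n = (LEAST n::nat. x [^] n \<in> J)"
    have n1: "x [^] n \<in> J" unfolding n_def by (rule LeastI_ex[OF Jr[OF x(1)]])
    have n2: "x [^] k \<notin> J" if "k < n" for k using not_less_Least that unfolding n_def by blast
    have "n \<noteq> 0"
    proof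
      assume "n = 0"
      then have "J = carrier R" using n1 J.one_imp_carrier by simp
      then show False using x xR by simp
    qed
    moreover have "n \<noteq> 1" using n1 x xR by auto
    ultimately have n: "n \<ge> 2" by simp
    define y where "y = x [^] (n - 1)"
    have y: "y \<in> carrier R" "y \<notin> J" unfolding y_def using n2[of "n - 1"] n xR by auto
    have "y \<otimes> y = x [^] n \<otimes> x [^] (n - 2)"
    proof -
      have "(n - 1) + (n - 1) = n + (n - 2)" using n by simp
      then show ?thesis unfolding y_def using xR by (simp only: nat_pow_mult)
    qed
    then have yy: "y \<otimes> y \<in> J" using n1 xR by (simp add: J.I_r_closed)
    let ?J1 = "J <+>\<^bsub>R\<^esub> PIdl y" and ?J2 = "{z \<in> carrier R. y \<otimes> z \<in> J}"
    have J1: "ideal ?J1 R" by (rule add_ideals[OF J cgenideal_ideal[OF y(1)]])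
    have J2: "ideal ?J2 R"
      using module.submodule_colon[OF module_self_module[OF is_cring], of J y] J y sub by auto
    have "y = \<zero> \<oplus> y" using y by simp
    then have "y \<in> ?J1" using J.zero_closed cgenideal_self[OF y(1)] unfolding set_add_def' by blast
    moreover have "J \<subseteq> ?J1"
    proof
      fix j assume j: "j \<in> J"
      then have "j = j \<oplus> \<zero>" using J.a_subset by auto
      moreover have "\<zero> \<in> PIdl y" using additive_subgroup.zero_closed ideal.axioms(1) cgenideal_ideal[OF y(1)] by blast
      ultimately show "j \<in> ?J1" using j unfolding set_add_def' by blast
    qed
    ultimately obtain c1 where c1: "ideal_pow R m c1 \<subseteq> ?J1" using big[OF J1] y by blast
    have "J \<subseteq> ?J2" using J.a_subset y by (auto simp: J.I_l_closed)
    moreover have "y \<in> ?J2" using y yy by auto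
    ultimately obtain c2 where c2: "ideal_pow R m c2 \<subseteq> ?J2" using big[OF J2] y by blast
    have "a \<otimes> b \<in> J" if a: "a \<in> ideal_pow R m c1" and b: "b \<in> ideal_pow R m c2" for a b
    proof -
      obtain j r where jr: "j \<in> J" "r \<in> carrier R" "a = j \<oplus> r \<otimes> y"
        using a c1 unfolding set_add_def' cgenideal_def by auto
      have bR: "b \<in> carrier R" "y \<otimes> b \<in> J" using b c2 by auto
      have "a \<otimes> b = j \<otimes> b \<oplus> r \<otimes> (y \<otimes> b)"
        using jr bR y J.a_subset by (auto simp: l_distr m_assoc subset_iff)
      then show ?thesis using jr bR by (simp add: J.I_l_closed J.I_r_closed)
    qed
    then have "ideal_pow R m (c1 + c2) \<subseteq> J"
      unfolding ideal_pow_add[OF m] by (intro ideal_prod_subset[OF J]) auto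
    then show False using Jn by blast
  qed
  then show thesis using J0 rad that by blast
qed

section \<open>Frobenius\<close>

lemma (in cring) binomial:
  assumes x: "x \<in> carrier R" and y: "y \<in> carrier R"
  shows "(x \<oplus> y) [^] (n::nat) = (\<Oplus>k\<in>{..n}. [(n choose k)] \<cdot> (x [^] k \<otimes> y [^] (n - k)))"
proof (induction n)
  case 0
  show ?case by simp
next
  case (Suc n)
  define T where "T = (\<lambda>k. x [^] k \<otimes> y [^] (Suc n - k))"
  have T: "T k \<in> carrier R" for k unfolding T_def using x y by simp
  let ?S = "\<Oplus>k\<in>{..n}. [(n choose k)] \<cdot> (x [^] k \<otimes> y [^] (n - k))"
  have 1: "x \<otimes> ?S = (\<Oplus>k\<in>{..n}. [(n choose k)] \<cdot> T (Suc k))"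
  proof -
    have "x \<otimes> ?S = (\<Oplus>k\<in>{..n}. x \<otimes> ([(n choose k)] \<cdot> (x [^] k \<otimes> y [^] (n - k))))"
      using x y by (intro finsum_rdistr) auto
    also have "\<dots> = (\<Oplus>k\<in>{..n}. [(n choose k)] \<cdot> T (Suc k))"
    proof (intro finsum_cong')
      fix k assume "k \<in> {..n}"
      show "x \<otimes> ([(n choose k)] \<cdot> (x [^] k \<otimes> y [^] (n - k))) = [(n choose k)] \<cdot> T (Suc k)"
        unfolding T_def using x y
        by (simp add: add_pow_rdistr m_assoc[symmetric] m_comm[of x "x [^] k"])
    qed (use T in auto)
    finally show ?thesis .
  qed
  have 2: "y \<otimes> ?S = (\<Oplus>k\<in>{..n}. [(n choose k)] \<cdot> T k)"
  proof -
    have "y \<otimes> ?S = (\<Oplus>k\<in>{..n}. y \<otimes> ([(n choose k)] \<cdot> (x [^] k \<otimes> y [^] (n - k))))"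
      using x y by (intro finsum_rdistr) auto
    also have "\<dots> = (\<Oplus>k\<in>{..n}. [(n choose k)] \<cdot> T k)"
    proof (intro finsum_cong')
      fix k assume k: "k \<in> {..n}"
      then have "Suc n - k = Suc (n - k)" by auto
      then show "y \<otimes> ([(n choose k)] \<cdot> (x [^] k \<otimes> y [^] (n - k))) = [(n choose k)] \<cdot> T k"
        unfolding T_def using x y by (simp add: add_pow_rdistr m_lcomm m_comm)
    qed (use T in auto)
    finally show ?thesis .
  qed
  have 3: "(\<Oplus>k\<in>{..n}. [(n choose k)] \<cdot> T k) = (\<Oplus>k\<in>{..n}. [(n choose Suc k)] \<cdot> T (Suc k)) \<oplus> T 0"
  proof -
    have "(\<Oplus>k\<in>{..n}. [(n choose k)] \<cdot> T k) = (\<Oplus>k\<in>{..Suc n}. [(n choose k)] \<cdot> T k)"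
      using T by (subst finsum_Suc) (auto simp: binomial_eq_0)
    also have "\<dots> = (\<Oplus>k\<in>{..n}. [(n choose Suc k)] \<cdot> T (Suc k)) \<oplus> [(n choose 0)] \<cdot> T 0"
      using T by (intro finsum_Suc2) auto
    finally show ?thesis using T by simp
  qed
  have "(x \<oplus> y) [^] Suc n = (x \<oplus> y) \<otimes> ?S"
    using Suc x y by (simp add: m_comm)
  also have "\<dots> = x \<otimes> ?S \<oplus> y \<otimes> ?S" using x y by (intro l_distr) auto
  also have "\<dots> = ((\<Oplus>k\<in>{..n}. [(n choose k)] \<cdot> T (Suc k)) \<oplus> (\<Oplus>k\<in>{..n}. [(n choose Suc k)] \<cdot> T (Suc k))) \<oplus> T 0"
    unfolding 1 2 3 using T by (intro a_assoc[symmetric]) auto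
  also have "(\<Oplus>k\<in>{..n}. [(n choose k)] \<cdot> T (Suc k)) \<oplus> (\<Oplus>k\<in>{..n}. [(n choose Suc k)] \<cdot> T (Suc k))
      = (\<Oplus>k\<in>{..n}. [(Suc n choose Suc k)] \<cdot> T (Suc k))"
    using T by (subst finsum_addf[symmetric]) (auto simp: add.nat_pow_mult intro!: finsum_cong')
  also have "(\<Oplus>k\<in>{..n}. [(Suc n choose Suc k)] \<cdot> T (Suc k)) \<oplus> T 0
     = (\<Oplus>k\<in>{..Suc n}. [(Suc n choose k)] \<cdot> T k)"
    using T by (subst finsum_Suc2[of _ n]) auto
  finally show ?case unfolding T_def .
qed

text \<open>Only p 1 = 0 is demanded, which ring homomorphisms transport to localizations and
  completions.\<close>

locale char_p = cring R for R (structure) +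
  fixes p :: nat
  assumes prime_p: "Factorial_Ring.prime p" and char_zero: "[p] \<cdot> \<one> = \<zero>"
begin

lemma add_pow_p: "x \<in> carrier R \<Longrightarrow> p dvd k \<Longrightarrow> [k] \<cdot> x = \<zero>"
proof -
  assume x: "x \<in> carrier R" and "p dvd k"
  then obtain l where k: "k = p * l" by blast
  have "[k] \<cdot> x = [l] \<cdot> ([p] \<cdot> (\<one> \<otimes> x))" using x by (simp add: k add.nat_pow_pow mult.commute)
  also have "[p] \<cdot> (\<one> \<otimes> x) = ([p] \<cdot> \<one>) \<otimes> x" using x by (subst add_pow_ldistr) auto
  also have "\<dots> = \<zero>" using x char_zero by simp
  finally show "[k] \<cdot> x = \<zero>" by simp
qed

lemma frob_add1:
  assumes x: "x \<in> carrier R" and y: "y \<in> carrier R"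
  shows "(x \<oplus> y) [^] p = x [^] p \<oplus> y [^] p"
proof -
  let ?t = "\<lambda>k. [(p choose k)] \<cdot> (x [^] k \<otimes> y [^] (p - k))"
  have p: "p > 1" using prime_p prime_gt_1_nat by blast
  obtain n where n: "p = Suc n" "n > 0" using p by (cases p) auto
  have "(\<Oplus>k\<in>{..p}. ?t k) = ?t p \<oplus> (\<Oplus>k\<in>{..n}. ?t k)"
    unfolding n(1) using x y by (intro finsum_Suc) auto
  also have "(\<Oplus>k\<in>{..n}. ?t k) = (\<Oplus>k\<in>{..n}. if 0 = k then ?t k else \<zero>)"
  proof (intro finsum_cong')
    fix k assume k: "k \<in> {..n}"
    show "?t k = (if 0 = k then ?t k else \<zero>)"
    proof (cases "k = 0")
      case False
      then have "p dvd (p choose k)" using n prime_p k by (intro dvd_choose_prime) auto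
      then have "?t k = \<zero>" using x y by (intro add_pow_p) auto
      then show ?thesis using False by simp
    qed simp
  qed (use x y in auto)
  also have "\<dots> = ?t 0" using x y by (intro finsum_singleton) auto
  finally show ?thesis unfolding binomial[OF x y] using x y by simp
qed

lemma frob_add:
  "x \<in> carrier R \<Longrightarrow> y \<in> carrier R \<Longrightarrow> (x \<oplus> y) [^] (p ^ e) = x [^] (p ^ e) \<oplus> y [^] (p ^ e)"
proof (induction e)
  case (Suc e)
  have "z [^] (p ^ Suc e) = (z [^] (p ^ e)) [^] p" if "z \<in> carrier R" for z
    using that by (simp add: nat_pow_pow mult.commute)
  then show ?case using Suc by (simp add: frob_add1)
qed simp

section \<open>The Frobenius pushforwards of R\<close>

abbreviation Fr :: "nat \<Rightarrow> ('a, 'a) module" where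
  "Fr e \<equiv> frobenius_pushforward p e R (self_module R)"

lemma Fr_simps [simp]:
  "carrier (Fr e) = carrier R" "zero (Fr e) = zero R" "add (Fr e) = add R"
  "smult (Fr e) = (\<lambda>x u. x [^] (p ^ e) \<otimes> u)"
  by (auto simp: frobenius_pushforward_def)

lemma Fr_abelian_group: "abelian_group (Fr e)"
  by (rule abelian_groupI) (auto simp: a_ac intro: l_neg)

lemma module_Fr: "module R (Fr e)"
  by (rule moduleI[OF is_cring Fr_abelian_group])
    (auto simp: frob_add l_distr r_distr nat_pow_distrib m_assoc)

lemma Fr_minus [simp]: "x \<in> carrier R \<Longrightarrow> y \<in> carrier R \<Longrightarrow> x \<ominus>\<^bsub>Fr e\<^esub> y = x \<ominus> y"
proof -
  interpret F: abelian_group "Fr e" by (rule Fr_abelian_group)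
  assume xy: "x \<in> carrier R" "y \<in> carrier R"
  have "\<ominus>\<^bsub>Fr e\<^esub> y = \<ominus> y" by (rule F.minus_equality) (use xy in \<open>auto simp: l_neg\<close>)
  then show ?thesis by (simp add: a_minus_def)
qed

lemma ideal_submodule_Fr: "ideal J R \<Longrightarrow> submodule J R (Fr e)"
proof -
  assume J: "ideal J R"
  interpret J: ideal J R by fact
  interpret F: module R "Fr e" by (rule module_Fr)
  show ?thesis unfolding F.submodule_iff using J.a_subset by (auto simp: J.I_l_closed)
qed

text \<open>F^(e+1)_*R is F^e_* applied to F_*R: if the g generate F^e_*R and the h generate F_*R,
  the products h^(p^e) g generate F^(e+1)_*R.\<close>

lemma fg_Fr:
  assumes fg: "fg_module R (Fr 1)" shows "fg_module R (Fr e)"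
proof (induction e)
  case 0
  interpret F: module R "Fr 0" by (rule module_Fr)
  have "N = carrier (Fr 0)" if N: "submodule N R (Fr 0) \<and> {\<one>} \<subseteq> N" for N
  proof -
    have "\<forall>a\<in>carrier R. \<forall>x\<in>N. a \<otimes> x \<in> N" "\<one> \<in> N" using N unfolding F.submodule_iff by auto
    then have "a \<otimes> \<one> \<in> N" if "a \<in> carrier R" for a using that by blast
    then have "a \<in> N" if "a \<in> carrier R" for a using that by fastforce
    then show ?thesis using N unfolding F.submodule_iff by auto
  qed
  then show ?case unfolding fg_module_def by (intro exI[of _ "{\<one>}"]) auto
next
  case (Suc e)
  interpret F: module R "Fr (Suc e)" by (rule module_Fr)
  interpret F1: module R "Fr 1" by (rule module_Fr)
  interpret Fe: module R "Fr e" by (rule module_Fr)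
  obtain G where G: "G \<subseteq> carrier R" "finite G" "\<And>N. submodule N R (Fr e) \<Longrightarrow> G \<subseteq> N \<Longrightarrow> N = carrier R"
    using Suc unfolding fg_module_def by auto
  obtain H where H: "H \<subseteq> carrier R" "finite H" "\<And>N. submodule N R (Fr 1) \<Longrightarrow> H \<subseteq> N \<Longrightarrow> N = carrier R"
    using fg unfolding fg_module_def by auto
  let ?K = "(\<lambda>(g, h). h [^] (p ^ e) \<otimes> g) ` (G \<times> H)"
  have "N = carrier (Fr (Suc e))" if N: "submodule N R (Fr (Suc e))" "?K \<subseteq> N" for N
  proof -
    have Ns: "N \<subseteq> carrier R" "\<zero> \<in> N" "\<And>x y. x \<in> N \<Longrightarrow> y \<in> N \<Longrightarrow> x \<oplus> y \<in> N"
      "\<And>a x. a \<in> carrier R \<Longrightarrow> x \<in> N \<Longrightarrow> a [^] (p ^ Suc e) \<otimes> x \<in> N"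
      using N(1) unfolding F.submodule_iff by auto
    have gN: "a [^] (p ^ e) \<otimes> g \<in> N" if g: "g \<in> G" and a: "a \<in> carrier R" for g a
    proof -
      \<comment> \<open>First the coefficients: a -> a^(p^e) g is linear from F_*R to F^(e+1)_*R, so
        it suffices to test the generators h of F_*R.\<close>
      let ?V = "{a \<in> carrier R. a [^] (p ^ e) \<otimes> g \<in> N}"
      have gR: "g \<in> carrier R" using g G by auto
      have "submodule ?V R (Fr 1)" unfolding F1.submodule_iff
      proof (intro conjI ballI)
        fix x b assume x: "x \<in> ?V" and b: "b \<in> carrier R"
        have "(b [^] p \<otimes> x) [^] (p ^ e) \<otimes> g = b [^] (p ^ Suc e) \<otimes> (x [^] (p ^ e) \<otimes> g)"
          using x b gR by (simp add: nat_pow_distrib nat_pow_pow m_assoc)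
        also have "\<dots> \<in> N" using x b Ns(4) by blast
        finally show "b \<odot>\<^bsub>Fr 1\<^esub> x \<in> ?V" using b x by simp
      next
        fix x y assume "x \<in> ?V" "y \<in> ?V"
        then show "x \<oplus>\<^bsub>Fr 1\<^esub> y \<in> ?V" using gR by (simp add: frob_add l_distr Ns(3))
      next
        have "p ^ e > 0" using prime_p prime_gt_0_nat by auto
        then have "\<zero> [^] (p ^ e) = \<zero>" by (simp add: nat_pow_zero)
        then show "\<zero>\<^bsub>Fr 1\<^esub> \<in> ?V" using gR Ns(2) by simp
      qed auto
      moreover have "H \<subseteq> ?V" using H(1) N(2) g by auto
      ultimately have "?V = carrier R" by (rule H(3))
      then show ?thesis using a by auto
    qed
    \<comment> \<open>Then the vectors: the x all of whose multiples a^(p^e) x lie in N form a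
      submodule of F^e_*R containing the g.\<close>
    let ?W = "{x \<in> carrier R. \<forall>a\<in>carrier R. a [^] (p ^ e) \<otimes> x \<in> N}"
    have "submodule ?W R (Fr e)" unfolding Fe.submodule_iff
    proof (intro conjI ballI)
      fix x b assume x: "x \<in> ?W" and b: "b \<in> carrier R"
      have "a [^] (p ^ e) \<otimes> (b [^] (p ^ e) \<otimes> x) \<in> N" if a: "a \<in> carrier R" for a
      proof -
        have "a [^] (p ^ e) \<otimes> (b [^] (p ^ e) \<otimes> x) = (a \<otimes> b) [^] (p ^ e) \<otimes> x"
          using a b x by (simp add: nat_pow_distrib m_assoc)
        then show ?thesis using x a b by simp
      qed
      then show "b \<odot>\<^bsub>Fr e\<^esub> x \<in> ?W" using x b by simp
    next
      fix x y assume "x \<in> ?W" "y \<in> ?W"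
      then show "x \<oplus>\<^bsub>Fr e\<^esub> y \<in> ?W" by (simp add: r_distr Ns(3))
    qed (use Ns in auto)
    moreover have "G \<subseteq> ?W" using gN G(1) by auto
    ultimately have W: "?W = carrier R" by (rule G(3))
    have "x \<in> N" if "x \<in> carrier R" for x
    proof -
      have "\<one> [^] (p ^ e) \<otimes> x \<in> N" using that W by blast
      then show ?thesis using that by simp
    qed
    then show ?thesis using Ns(1) by auto
  qed
  moreover have "?K \<subseteq> carrier (Fr (Suc e))" "finite ?K" using G(1,2) H(1,2) by auto
  ultimately show ?case unfolding fg_module_def by blast
qed

end

lemma F_finite_char_p:
  assumes "Factorial_Ring.prime p" "F_finite p R" shows "char_p R p"
proof -
  interpret cring R using assms(2) by (simp add: F_finite_def)
  show ?thesis
    by unfold_locales (use assms in \<open>auto simp: F_finite_def has_characteristic_def\<close>)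
qed

text \<open>Maps from $F^e_*R$ to $F^{e'}_*R$; here $a = p^e$ and $b = p^{e'}$.\<close>

definition twisted_linear :: "('a, 'r) ring_scheme \<Rightarrow> nat \<Rightarrow> nat \<Rightarrow> ('a \<Rightarrow> 'a) \<Rightarrow> bool" where
  "twisted_linear R a b h \<longleftrightarrow> h \<in> carrier R \<rightarrow> carrier R \<and>
     (\<forall>x\<in>carrier R. \<forall>y\<in>carrier R. h (x \<oplus>\<^bsub>R\<^esub> y) = h x \<oplus>\<^bsub>R\<^esub> h y) \<and>
     (\<forall>x\<in>carrier R. \<forall>u\<in>carrier R. h (x [^]\<^bsub>R\<^esub> a \<otimes>\<^bsub>R\<^esub> u) = x [^]\<^bsub>R\<^esub> b \<otimes>\<^bsub>R\<^esub> h u)"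

section \<open>Adic completion\<close>

text \<open>K n stands for the kernel of the projection from S to A/m^n. What follows rests on these
  properties alone: the K n form a separated and complete filtration by ideals, \<iota> A is dense,
  and the filtration induced on A is the m-adic one. The K n are used as they are, without being
  identified with powers of an ideal of S.\<close>

locale adic_completion = A: cring A + S: cring S + m: ideal m A
  for A (structure) and m and S :: "('s, 't) ring_scheme" +
  fixes \<iota> :: "'a \<Rightarrow> 's" and K :: "nat \<Rightarrow> 's set"
  assumes iota_hom: "\<iota> \<in> ring_hom A S"
    and K_ideal: "ideal (K n) S"
    and K_Suc: "K (Suc n) \<subseteq> K n"
    and K_Inter: "x \<in> carrier S \<Longrightarrow> (\<And>n. x \<in> K n) \<Longrightarrow> x = \<zero>\<^bsub>S\<^esub>"
    and K_iota: "a \<in> carrier A \<Longrightarrow> \<iota> a \<in> K n \<longleftrightarrow> a \<in> ideal_pow A m n"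
    and K_dense: "x \<in> carrier S \<Longrightarrow> \<exists>a\<in>carrier A. x \<ominus>\<^bsub>S\<^esub> \<iota> a \<in> K n"
    and K_complete: "(\<And>n. y n \<in> carrier S) \<Longrightarrow> (\<And>n. y (Suc n) \<ominus>\<^bsub>S\<^esub> y n \<in> K n) \<Longrightarrow>
       \<exists>z\<in>carrier S. \<forall>n. z \<ominus>\<^bsub>S\<^esub> y n \<in> K n"

lemma completion_simps:
  "carrier (completion A I) = {x. (\<forall>n. x n \<in> carrier (A Quot (ideal_pow A I n))) \<and> (\<forall>n. x (Suc n) \<subseteq> x n)}"
  "x \<otimes>\<^bsub>completion A I\<^esub> y = (\<lambda>n. x n \<otimes>\<^bsub>A Quot (ideal_pow A I n)\<^esub> y n)"
  "x \<oplus>\<^bsub>completion A I\<^esub> y = (\<lambda>n. x n \<oplus>\<^bsub>A Quot (ideal_pow A I n)\<^esub> y n)"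
  "\<one>\<^bsub>completion A I\<^esub> = (\<lambda>n. \<one>\<^bsub>A Quot (ideal_pow A I n)\<^esub>)"
  "\<zero>\<^bsub>completion A I\<^esub> = (\<lambda>n. \<zero>\<^bsub>A Quot (ideal_pow A I n)\<^esub>)"
  by (auto simp: completion_def Let_def)

lemma (in cring) completion_adic:
  assumes m: "ideal m R"
  shows "adic_completion R m (completion R m) (\<lambda>a n. ideal_pow R m n +> a)
    (\<lambda>n. {x \<in> carrier (completion R m). x n = ideal_pow R m n})"
proof -
  interpret m: ideal m R by fact
  let ?S = "completion R m"
  let ?I = "ideal_pow R m"
  let ?Q = "\<lambda>n. R Quot ?I n"
  have I: "ideal (?I n) R" for n by (rule ideal_ideal_pow[OF m])
  have mono: "?I (Suc n) \<subseteq> ?I n" for n by (rule ideal_pow_antimono[OF m]) simp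
  have Q: "cring (?Q n)" for n by (rule ideal.quotient_is_cring[OF I is_cring])
  have Qc: "carrier (?Q n) = (\<lambda>a. ?I n +> a) ` carrier R" for n
    unfolding FactRing_def A_RCOSETS_def' by auto
  have Qz: "\<zero>\<^bsub>?Q n\<^esub> = ?I n" for n by (simp add: FactRing_def)
  have hom: "(+>) (?I n) \<in> ring_hom R (?Q n)" for n by (rule ideal.rcos_ring_hom[OF I])
  have h_add: "(?I n +> a) \<oplus>\<^bsub>?Q n\<^esub> (?I n +> b) = ?I n +> (a \<oplus> b)"
    and h_mult: "(?I n +> a) \<otimes>\<^bsub>?Q n\<^esub> (?I n +> b) = ?I n +> (a \<otimes> b)"
    if "a \<in> carrier R" "b \<in> carrier R" for a b n
    using ring_hom_add[OF hom that] ring_hom_mult[OF hom that] by simp_all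
  have h_one: "\<one>\<^bsub>?Q n\<^esub> = ?I n +> \<one>" for n using ring_hom_one[OF hom] by simp
  have h_zero: "?I n +> \<zero> = ?I n" for n by (rule a_coset_add_zero) (rule additive_subgroup.a_subset[OF ideal.axioms(1)[OF I]])
  interpret Q: cring "?Q n" for n by (rule Q)
  have h_neg: "\<ominus>\<^bsub>?Q n\<^esub> (?I n +> a) = ?I n +> (\<ominus> a)" if "a \<in> carrier R" for a n
    by (rule Q.minus_equality) (use that in \<open>simp_all add: h_add l_neg h_zero Qz Qc\<close>)
  have mono_coset: "?I (Suc n) +> a \<subseteq> ?I n +> a" for a n using mono by (auto simp: a_r_coset_def')
  have point: "x n \<in> carrier (?Q n)" if "x \<in> carrier ?S" for x n using that unfolding completion_simps(1) by blast
  have sub: "x (Suc n) \<subseteq> x n" if "x \<in> carrier ?S" for x n using that unfolding completion_simps(1) by blast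
  have add_cl: "x \<oplus>\<^bsub>?S\<^esub> y \<in> carrier ?S" if xy: "x \<in> carrier ?S" "y \<in> carrier ?S" for x y
  proof -
    have "x (Suc n) \<oplus>\<^bsub>?Q (Suc n)\<^esub> y (Suc n) \<subseteq> x n \<oplus>\<^bsub>?Q n\<^esub> y n" for n
      using sub[OF xy(1), of n] sub[OF xy(2), of n] by (auto simp: FactRing_def set_add_def')
    then show ?thesis using point[OF xy(1)] point[OF xy(2)] by (simp add: completion_simps(1,3))
  qed
  have mult_cl: "x \<otimes>\<^bsub>?S\<^esub> y \<in> carrier ?S" if xy: "x \<in> carrier ?S" "y \<in> carrier ?S" for x y
  proof -
    have "x (Suc n) \<otimes>\<^bsub>?Q (Suc n)\<^esub> y (Suc n) \<subseteq> x n \<otimes>\<^bsub>?Q n\<^esub> y n" for n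
      using UN_mono[OF sub[OF xy(1)] UN_mono[OF sub[OF xy(2)] mono_coset]] by (simp add: FactRing_def rcoset_mult_def)
    then show ?thesis using point[OF xy(1)] point[OF xy(2)] by (simp add: completion_simps(1,2))
  qed
  have const: "(\<lambda>n. ?I n +> a) \<in> carrier ?S" if "a \<in> carrier R" for a
    using that mono_coset unfolding completion_simps(1) Qc by blast
  have zero: "\<zero>\<^bsub>?S\<^esub> = (\<lambda>n. ?I n +> \<zero>)" and one: "\<one>\<^bsub>?S\<^esub> = (\<lambda>n. ?I n +> \<one>)"
    unfolding completion_simps by (simp_all add: h_one h_zero Qz)
  \<comment> \<open>Compatibility of the negatives with the projections is inherited from products,
    by multiplying with the constant sequence -1.\<close>
  have neg: "(\<lambda>n. \<ominus>\<^bsub>?Q n\<^esub> x n) \<in> carrier ?S" if x: "x \<in> carrier ?S" for x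
  proof -
    have "(\<lambda>n. ?I n +> (\<ominus> \<one>)) \<otimes>\<^bsub>?S\<^esub> x = (\<lambda>n. \<ominus>\<^bsub>?Q n\<^esub> x n)"
      using point[OF x] by (simp add: completion_simps(2) h_neg[symmetric] h_one[symmetric] Q.l_minus)
    then show ?thesis using mult_cl[OF const x, of "\<ominus> \<one>"] by simp
  qed
  have Scr: "cring ?S"
  proof (rule cringI)
    show "abelian_group ?S"
    proof (rule abelian_groupI)
      show "\<zero>\<^bsub>?S\<^esub> \<in> carrier ?S" unfolding zero by (rule const) simp
      fix x assume x: "x \<in> carrier ?S"
      show "\<zero>\<^bsub>?S\<^esub> \<oplus>\<^bsub>?S\<^esub> x = x" unfolding completion_simps using point[OF x] by simp
      show "\<exists>y\<in>carrier ?S. y \<oplus>\<^bsub>?S\<^esub> x = \<zero>\<^bsub>?S\<^esub>"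
        using neg[OF x] by (rule bexI[rotated]) (use point[OF x] in \<open>simp add: completion_simps Q.l_neg\<close>)
      fix y assume y: "y \<in> carrier ?S"
      show "x \<oplus>\<^bsub>?S\<^esub> y = y \<oplus>\<^bsub>?S\<^esub> x" unfolding completion_simps using point[OF x] point[OF y] by (simp add: Q.a_comm)
      fix z assume z: "z \<in> carrier ?S"
      show "x \<oplus>\<^bsub>?S\<^esub> y \<oplus>\<^bsub>?S\<^esub> z = x \<oplus>\<^bsub>?S\<^esub> (y \<oplus>\<^bsub>?S\<^esub> z)"
        unfolding completion_simps using point[OF x] point[OF y] point[OF z] by (simp add: Q.a_assoc)
    qed (rule add_cl)
    show "comm_monoid ?S"
    proof (rule comm_monoidI)
      show "\<one>\<^bsub>?S\<^esub> \<in> carrier ?S" unfolding one by (rule const) simp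
      fix x assume x: "x \<in> carrier ?S"
      show "\<one>\<^bsub>?S\<^esub> \<otimes>\<^bsub>?S\<^esub> x = x" unfolding completion_simps using point[OF x] by simp
      fix y assume y: "y \<in> carrier ?S"
      show "x \<otimes>\<^bsub>?S\<^esub> y = y \<otimes>\<^bsub>?S\<^esub> x" unfolding completion_simps using point[OF x] point[OF y] by (simp add: Q.m_comm)
      fix z assume z: "z \<in> carrier ?S"
      show "x \<otimes>\<^bsub>?S\<^esub> y \<otimes>\<^bsub>?S\<^esub> z = x \<otimes>\<^bsub>?S\<^esub> (y \<otimes>\<^bsub>?S\<^esub> z)"
        unfolding completion_simps using point[OF x] point[OF y] point[OF z] by (simp add: Q.m_assoc)
    qed (rule mult_cl)
    fix x y z assume xyz: "x \<in> carrier ?S" "y \<in> carrier ?S" "z \<in> carrier ?S"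
    show "(x \<oplus>\<^bsub>?S\<^esub> y) \<otimes>\<^bsub>?S\<^esub> z = x \<otimes>\<^bsub>?S\<^esub> z \<oplus>\<^bsub>?S\<^esub> y \<otimes>\<^bsub>?S\<^esub> z"
      unfolding completion_simps using point[OF xyz(1)] point[OF xyz(2)] point[OF xyz(3)] by (simp add: Q.l_distr)
  qed
  interpret S: cring ?S by (rule Scr)
  have neg_eq: "\<ominus>\<^bsub>?S\<^esub> x = (\<lambda>n. \<ominus>\<^bsub>?Q n\<^esub> x n)" if x: "x \<in> carrier ?S" for x
    by (rule S.minus_equality) (use neg[OF x] x point[OF x] in \<open>simp_all add: completion_simps(3,5) Q.l_neg\<close>)
  have minus_eq: "(x \<ominus>\<^bsub>?S\<^esub> y) n = x n \<ominus>\<^bsub>?Q n\<^esub> y n" if "y \<in> carrier ?S" for x y n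
    by (simp add: a_minus_def neg_eq[OF that] completion_simps(3))
  let ?K = "\<lambda>n. {x \<in> carrier ?S. x n = ?I n}"
  have K_minus: "x \<ominus>\<^bsub>?S\<^esub> y \<in> ?K n \<longleftrightarrow> x n = y n" if "x \<in> carrier ?S" "y \<in> carrier ?S" for x y n
    using Q.minus_eq_zero_iff[OF point[OF that(1), of n] point[OF that(2), of n]] Qz[of n] S.minus_closed[OF that]
      minus_eq[OF that(2), of x n] by auto
  show ?thesis
  proof (intro adic_completion.intro adic_completion_axioms.intro)
    show "(\<lambda>a n. ?I n +> a) \<in> ring_hom R ?S"
      by (rule ring_hom_memI) (simp_all add: const one completion_simps(2,3) h_add h_mult)
    fix n
    have zK: "\<zero>\<^bsub>?S\<^esub> n = ?I n" by (simp add: completion_simps Qz)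
    show "ideal (?K n) ?S"
    proof (rule idealI)
      show "subgroup (?K n) (add_monoid ?S)"
      proof (rule S.add.subgroupI)
        show "?K n \<noteq> {}" using zK S.zero_closed by blast
        fix x y assume x: "x \<in> ?K n"
        then have "(\<ominus>\<^bsub>?S\<^esub> x) n = \<ominus>\<^bsub>?Q n\<^esub> \<zero>\<^bsub>?Q n\<^esub>" by (simp add: neg_eq Qz)
        also have "\<dots> = ?I n" unfolding Q.minus_zero by (rule Qz)
        finally show "\<ominus>\<^bsub>?S\<^esub> x \<in> ?K n" using S.a_inv_closed[of x] x by blast
        assume y: "y \<in> ?K n"
        have "(x \<oplus>\<^bsub>?S\<^esub> y) n = \<zero>\<^bsub>?Q n\<^esub> \<oplus>\<^bsub>?Q n\<^esub> \<zero>\<^bsub>?Q n\<^esub>"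
          using x y unfolding completion_simps(3) Qz by simp
        also have "\<dots> = ?I n" unfolding Q.l_zero[OF Q.zero_closed] by (rule Qz)
        finally show "x \<oplus>\<^bsub>?S\<^esub> y \<in> ?K n" using S.a_closed[of x y] x y by blast
      qed auto
      fix a x assume a: "a \<in> ?K n" and x: "x \<in> carrier ?S"
      have "(x \<otimes>\<^bsub>?S\<^esub> a) n = x n \<otimes>\<^bsub>?Q n\<^esub> \<zero>\<^bsub>?Q n\<^esub>" using a unfolding completion_simps(2) Qz by simp
      also have "\<dots> = ?I n" unfolding Q.r_null[OF point[OF x]] by (rule Qz)
      finally show xa: "x \<otimes>\<^bsub>?S\<^esub> a \<in> ?K n" using S.m_closed[of x a] x a by blast
      show "a \<otimes>\<^bsub>?S\<^esub> x \<in> ?K n" using xa x a S.m_comm[of a x] by simp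
    qed (rule S.ring_axioms)
    show "?K (Suc n) \<subseteq> ?K n"
    proof
      fix x assume "x \<in> ?K (Suc n)"
      then have x: "x \<in> carrier ?S" "x (Suc n) = ?I (Suc n)" by blast+
      obtain a where a: "a \<in> carrier R" "x n = ?I n +> a" using point[OF x(1), of n] Qc by blast
      have "?I (Suc n) \<subseteq> ?I n +> a" using sub[OF x(1), of n] x(2) a by simp
      then have "\<zero> \<in> ?I n +> a" using additive_subgroup.zero_closed[OF ideal.axioms(1)[OF I]] by blast
      then have "?I n +> a = ?I n +> \<zero>" by (rule a_repr_independence[OF _ a(1) additive_subgroup.a_subgroup[OF ideal.axioms(1)[OF I]]])
      then have "x n = ?I n" unfolding a(2) by (rule trans[OF _ h_zero])
      then show "x \<in> ?K n" using x by blast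
    qed
    fix x assume x: "x \<in> carrier ?S"
    show "x = \<zero>\<^bsub>?S\<^esub>" if "\<And>n. x \<in> ?K n" unfolding completion_simps(5) Qz using that by blast
    obtain a where a: "a \<in> carrier R" "x n = ?I n +> a" using point[OF x, of n] Qc by blast
    show "\<exists>a\<in>carrier R. x \<ominus>\<^bsub>?S\<^esub> (\<lambda>n. ?I n +> a) \<in> ?K n"
      by (rule bexI[OF _ a(1)], subst K_minus) (use x const a in auto)
  next
    fix a n assume a: "a \<in> carrier R"
    have "?I n +> a = ?I n \<longleftrightarrow> a \<in> ?I n"
      using ideal.rcos_const_imp_mem[OF I a] a_coset_join2[OF a additive_subgroup.a_subgroup[OF ideal.axioms(1)[OF I]]] by blast
    then show "((\<lambda>n. ?I n +> a) \<in> ?K n) = (a \<in> ?I n)" using const[OF a] by simp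
  next
    fix y assume y: "\<And>n::nat. y n \<in> carrier ?S" "\<And>n. y (Suc n) \<ominus>\<^bsub>?S\<^esub> y n \<in> ?K n"
    \<comment> \<open>The limit is the diagonal sequence; \<open>eq\<close> says that passing from y
      n to y (n + 1) leaves the n-th coset unchanged.\<close>
    have eq: "y (Suc n) n = y n n" for n using y(2)[of n] K_minus[OF y(1) y(1)] by blast
    have z: "(\<lambda>n. y n n) \<in> carrier ?S"
      using point[OF y(1)] sub[OF y(1)] eq unfolding completion_simps(1) by (auto) (metis subsetD)
    show "\<exists>z\<in>carrier ?S. \<forall>n. z \<ominus>\<^bsub>?S\<^esub> y n \<in> ?K n"
      by (rule bexI[OF _ z], intro allI, subst K_minus) (use z y in auto)
  qed (rule is_cring Scr m)+
qed

section \<open>Cancellation rules for differences\<close>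

context abelian_group
begin

lemma minus_add_cancel: "x \<in> carrier G \<Longrightarrow> y \<in> carrier G \<Longrightarrow> x \<ominus> y \<oplus> y = x"
  by (simp add: a_minus_def a_assoc l_neg)

lemma add_minus_cancel: "x \<in> carrier G \<Longrightarrow> y \<in> carrier G \<Longrightarrow> x \<oplus> y \<ominus> x = y"
  by (simp add: a_minus_def a_comm[of x y] a_assoc r_neg)

lemma minus_add_eq: "x \<in> carrier G \<Longrightarrow> u \<in> carrier G \<Longrightarrow> v \<in> carrier G \<Longrightarrow> x \<ominus> (u \<oplus> v) = x \<ominus> u \<ominus> v"
  by (simp add: a_minus_def minus_add a_assoc)

lemma minus_minus_cancel:
  "x \<in> carrier G \<Longrightarrow> y \<in> carrier G \<Longrightarrow> z \<in> carrier G \<Longrightarrow> x \<ominus> y \<ominus> (z \<ominus> y) = x \<ominus> z"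
  by (simp add: a_minus_def minus_add a_assoc) (simp add: a_comm[of "\<ominus> z"] r_neg1)

end

lemma (in char_p) Fr_finsum [simp]: "finsum (Fr e) f X = finsum R f X"
  by (simp add: finsum_def finprod_def)

lemma (in char_p) generates_FrD:
  assumes "generates R (Fr e) g r"
  shows "g \<in> {..<r} \<rightarrow> carrier R"
    and "x \<in> carrier R \<Longrightarrow> \<exists>a\<in>carrier (free_mod R {..<r}). x = (\<Oplus>i\<in>{..<r}. a i [^] (p ^ e) \<otimes> g i)"
  using assms unfolding generates_def by auto

lemma (in ideal) finsum_closed_ideal:
  assumes "finite X" "\<And>i. i \<in> X \<Longrightarrow> f i \<in> I" shows "finsum R f X \<in> I"
  using assms
proof (induction X)
  case (insert x X)
  then have "finsum R f (insert x X) = f x \<oplus> finsum R f X"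
    by (intro finsum_insert) (auto intro: a_Hcarr)
  then show ?case using insert by simp
qed simp

locale local_completion = adic_completion A m S \<iota> K + A: char_p A p
  for A (structure) and m and S :: "('s, 't) ring_scheme" and \<iota> and K and p +
  assumes local: "a \<in> carrier A \<Longrightarrow> a \<notin> m \<Longrightarrow> a \<in> Units A"
    and m_proper: "\<one> \<notin> m"
    and noetherian: "noetherian_ring A"
    and fg: "fg_module A (A.Fr 1)"
begin

sublocale iota: ring_hom_cring A S \<iota>
  by unfold_locales (rule iota_hom)

section \<open>The filtration K against the powers of m\<close>

abbreviation I :: "nat \<Rightarrow> 'a set" where "I n \<equiv> ideal_pow A m n"

lemma Am: "module A (self_module A)" by (rule module_self_module[OF A.is_cring])

lemma Sm: "module S (self_module S)" by (rule module_self_module[OF S.is_cring])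

lemma I_ideal: "ideal (I n) A" by (rule A.ideal_ideal_pow[OF m.ideal_axioms])

lemma I_subset: "I n \<subseteq> carrier A" using I_ideal additive_subgroup.a_subset ideal.axioms(1) by blast

lemma K_subset: "K n \<subseteq> carrier S" using K_ideal additive_subgroup.a_subset ideal.axioms(1) by blast

lemma K_mono: "k \<le> l \<Longrightarrow> K l \<subseteq> K k"
  by (rule lift_Suc_antimono_le[of K, OF K_Suc])

lemma K_add: "x \<in> K n \<Longrightarrow> y \<in> K n \<Longrightarrow> x \<oplus>\<^bsub>S\<^esub> y \<in> K n"
  and K_lmult: "x \<in> carrier S \<Longrightarrow> y \<in> K n \<Longrightarrow> x \<otimes>\<^bsub>S\<^esub> y \<in> K n"
  and K_rmult: "x \<in> carrier S \<Longrightarrow> y \<in> K n \<Longrightarrow> y \<otimes>\<^bsub>S\<^esub> x \<in> K n"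
  and K_zero: "\<zero>\<^bsub>S\<^esub> \<in> K n"
  and K_neg: "x \<in> K n \<Longrightarrow> \<ominus>\<^bsub>S\<^esub> x \<in> K n"
proof -
  interpret Kn: ideal "K n" S by (rule K_ideal)
  show "x \<in> K n \<Longrightarrow> y \<in> K n \<Longrightarrow> x \<oplus>\<^bsub>S\<^esub> y \<in> K n" "\<zero>\<^bsub>S\<^esub> \<in> K n" "x \<in> K n \<Longrightarrow> \<ominus>\<^bsub>S\<^esub> x \<in> K n"
    "x \<in> carrier S \<Longrightarrow> y \<in> K n \<Longrightarrow> x \<otimes>\<^bsub>S\<^esub> y \<in> K n" "x \<in> carrier S \<Longrightarrow> y \<in> K n \<Longrightarrow> y \<otimes>\<^bsub>S\<^esub> x \<in> K n"
    by (auto simp: Kn.I_l_closed Kn.I_r_closed)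
qed

lemma K_minus: "x \<in> K n \<Longrightarrow> y \<in> K n \<Longrightarrow> x \<ominus>\<^bsub>S\<^esub> y \<in> K n"
  by (simp add: a_minus_def K_add K_neg)

lemma K_0: "K 0 = carrier S"
proof -
  have "\<iota> \<one> \<in> K 0" by (subst K_iota) (auto simp: ideal_pow_0)
  then show ?thesis using ideal.one_imp_carrier[OF K_ideal] by simp
qed

text \<open>Density puts a within K n of x; as K n is contained in K k, membership in K k passes
  from x to \<iota> a.\<close>

lemma K_approx:
  assumes "x \<in> K k" "k \<le> n" obtains a where "a \<in> I k" "x \<ominus>\<^bsub>S\<^esub> \<iota> a \<in> K n"
proof -
  have x: "x \<in> carrier S" using assms K_subset by blast
  obtain a where a: "a \<in> carrier A" "x \<ominus>\<^bsub>S\<^esub> \<iota> a \<in> K n" using K_dense[OF x] by blast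
  have "\<iota> a = x \<ominus>\<^bsub>S\<^esub> (x \<ominus>\<^bsub>S\<^esub> \<iota> a)"
  proof -
    have "\<iota> a \<in> carrier S" using a by simp
    then show ?thesis using x by algebra
  qed
  also have "\<dots> \<in> K k" using assms a K_mono[OF assms(2)] by (auto intro: K_minus[OF assms(1), of "x \<ominus>\<^bsub>S\<^esub> \<iota> a"])
  finally show thesis using that[OF _ a(2)] K_iota[OF a(1)] by blast
qed

text \<open>Modulo K (k + l) both factors may be replaced by elements of m^k and m^l.\<close>

lemma K_mult:
  assumes x: "x \<in> K k" and y: "y \<in> K l" shows "x \<otimes>\<^bsub>S\<^esub> y \<in> K (k + l)"
proof -
  obtain a where a: "a \<in> I k" "x \<ominus>\<^bsub>S\<^esub> \<iota> a \<in> K (k + l)" using K_approx[OF x, of "k + l"] by auto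
  obtain b where b: "b \<in> I l" "y \<ominus>\<^bsub>S\<^esub> \<iota> b \<in> K (k + l)" using K_approx[OF y, of "k + l"] by auto
  have c: "x \<in> carrier S" "y \<in> carrier S" "a \<in> carrier A" "b \<in> carrier A"
    using x y a b K_subset I_subset by blast+
  have "\<iota> a \<in> carrier S" "\<iota> b \<in> carrier S" using c by auto
  then have "x \<otimes>\<^bsub>S\<^esub> y = (x \<ominus>\<^bsub>S\<^esub> \<iota> a) \<otimes>\<^bsub>S\<^esub> y \<oplus>\<^bsub>S\<^esub> \<iota> a \<otimes>\<^bsub>S\<^esub> (y \<ominus>\<^bsub>S\<^esub> \<iota> b) \<oplus>\<^bsub>S\<^esub> \<iota> a \<otimes>\<^bsub>S\<^esub> \<iota> b"
    using c(1,2) by algebra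
  moreover have "\<iota> a \<otimes>\<^bsub>S\<^esub> \<iota> b \<in> K (k + l)"
    using A.ideal_pow_mult[OF m.ideal_axioms a(1) b(1)] K_iota[of "a \<otimes> b" "k + l"] c by simp
  ultimately show ?thesis using a b c by (simp add: K_add K_lmult K_rmult)
qed

text \<open>The inverse is the limit of the inverses of elements of A approximating x.\<close>

lemma K_unit:
  assumes x: "x \<in> carrier S" "x \<notin> K 1" shows "x \<in> Units S"
proof -
  \<comment> \<open>Precision n + 1 instead of n makes every approximation congruent to x modulo K
    1, so that it lies outside m.\<close>
  have "\<exists>a\<in>carrier A. x \<ominus>\<^bsub>S\<^esub> \<iota> a \<in> K (Suc n)" for n by (rule K_dense[OF x(1)])
  then obtain a where a: "\<And>n. a n \<in> carrier A" "\<And>n. x \<ominus>\<^bsub>S\<^esub> \<iota> (a n) \<in> K (Suc n)" by metis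
  have aU: "a n \<in> Units A" for n
  proof (rule local[OF a(1)])
    show "a n \<notin> m"
    proof
      assume "a n \<in> m"
      then have "\<iota> (a n) \<in> K 1" using K_iota[of "a n" 1] A.ideal_pow_1[OF m.ideal_axioms] a by simp
      moreover have "x \<ominus>\<^bsub>S\<^esub> \<iota> (a n) \<in> K 1" using a(2)[of n] K_mono[of 1 "Suc n"] by auto
      ultimately have "(x \<ominus>\<^bsub>S\<^esub> \<iota> (a n)) \<oplus>\<^bsub>S\<^esub> \<iota> (a n) \<in> K 1" by (simp add: K_add)
      moreover have "(x \<ominus>\<^bsub>S\<^esub> \<iota> (a n)) \<oplus>\<^bsub>S\<^esub> \<iota> (a n) = x"
        using x a(1)[of n] by (simp add: a_minus_def S.a_assoc S.l_neg)
      ultimately show False using x by simp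
    qed
  qed
  define y where "y = (\<lambda>n. \<iota> (inv (a n)))"
  have yc: "y n \<in> carrier S" for n unfolding y_def using aU by auto
  have ay: "\<iota> (a n) \<otimes>\<^bsub>S\<^esub> y n = \<one>\<^bsub>S\<^esub>" for n
    unfolding y_def using aU[of n] a(1)[of n] by (simp add: iota.hom_mult[symmetric] del: iota.hom_mult)
  have xy: "x \<otimes>\<^bsub>S\<^esub> y n \<ominus>\<^bsub>S\<^esub> \<one>\<^bsub>S\<^esub> \<in> K (Suc n)" for n
  proof -
    have "x \<otimes>\<^bsub>S\<^esub> y n \<ominus>\<^bsub>S\<^esub> \<one>\<^bsub>S\<^esub> = (x \<ominus>\<^bsub>S\<^esub> \<iota> (a n)) \<otimes>\<^bsub>S\<^esub> y n"
      unfolding ay[of n, symmetric] using x yc[of n] a(1)[of n]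
      by (simp add: a_minus_def S.l_distr S.l_minus)
    then show ?thesis using a(2)[of n] yc[of n] by (simp add: K_rmult)
  qed
  have step: "y (Suc n) \<ominus>\<^bsub>S\<^esub> y n \<in> K n" for n
  proof -
    let ?u = "y (Suc n)" and ?v = "y n"
    have c: "?u \<in> carrier S" "?v \<in> carrier S" using yc by auto
    have "?u \<ominus>\<^bsub>S\<^esub> ?v = (x \<otimes>\<^bsub>S\<^esub> ?u \<ominus>\<^bsub>S\<^esub> \<one>\<^bsub>S\<^esub>) \<otimes>\<^bsub>S\<^esub> ?v \<ominus>\<^bsub>S\<^esub> (x \<otimes>\<^bsub>S\<^esub> ?v \<ominus>\<^bsub>S\<^esub> \<one>\<^bsub>S\<^esub>) \<otimes>\<^bsub>S\<^esub> ?u"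
      using c x(1) by algebra
    also have "\<dots> \<in> K n"
    proof (rule K_minus; rule K_rmult)
      show "x \<otimes>\<^bsub>S\<^esub> ?u \<ominus>\<^bsub>S\<^esub> \<one>\<^bsub>S\<^esub> \<in> K n" using xy[of "Suc n"] K_mono[of n "Suc (Suc n)"] by auto
      show "x \<otimes>\<^bsub>S\<^esub> ?v \<ominus>\<^bsub>S\<^esub> \<one>\<^bsub>S\<^esub> \<in> K n" using xy[of n] K_mono[of n "Suc n"] by auto
    qed (rule c)+
    finally show ?thesis .
  qed
  obtain z where z: "z \<in> carrier S" "\<And>n. z \<ominus>\<^bsub>S\<^esub> y n \<in> K n" using K_complete[OF yc step] by blast
  have "x \<otimes>\<^bsub>S\<^esub> z \<ominus>\<^bsub>S\<^esub> \<one>\<^bsub>S\<^esub> \<in> K n" for n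
  proof -
    have "x \<otimes>\<^bsub>S\<^esub> z \<ominus>\<^bsub>S\<^esub> \<one>\<^bsub>S\<^esub> = x \<otimes>\<^bsub>S\<^esub> (z \<ominus>\<^bsub>S\<^esub> y n) \<oplus>\<^bsub>S\<^esub> (x \<otimes>\<^bsub>S\<^esub> y n \<ominus>\<^bsub>S\<^esub> \<one>\<^bsub>S\<^esub>)"
      using x(1) z(1) yc[of n] by algebra
    also have "\<dots> \<in> K n" using z xy[of n] K_mono[of n "Suc n"] x by (intro K_add K_lmult) auto
    finally show ?thesis .
  qed
  then have "x \<otimes>\<^bsub>S\<^esub> z \<ominus>\<^bsub>S\<^esub> \<one>\<^bsub>S\<^esub> = \<zero>\<^bsub>S\<^esub>" using x z by (intro K_Inter) auto
  then have "x \<otimes>\<^bsub>S\<^esub> z = \<one>\<^bsub>S\<^esub>" using x z by (simp add: S.minus_eq_zero_iff)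
  moreover have "z \<otimes>\<^bsub>S\<^esub> x = \<one>\<^bsub>S\<^esub>" using calculation S.m_comm[OF x(1) z(1)] by simp
  ultimately show ?thesis unfolding Units_def using x(1) z(1) by blast
qed

lemma S_char_p: "char_p S p"
proof -
  have "[k] \<cdot>\<^bsub>S\<^esub> \<one>\<^bsub>S\<^esub> = \<iota> ([k] \<cdot> \<one>)" for k :: nat
    by (induction k) auto
  then have "[p] \<cdot>\<^bsub>S\<^esub> \<one>\<^bsub>S\<^esub> = \<zero>\<^bsub>S\<^esub>" using A.char_zero by simp
  then show ?thesis using A.prime_p by (intro char_p.intro char_p_axioms.intro S.is_cring) auto
qed

sublocale S: char_p S p by (rule S_char_p)

lemma iota_pow: "a \<in> carrier A \<Longrightarrow> \<iota> (a [^] (n::nat)) = \<iota> a [^]\<^bsub>S\<^esub> n"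
  by (induction n) auto

lemma iota_minus: "a \<in> carrier A \<Longrightarrow> b \<in> carrier A \<Longrightarrow> \<iota> (a \<ominus> b) = \<iota> a \<ominus>\<^bsub>S\<^esub> \<iota> b"
  by (simp add: a_minus_def)

lemma q_pos: "p ^ e > 0"
  using A.prime_p prime_gt_0_nat by auto

lemma K_pow: "x \<in> K n \<Longrightarrow> x [^]\<^bsub>S\<^esub> (p ^ e) \<in> K n"
proof -
  assume x: "x \<in> K n"
  then have xS: "x \<in> carrier S" using K_subset by blast
  obtain k where "p ^ e = Suc k" using q_pos[of e] gr0_conv_Suc by blast
  then show ?thesis using x xS by (simp add: K_lmult)
qed

lemma I_pow: "x \<in> I n \<Longrightarrow> x [^] (p ^ e) \<in> I n"
  using K_pow[of "\<iota> x" n e] K_iota[of x n] K_iota[of "x [^] (p ^ e)" n] I_subset[of n]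
  by (auto simp: iota_pow)

text \<open>The combinations with coefficients in m^j form a submodule V of F^e_*A, in general no
  ideal; J is the ideal of all b whose multiples all lie in V. For x in m the power x^(j p^e) lies
  in J, since it multiplies the coefficients by x^j. As A is Noetherian, some m^c is contained in
  J.\<close>

lemma I_deep_combination:
  assumes g: "generates A (A.Fr e) g r"
  obtains c where "\<And>b. b \<in> I c \<Longrightarrow> \<exists>\<alpha>\<in>carrier (free_mod A {..<r}). (\<forall>i. \<alpha> i \<in> I j) \<and>
     b = (\<Oplus>i\<in>{..<r}. \<alpha> i [^] (p ^ e) \<otimes> g i)"
proof -
  note gR = A.generates_FrD(1)[OF g] and gE = A.generates_FrD(2)[OF g]
  interpret F: module A "A.Fr e" by (rule A.module_Fr)
  interpret FM: module A "free_mod A {..<r}" by (rule module_fun_mod[OF Am])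
  interpret Ij: ideal "I j" A by (rule I_ideal)
  let ?h = "\<lambda>\<alpha>. \<Oplus>i\<in>{..<r}. \<alpha> i [^] (p ^ e) \<otimes> g i"
  have gg: "g \<in> {..<r} \<rightarrow> carrier (A.Fr e)" using gR by simp
  have h: "?h \<in> module_hom A (free_mod A {..<r}) (A.Fr e)"
    using module_hom_combination[OF A.module_Fr finite_lessThan gg] by simp
  let ?U = "{\<alpha> \<in> carrier (free_mod A {..<r}). \<forall>i. \<alpha> i \<in> I j}"
  have U: "submodule ?U A (free_mod A {..<r})"
    unfolding FM.submodule_iff by (auto simp: Ij.I_l_closed)
  have V: "submodule (?h ` ?U) A (A.Fr e)" by (rule submodule_image[OF module_fun_mod[OF Am] A.module_Fr h U])
  define V where "V = ?h ` ?U"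
  let ?J = "{b \<in> carrier A. \<forall>y\<in>carrier A. b \<otimes> y \<in> V}"
  have Vs: "\<zero> \<in> V" "\<And>x y. x \<in> V \<Longrightarrow> y \<in> V \<Longrightarrow> x \<oplus> y \<in> V"
    using V unfolding F.submodule_iff V_def by auto
  have J: "ideal ?J A"
  proof -
    have "submodule ?J A (self_module A)"
      unfolding module.submodule_iff[OF Am]
    proof (intro conjI ballI)
      show "\<zero>\<^bsub>self_module A\<^esub> \<in> ?J" using Vs by auto
      show "x \<oplus>\<^bsub>self_module A\<^esub> y \<in> ?J" if "x \<in> ?J" "y \<in> ?J" for x y
        using that Vs by (auto simp: A.l_distr)
      show "a \<odot>\<^bsub>self_module A\<^esub> x \<in> ?J" if "a \<in> carrier A" "x \<in> ?J" for a x
      proof -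
        have "a \<otimes> x \<otimes> y \<in> V" if "y \<in> carrier A" for y
        proof -
          have "a \<otimes> x \<otimes> y = x \<otimes> (a \<otimes> y)" using that \<open>a \<in> carrier A\<close> \<open>x \<in> ?J\<close> by (simp add: A.m_ac)
          then show ?thesis using that \<open>a \<in> carrier A\<close> \<open>x \<in> ?J\<close> by auto
        qed
        then show ?thesis using that by simp
      qed
    qed auto
    then show ?thesis using submodule_self_iff_ideal[OF A.is_cring] by blast
  qed
  have "\<exists>n::nat. x [^] n \<in> ?J" if x: "x \<in> m" for x
  proof (intro exI[of _ "j * p ^ e"] CollectI conjI ballI)
    have xR: "x \<in> carrier A" using x m.a_subset by auto
    then show "x [^] (j * p ^ e) \<in> carrier A" by simp
    fix y assume "y \<in> carrier A"
    then obtain a where a: "a \<in> carrier (free_mod A {..<r})" "y = ?h a" using gE by blast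
    have xj: "x [^] j \<in> I j" by (rule A.ideal_pow_elem[OF m.ideal_axioms x])
    let ?b = "(x [^] j) \<odot>\<^bsub>free_mod A {..<r}\<^esub> a"
    have "?h ?b = (x [^] j) \<odot>\<^bsub>A.Fr e\<^esub> ?h a"
      using module_hom_smult[OF h _ a(1), of "x [^] j"] xR by simp
    also have "\<dots> = x [^] (j * p ^ e) \<otimes> y" using a xR by (simp add: A.nat_pow_pow)
    finally have "x [^] (j * p ^ e) \<otimes> y = ?h ?b" ..
    moreover have "?b \<in> ?U"
    proof -
      have "?b \<in> carrier (free_mod A {..<r})" by (rule FM.smult_closed) (use a xR in auto)
      moreover have "?b i \<in> I j" for i
        using xj fun_mod_closed[OF Am a(1), of i] by (simp add: Ij.I_r_closed)
      ultimately show ?thesis by blast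
    qed
    ultimately show "x [^] (j * p ^ e) \<otimes> y \<in> V" unfolding V_def by blast
  qed
  then obtain c where c: "I c \<subseteq> ?J" using A.ideal_pow_subset[OF noetherian m.ideal_axioms J] by blast
  show thesis
  proof (rule that[of c])
    fix b assume "b \<in> I c"
    then have b: "b \<in> ?J" using c by blast
    then have "b \<otimes> \<one> \<in> V" by blast
    then have "b \<in> V" using b by simp
    then show "\<exists>\<alpha>\<in>carrier (free_mod A {..<r}). (\<forall>i. \<alpha> i \<in> I j) \<and> b = ?h \<alpha>"
      unfolding V_def by blast
  qed
qed

lemma iota_fun: "\<alpha> \<in> carrier (free_mod A X) \<Longrightarrow> (\<lambda>i. \<iota> (\<alpha> i)) \<in> carrier (free_mod S X)"
  by auto

lemma iota_combination:
  assumes "\<alpha> \<in> carrier (free_mod A {..<r})" "g \<in> {..<r} \<rightarrow> carrier A"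
  shows "\<iota> (\<Oplus>i\<in>{..<r}. \<alpha> i [^] (p ^ e) \<otimes> g i) = (\<Oplus>\<^bsub>S\<^esub>i\<in>{..<r}. \<iota> (\<alpha> i) [^]\<^bsub>S\<^esub> (p ^ e) \<otimes>\<^bsub>S\<^esub> \<iota> (g i))"
proof -
  have c: "\<alpha> i \<in> carrier A" "g i \<in> carrier A" if "i < r" for i using assms that by auto
  have "\<iota> (\<Oplus>i\<in>{..<r}. \<alpha> i [^] (p ^ e) \<otimes> g i) = (\<Oplus>\<^bsub>S\<^esub>i\<in>{..<r}. (\<iota> \<circ> (\<lambda>i. \<alpha> i [^] (p ^ e) \<otimes> g i)) i)"
    by (subst iota.hom_finsum) (use c in \<open>auto simp: o_def\<close>)
  also have "\<dots> = (\<Oplus>\<^bsub>S\<^esub>i\<in>{..<r}. \<iota> (\<alpha> i) [^]\<^bsub>S\<^esub> (p ^ e) \<otimes>\<^bsub>S\<^esub> \<iota> (g i))"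
    by (rule S.finsum_cong') (use c in \<open>auto simp: iota_pow\<close>)
  finally show ?thesis .
qed

text \<open>Completeness turns the approximate expansions of \<open>I_deep_combination\<close> into a convergent series.\<close>

lemma K_deep_combination:
  assumes g: "generates A (A.Fr e) g r"
  obtains c where "\<And>x. x \<in> K c \<Longrightarrow> \<exists>\<gamma>\<in>carrier (free_mod S {..<r}). (\<forall>i. \<gamma> i \<in> K j) \<and>
     x = (\<Oplus>\<^bsub>S\<^esub>i\<in>{..<r}. \<gamma> i [^]\<^bsub>S\<^esub> (p ^ e) \<otimes>\<^bsub>S\<^esub> \<iota> (g i))"
proof -
  note gR = A.generates_FrD(1)[OF g]
  have giS: "\<iota> (g i) \<in> carrier S" if "i < r" for i using gR that by auto
  interpret FM: module A "free_mod A {..<r}" by (rule module_fun_mod[OF Am])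
  interpret SM: module S "free_mod S {..<r}" by (rule module_fun_mod[OF Sm])
  let ?AF = "carrier (free_mod A {..<r})"
  let ?SF = "carrier (free_mod S {..<r})"
  let ?h = "\<lambda>\<alpha>. \<Oplus>i\<in>{..<r}. \<alpha> i [^] (p ^ e) \<otimes> g i"
  let ?H = "\<lambda>\<gamma>. \<Oplus>\<^bsub>S\<^esub>i\<in>{..<r}. \<gamma> i [^]\<^bsub>S\<^esub> (p ^ e) \<otimes>\<^bsub>S\<^esub> \<iota> (g i)"
  have gg: "g \<in> {..<r} \<rightarrow> carrier (A.Fr e)" "(\<lambda>i. \<iota> (g i)) \<in> {..<r} \<rightarrow> carrier (S.Fr e)" using gR by auto
  have h: "?h \<in> module_hom A (free_mod A {..<r}) (A.Fr e)"
    using module_hom_combination[OF A.module_Fr finite_lessThan gg(1)] by simp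
  have H: "?H \<in> module_hom S (free_mod S {..<r}) (S.Fr e)"
    using module_hom_combination[OF S.module_Fr finite_lessThan gg(2)] by simp
  have "\<exists>c. \<forall>b. b \<in> I c \<longrightarrow> (\<exists>\<alpha>\<in>?AF. (\<forall>i. \<alpha> i \<in> I l) \<and> b = ?h \<alpha>)" for l
    by (rule I_deep_combination[OF g, of l]) blast
  then have "\<exists>c. \<forall>l. \<forall>b. b \<in> I (c l) \<longrightarrow> (\<exists>\<alpha>\<in>?AF. (\<forall>i. \<alpha> i \<in> I l) \<and> b = ?h \<alpha>)"
    by (intro choice allI)
  then obtain c where c: "\<And>l b. b \<in> I (c l) \<Longrightarrow> \<exists>\<alpha>\<in>?AF. (\<forall>i. \<alpha> i \<in> I l) \<and> b = ?h \<alpha>" by blast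
  \<comment> \<open>The sum dominates c l and is increasing in l; the summand l makes the remainders
    tend to zero.\<close>
  define D where "D = (\<lambda>l. (\<Sum>k\<le>l. c k) + l)"
  have Dc: "c l \<le> D l" "l \<le> D l" for l unfolding D_def by (auto intro: member_le_sum trans_le_add1)
  have DS: "D l \<le> D (Suc l)" for l unfolding D_def by simp
  have D: "\<exists>\<alpha>\<in>?AF. (\<forall>i. \<alpha> i \<in> I l) \<and> b = ?h \<alpha>" if "b \<in> I (D l)" for l b
    using c A.ideal_pow_antimono[OF m.ideal_axioms Dc(1)] that by blast
  have "\<exists>\<gamma>\<in>?SF. (\<forall>i. \<gamma> i \<in> K j) \<and> x = ?H \<gamma>" if x: "x \<in> K (D j)" for x
  proof -
    have xS: "x \<in> carrier S" using x K_subset by blast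
    \<comment> \<open>Stage n: coefficients \<beta> whose remainder lies in K (D (j + n)). The next
      correction is expanded with coefficients in m^(j + n), so the coefficient sequences
      converge.\<close>
    let ?P = "\<lambda>n \<beta>. \<beta> \<in> ?AF \<and> (\<forall>i. \<beta> i \<in> I j) \<and> x \<ominus>\<^bsub>S\<^esub> \<iota> (?h \<beta>) \<in> K (D (j + n))"
    let ?Q = "\<lambda>n \<beta> \<beta>'. \<forall>i. \<beta>' i \<ominus> \<beta> i \<in> I (j + n)"
    have "\<exists>B. \<forall>n. ?P n (B n) \<and> ?Q n (B n) (B (Suc n))"
    proof (rule dependent_nat_choice)
      have z: "(\<lambda>_. \<zero>) \<in> ?AF" by simp
      have "?h (\<lambda>_. \<zero>) = \<zero>" using module_hom_zero[OF FM.module_axioms A.module_Fr h] by simp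
      then have "x \<ominus>\<^bsub>S\<^esub> \<iota> (?h (\<lambda>_. \<zero>)) = x" using xS by (simp add: a_minus_def)
      then show "\<exists>\<beta>. ?P 0 \<beta>" using z x additive_subgroup.zero_closed[OF ideal.axioms(1)[OF I_ideal]]
        by (intro exI[of _ "\<lambda>_. \<zero>"]) simp
    next
      fix \<beta> n assume \<beta>: "?P n \<beta>"
      then obtain b where b: "b \<in> I (D (j + n))" "x \<ominus>\<^bsub>S\<^esub> \<iota> (?h \<beta>) \<ominus>\<^bsub>S\<^esub> \<iota> b \<in> K (D (j + Suc n))"
        using K_approx[of "x \<ominus>\<^bsub>S\<^esub> \<iota> (?h \<beta>)" "D (j + n)" "D (j + Suc n)"] DS[of "j + n"] by auto
      obtain \<alpha> where \<alpha>: "\<alpha> \<in> ?AF" "\<And>i. \<alpha> i \<in> I (j + n)" "b = ?h \<alpha>" using D[OF b(1)] by blast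
      let ?B = "\<beta> \<oplus>\<^bsub>free_mod A {..<r}\<^esub> \<alpha>"
      have B: "?B \<in> ?AF" using \<beta> \<alpha>(1) by (intro FM.M.add.m_closed) auto
      have c: "?h \<beta> \<in> carrier A" "?h \<alpha> \<in> carrier A" "\<And>i. \<beta> i \<in> carrier A" "\<And>i. \<alpha> i \<in> carrier A"
        using module_hom_closed[OF h] \<beta> \<alpha> fun_mod_closed[OF Am] by auto
      have "?h ?B = ?h \<beta> \<oplus> ?h \<alpha>" using module_hom_add[OF h _ \<alpha>(1), of \<beta>] \<beta> by simp
      then have "x \<ominus>\<^bsub>S\<^esub> \<iota> (?h ?B) = x \<ominus>\<^bsub>S\<^esub> (\<iota> (?h \<beta>) \<oplus>\<^bsub>S\<^esub> \<iota> b)" using c \<alpha>(3) by simp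
      also have "\<dots> = x \<ominus>\<^bsub>S\<^esub> \<iota> (?h \<beta>) \<ominus>\<^bsub>S\<^esub> \<iota> b"
      proof -
        have "\<iota> (?h \<beta>) \<in> carrier S" "\<iota> b \<in> carrier S" using c \<alpha>(3) by auto
        then show ?thesis using xS by (simp only: S.minus_add_eq)
      qed
      finally have "x \<ominus>\<^bsub>S\<^esub> \<iota> (?h ?B) \<in> K (D (j + Suc n))" using b(2) by simp
      moreover have "?B i \<in> I j" for i
      proof -
        have "\<alpha> i \<in> I j" using \<alpha>(2) A.ideal_pow_antimono[OF m.ideal_axioms, of j "j + n"] by auto
        then show ?thesis using \<beta> additive_subgroup.a_closed[OF ideal.axioms(1)[OF I_ideal], of "\<beta> i" j "\<alpha> i"] by simp
      qed
      moreover have "?B i \<ominus> \<beta> i \<in> I (j + n)" for i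
      proof -
        have "?B i \<ominus> \<beta> i = \<alpha> i" using c(3,4)[of i] by (simp add: A.add_minus_cancel)
        then show ?thesis using \<alpha>(2) by simp
      qed
      ultimately show "\<exists>\<beta>'. ?P (Suc n) \<beta>' \<and> ?Q n \<beta> \<beta>'" using B by blast
    qed
    then obtain B where B: "\<And>n. ?P n (B n)" "\<And>n. ?Q n (B n) (B (Suc n))" by blast
    have Bc: "B n i \<in> carrier A" for n i using B(1)[of n] I_subset by blast
    have ex: "\<exists>z\<in>carrier S. \<forall>n. z \<ominus>\<^bsub>S\<^esub> \<iota> (B n i) \<in> K n" for i
    proof (rule K_complete)
      show "\<iota> (B n i) \<in> carrier S" for n using Bc by simp
      show "\<iota> (B (Suc n) i) \<ominus>\<^bsub>S\<^esub> \<iota> (B n i) \<in> K n" for n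
      proof -
        have "B (Suc n) i \<ominus> B n i \<in> I n"
          using B(2)[of n] A.ideal_pow_antimono[OF m.ideal_axioms, of n "j + n"] by auto
        then have "\<iota> (B (Suc n) i \<ominus> B n i) \<in> K n" using K_iota Bc by blast
        then show ?thesis using iota_minus Bc by simp
      qed
    qed
    then obtain z where z: "\<And>i. z i \<in> carrier S" "\<And>i n. z i \<ominus>\<^bsub>S\<^esub> \<iota> (B n i) \<in> K n" by metis
    \<comment> \<open>The limits are cut off at r so that \<gamma> is an element of the free
      module.\<close>
    define \<gamma> where "\<gamma> = (\<lambda>i. if i < r then z i else \<zero>\<^bsub>S\<^esub>)"
    have \<gamma>: "\<gamma> \<in> ?SF" unfolding \<gamma>_def using z by auto
    have \<gamma>B: "\<gamma> i \<ominus>\<^bsub>S\<^esub> \<iota> (B n i) \<in> K n" for i n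
    proof (cases "i < r")
      case False
      then have "B n i = \<zero>" using B(1)[of n] by auto
      then show ?thesis using False by (simp add: \<gamma>_def a_minus_def K_zero)
    qed (simp add: \<gamma>_def z)
    have "\<gamma> i \<in> K j" for i
    proof -
      have "\<iota> (B j i) \<in> K j" using B(1)[of j] K_iota Bc by blast
      then have "(\<gamma> i \<ominus>\<^bsub>S\<^esub> \<iota> (B j i)) \<oplus>\<^bsub>S\<^esub> \<iota> (B j i) \<in> K j" using \<gamma>B K_add by blast
      then show ?thesis using fun_mod_closed[OF Sm \<gamma>, of i] Bc by (simp add: a_minus_def S.a_assoc S.l_neg)
    qed
    moreover have "x = ?H \<gamma>"
    proof -
      have HS: "?H \<gamma> \<in> carrier S" using module_hom_closed[OF H \<gamma>] by simp
      have "x \<ominus>\<^bsub>S\<^esub> ?H \<gamma> \<in> K n" for n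
      proof -
        let ?Y = "\<lambda>i. \<iota> (B n i)"
        have Y: "?Y \<in> ?SF" using iota_fun B(1) by blast
        have hB: "\<iota> (?h (B n)) = ?H ?Y" using iota_combination[OF _ gR] B(1) by blast
        have HY: "?H ?Y \<in> carrier S" using module_hom_closed[OF H Y] by simp
        let ?G = "\<gamma> \<ominus>\<^bsub>free_mod S {..<r}\<^esub> ?Y"
        have G: "?G = (\<lambda>i. \<gamma> i \<ominus>\<^bsub>self_module S\<^esub> ?Y i)" by (rule fun_mod_minus[OF Sm \<gamma> Y])
        have smi: "a \<ominus>\<^bsub>self_module S\<^esub> b = a \<ominus>\<^bsub>S\<^esub> b" for a b
          by (simp add: a_minus_def a_inv_def m_inv_def)
        \<comment> \<open>\<open>?H\<close> is additive because Frobenius is, so the difference of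
          the two sums is the combination with the differences of coefficients, whose p^e-th powers
          lie in K n.\<close>
        have "?H \<gamma> \<ominus>\<^bsub>S\<^esub> ?H ?Y = ?H ?G"
          using module_hom_minus[OF SM.module_axioms S.module_Fr H \<gamma> Y] HS HY by simp
        also have "\<dots> \<in> K n"
          by (rule ideal.finsum_closed_ideal[OF K_ideal])
            (use \<gamma>B giS in \<open>auto simp: G smi intro!: K_rmult K_pow\<close>)
        finally have 1: "?H \<gamma> \<ominus>\<^bsub>S\<^esub> ?H ?Y \<in> K n" .
        have 2: "x \<ominus>\<^bsub>S\<^esub> ?H ?Y \<in> K n"
          using B(1)[of n] hB K_mono[of n "D (j + n)"] Dc(2)[of "j + n"] by auto
        have "x \<ominus>\<^bsub>S\<^esub> ?H \<gamma> = (x \<ominus>\<^bsub>S\<^esub> ?H ?Y) \<ominus>\<^bsub>S\<^esub> (?H \<gamma> \<ominus>\<^bsub>S\<^esub> ?H ?Y)"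
          using xS HS HY by (simp only: S.minus_minus_cancel)
        then show ?thesis using K_minus[OF 2 1] by simp
      qed
      then have "x \<ominus>\<^bsub>S\<^esub> ?H \<gamma> = \<zero>\<^bsub>S\<^esub>" using xS HS by (intro K_Inter) auto
      then show ?thesis using xS HS by (simp add: S.minus_eq_zero_iff)
    qed
    ultimately show ?thesis using \<gamma> by blast
  qed
  then show thesis using that by blast
qed

text \<open>An element x of S lies in \<iota> A up to a remainder in K c. The former part expands
  over A, the latter by the convergent series. The series is used with j = 0, where K 0 is all of S
  and the coefficients are unrestricted.\<close>

lemma S_generates:
  assumes g: "generates A (A.Fr e) g r" shows "generates S (S.Fr e) (\<lambda>i. \<iota> (g i)) r"
proof -
  note gR = A.generates_FrD(1)[OF g]
  obtain c where c: "\<And>x. x \<in> K c \<Longrightarrow> \<exists>\<gamma>\<in>carrier (free_mod S {..<r}). (\<forall>i. \<gamma> i \<in> K 0) \<and>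
     x = (\<Oplus>\<^bsub>S\<^esub>i\<in>{..<r}. \<gamma> i [^]\<^bsub>S\<^esub> (p ^ e) \<otimes>\<^bsub>S\<^esub> \<iota> (g i))" using K_deep_combination[OF g] by blast
  let ?H = "\<lambda>\<gamma>. \<Oplus>\<^bsub>S\<^esub>i\<in>{..<r}. \<gamma> i [^]\<^bsub>S\<^esub> (p ^ e) \<otimes>\<^bsub>S\<^esub> \<iota> (g i)"
  interpret SM: module S "free_mod S {..<r}" by (rule module_fun_mod[OF Sm])
  have gg: "(\<lambda>i. \<iota> (g i)) \<in> {..<r} \<rightarrow> carrier (S.Fr e)" using gR by auto
  have H: "?H \<in> module_hom S (free_mod S {..<r}) (S.Fr e)"
    using module_hom_combination[OF S.module_Fr finite_lessThan gg] by simp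
  have "\<exists>\<gamma>\<in>carrier (free_mod S {..<r}). x = ?H \<gamma>" if x: "x \<in> carrier S" for x
  proof -
    obtain a where a: "a \<in> carrier A" "x \<ominus>\<^bsub>S\<^esub> \<iota> a \<in> K c" using K_dense[OF x] by blast
    obtain \<alpha> where \<alpha>: "\<alpha> \<in> carrier (free_mod A {..<r})" "a = (\<Oplus>i\<in>{..<r}. \<alpha> i [^] (p ^ e) \<otimes> g i)"
      using A.generates_FrD(2)[OF g a(1)] by blast
    obtain \<gamma> where \<gamma>: "\<gamma> \<in> carrier (free_mod S {..<r})" "x \<ominus>\<^bsub>S\<^esub> \<iota> a = ?H \<gamma>" using c[OF a(2)] by blast
    let ?Y = "\<lambda>i. \<iota> (\<alpha> i)"
    have Y: "?Y \<in> carrier (free_mod S {..<r})" by (rule iota_fun[OF \<alpha>(1)])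
    have 1: "\<iota> a = ?H ?Y" unfolding \<alpha>(2) by (rule iota_combination[OF \<alpha>(1) gR])
    have "x = (x \<ominus>\<^bsub>S\<^esub> \<iota> a) \<oplus>\<^bsub>S\<^esub> \<iota> a" using x a(1) by (simp add: S.minus_add_cancel)
    also have "\<dots> = ?H \<gamma> \<oplus>\<^bsub>S\<^esub> ?H ?Y" by (simp only: \<gamma>(2) 1[symmetric])
    also have "\<dots> = ?H (\<gamma> \<oplus>\<^bsub>free_mod S {..<r}\<^esub> ?Y)"
      using module_hom_add[OF H \<gamma>(1) Y] by simp
    finally show ?thesis using SM.M.add.m_closed[OF \<gamma>(1) Y] by blast
  qed
  then show ?thesis unfolding generates_def using gg by simp
qed

end

section \<open>Decompositions into indecomposables\<close>

lemma (in module) finsum_in_submodule: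
  assumes "submodule U R M" "finite X" "\<And>i. i \<in> X \<Longrightarrow> f i \<in> U"
  shows "finsum M f X \<in> U"
  using assms(2,3)
proof (induction X)
  case empty then show ?case using assms(1) by (simp add: submodule_iff)
next
  case (insert x X)
  note U = assms(1)[unfolded submodule_iff]
  have "finsum M f (insert x X) = f x \<oplus>\<^bsub>M\<^esub> finsum M f X"
    using insert U by (intro M.finsum_insert) auto
  then show ?case using insert U by auto
qed

text \<open>The generators are indexed by a finite set instead of an initial segment, because they
  are removed one at a time and their number is the induction measure for decompositions.\<close>

definition spans ::
    "('a, 'r) ring_scheme \<Rightarrow> ('a, 'b, 'm) module_scheme \<Rightarrow> 'b set \<Rightarrow> nat set \<Rightarrow> (nat \<Rightarrow> 'b) \<Rightarrow> bool" where
  "spans R M U X u \<longleftrightarrow> finite X \<and> u \<in> X \<rightarrow> U \<and>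
     (\<forall>x\<in>U. \<exists>a\<in>carrier (free_mod R X). x = (\<Oplus>\<^bsub>M\<^esub>i\<in>X. a i \<odot>\<^bsub>M\<^esub> u i))"

lemma (in module) spans_image_subset:
  assumes "submodule V R M" "finite X" "u \<in> X \<rightarrow> V" "a \<in> carrier (free_mod R X)"
  shows "(\<Oplus>\<^bsub>M\<^esub>i\<in>X. a i \<odot>\<^bsub>M\<^esub> u i) \<in> V"
proof (rule finsum_in_submodule[OF assms(1,2)])
  fix i assume "i \<in> X"
  then have "a i \<in> carrier R" "u i \<in> V" using assms(3,4) by auto
  then show "a i \<odot>\<^bsub>M\<^esub> u i \<in> V" using assms(1) unfolding submodule_iff by blast
qed

lemma (in module) spansI:
  assumes U: "submodule U R M" and X: "finite X" and u: "u \<in> X \<rightarrow> U"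
    and min: "\<And>V. submodule V R M \<Longrightarrow> u ` X \<subseteq> V \<Longrightarrow> U \<subseteq> V"
  shows "spans R M U X u"
proof -
  have Rm: "module R (self_module R)" by (rule module_self_module[OF R.is_cring])
  interpret F: module R "free_mod R X" by (rule module_fun_mod[OF Rm])
  have uM: "u \<in> X \<rightarrow> carrier M" using u submoduleE(1)[OF U] by auto
  let ?h = "\<lambda>c. \<Oplus>\<^bsub>M\<^esub>i\<in>X. c i \<odot>\<^bsub>M\<^esub> u i"
  have h: "?h \<in> module_hom R (free_mod R X) M"
    by (rule module_hom_combination[OF module_axioms X uM])
  have "u i \<in> ?h ` carrier (free_mod R X)" if i: "i \<in> X" for i
  proof -
    let ?c = "\<lambda>j. if j = i then \<one> else \<zero>"
    have "?h ?c = (\<Oplus>\<^bsub>M\<^esub>j\<in>X. if i = j then u j else \<zero>\<^bsub>M\<^esub>)"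
      by (rule M.finsum_cong') (use uM in \<open>auto simp: Pi_def\<close>)
    also have "\<dots> = u i" using i uM X by (intro M.finsum_singleton) auto
    finally show ?thesis using i by (intro image_eqI[of _ _ ?c]) auto
  qed
  then have "U \<subseteq> ?h ` carrier (free_mod R X)"
    by (intro min submodule_image[OF module_fun_mod[OF Rm] module_axioms h F.carrier_is_submodule]) auto
  then show ?thesis unfolding spans_def using X u by blast
qed

section \<open>Direct sums of submodules\<close>

lemma submodule_trans:
  assumes M: "module R M" and U: "submodule U R M"
  shows "submodule K R (M\<lparr>carrier := U\<rparr>) \<longleftrightarrow> submodule K R M \<and> K \<subseteq> U"
proof -
  interpret M: module R M by fact
  interpret U: module R "M\<lparr>carrier := U\<rparr>" by (rule submodule.submodule_is_module[OF U M])
  show ?thesis unfolding M.submodule_iff U.submodule_iff using M.submoduleE(1)[OF U] by auto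
qed

lemma (in module) direct_sum_projections:
  assumes U: "submodule U R M" and K: "submodule K R M" and L: "submodule L R M"
    and sum: "U = {k \<oplus>\<^bsub>M\<^esub> l | k l. k \<in> K \<and> l \<in> L}" and int: "K \<inter> L = {\<zero>\<^bsub>M\<^esub>}"
  obtains \<pi> where "\<pi> \<in> module_hom R (M\<lparr>carrier := U\<rparr>) M"
    "\<And>x. x \<in> U \<Longrightarrow> \<pi> x \<in> K" "\<And>x. x \<in> K \<Longrightarrow> \<pi> x = x" "\<And>x. x \<in> L \<Longrightarrow> \<pi> x = \<zero>\<^bsub>M\<^esub>"
proof -
  note Ks = K[unfolded submodule_iff] and Ls = L[unfolded submodule_iff]
  have uniq: "k = k'" if kl: "k \<in> K" "k' \<in> K" "l \<in> L" "l' \<in> L" "k \<oplus>\<^bsub>M\<^esub> l = k' \<oplus>\<^bsub>M\<^esub> l'" for k k' l l'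
  proof -
    have c: "k \<in> carrier M" "k' \<in> carrier M" "l \<in> carrier M" "l' \<in> carrier M" using kl Ks Ls by auto
    have "k \<ominus>\<^bsub>M\<^esub> k' = l' \<ominus>\<^bsub>M\<^esub> l"
    proof -
      have "k = k' \<oplus>\<^bsub>M\<^esub> l' \<ominus>\<^bsub>M\<^esub> l" using kl(5)[symmetric] c by (simp add: M.add_minus_cancel M.a_comm[of k l])
      then have "k \<ominus>\<^bsub>M\<^esub> k' = k' \<oplus>\<^bsub>M\<^esub> (l' \<ominus>\<^bsub>M\<^esub> l) \<ominus>\<^bsub>M\<^esub> k'" using c by (simp add: a_minus_def M.a_assoc)
      then show ?thesis using c by (simp add: M.add_minus_cancel)
    qed
    moreover have "k \<ominus>\<^bsub>M\<^esub> k' \<in> K" "l' \<ominus>\<^bsub>M\<^esub> l \<in> L" using submodule_minus K L kl by auto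
    ultimately have "k \<ominus>\<^bsub>M\<^esub> k' = \<zero>\<^bsub>M\<^esub>" using int by auto
    then show ?thesis using c M.minus_eq_zero_iff by blast
  qed
  define \<pi> where "\<pi> = (\<lambda>x. THE k. k \<in> K \<and> (\<exists>l\<in>L. x = k \<oplus>\<^bsub>M\<^esub> l))"
  have \<pi>: "\<pi> (k \<oplus>\<^bsub>M\<^esub> l) = k" if "k \<in> K" "l \<in> L" for k l
    unfolding \<pi>_def by (rule the_equality) (use that uniq in blast)+
  show thesis
  proof (rule that[of \<pi>])
    show "\<pi> \<in> module_hom R (M\<lparr>carrier := U\<rparr>) M"
    proof (rule module_homI)
      fix x assume "x \<in> carrier (M\<lparr>carrier := U\<rparr>)"
      then obtain k l where x: "k \<in> K" "l \<in> L" "x = k \<oplus>\<^bsub>M\<^esub> l" using sum by auto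
      then show "\<pi> x \<in> carrier M" using \<pi> Ks by auto
      fix a assume a: "a \<in> carrier R"
      have "a \<odot>\<^bsub>M\<^esub> x = a \<odot>\<^bsub>M\<^esub> k \<oplus>\<^bsub>M\<^esub> a \<odot>\<^bsub>M\<^esub> l" using x a Ks Ls by (auto intro: smult_r_distr)
      then show "\<pi> (a \<odot>\<^bsub>M\<lparr>carrier := U\<rparr>\<^esub> x) = a \<odot>\<^bsub>M\<^esub> \<pi> x" using x a Ks Ls by (simp add: \<pi>)
    next
      fix x y assume xy: "x \<in> carrier (M\<lparr>carrier := U\<rparr>)" "y \<in> carrier (M\<lparr>carrier := U\<rparr>)"
      obtain k l where x: "k \<in> K" "l \<in> L" "x = k \<oplus>\<^bsub>M\<^esub> l" using xy sum by auto
      obtain k' l' where y: "k' \<in> K" "l' \<in> L" "y = k' \<oplus>\<^bsub>M\<^esub> l'" using xy sum by auto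
      have "k \<in> carrier M" "k' \<in> carrier M" "l \<in> carrier M" "l' \<in> carrier M" using x y Ks Ls by auto
      then have "x \<oplus>\<^bsub>M\<^esub> y = (k \<oplus>\<^bsub>M\<^esub> k') \<oplus>\<^bsub>M\<^esub> (l \<oplus>\<^bsub>M\<^esub> l')" unfolding x y by (simp add: M.a_ac)
      then show "\<pi> (x \<oplus>\<^bsub>M\<lparr>carrier := U\<rparr>\<^esub> y) = \<pi> x \<oplus>\<^bsub>M\<^esub> \<pi> y" using x y Ks Ls by (simp add: \<pi>)
    qed
    show "\<pi> x \<in> K" if "x \<in> U" for x using that \<pi> unfolding sum by auto
    show "\<pi> x = x" if "x \<in> K" for x using \<pi>[of x "\<zero>\<^bsub>M\<^esub>"] that Ls Ks by auto
    show "\<pi> x = \<zero>\<^bsub>M\<^esub>" if "x \<in> L" for x using \<pi>[of "\<zero>\<^bsub>M\<^esub>" x] that Ls Ks by auto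
  qed
qed

text \<open>An element of \<open>L\<close> outside \<open>m U\<close> yields a relation with a unit coefficient among
  the projections of the generators to \<open>K\<close>, so one of these is redundant.\<close>

lemma (in module) direct_summand_fewer_generators:
  assumes U: "submodule U R M" and K: "submodule K R M" and L: "submodule L R M"
    and sum: "U = {k \<oplus>\<^bsub>M\<^esub> l | k l. k \<in> K \<and> l \<in> L}" and int: "K \<inter> L = {\<zero>\<^bsub>M\<^esub>}" and L0: "L \<noteq> {\<zero>\<^bsub>M\<^esub>}"
    and sp: "spans R M U X u"
    and local: "\<And>a. a \<in> carrier R \<Longrightarrow> a \<notin> m \<Longrightarrow> a \<in> Units R"
    and F: "\<And>j::nat. submodule (F j) R M" "F 0 = carrier M" "\<And>a x j. a \<in> m \<Longrightarrow> x \<in> F j \<Longrightarrow> a \<odot>\<^bsub>M\<^esub> x \<in> F (Suc j)"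
      "\<And>x. x \<in> carrier M \<Longrightarrow> (\<And>j. x \<in> F j) \<Longrightarrow> x = \<zero>\<^bsub>M\<^esub>"
  obtains v i where "i \<in> X" "spans R M K (X - {i}) v"
proof -
  have Rm: "module R (self_module R)" by (rule module_self_module[OF R.is_cring])
  note clo = fun_mod_closed[OF Rm, unfolded self_module_simps]
  have X: "finite X" and uU: "u \<in> X \<rightarrow> U"
    and rep: "\<And>x. x \<in> U \<Longrightarrow> \<exists>a\<in>carrier (free_mod R X). x = (\<Oplus>\<^bsub>M\<^esub>i\<in>X. a i \<odot>\<^bsub>M\<^esub> u i)"
    using sp unfolding spans_def by blast+
  note Us = U[unfolded submodule_iff] and Ks = K[unfolded submodule_iff] and Ls = L[unfolded submodule_iff]
  interpret UM: module R "M\<lparr>carrier := U\<rparr>" by (rule submodule.submodule_is_module[OF U module_axioms])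
  have sum': "U = {k \<oplus>\<^bsub>M\<^esub> l | k l. k \<in> L \<and> l \<in> K}"
    unfolding sum using M.a_comm Ks Ls by (auto) (metis subsetD)+
  obtain \<pi> where \<pi>: "\<pi> \<in> module_hom R (M\<lparr>carrier := U\<rparr>) M"
    "\<And>x. x \<in> U \<Longrightarrow> \<pi> x \<in> K" "\<And>x. x \<in> K \<Longrightarrow> \<pi> x = x" "\<And>x. x \<in> L \<Longrightarrow> \<pi> x = \<zero>\<^bsub>M\<^esub>"
    by (rule direct_sum_projections[OF U K L sum int]) blast
  obtain \<rho> where \<rho>: "\<rho> \<in> module_hom R (M\<lparr>carrier := U\<rparr>) M"
    "\<And>x. x \<in> U \<Longrightarrow> \<rho> x \<in> L" "\<And>x. x \<in> L \<Longrightarrow> \<rho> x = x"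
    by (rule direct_sum_projections[OF U L K sum']) (use int in blast)+
  have finsumU: "finsum (M\<lparr>carrier := U\<rparr>) f X = finsum M f X" if "\<And>i. i \<in> X \<Longrightarrow> f i \<in> U" for f
    using X that
  proof (induction X)
    case (insert x X)
    have "finsum (M\<lparr>carrier := U\<rparr>) f (insert x X) = f x \<oplus>\<^bsub>M\<^esub> finsum (M\<lparr>carrier := U\<rparr>) f X"
      using insert by (subst UM.M.finsum_insert) auto
    moreover have "finsum M f (insert x X) = f x \<oplus>\<^bsub>M\<^esub> finsum M f X"
      using insert Us by (subst M.finsum_insert) auto
    ultimately show ?case using insert by simp
  qed simp
  have hom_sum: "h (\<Oplus>\<^bsub>M\<^esub>i\<in>X. a i \<odot>\<^bsub>M\<^esub> u i) = (\<Oplus>\<^bsub>M\<^esub>i\<in>X. a i \<odot>\<^bsub>M\<^esub> h (u i))"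
    if h: "h \<in> module_hom R (M\<lparr>carrier := U\<rparr>) M" and a: "a \<in> carrier (free_mod R X)" for h a
  proof -
    have au: "a i \<odot>\<^bsub>M\<^esub> u i \<in> U" if "i \<in> X" for i using funcset_mem[OF uU that] Us clo[OF a] by blast
    have "h (finsum (M\<lparr>carrier := U\<rparr>) (\<lambda>i. a i \<odot>\<^bsub>M\<^esub> u i) X) = (\<Oplus>\<^bsub>M\<^esub>i\<in>X. h (a i \<odot>\<^bsub>M\<^esub> u i))"
      using au by (intro module_hom_finsum[OF UM.module_axioms module_axioms h X]) auto
    also have "\<dots> = (\<Oplus>\<^bsub>M\<^esub>i\<in>X. a i \<odot>\<^bsub>M\<^esub> h (u i))"
    proof (rule M.finsum_cong')
      have hu: "h (u i) \<in> carrier M" if "i \<in> X" for i using module_hom_closed[OF h, of "u i"] that uU by auto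
      then show "(\<lambda>i. a i \<odot>\<^bsub>M\<^esub> h (u i)) \<in> X \<rightarrow> carrier M" using clo[OF a] by auto
      show "h (a i \<odot>\<^bsub>M\<^esub> u i) = a i \<odot>\<^bsub>M\<^esub> h (u i)" if "i \<in> X" for i
        using module_hom_smult[OF h clo[OF a], of "u i"] that uU by auto
    qed simp
    finally show ?thesis using finsumU au by simp
  qed
  \<comment> \<open>Otherwise every expansion of an element of L has all its coefficients in m.
    Projecting the expansion to L by \<rho> shows inductively that L lies in every F j, so L =
    0.\<close>
  have "\<exists>a\<in>carrier (free_mod R X). (\<Oplus>\<^bsub>M\<^esub>i\<in>X. a i \<odot>\<^bsub>M\<^esub> u i) \<in> L \<and> (\<exists>i\<in>X. a i \<notin> m)"
  proof (rule ccontr)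
    assume no: "\<not> ?thesis"
    have LU: "L \<subseteq> U"
    proof
      fix l assume l: "l \<in> L"
      then have "l = \<zero>\<^bsub>M\<^esub> \<oplus>\<^bsub>M\<^esub> l" using Ls by auto
      then show "l \<in> U" unfolding sum using l Ks by blast
    qed
    have "L \<subseteq> F j" for j
    proof (induction j)
      case 0 then show ?case using F(2) Ls by simp
    next
      case (Suc j)
      show ?case
      proof
        fix l assume l: "l \<in> L"
        then obtain a where a: "a \<in> carrier (free_mod R X)" "l = (\<Oplus>\<^bsub>M\<^esub>i\<in>X. a i \<odot>\<^bsub>M\<^esub> u i)" using rep LU by blast
        then have am: "a i \<in> m" if "i \<in> X" for i using no l that by blast
        have "l = \<rho> l" using \<rho>(3) l by simp
        also have "\<dots> = (\<Oplus>\<^bsub>M\<^esub>i\<in>X. a i \<odot>\<^bsub>M\<^esub> \<rho> (u i))" unfolding a(2) by (rule hom_sum[OF \<rho>(1) a(1)])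
        also have "\<dots> \<in> F (Suc j)"
          using am \<rho>(2) uU Suc by (intro finsum_in_submodule[OF F(1) X]) (auto intro!: F(3))
        finally show "l \<in> F (Suc j)" .
      qed
    qed
    then have "l = \<zero>\<^bsub>M\<^esub>" if "l \<in> L" for l using F(4)[of l] submoduleE(1)[OF L] that by auto
    moreover have "\<zero>\<^bsub>M\<^esub> \<in> L" using Ls by simp
    ultimately have "L = {\<zero>\<^bsub>M\<^esub>}" by blast
    then show False by (rule notE[OF L0])
  qed
  then obtain a i where a: "a \<in> carrier (free_mod R X)" "(\<Oplus>\<^bsub>M\<^esub>i\<in>X. a i \<odot>\<^bsub>M\<^esub> u i) \<in> L"
    and i: "i \<in> X" "a i \<notin> m" by blast
  have ai: "a i \<in> Units R" using local clo[OF a(1)] i by blast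
  let ?v = "\<lambda>i. \<pi> (u i)"
  have vK: "?v j \<in> K" if "j \<in> X" for j using \<pi>(2) uU that by auto
  have vM: "?v j \<in> carrier M" if "j \<in> X" for j using vK[OF that] Ks by auto
  have zero: "(\<Oplus>\<^bsub>M\<^esub>j\<in>X. a j \<odot>\<^bsub>M\<^esub> ?v j) = \<zero>\<^bsub>M\<^esub>"
    using hom_sum[OF \<pi>(1) a(1)] \<pi>(4)[OF a(2)] by simp
  \<comment> \<open>The chosen combination of generators lies in L, so \<pi> turns it into a
    relation; the unit a i then expresses the i-th projected generator through the others.\<close>
  have "spans R M K (X - {i}) ?v"
  proof (rule spansI[OF K])
    show "finite (X - {i})" "?v \<in> X - {i} \<rightarrow> K" using X vK by auto
    fix V assume V: "submodule V R M" "?v ` (X - {i}) \<subseteq> V"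
    note Vs = V(1)[unfolded submodule_iff]
    let ?s = "\<Oplus>\<^bsub>M\<^esub>j\<in>X - {i}. a j \<odot>\<^bsub>M\<^esub> ?v j"
    have s: "?s \<in> V" using X V Vs clo[OF a(1)] by (intro finsum_in_submodule[OF V(1)]) auto
    have "X = insert i (X - {i})" using i by auto
    then have "(\<Oplus>\<^bsub>M\<^esub>j\<in>X. a j \<odot>\<^bsub>M\<^esub> ?v j) = a i \<odot>\<^bsub>M\<^esub> ?v i \<oplus>\<^bsub>M\<^esub> ?s"
      using X vM clo[OF a(1)] i by (subst \<open>X = _\<close>, subst M.finsum_insert) auto
    then have "a i \<odot>\<^bsub>M\<^esub> ?v i \<oplus>\<^bsub>M\<^esub> ?s = \<zero>\<^bsub>M\<^esub>" using zero by simp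
    moreover have "?s \<in> carrier M" using s submoduleE(1)[OF V(1)] by blast
    ultimately have "\<ominus>\<^bsub>M\<^esub> ?s = a i \<odot>\<^bsub>M\<^esub> ?v i"
      using vM[OF i(1)] clo[OF a(1), of i] by (intro M.minus_equality) auto
    then have "a i \<odot>\<^bsub>M\<^esub> ?v i \<in> V" using submoduleE(3)[OF V(1) s] by metis
    then have "inv a i \<odot>\<^bsub>M\<^esub> (a i \<odot>\<^bsub>M\<^esub> ?v i) \<in> V" using Vs ai by auto
    then have vi: "?v i \<in> V" using ai vM[OF i(1)] by (simp add: smult_assoc1[symmetric] R.Units_closed)
    show "K \<subseteq> V"
    proof
      fix x assume x: "x \<in> K"
      have "x = x \<oplus>\<^bsub>M\<^esub> \<zero>\<^bsub>M\<^esub>" using x Ks by auto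
      then have "x \<in> U" unfolding sum using x Ls by blast
      then obtain b where b: "b \<in> carrier (free_mod R X)" "x = (\<Oplus>\<^bsub>M\<^esub>i\<in>X. b i \<odot>\<^bsub>M\<^esub> u i)" using rep by blast
      have "x = \<pi> x" using \<pi>(3) x by simp
      also have "\<dots> = (\<Oplus>\<^bsub>M\<^esub>i\<in>X. b i \<odot>\<^bsub>M\<^esub> ?v i)" unfolding b(2) by (rule hom_sum[OF \<pi>(1) b(1)])
      also have "\<dots> \<in> V" by (rule spans_image_subset[OF V(1) X _ b(1)]) (use vi V(2) in auto)
      finally show "x \<in> V" .
    qed
  qed
  then show thesis using that i by blast
qed

text \<open>The notion of \<open>indecomposable_decomposition\<close> for a submodule U of a fixed
  M: all parts stay submodules of one module while the induction descends to summands.\<close>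

definition decomposes ::
    "('a, 'r) ring_scheme \<Rightarrow> ('a, 'b, 'm) module_scheme \<Rightarrow> 'b set \<Rightarrow> nat \<Rightarrow> (nat \<Rightarrow> 'b set) \<Rightarrow> bool" where
  "decomposes R M U n N \<longleftrightarrow> (\<forall>k<n. submodule (N k) R M \<and> indecomposable_module R (M\<lparr>carrier := N k\<rparr>)) \<and>
     bij_betw (\<lambda>x. finsum M x {..<n}) (Pi\<^sub>E {..<n} N) U"

lemma (in module) finsum_lessThan_add:
  assumes "f \<in> {..<n + k} \<rightarrow> carrier M"
  shows "finsum M f {..<n + k} = finsum M f {..<n} \<oplus>\<^bsub>M\<^esub> finsum M (\<lambda>i. f (n + i)) {..<k::nat}"
proof -
  have e: "{..<n + k} = {..<n} \<union> (\<lambda>i. n + i) ` {..<k}"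
  proof (intro equalityI subsetI)
    fix x assume "x \<in> {..<n + k}"
    then show "x \<in> {..<n} \<union> (\<lambda>i. n + i) ` {..<k}" by (cases "x < n") (auto intro!: image_eqI[of _ _ "x - n"])
  qed auto
  have f: "f i \<in> carrier M" if "i < n + k" for i using assms that by auto
  have "finsum M f {..<n + k} = finsum M f {..<n} \<oplus>\<^bsub>M\<^esub> finsum M f ((\<lambda>i. n + i) ` {..<k})"
    unfolding e by (rule M.finsum_Un_disjoint) (use f in auto)
  also have "finsum M f ((\<lambda>i. n + i) ` {..<k}) = finsum M (\<lambda>i. f (n + i)) {..<k}"
    by (rule M.finsum_reindex) (use f in auto)
  finally show ?thesis .
qed

text \<open>The two families are concatenated, the second one shifted by n1; a choice of components
  then splits into a restriction and a shifted restriction.\<close>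

lemma (in module) decomposes_direct_sum:
  assumes K: "submodule K R M" and L: "submodule L R M"
    and sum: "U = {k \<oplus>\<^bsub>M\<^esub> l | k l. k \<in> K \<and> l \<in> L}" and int: "K \<inter> L = {\<zero>\<^bsub>M\<^esub>}"
    and N1: "decomposes R M K n1 N1" and N2: "decomposes R M L n2 N2"
  shows "\<exists>n N. decomposes R M U n N"
proof -
  let ?N = "\<lambda>k. if k < n1 then N1 k else N2 (k - n1)"
  let ?f = "\<lambda>n x. finsum M x {..<n::nat}"
  note Ks = K[unfolded submodule_iff] and Ls = L[unfolded submodule_iff]
  have b1: "bij_betw (?f n1) (Pi\<^sub>E {..<n1} N1) K" and b2: "bij_betw (?f n2) (Pi\<^sub>E {..<n2} N2) L"
    using N1 N2 unfolding decomposes_def by auto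
  have s1: "N1 k \<subseteq> carrier M" if "k < n1" for k using N1 that submoduleE(1) unfolding decomposes_def by blast
  have s2: "N2 k \<subseteq> carrier M" if "k < n2" for k using N2 that submoduleE(1) unfolding decomposes_def by blast
  have split: "?f (n1 + n2) x = ?f n1 (restrict x {..<n1}) \<oplus>\<^bsub>M\<^esub> ?f n2 (restrict (\<lambda>i. x (n1 + i)) {..<n2})"
    and r1: "restrict x {..<n1} \<in> Pi\<^sub>E {..<n1} N1" and r2: "restrict (\<lambda>i. x (n1 + i)) {..<n2} \<in> Pi\<^sub>E {..<n2} N2"
    if x: "x \<in> Pi\<^sub>E {..<n1 + n2} ?N" for x
  proof -
    have x1: "x i \<in> N1 i" if "i < n1" for i using PiE_mem[OF x, of i] that by auto
    have x2: "x (n1 + i) \<in> N2 i" if "i < n2" for i using PiE_mem[OF x, of "n1 + i"] that by auto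
    have xc: "x i \<in> carrier M" if "i < n1 + n2" for i
    proof (cases "i < n1")
      case True then show ?thesis using x1 s1 by blast
    next
      case False
      then have "i = n1 + (i - n1)" "i - n1 < n2" using that by auto
      then show ?thesis using x2 s2 by (metis subsetD)
    qed
    have "?f (n1 + n2) x = ?f n1 x \<oplus>\<^bsub>M\<^esub> ?f n2 (\<lambda>i. x (n1 + i))"
      by (rule finsum_lessThan_add) (use xc in auto)
    also have "?f n1 x = ?f n1 (restrict x {..<n1})" by (rule M.finsum_cong') (use xc in auto)
    also have "?f n2 (\<lambda>i. x (n1 + i)) = ?f n2 (restrict (\<lambda>i. x (n1 + i)) {..<n2})"
      by (rule M.finsum_cong') (use xc in auto)
    finally show "?f (n1 + n2) x = ?f n1 (restrict x {..<n1}) \<oplus>\<^bsub>M\<^esub> ?f n2 (restrict (\<lambda>i. x (n1 + i)) {..<n2})" .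
    show "restrict x {..<n1} \<in> Pi\<^sub>E {..<n1} N1" "restrict (\<lambda>i. x (n1 + i)) {..<n2} \<in> Pi\<^sub>E {..<n2} N2"
      using x1 x2 by auto
  qed
  have f1: "?f n1 x \<in> K" if "x \<in> Pi\<^sub>E {..<n1} N1" for x using b1 that unfolding bij_betw_def by blast
  have f2: "?f n2 x \<in> L" if "x \<in> Pi\<^sub>E {..<n2} N2" for x using b2 that unfolding bij_betw_def by blast
  have UU: "submodule U R M" unfolding sum by (rule submodule_sum[OF K L])
  have sum': "U = {k \<oplus>\<^bsub>M\<^esub> l | k l. k \<in> L \<and> l \<in> K}"
    unfolding sum using M.a_comm Ks Ls by (auto) (metis subsetD)+
  have uniq: "k = k' \<and> l = l'" if kl: "k \<in> K" "k' \<in> K" "l \<in> L" "l' \<in> L" "k \<oplus>\<^bsub>M\<^esub> l = k' \<oplus>\<^bsub>M\<^esub> l'" for k k' l l'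
  proof -
    obtain \<pi> where \<pi>: "\<pi> \<in> module_hom R (M\<lparr>carrier := U\<rparr>) M"
      "\<And>x. x \<in> K \<Longrightarrow> \<pi> x = x" "\<And>x. x \<in> L \<Longrightarrow> \<pi> x = \<zero>\<^bsub>M\<^esub>"
      by (rule direct_sum_projections[OF UU K L sum int]) blast
    have inU: "x \<in> U" if "x \<in> K \<union> L" for x
    proof -
      have "x = x \<oplus>\<^bsub>M\<^esub> \<zero>\<^bsub>M\<^esub>" "x = \<zero>\<^bsub>M\<^esub> \<oplus>\<^bsub>M\<^esub> x" using that Ks Ls by auto
      then show ?thesis unfolding sum using that Ks Ls by blast
    qed
    have e: "\<pi> (a \<oplus>\<^bsub>M\<^esub> b) = a" if "a \<in> K" "b \<in> L" for a b
      using module_hom_add[OF \<pi>(1), of a b] that inU \<pi>(2,3) Ks by auto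
    have "k = k'" using e[of k l] e[of k' l'] kl by simp
    moreover have "k \<in> carrier M" "l \<in> carrier M" "l' \<in> carrier M" using kl Ks Ls by auto
    ultimately show ?thesis using kl(5) M.add.l_cancel[of k l l'] by simp
  qed
  have "bij_betw (?f (n1 + n2)) (Pi\<^sub>E {..<n1 + n2} ?N) U"
  proof (rule bij_betw_imageI)
    show "inj_on (?f (n1 + n2)) (Pi\<^sub>E {..<n1 + n2} ?N)"
    proof (rule inj_onI)
      fix x y assume x: "x \<in> Pi\<^sub>E {..<n1 + n2} ?N" and y: "y \<in> Pi\<^sub>E {..<n1 + n2} ?N"
        and eq: "?f (n1 + n2) x = ?f (n1 + n2) y"
      have "?f n1 (restrict x {..<n1}) = ?f n1 (restrict y {..<n1}) \<and>
         ?f n2 (restrict (\<lambda>i. x (n1 + i)) {..<n2}) = ?f n2 (restrict (\<lambda>i. y (n1 + i)) {..<n2})"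
        using uniq[OF f1[OF r1[OF x]] f1[OF r1[OF y]] f2[OF r2[OF x]] f2[OF r2[OF y]]] eq
        unfolding split[OF x] split[OF y] by blast
      then have "restrict x {..<n1} = restrict y {..<n1}"
        "restrict (\<lambda>i. x (n1 + i)) {..<n2} = restrict (\<lambda>i. y (n1 + i)) {..<n2}"
        using inj_onD[OF bij_betw_imp_inj_on[OF b1] _ r1[OF x] r1[OF y]]
          inj_onD[OF bij_betw_imp_inj_on[OF b2] _ r2[OF x] r2[OF y]] by blast+
      note e = this
      show "x = y"
      proof (rule PiE_ext[OF x y])
        fix i assume i: "i \<in> {..<n1 + n2}"
        show "x i = y i"
        proof (cases "i < n1")
          case True then show ?thesis using fun_cong[OF e(1), of i] by simp
        next
          case False
          then have "i - n1 < n2" "n1 + (i - n1) = i" using i by auto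
          then show ?thesis using fun_cong[OF e(2), of "i - n1"] by simp
        qed
      qed
    qed
    show "?f (n1 + n2) ` (Pi\<^sub>E {..<n1 + n2} ?N) = U"
    proof
      show "?f (n1 + n2) ` (Pi\<^sub>E {..<n1 + n2} ?N) \<subseteq> U"
      proof
        fix z assume "z \<in> ?f (n1 + n2) ` (Pi\<^sub>E {..<n1 + n2} ?N)"
        then obtain x where x: "x \<in> Pi\<^sub>E {..<n1 + n2} ?N" "z = ?f (n1 + n2) x" by (rule imageE)
        show "z \<in> U" unfolding sum x(2) split[OF x(1)] using f1[OF r1[OF x(1)]] f2[OF r2[OF x(1)]] by blast
      qed
      show "U \<subseteq> ?f (n1 + n2) ` (Pi\<^sub>E {..<n1 + n2} ?N)"
      proof
        fix u assume "u \<in> U"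
        then obtain k l where kl: "k \<in> K" "l \<in> L" "u = k \<oplus>\<^bsub>M\<^esub> l" unfolding sum by blast
        obtain x1 where x1: "x1 \<in> Pi\<^sub>E {..<n1} N1" "k = ?f n1 x1"
          using kl(1) unfolding bij_betw_imp_surj_on[OF b1, symmetric] by (rule imageE)
        obtain x2 where x2: "x2 \<in> Pi\<^sub>E {..<n2} N2" "l = ?f n2 x2"
          using kl(2) unfolding bij_betw_imp_surj_on[OF b2, symmetric] by (rule imageE)
        let ?x = "\<lambda>i. if i < n1 then x1 i else if i < n1 + n2 then x2 (i - n1) else undefined"
        have x: "?x \<in> Pi\<^sub>E {..<n1 + n2} ?N"
          using PiE_mem[OF x1(1)] PiE_mem[OF x2(1)] by (intro PiE_I) auto
        have "restrict ?x {..<n1} = x1" by (rule PiE_ext[OF r1[OF x] x1(1)]) auto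
        moreover have "restrict (\<lambda>i. ?x (n1 + i)) {..<n2} = x2" by (rule PiE_ext[OF r2[OF x] x2(1)]) auto
        ultimately have "?f (n1 + n2) ?x = u" unfolding split[OF x] kl(3) x1(2) x2(2) by simp
        then show "u \<in> ?f (n1 + n2) ` (Pi\<^sub>E {..<n1 + n2} ?N)" using x by blast
      qed
    qed
  qed
  moreover have "submodule (?N k) R M \<and> indecomposable_module R (M\<lparr>carrier := ?N k\<rparr>)" if "k < n1 + n2" for k
    using N1 N2 that unfolding decomposes_def by auto
  ultimately have "decomposes R M U (n1 + n2) ?N" unfolding decomposes_def by blast
  then show ?thesis by blast
qed

text \<open>Both parts of a nontrivial splitting are spanned by fewer elements than U, so repeated
  splitting terminates. The filtration F, which m shifts by one and whose intersection is zero, is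
  what makes a nonzero summand visible modulo m.\<close>

lemma (in module) decomposition_exists:
  assumes local: "\<And>a. a \<in> carrier R \<Longrightarrow> a \<notin> m \<Longrightarrow> a \<in> Units R"
    and F: "\<And>j::nat. submodule (F j) R M" "F 0 = carrier M" "\<And>a x j. a \<in> m \<Longrightarrow> x \<in> F j \<Longrightarrow> a \<odot>\<^bsub>M\<^esub> x \<in> F (Suc j)"
      "\<And>x. x \<in> carrier M \<Longrightarrow> (\<And>j. x \<in> F j) \<Longrightarrow> x = \<zero>\<^bsub>M\<^esub>"
    and U: "submodule U R M" and sp: "spans R M U X u"
  shows "\<exists>n N. decomposes R M U n N"
  using U sp
proof (induction "card X" arbitrary: U X u rule: less_induct)
  case less
  note U = less.prems(1) and sp = less.prems(2)
  note Us = U[unfolded submodule_iff]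
  have X: "finite X" using sp unfolding spans_def by blast
  show ?case
  proof (cases "U = {\<zero>\<^bsub>M\<^esub>}")
    case True
    \<comment> \<open>The zero module is the empty direct sum.\<close>
    have "decomposes R M U 0 (\<lambda>_. {})"
      unfolding decomposes_def True by (auto simp: bij_betw_def)
    then show ?thesis by blast
  next
    case U0: False
    show ?thesis
    proof (cases "indecomposable_module R (M\<lparr>carrier := U\<rparr>)")
      case True
      have "bij_betw (\<lambda>x. finsum M x {..<1}) (Pi\<^sub>E {..<1::nat} (\<lambda>_. U)) U"
      proof (rule bij_betw_byWitness[of _ "\<lambda>u. \<lambda>i\<in>{..<1}. u"])
        have s: "finsum M x {..<1::nat} = x 0" if "x 0 \<in> U" for x
        proof -
          have "{..<1::nat} = {0}" by auto
          then show ?thesis using M.finsum_insert[of "{}" 0 x] that Us by auto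
        qed
        show "\<forall>x\<in>Pi\<^sub>E {..<1::nat} (\<lambda>_. U). (\<lambda>i\<in>{..<1}. finsum M x {..<1}) = x"
        proof
          fix x assume x: "x \<in> Pi\<^sub>E {..<1::nat} (\<lambda>_. U)"
          then have "finsum M x {..<1} = x 0" by (intro s) auto
          then show "(\<lambda>i\<in>{..<1}. finsum M x {..<1}) = x" using x by (auto simp: fun_eq_iff restrict_def PiE_def extensional_def)
        qed
        show "\<forall>u\<in>U. finsum M (\<lambda>i\<in>{..<1::nat}. u) {..<1} = u"
        proof
          fix u assume "u \<in> U"
          then show "finsum M (\<lambda>i\<in>{..<1::nat}. u) {..<1} = u" using s[of "\<lambda>i\<in>{..<1::nat}. u"] by simp
        qed
        show "(\<lambda>x. finsum M x {..<1}) ` (Pi\<^sub>E {..<1::nat} (\<lambda>_. U)) \<subseteq> U"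
        proof (rule image_subsetI)
          fix x assume "x \<in> Pi\<^sub>E {..<1::nat} (\<lambda>_. U)"
          from PiE_mem[OF this, of 0] show "finsum M x {..<1} \<in> U" using s[of x] by simp
        qed
        show "(\<lambda>u. \<lambda>i\<in>{..<1::nat}. u) ` U \<subseteq> Pi\<^sub>E {..<1::nat} (\<lambda>_. U)"
          by (rule image_subsetI) (simp only: restrict_PiE_iff, blast)
      qed
      then have "decomposes R M U 1 (\<lambda>_. U)" unfolding decomposes_def using True U by auto
      then show ?thesis by blast
    next
      case False
      then obtain K L where KL: "submodule K R (M\<lparr>carrier := U\<rparr>)" "submodule L R (M\<lparr>carrier := U\<rparr>)"
        "K <+>\<^bsub>M\<lparr>carrier := U\<rparr>\<^esub> L = U" "K \<inter> L = {\<zero>\<^bsub>M\<^esub>}" "K \<noteq> {\<zero>\<^bsub>M\<^esub>}" "L \<noteq> {\<zero>\<^bsub>M\<^esub>}"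
        using U0 unfolding indecomposable_module_def by auto
      have K: "submodule K R M" and L: "submodule L R M" using KL submodule_trans[OF module_axioms U] by auto
      have sum: "U = {k \<oplus>\<^bsub>M\<^esub> l | k l. k \<in> K \<and> l \<in> L}"
        using KL(3) unfolding set_add_def' by auto
      have sum': "U = {k \<oplus>\<^bsub>M\<^esub> l | k l. k \<in> L \<and> l \<in> K}"
        unfolding sum using M.a_comm submoduleE(1)[OF K] submoduleE(1)[OF L] by (auto) (metis subsetD)+
      obtain i v where iv: "i \<in> X" "spans R M K (X - {i}) v"
        by (rule direct_summand_fewer_generators[OF U K L sum KL(4,6) sp local F]) blast+
      obtain i' v' where iv': "i' \<in> X" "spans R M L (X - {i'}) v'"
        by (rule direct_summand_fewer_generators[OF U L K sum' _ KL(5) sp local F]) (use KL(4) in blast)+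
      have "card (X - {i}) < card X" "card (X - {i'}) < card X"
        using card_Diff1_less[OF X] iv(1) iv'(1) by blast+
      then obtain n1 N1 n2 N2 where "decomposes R M K n1 N1" "decomposes R M L n2 N2"
        using less.hyps K L iv(2) iv'(2) by meson
      then show ?thesis using decomposes_direct_sum[OF K L sum KL(4)] by blast
    qed
  qed
qed

section \<open>Descending splittings from the completion\<close>

lemma module_hom_factor:
  assumes L: "module R L" and M: "module R M" and N: "module R N"
    and h: "h \<in> module_hom R L M" and surj: "h ` carrier L = carrier M" and k: "k \<in> module_hom R L N"
    and ker: "\<And>x. x \<in> carrier L \<Longrightarrow> h x = \<zero>\<^bsub>M\<^esub> \<Longrightarrow> k x = \<zero>\<^bsub>N\<^esub>"
  shows "\<exists>l\<in>module_hom R M N. \<forall>x\<in>carrier L. l (h x) = k x"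
proof -
  interpret L: module R L by fact
  interpret M: module R M by fact
  interpret N: module R N by fact
  define s where "s = inv_into (carrier L) h"
  have s: "s u \<in> carrier L" "h (s u) = u" if "u \<in> carrier M" for u
    using that unfolding s_def surj[symmetric] by (auto intro: inv_into_into f_inv_into_f)
  have same: "k x = k y" if xy: "x \<in> carrier L" "y \<in> carrier L" "h x = h y" for x y
  proof -
    have "h (x \<ominus>\<^bsub>L\<^esub> y) = \<zero>\<^bsub>M\<^esub>"
      using module_hom_minus[OF L M h xy(1,2)] xy module_hom_closed[OF h] by (simp add: M.minus_eq_zero_iff)
    then have "k (x \<ominus>\<^bsub>L\<^esub> y) = \<zero>\<^bsub>N\<^esub>" using ker xy by simp
    then show ?thesis
      using module_hom_minus[OF L N k xy(1,2)] xy module_hom_closed[OF k] by (simp add: N.minus_eq_zero_iff)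
  qed
  let ?l = "\<lambda>u. k (s u)"
  have l: "?l (h x) = k x" if "x \<in> carrier L" for x
    using that s[OF module_hom_closed[OF h that]] by (intro same) auto
  show ?thesis
  proof (rule bexI[of _ ?l])
    show "?l \<in> module_hom R M N"
    proof (rule module_homI)
      fix u assume u: "u \<in> carrier M"
      then show "?l u \<in> carrier N" using s module_hom_closed[OF k] by auto
      fix a assume a: "a \<in> carrier R"
      have "?l (h (a \<odot>\<^bsub>L\<^esub> s u)) = k (a \<odot>\<^bsub>L\<^esub> s u)" by (rule l) (use s(1)[OF u] a in simp)
      then show "?l (a \<odot>\<^bsub>M\<^esub> u) = a \<odot>\<^bsub>N\<^esub> ?l u"
        using module_hom_smult[OF h a s(1)[OF u]] module_hom_smult[OF k a s(1)[OF u]] s(2)[OF u] by simp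
    next
      fix u v assume uv: "u \<in> carrier M" "v \<in> carrier M"
      have "?l (h (s u \<oplus>\<^bsub>L\<^esub> s v)) = k (s u \<oplus>\<^bsub>L\<^esub> s v)" by (rule l) (use s(1)[OF uv(1)] s(1)[OF uv(2)] in simp)
      then show "?l (u \<oplus>\<^bsub>M\<^esub> v) = ?l u \<oplus>\<^bsub>N\<^esub> ?l v"
        using module_hom_add[OF h s(1)[OF uv(1)] s(1)[OF uv(2)]] module_hom_add[OF k s(1)[OF uv(1)] s(1)[OF uv(2)]] s(2) uv by simp
    qed
  qed (use l in blast)
qed

lemma module_hom_inv:
  assumes "h \<in> module_hom R M N" "bij_betw h (carrier M) (carrier N)" and M: "module R M"
  shows "inv_into (carrier M) h \<in> module_hom R N M"
proof -
  interpret M: module R M by fact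
  let ?i = "inv_into (carrier M) h"
  have i: "?i y \<in> carrier M" "h (?i y) = y" if "y \<in> carrier N" for y
    using that assms(2) unfolding bij_betw_def by (auto intro: inv_into_into f_inv_into_f)
  have ih: "?i (h x) = x" if "x \<in> carrier M" for x using that assms(2) by (simp add: bij_betw_def)
  show ?thesis
  proof (rule module_homI)
    fix y assume y: "y \<in> carrier N"
    then show "?i y \<in> carrier M" by (rule i)
    fix a assume a: "a \<in> carrier R"
    have "?i (h (a \<odot>\<^bsub>M\<^esub> ?i y)) = a \<odot>\<^bsub>M\<^esub> ?i y" using i[OF y] a by (intro ih) auto
    then show "?i (a \<odot>\<^bsub>N\<^esub> y) = a \<odot>\<^bsub>M\<^esub> ?i y" using module_hom_smult[OF assms(1) a i(1)[OF y]] i(2)[OF y] by simp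
  next
    fix x y assume xy: "x \<in> carrier N" "y \<in> carrier N"
    have "?i (h (?i x \<oplus>\<^bsub>M\<^esub> ?i y)) = ?i x \<oplus>\<^bsub>M\<^esub> ?i y" using i xy by (intro ih) auto
    then show "?i (x \<oplus>\<^bsub>N\<^esub> y) = ?i x \<oplus>\<^bsub>M\<^esub> ?i y"
      using module_hom_add[OF assms(1) i(1)[OF xy(1)] i(1)[OF xy(2)]] i(2) xy by simp
  qed
qed

lemma module_hom_finsum_fun:
  assumes M: "module R M" and N: "module R N" and "finite X" "\<And>k. k \<in> X \<Longrightarrow> h k \<in> module_hom R M N"
  shows "(\<lambda>x. \<Oplus>\<^bsub>N\<^esub>k\<in>X. h k x) \<in> module_hom R M N"
proof -
  interpret M: module R M by fact
  interpret N: module R N by fact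
  note hc = module_hom_closed[OF assms(4)]
  show ?thesis
  proof (rule module_homI)
    fix x assume x: "x \<in> carrier M"
    show "(\<Oplus>\<^bsub>N\<^esub>k\<in>X. h k x) \<in> carrier N" using hc x by (intro N.M.finsum_closed) auto
    fix a assume a: "a \<in> carrier R"
    have "(\<Oplus>\<^bsub>N\<^esub>k\<in>X. h k (a \<odot>\<^bsub>M\<^esub> x)) = (\<Oplus>\<^bsub>N\<^esub>k\<in>X. a \<odot>\<^bsub>N\<^esub> h k x)"
      by (rule N.M.finsum_cong') (use hc x a module_hom_smult[OF assms(4) a x] in auto)
    then show "(\<Oplus>\<^bsub>N\<^esub>k\<in>X. h k (a \<odot>\<^bsub>M\<^esub> x)) = a \<odot>\<^bsub>N\<^esub> (\<Oplus>\<^bsub>N\<^esub>k\<in>X. h k x)"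
      using N.finsum_smult_ldistr[OF assms(3) a, of "\<lambda>k. h k x"] hc x by auto
  next
    fix x y assume xy: "x \<in> carrier M" "y \<in> carrier M"
    have "(\<Oplus>\<^bsub>N\<^esub>k\<in>X. h k (x \<oplus>\<^bsub>M\<^esub> y)) = (\<Oplus>\<^bsub>N\<^esub>k\<in>X. h k x \<oplus>\<^bsub>N\<^esub> h k y)"
      by (rule N.M.finsum_cong') (use hc xy module_hom_add[OF assms(4) xy] in auto)
    also have "\<dots> = (\<Oplus>\<^bsub>N\<^esub>k\<in>X. h k x) \<oplus>\<^bsub>N\<^esub> (\<Oplus>\<^bsub>N\<^esub>k\<in>X. h k y)"
      using hc xy by (intro N.M.finsum_addf) auto
    finally show "(\<Oplus>\<^bsub>N\<^esub>k\<in>X. h k (x \<oplus>\<^bsub>M\<^esub> y)) = (\<Oplus>\<^bsub>N\<^esub>k\<in>X. h k x) \<oplus>\<^bsub>N\<^esub> (\<Oplus>\<^bsub>N\<^esub>k\<in>X. h k y)" .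
  qed
qed

lemma (in module) decomposition_projections:
  assumes dec: "indecomposable_decomposition R M n N"
  obtains \<pi> where "\<And>k. k < n \<Longrightarrow> \<pi> k \<in> module_hom R M (M\<lparr>carrier := N k\<rparr>)"
    "\<And>x. x \<in> carrier M \<Longrightarrow> x = (\<Oplus>\<^bsub>M\<^esub>k\<in>{..<n}. \<pi> k x)" "\<And>k x. k < n \<Longrightarrow> x \<in> N k \<Longrightarrow> \<pi> k x = x"
proof -
  let ?f = "\<lambda>x. finsum M x {..<n}" and ?P = "Pi\<^sub>E {..<n} N"
  have N: "submodule (N k) R M" if "k < n" for k using dec that unfolding indecomposable_decomposition_def by blast
  have bij: "bij_betw ?f ?P (carrier M)" using dec unfolding indecomposable_decomposition_def by blast
  note Ns = N[unfolded submodule_iff]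
  define c where "c = inv_into ?P ?f"
  have c: "c x \<in> ?P" "?f (c x) = x" if "x \<in> carrier M" for x
    unfolding c_def using bij_betw_apply[OF bij_betw_inv_into[OF bij] that] bij_betw_inv_into_right[OF bij that]
    by blast+
  have cf: "c (?f z) = z" if "z \<in> ?P" for z unfolding c_def by (rule bij_betw_inv_into_left[OF bij that])
  have ck: "c x k \<in> N k" if "x \<in> carrier M" "k < n" for x k using PiE_mem[OF c(1)[OF that(1)], of k] that by simp
  have ckM: "c x k \<in> carrier M" if "x \<in> carrier M" "k < n" for x k using ck[OF that] Ns[OF that(2)] by blast
  show thesis
  proof (rule that[of "\<lambda>k x. c x k"])
    fix k assume k: "k < n"
    show "(\<lambda>x. c x k) \<in> module_hom R M (M\<lparr>carrier := N k\<rparr>)"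
    proof (rule module_homI)
      fix x assume x: "x \<in> carrier M"
      show "c x k \<in> carrier (M\<lparr>carrier := N k\<rparr>)" using ck x k by simp
      fix a assume a: "a \<in> carrier R"
      let ?z = "\<lambda>k\<in>{..<n}. a \<odot>\<^bsub>M\<^esub> c x k"
      have z: "?z \<in> ?P" using ck[OF x] Ns a by auto
      have "?f ?z = (\<Oplus>\<^bsub>M\<^esub>k\<in>{..<n}. a \<odot>\<^bsub>M\<^esub> c x k)"
        by (rule M.finsum_cong') (use ckM[OF x] a in auto)
      also have "\<dots> = a \<odot>\<^bsub>M\<^esub> ?f (c x)" using ckM[OF x] a by (intro finsum_smult_ldistr[symmetric]) auto
      finally have "c (a \<odot>\<^bsub>M\<^esub> x) = ?z" using c(2)[OF x] cf[OF z] by simp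
      then show "c (a \<odot>\<^bsub>M\<^esub> x) k = a \<odot>\<^bsub>M\<lparr>carrier := N k\<rparr>\<^esub> c x k" using k by simp
    next
      fix x y assume xy: "x \<in> carrier M" "y \<in> carrier M"
      let ?z = "\<lambda>k\<in>{..<n}. c x k \<oplus>\<^bsub>M\<^esub> c y k"
      have z: "?z \<in> ?P" using ck[OF xy(1)] ck[OF xy(2)] Ns by auto
      have "?f ?z = (\<Oplus>\<^bsub>M\<^esub>k\<in>{..<n}. c x k \<oplus>\<^bsub>M\<^esub> c y k)"
        by (rule M.finsum_cong') (use ckM[OF xy(1)] ckM[OF xy(2)] in auto)
      also have "\<dots> = ?f (c x) \<oplus>\<^bsub>M\<^esub> ?f (c y)"
        using ckM[OF xy(1)] ckM[OF xy(2)] by (intro M.finsum_addf) auto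
      finally have "c (x \<oplus>\<^bsub>M\<^esub> y) = ?z" using c(2)[OF xy(1)] c(2)[OF xy(2)] cf[OF z] by simp
      then show "c (x \<oplus>\<^bsub>M\<^esub> y) k = c x k \<oplus>\<^bsub>M\<lparr>carrier := N k\<rparr>\<^esub> c y k" using k by simp
    qed
    fix x assume x: "x \<in> N k"
    have xM: "x \<in> carrier M" using x Ns[OF k] by blast
    let ?z = "\<lambda>j\<in>{..<n}. if j = k then x else \<zero>\<^bsub>M\<^esub>"
    have z: "?z \<in> ?P" using x Ns by auto
    have "?f ?z = (\<Oplus>\<^bsub>M\<^esub>j\<in>{..<n}. if k = j then x else \<zero>\<^bsub>M\<^esub>)"
      by (rule M.finsum_cong') (use xM in auto)
    also have "\<dots> = x" using k xM by (intro M.finsum_singleton) auto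
    finally have "c x = ?z" using cf[OF z] by simp
    then show "c x k = x" using k by simp
  next
    show "x = (\<Oplus>\<^bsub>M\<^esub>k\<in>{..<n}. c x k)" if "x \<in> carrier M" for x using c(2)[OF that] by simp
  qed
qed

section \<open>Splittings over the completion\<close>

context local_completion
begin

lemma A_generates: obtains g r where "generates A (A.Fr e) g r"
  using fg_module_generates[OF A.module_Fr A.fg_Fr[OF fg]] by blast

lemma A_noeth: "noeth A (A.Fr e)"
  using A_generates generates_noeth[OF A.module_Fr noetherian] by metis

text \<open>The filtration is K itself: each K j is a submodule of F^e_*S, and an element of K 1
  acts through its p^e-th power, which is again in K 1 and therefore raises the index.\<close>

lemma S_decomposition: "\<exists>n N. indecomposable_decomposition S (S.Fr e) n N"
proof -
  interpret F: module S "S.Fr e" by (rule S.module_Fr)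
  obtain g r where g: "generates A (A.Fr e) g r" by (rule A_generates)
  have "spans S (S.Fr e) (carrier (S.Fr e)) {..<r} (\<lambda>i. \<iota> (g i))"
    using S_generates[OF g] unfolding generates_def spans_def by simp
  then have "\<exists>n N. decomposes S (S.Fr e) (carrier (S.Fr e)) n N"
  proof (rule F.decomposition_exists[of "K 1" K, rotated -1])
    show "a \<in> Units S" if "a \<in> carrier S" "a \<notin> K 1" for a using K_unit that by blast
    show "submodule (K j) S (S.Fr e)" for j by (rule S.ideal_submodule_Fr[OF K_ideal])
    show "a \<odot>\<^bsub>S.Fr e\<^esub> x \<in> K (Suc j)" if "a \<in> K 1" "x \<in> K j" for a x j
      using K_mult[OF K_pow[OF that(1)] that(2)] by simp
    show "x = \<zero>\<^bsub>S.Fr e\<^esub>" if "x \<in> carrier (S.Fr e)" "\<And>j. x \<in> K j" for x using K_Inter that by simp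
  qed (simp_all add: K_0 F.carrier_is_submodule[simplified])
  then show ?thesis unfolding decomposes_def indecomposable_decomposition_def by simp
qed

text \<open>Every class that occurs in some F^e_*S occurs already at a level up to e0. So each part
  of a decomposition of F^(e0+1)_*S is isomorphic to a direct summand of a lower F^e_*S; \<psi> is
  the projection followed by this isomorphism, \<phi> is the way back, and the composites add up to
  the identity.\<close>

lemma S_splitting:
  assumes "FFRT p S"
  obtains e0 n :: nat and \<epsilon> :: "nat \<Rightarrow> nat" and \<psi> \<phi> :: "nat \<Rightarrow> 's \<Rightarrow> 's"
  where "\<And>k. k < n \<Longrightarrow> \<epsilon> k \<le> e0"
    and "\<And>k. k < n \<Longrightarrow> \<psi> k \<in> module_hom S (S.Fr (Suc e0)) (S.Fr (\<epsilon> k))"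
    and "\<And>k. k < n \<Longrightarrow> \<phi> k \<in> module_hom S (S.Fr (\<epsilon> k)) (S.Fr (Suc e0))"
    and "\<And>x. x \<in> carrier S \<Longrightarrow> x = (\<Oplus>\<^bsub>S\<^esub>k\<in>{..<n}. \<phi> k (\<psi> k x))"
proof -
  let ?J = "\<lambda>e. indec_classes S (S.Fr e)"
  have fin: "finite (\<Union>e. ?J e)" using assms unfolding FFRT_def .
  define lev where "lev = (\<lambda>C. SOME e. C \<in> ?J e)"
  have lev: "C \<in> ?J (lev C)" if "C \<in> (\<Union>e. ?J e)" for C
    unfolding lev_def using that by (intro someI_ex[of "\<lambda>e. C \<in> ?J e"]) blast
  \<comment> \<open>The sum over the finite set of classes serves as an upper bound for their chosen
    levels.\<close>
  define e0 where "e0 = (\<Sum>C\<in>(\<Union>e. ?J e). lev C)"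
  have le: "lev C \<le> e0" if "C \<in> (\<Union>e. ?J e)" for C unfolding e0_def by (rule member_le_sum[OF that]) (use fin in auto)
  let ?E = "S.Fr (Suc e0)"
  interpret E: module S ?E by (rule S.module_Fr)
  obtain n N where dec: "indecomposable_decomposition S ?E n N" using S_decomposition by blast
  obtain \<pi> where \<pi>: "\<And>k. k < n \<Longrightarrow> \<pi> k \<in> module_hom S ?E (?E\<lparr>carrier := N k\<rparr>)"
    "\<And>x. x \<in> carrier ?E \<Longrightarrow> x = (\<Oplus>\<^bsub>?E\<^esub>k\<in>{..<n}. \<pi> k x)" "\<And>k x. k < n \<Longrightarrow> x \<in> N k \<Longrightarrow> \<pi> k x = x"
    by (rule E.decomposition_projections[OF dec]) blast
  have "\<exists>e \<psi> \<phi>. e \<le> e0 \<and> \<psi> \<in> module_hom S ?E (S.Fr e) \<and> \<phi> \<in> module_hom S (S.Fr e) ?E \<and>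
      (\<forall>x\<in>carrier S. \<phi> (\<psi> x) = \<pi> k x)" if k: "k < n" for k
  proof -
    have Nk: "submodule (N k) S ?E" using dec k unfolding indecomposable_decomposition_def by blast
    have Nm: "module S (?E\<lparr>carrier := N k\<rparr>)" by (rule submodule.submodule_is_module[OF Nk S.module_Fr])
    have "iso_class S (?E\<lparr>carrier := N k\<rparr>) \<in> ?J (Suc e0)" unfolding indec_classes_def using dec k by blast
    then have C: "iso_class S (?E\<lparr>carrier := N k\<rparr>) \<in> (\<Union>e. ?J e)" by blast
    define e where "e = lev (iso_class S (?E\<lparr>carrier := N k\<rparr>))"
    have e: "e \<le> e0" unfolding e_def by (rule le[OF C])
    interpret e: module S "S.Fr e" by (rule S.module_Fr)
    obtain N' n' k' where N': "indecomposable_decomposition S (S.Fr e) n' N'" "k' < n'"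
      "iso_class S (?E\<lparr>carrier := N k\<rparr>) = iso_class S ((S.Fr e)\<lparr>carrier := N' k'\<rparr>)"
      using lev[OF C] unfolding e_def[symmetric] indec_classes_def by blast
    let ?N' = "(S.Fr e)\<lparr>carrier := N' k'\<rparr>"
    have N's: "submodule (N' k') S (S.Fr e)" using N' unfolding indecomposable_decomposition_def by blast
    have N'm: "module S ?N'" by (rule submodule.submodule_is_module[OF N's S.module_Fr])
    \<comment> \<open>Reflexivity puts the summand into its own class, so equality of the two
      classes yields an isomorphism.\<close>
    have "module_iso S ?N' ?N'"
      unfolding module_iso_def by (rule bexI[of _ "\<lambda>x. x"]) (auto simp: module_hom_def bij_betw_def)
    then have "?N' \<in> iso_class S ?N'" unfolding iso_class_def using N'm by blast
    then have "?N' \<in> iso_class S (?E\<lparr>carrier := N k\<rparr>)" unfolding N'(3) .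
    then obtain h where h: "h \<in> module_hom S (?E\<lparr>carrier := N k\<rparr>) ?N'" "bij_betw h (carrier (?E\<lparr>carrier := N k\<rparr>)) (carrier ?N')"
      unfolding iso_class_def module_iso_def by blast
    let ?i = "inv_into (N k) h"
    have i: "?i \<in> module_hom S ?N' (?E\<lparr>carrier := N k\<rparr>)" using module_hom_inv[OF h Nm] by simp
    obtain \<pi>' where \<pi>': "\<And>k. k < n' \<Longrightarrow> \<pi>' k \<in> module_hom S (S.Fr e) ((S.Fr e)\<lparr>carrier := N' k\<rparr>)"
      "\<And>k x. k < n' \<Longrightarrow> x \<in> N' k \<Longrightarrow> \<pi>' k x = x"
      by (rule e.decomposition_projections[OF N'(1)]) blast
    have incl: "(\<lambda>x. x) \<in> module_hom S (M\<lparr>carrier := H\<rparr>) M" if "submodule H S M" "module S M" for H and M :: "('s, 's) module"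
      using module.submoduleE(1)[OF that(2,1)] by (auto simp: module_hom_def)
    have "(\<lambda>x. h (\<pi> k x)) \<in> module_hom S ?E ?N'" by (rule module_hom_comp[OF \<pi>(1)[OF k] h(1)])
    from module_hom_comp[OF this incl[OF N's S.module_Fr]]
    have \<psi>: "(\<lambda>x. h (\<pi> k x)) \<in> module_hom S ?E (S.Fr e)" .
    have "(\<lambda>x. ?i (\<pi>' k' x)) \<in> module_hom S (S.Fr e) (?E\<lparr>carrier := N k\<rparr>)"
      by (rule module_hom_comp[OF \<pi>'(1)[OF N'(2)] i])
    from module_hom_comp[OF this incl[OF Nk S.module_Fr]]
    have \<phi>: "(\<lambda>x. ?i (\<pi>' k' x)) \<in> module_hom S (S.Fr e) ?E" .
    have "?i (\<pi>' k' (h (\<pi> k x))) = \<pi> k x" if "x \<in> carrier S" for x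
    proof -
      have px: "\<pi> k x \<in> N k" using module_hom_closed[OF \<pi>(1)[OF k], of x] that by simp
      then have "h (\<pi> k x) \<in> N' k'" using module_hom_closed[OF h(1), of "\<pi> k x"] by simp
      then have "\<pi>' k' (h (\<pi> k x)) = h (\<pi> k x)" by (rule \<pi>'(2)[OF N'(2)])
      then show ?thesis using h(2) px by (simp add: bij_betw_def)
    qed
    then show ?thesis using e \<psi> \<phi> by blast
  qed
  then have "\<forall>k. \<exists>e \<psi> \<phi>. k < n \<longrightarrow> e \<le> e0 \<and> \<psi> \<in> module_hom S ?E (S.Fr e) \<and> \<phi> \<in> module_hom S (S.Fr e) ?E \<and>
      (\<forall>x\<in>carrier S. \<phi> (\<psi> x) = \<pi> k x)" by blast
  then obtain \<epsilon> \<psi> \<phi> where w: "\<And>k. k < n \<Longrightarrow> \<epsilon> k \<le> e0 \<and> \<psi> k \<in> module_hom S ?E (S.Fr (\<epsilon> k)) \<and> \<phi> k \<in> module_hom S (S.Fr (\<epsilon> k)) ?E \<and>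
      (\<forall>x\<in>carrier S. \<phi> k (\<psi> k x) = \<pi> k x)"
    unfolding choice_iff by blast
  have "x = (\<Oplus>\<^bsub>S\<^esub>k\<in>{..<n}. \<phi> k (\<psi> k x))" if x: "x \<in> carrier S" for x
  proof -
    have "\<pi> k x \<in> carrier S" if "k < n" for k
    proof -
      have "\<pi> k x \<in> N k" using module_hom_closed[OF \<pi>(1)[OF that], of x] x by simp
      moreover have "submodule (N k) S ?E" using dec that unfolding indecomposable_decomposition_def by blast
      ultimately show ?thesis using E.submoduleE(1) by auto
    qed
    then have "(\<Oplus>\<^bsub>S\<^esub>k\<in>{..<n}. \<phi> k (\<psi> k x)) = (\<Oplus>\<^bsub>S\<^esub>k\<in>{..<n}. \<pi> k x)"
      using w x by (intro S.finsum_cong') auto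
    then show ?thesis using \<pi>(2)[of x] x by simp
  qed
  then show thesis using that w by blast
qed

end

section \<open>Approximating homomorphisms over S by homomorphisms over A\<close>

definition point_mass :: "('a, 'b, 'm) module_scheme \<Rightarrow> 'i \<Rightarrow> 'b \<Rightarrow> 'i \<Rightarrow> 'b" where
  "point_mass M i x = (\<lambda>j. if j = i then x else \<zero>\<^bsub>M\<^esub>)"

lemma fun_mod_support_induct:
  assumes M: "module R M" and N: "submodule N R (fun_mod M X)" and X: "finite X"
    and z: "z \<in> carrier (fun_mod M X)" and pm: "\<And>i. i \<in> X \<Longrightarrow> point_mass M i (z i) \<in> N"
  shows "z \<in> N"
proof -
  interpret M: module R M by fact
  interpret F: module R "fun_mod M X" by (rule module_fun_mod[OF M])
  note Ns = N[unfolded F.submodule_iff]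
  note zM = fun_mod_closed[OF M z]
  have "(\<lambda>i. if i \<in> Y then z i else \<zero>\<^bsub>M\<^esub>) \<in> N" if "Y \<subseteq> X" for Y
    using finite_subset[OF that X] that
  proof (induction Y)
    case empty then show ?case using Ns by simp
  next
    case (insert y Y)
    have e: "(\<lambda>i. if i \<in> insert y Y then z i else \<zero>\<^bsub>M\<^esub>)
       = point_mass M y (z y) \<oplus>\<^bsub>fun_mod M X\<^esub> (\<lambda>i. if i \<in> Y then z i else \<zero>\<^bsub>M\<^esub>)"
      using insert.hyps zM by (auto simp: point_mass_def fun_eq_iff)
    have "point_mass M y (z y) \<in> N" "(\<lambda>i. if i \<in> Y then z i else \<zero>\<^bsub>M\<^esub>) \<in> N"
      using pm insert by auto
    then show ?case unfolding e using Ns by blast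
  qed
  from this[of X] have "(\<lambda>i. if i \<in> X then z i else \<zero>\<^bsub>M\<^esub>) \<in> N" by simp
  moreover have "(\<lambda>i. if i \<in> X then z i else \<zero>\<^bsub>M\<^esub>) = z" using z by (auto simp: fun_eq_iff)
  ultimately show ?thesis by simp
qed

text \<open>This is multiplication of a vector by the matrix \<rho>.\<close>

lemma module_hom_fun_mod_combination:
  assumes M: "module R M" and X: "finite X" and \<rho>: "\<And>j i. j \<in> J \<Longrightarrow> \<rho> j i \<in> carrier R"
  shows "(\<lambda>y j. if j \<in> J then \<Oplus>\<^bsub>M\<^esub>i\<in>X. \<rho> j i \<odot>\<^bsub>M\<^esub> y i else \<zero>\<^bsub>M\<^esub>) \<in> module_hom R (fun_mod M X) (fun_mod M J)"
proof -
  interpret M: module R M by fact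
  note cl = fun_mod_closed[OF M]
  have row: "(\<lambda>y. \<Oplus>\<^bsub>M\<^esub>i\<in>X. \<rho> j i \<odot>\<^bsub>M\<^esub> y i) \<in> module_hom R (fun_mod M X) M" if j: "j \<in> J" for j
  proof (rule module_hom_finsum_fun[OF module_fun_mod[OF M] M X])
    fix i
    show "(\<lambda>y. \<rho> j i \<odot>\<^bsub>M\<^esub> y i) \<in> module_hom R (fun_mod M X) M"
    proof (rule module_homI)
      fix y assume y: "y \<in> carrier (fun_mod M X)"
      show "\<rho> j i \<odot>\<^bsub>M\<^esub> y i \<in> carrier M" using cl[OF y] \<rho>[OF j] by simp
      fix a assume a: "a \<in> carrier R"
      have "\<rho> j i \<odot>\<^bsub>M\<^esub> (a \<odot>\<^bsub>M\<^esub> y i) = a \<odot>\<^bsub>M\<^esub> (\<rho> j i \<odot>\<^bsub>M\<^esub> y i)"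
        using cl[OF y] \<rho>[OF j] a by (metis M.R.m_comm M.smult_assoc1)
      then show "\<rho> j i \<odot>\<^bsub>M\<^esub> (a \<odot>\<^bsub>fun_mod M X\<^esub> y) i = a \<odot>\<^bsub>M\<^esub> (\<rho> j i \<odot>\<^bsub>M\<^esub> y i)" by simp
    next
      fix y y' assume "y \<in> carrier (fun_mod M X)" "y' \<in> carrier (fun_mod M X)"
      then show "\<rho> j i \<odot>\<^bsub>M\<^esub> (y \<oplus>\<^bsub>fun_mod M X\<^esub> y') i = \<rho> j i \<odot>\<^bsub>M\<^esub> y i \<oplus>\<^bsub>M\<^esub> \<rho> j i \<odot>\<^bsub>M\<^esub> y' i"
        using cl[of y X i] cl[of y' X i] \<rho>[OF j] by (simp add: M.smult_r_distr)
    qed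
  qed
  show ?thesis
  proof (rule module_homI)
    fix y assume y: "y \<in> carrier (fun_mod M X)"
    show "(\<lambda>j. if j \<in> J then \<Oplus>\<^bsub>M\<^esub>i\<in>X. \<rho> j i \<odot>\<^bsub>M\<^esub> y i else \<zero>\<^bsub>M\<^esub>) \<in> carrier (fun_mod M J)"
      using module_hom_closed[OF row y] by simp
    fix a assume a: "a \<in> carrier R"
    show "(\<lambda>j. if j \<in> J then \<Oplus>\<^bsub>M\<^esub>i\<in>X. \<rho> j i \<odot>\<^bsub>M\<^esub> (a \<odot>\<^bsub>fun_mod M X\<^esub> y) i else \<zero>\<^bsub>M\<^esub>)
      = a \<odot>\<^bsub>fun_mod M J\<^esub> (\<lambda>j. if j \<in> J then \<Oplus>\<^bsub>M\<^esub>i\<in>X. \<rho> j i \<odot>\<^bsub>M\<^esub> y i else \<zero>\<^bsub>M\<^esub>)"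
      using module_hom_smult[OF row a y] a by (auto simp: fun_eq_iff)
  next
    fix y y' assume y: "y \<in> carrier (fun_mod M X)" "y' \<in> carrier (fun_mod M X)"
    show "(\<lambda>j. if j \<in> J then \<Oplus>\<^bsub>M\<^esub>i\<in>X. \<rho> j i \<odot>\<^bsub>M\<^esub> (y \<oplus>\<^bsub>fun_mod M X\<^esub> y') i else \<zero>\<^bsub>M\<^esub>)
      = (\<lambda>j. if j \<in> J then \<Oplus>\<^bsub>M\<^esub>i\<in>X. \<rho> j i \<odot>\<^bsub>M\<^esub> y i else \<zero>\<^bsub>M\<^esub>) \<oplus>\<^bsub>fun_mod M J\<^esub>
        (\<lambda>j. if j \<in> J then \<Oplus>\<^bsub>M\<^esub>i\<in>X. \<rho> j i \<odot>\<^bsub>M\<^esub> y' i else \<zero>\<^bsub>M\<^esub>)"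
      using module_hom_add[OF row y] by (auto simp: fun_eq_iff)
  qed
qed

context local_completion
begin

lemma hom_iota_combination:
  fixes r :: nat
  assumes h: "h \<in> module_hom S (S.Fr e) (S.Fr e')"
    and a: "a \<in> carrier (free_mod S {..<r})" and u: "u \<in> {..<r} \<rightarrow> carrier S"
  shows "h (\<Oplus>\<^bsub>S\<^esub>i\<in>{..<r}. a i [^]\<^bsub>S\<^esub> (p ^ e) \<otimes>\<^bsub>S\<^esub> u i) = (\<Oplus>\<^bsub>S\<^esub>i\<in>{..<r}. a i [^]\<^bsub>S\<^esub> (p ^ e') \<otimes>\<^bsub>S\<^esub> h (u i))"
proof -
  have ac: "a i \<in> carrier S" "u i \<in> carrier S" if "i < r" for i using a u that by auto
  have hc: "h (u i) \<in> carrier S" if "i < r" for i using module_hom_closed[OF h, of "u i"] ac[OF that] by simp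
  have "h (\<Oplus>\<^bsub>S\<^esub>i\<in>{..<r}. a i [^]\<^bsub>S\<^esub> (p ^ e) \<otimes>\<^bsub>S\<^esub> u i) = (\<Oplus>\<^bsub>S\<^esub>i\<in>{..<r}. h (a i [^]\<^bsub>S\<^esub> (p ^ e) \<otimes>\<^bsub>S\<^esub> u i))"
    using module_hom_finsum[OF S.module_Fr S.module_Fr h finite_lessThan, of "\<lambda>i. a i [^]\<^bsub>S\<^esub> (p ^ e) \<otimes>\<^bsub>S\<^esub> u i" r] ac by simp
  also have "\<dots> = (\<Oplus>\<^bsub>S\<^esub>i\<in>{..<r}. a i [^]\<^bsub>S\<^esub> (p ^ e') \<otimes>\<^bsub>S\<^esub> h (u i))"
  proof (rule S.finsum_cong')
    show "h (a i [^]\<^bsub>S\<^esub> (p ^ e) \<otimes>\<^bsub>S\<^esub> u i) = a i [^]\<^bsub>S\<^esub> (p ^ e') \<otimes>\<^bsub>S\<^esub> h (u i)" if "i \<in> {..<r}" for i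
      using module_hom_smult[OF h, of "a i" "u i"] ac that by simp
  qed (use ac hc in auto)
  finally show ?thesis .
qed

text \<open>An element of a deep K c is a combination of generators with coefficients in K j; a
  homomorphism changes the generators and the exponent of the coefficients, and the powers of the
  coefficients stay in K j.\<close>

lemma hom_continuous:
  assumes h: "h \<in> module_hom S (S.Fr e) (S.Fr e')"
  obtains c where "\<And>x. x \<in> K c \<Longrightarrow> h x \<in> K j"
proof -
  obtain g r where g: "generates A (A.Fr e) g r" by (rule A_generates)
  have gS: "(\<lambda>i. \<iota> (g i)) \<in> {..<r} \<rightarrow> carrier S" using A.generates_FrD(1)[OF g] by auto
  obtain c where c: "\<And>x. x \<in> K c \<Longrightarrow> \<exists>\<gamma>\<in>carrier (free_mod S {..<r}). (\<forall>i. \<gamma> i \<in> K j) \<and>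
     x = (\<Oplus>\<^bsub>S\<^esub>i\<in>{..<r}. \<gamma> i [^]\<^bsub>S\<^esub> (p ^ e) \<otimes>\<^bsub>S\<^esub> \<iota> (g i))" using K_deep_combination[OF g] by blast
  have "h x \<in> K j" if "x \<in> K c" for x
  proof -
    obtain \<gamma> where \<gamma>: "\<gamma> \<in> carrier (free_mod S {..<r})" "\<And>i. \<gamma> i \<in> K j"
      "x = (\<Oplus>\<^bsub>S\<^esub>i\<in>{..<r}. \<gamma> i [^]\<^bsub>S\<^esub> (p ^ e) \<otimes>\<^bsub>S\<^esub> \<iota> (g i))" using c \<open>x \<in> K c\<close> by blast
    have hc: "h (\<iota> (g i)) \<in> carrier S" if "i < r" for i
      using module_hom_closed[OF h, of "\<iota> (g i)"] gS that by (auto simp: Pi_def)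
    have "h x = (\<Oplus>\<^bsub>S\<^esub>i\<in>{..<r}. \<gamma> i [^]\<^bsub>S\<^esub> (p ^ e') \<otimes>\<^bsub>S\<^esub> h (\<iota> (g i)))"
      unfolding \<gamma>(3) by (rule hom_iota_combination[OF h \<gamma>(1) gS])
    also have "\<dots> \<in> K j"
      by (rule ideal.finsum_closed_ideal[OF K_ideal]) (use \<gamma>(2) hc in \<open>auto intro!: K_rmult K_pow\<close>)
    finally show ?thesis .
  qed
  then show thesis by (rule that)
qed

text \<open>\<open>ideal_pow_subset\<close> is applied to the ideal of all b such that every
  multiple of b, placed in any single coordinate, lies in N. It contains x^(n p^e), because x^n acts
  on F^e_*A as this power.\<close>

lemma deep_vectors:
  assumes X: "finite X" and N: "submodule N A (fun_mod (A.Fr e) X)"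
    and pow: "\<And>x. x \<in> m \<Longrightarrow> \<exists>n::nat. \<forall>z\<in>carrier (fun_mod (A.Fr e) X). (x [^] n) \<odot>\<^bsub>fun_mod (A.Fr e) X\<^esub> z \<in> N"
  shows "\<exists>c. \<forall>z\<in>carrier (fun_mod (A.Fr e) X). (\<forall>i\<in>X. z i \<in> I c) \<longrightarrow> z \<in> N"
proof -
  interpret F: module A "fun_mod (A.Fr e) X" by (rule module_fun_mod[OF A.module_Fr])
  note Ns = N[unfolded F.submodule_iff]
  let ?\<delta> = "point_mass (A.Fr e)"
  have \<delta>c: "?\<delta> i x \<in> carrier (fun_mod (A.Fr e) X)" if "i \<in> X" "x \<in> carrier A" for i x
    using that by (auto simp: point_mass_def)
  let ?J = "{b \<in> carrier A. \<forall>y\<in>carrier A. \<forall>i\<in>X. ?\<delta> i (b \<otimes> y) \<in> N}"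
  have J: "ideal ?J A"
  proof -
    have "submodule ?J A (self_module A)"
      unfolding module.submodule_iff[OF Am]
    proof (intro conjI ballI)
      have "?\<delta> i \<zero> = \<zero>\<^bsub>fun_mod (A.Fr e) X\<^esub>" for i by (simp add: point_mass_def fun_eq_iff)
      then show "\<zero>\<^bsub>self_module A\<^esub> \<in> ?J" using Ns by simp
    next
      fix b b' assume b: "b \<in> ?J" "b' \<in> ?J"
      have "?\<delta> i ((b \<oplus> b') \<otimes> y) \<in> N" if y: "y \<in> carrier A" "i \<in> X" for y i
      proof -
        have "?\<delta> i ((b \<oplus> b') \<otimes> y) = ?\<delta> i (b \<otimes> y) \<oplus>\<^bsub>fun_mod (A.Fr e) X\<^esub> ?\<delta> i (b' \<otimes> y)"
          using b y by (auto simp: point_mass_def fun_eq_iff A.l_distr)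
        moreover have "?\<delta> i (b \<otimes> y) \<in> N" "?\<delta> i (b' \<otimes> y) \<in> N" using b y by auto
        ultimately show ?thesis using F.submoduleE(5)[OF N] by simp
      qed
      then show "b \<oplus>\<^bsub>self_module A\<^esub> b' \<in> ?J" using b by simp
    next
      fix a b assume a: "a \<in> carrier A" and b: "b \<in> ?J"
      have "?\<delta> i (a \<otimes> b \<otimes> y) \<in> N" if y: "y \<in> carrier A" "i \<in> X" for y i
      proof -
        have "a \<otimes> b \<otimes> y = b \<otimes> (a \<otimes> y)" using a b y by (simp add: A.m_ac)
        moreover have "?\<delta> i (b \<otimes> (a \<otimes> y)) \<in> N" using b a y by simp
        ultimately show ?thesis by simp
      qed
      then show "a \<odot>\<^bsub>self_module A\<^esub> b \<in> ?J" using a b by simp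
    qed auto
    then show ?thesis using submodule_self_iff_ideal[OF A.is_cring] by blast
  qed
  have "\<exists>n::nat. x [^] n \<in> ?J" if x: "x \<in> m" for x
  proof -
    have xR: "x \<in> carrier A" using x m.a_subset by auto
    obtain n :: nat where n: "\<And>z. z \<in> carrier (fun_mod (A.Fr e) X) \<Longrightarrow> (x [^] n) \<odot>\<^bsub>fun_mod (A.Fr e) X\<^esub> z \<in> N"
      using pow[OF x] by blast
    have "?\<delta> i (x [^] (n * p ^ e) \<otimes> y) \<in> N" if y: "y \<in> carrier A" "i \<in> X" for y i
    proof -
      have "(x [^] n) \<odot>\<^bsub>fun_mod (A.Fr e) X\<^esub> ?\<delta> i y = ?\<delta> i (x [^] (n * p ^ e) \<otimes> y)"
        using xR y by (auto simp: point_mass_def fun_eq_iff A.nat_pow_pow)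
      then show ?thesis using n[OF \<delta>c[OF y(2,1)]] by simp
    qed
    then show ?thesis using xR by (intro exI[of _ "n * p ^ e"]) simp
  qed
  then obtain c where c: "I c \<subseteq> ?J" using A.ideal_pow_subset[OF noetherian m.ideal_axioms J] by blast
  show ?thesis
  proof (intro exI[of _ c] ballI impI)
    fix z assume z: "z \<in> carrier (fun_mod (A.Fr e) X)" and "\<forall>i\<in>X. z i \<in> I c"
    then have zI: "\<And>i. i \<in> X \<Longrightarrow> z i \<in> I c" by blast
    show "z \<in> N"
    proof (rule fun_mod_support_induct[OF A.module_Fr N X z])
      fix i assume i: "i \<in> X"
      then have "?\<delta> i (z i \<otimes> \<one>) \<in> N" using zI[OF i] c by blast
      moreover have "z i \<in> carrier A" using zI[OF i] I_subset by blast
      ultimately show "?\<delta> i (z i) \<in> N" by simp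
    qed
  qed
qed

text \<open>A homomorphism is determined by the images of the generators g, subject to their
  relations. Approximating these images by elements y of A breaks the relations only slightly: the
  vector T y of defects is deep. The Artin--Rees substitute gives T y = T v for a v with entries in
  m^c, so y - v satisfies all relations exactly and is still close.\<close>

lemma approximate_hom:
  assumes \<psi>: "\<psi> \<in> module_hom S (S.Fr E) (S.Fr e)"
  obtains \<psi>' where "\<psi>' \<in> module_hom A (A.Fr E) (A.Fr e)" "\<And>u. u \<in> carrier A \<Longrightarrow> \<psi> (\<iota> u) \<ominus>\<^bsub>S\<^esub> \<iota> (\<psi>' u) \<in> K c"
proof -
  obtain g r where g: "generates A (A.Fr E) g r" by (rule A_generates)
  note gR = A.generates_FrD(1)[OF g] and gE = A.generates_FrD(2)[OF g]
  let ?\<psi>g = "\<lambda>i. \<psi> (\<iota> (g i))" and ?w = "\<lambda>\<rho> i. \<iota> (\<rho> i) [^]\<^bsub>S\<^esub> (p ^ e)"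
  have gi: "g i \<in> carrier A" if "i < r" for i using gR that by auto
  have gS: "(\<lambda>i. \<iota> (g i)) \<in> {..<r} \<rightarrow> carrier S" using gi by auto
  have \<psi>g: "?\<psi>g i \<in> carrier S" if "i < r" for i
    using module_hom_closed[OF \<psi>, of "\<iota> (g i)"] gi[OF that] by simp
  let ?L = "free_mod A {..<r}"
  interpret L: module A ?L by (rule module_fun_mod[OF Am])
  note Lc = fun_mod_closed[OF Am, of _ "{..<r}", unfolded self_module_simps]
  let ?h = "\<lambda>\<alpha>. \<Oplus>i\<in>{..<r}. \<alpha> i [^] (p ^ E) \<otimes> g i"
  have gg: "g \<in> {..<r} \<rightarrow> carrier (A.Fr E)" using gR by simp
  have h: "?h \<in> module_hom A ?L (A.Fr E)" using module_hom_combination[OF A.module_Fr finite_lessThan gg] by simp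
  let ?Rel = "{\<rho> \<in> carrier ?L. ?h \<rho> \<in> {\<zero>}}"
  interpret FE: module A "A.Fr E" by (rule A.module_Fr)
  interpret Fe: module A "A.Fr e" by (rule A.module_Fr)
  have "submodule {\<zero>} A (A.Fr E)" unfolding FE.submodule_iff by auto
  then have Rel: "submodule ?Rel A ?L" by (rule submodule_vimage[OF L.module_axioms A.module_Fr h])
  have nL: "noeth A ?L" by (rule noeth_fun_mod[OF noeth_self_module[OF A.is_cring noetherian]]) simp
  \<comment> \<open>Finitely many relations J generate all of them, so the vector of defects has
    finitely many coordinates.\<close>
  obtain J where J: "J \<subseteq> ?Rel" "finite J" "\<And>V. submodule V A ?L \<Longrightarrow> J \<subseteq> V \<Longrightarrow> ?Rel \<subseteq> V"
    using nL Rel unfolding noeth_def fg_sub_def by meson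
  have Jc: "\<rho> i \<in> carrier A" if "\<rho> \<in> J" for \<rho> i using Lc J(1) that by blast
  let ?Y = "fun_mod (A.Fr e) {..<r}" and ?X = "fun_mod (A.Fr e) J"
  interpret Y: module A ?Y by (rule module_fun_mod[OF A.module_Fr])
  interpret X: module A ?X by (rule module_fun_mod[OF A.module_Fr])
  have nX: "noeth A ?X" by (rule noeth_fun_mod[OF A_noeth J(2)])
  \<comment> \<open>T y lists the defects in the relations of J when g i is sent to y i; the
    exponent p^e is that of the target.\<close>
  define T where "T = (\<lambda>y \<rho>. if \<rho> \<in> J then \<Oplus>i\<in>{..<r}. \<rho> i [^] (p ^ e) \<otimes> y i else \<zero>)"
  have T: "T \<in> module_hom A ?Y ?X"
    using module_hom_fun_mod_combination[OF A.module_Fr finite_lessThan, of J "\<lambda>\<rho>. \<rho>" e r] Jc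
    unfolding T_def by (simp cong: if_cong)
  let ?V = "{y \<in> carrier ?Y. \<forall>i. y i \<in> I c}"
  interpret Ic: ideal "I c" A by (rule I_ideal)
  have V: "submodule ?V A ?Y" unfolding Y.submodule_iff by (auto simp: Ic.I_l_closed)
  have TV: "submodule (T ` ?V) A ?X" by (rule submodule_image[OF Y.module_axioms X.module_axioms T V])
  have TY: "submodule (T ` carrier ?Y) A ?X"
    by (rule submodule_image[OF Y.module_axioms X.module_axioms T Y.carrier_is_submodule])
  \<comment> \<open>For x in m the power x^c acts on F^e_*A through its p^e-th power, which lies in
    m^c, so it moves every y into \<open>?V\<close>.\<close>
  have pw: "\<exists>c::nat. \<forall>y\<in>T ` carrier ?Y. (x [^] c) \<odot>\<^bsub>?X\<^esub> y \<in> T ` ?V" if x: "x \<in> m" for x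
  proof -
    have xR: "x \<in> carrier A" using x m.a_subset by auto
    have "(x [^] c) \<odot>\<^bsub>?X\<^esub> T y \<in> T ` ?V" if y: "y \<in> carrier ?Y" for y
    proof -
      have inV: "(x [^] c) \<odot>\<^bsub>?Y\<^esub> y \<in> ?V"
      proof -
        have "(x [^] c) \<odot>\<^bsub>?Y\<^esub> y \<in> carrier ?Y" by (rule Y.smult_closed[OF _ y]) (use xR in simp)
        moreover have "((x [^] c) \<odot>\<^bsub>?Y\<^esub> y) i \<in> I c" for i
          using I_pow[OF A.ideal_pow_elem[OF m.ideal_axioms x], of c e] fun_mod_closed[OF A.module_Fr y, of i]
          by (simp add: Ic.I_r_closed)
        ultimately show ?thesis by blast
      qed
      have e: "(x [^] c) \<odot>\<^bsub>?X\<^esub> T y = T ((x [^] c) \<odot>\<^bsub>?Y\<^esub> y)"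
        using module_hom_smult[OF T _ y, of "x [^] c"] xR by simp
      show ?thesis unfolding e by (rule imageI[OF inV])
    qed
    then show ?thesis by blast
  qed
  have sub: "T ` ?V \<subseteq> T ` carrier ?Y" by blast
  have "\<exists>N. submodule N A ?X \<and> N \<inter> T ` carrier ?Y \<subseteq> T ` ?V \<and>
    (\<forall>x\<in>m. \<exists>n::nat. \<forall>z\<in>carrier ?X. (x [^] n) \<odot>\<^bsub>?X\<^esub> z \<in> N)"
  proof (rule weak_artin_rees[OF nX TY TV sub m.a_subset pw])
    fix N assume "submodule N A ?X" "N \<inter> T ` carrier ?Y \<subseteq> T ` ?V"
      and "\<And>x. x \<in> m \<Longrightarrow> \<exists>n::nat. \<forall>z\<in>carrier ?X. (x [^] n) \<odot>\<^bsub>?X\<^esub> z \<in> N"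
    then show ?thesis by (intro exI[of _ N] conjI ballI)
  qed assumption
  then obtain N where N0: "submodule N A ?X \<and> N \<inter> T ` carrier ?Y \<subseteq> T ` ?V \<and>
    (\<forall>x\<in>m. \<exists>n::nat. \<forall>z\<in>carrier ?X. (x [^] n) \<odot>\<^bsub>?X\<^esub> z \<in> N)" ..
  note N = conjunct1[OF N0] conjunct1[OF conjunct2[OF N0]] bspec[OF conjunct2[OF conjunct2[OF N0]]]
  obtain C where C: "\<forall>z\<in>carrier ?X. (\<forall>i\<in>J. z i \<in> I C) \<longrightarrow> z \<in> N"
    using deep_vectors[OF J(2) N(1,3)] ..
  \<comment> \<open>C is the depth at which vectors lie in N, c the requested precision; the images
    are approximated to depth \<open>max C c\<close> to serve both.\<close>
  have "\<forall>i. \<exists>a. i < r \<longrightarrow> a \<in> carrier A \<and> ?\<psi>g i \<ominus>\<^bsub>S\<^esub> \<iota> a \<in> K (max C c)"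
    using K_dense[OF \<psi>g] by blast
  then obtain a where a: "\<And>i. i < r \<Longrightarrow> a i \<in> carrier A \<and> ?\<psi>g i \<ominus>\<^bsub>S\<^esub> \<iota> (a i) \<in> K (max C c)" by metis
  define y where "y = (\<lambda>i. if i < r then a i else \<zero>)"
  have y: "y \<in> carrier ?Y" unfolding y_def using a by auto
  have yc: "y i \<in> carrier A" for i using a by (simp add: y_def)
  have y\<psi>: "?\<psi>g i \<ominus>\<^bsub>S\<^esub> \<iota> (y i) \<in> K (max C c)" if "i < r" for i using a[OF that] that by (simp add: y_def)
  have diff: "(\<Oplus>\<^bsub>S\<^esub>i\<in>{..<r}. ?w \<rho> i \<otimes>\<^bsub>S\<^esub> ?\<psi>g i) \<ominus>\<^bsub>S\<^esub> \<iota> (\<Oplus>i\<in>{..<r}. \<rho> i [^] (p ^ e) \<otimes> z i) \<in> K l"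
    if \<rho>: "\<rho> \<in> carrier ?L" and z: "\<And>i. i < r \<Longrightarrow> z i \<in> carrier A" "\<And>i. i < r \<Longrightarrow> ?\<psi>g i \<ominus>\<^bsub>S\<^esub> \<iota> (z i) \<in> K l" for \<rho> z l
  proof -
    note \<rho>c = Lc[OF \<rho>]
    have e1: "\<iota> (\<Oplus>i\<in>{..<r}. \<rho> i [^] (p ^ e) \<otimes> z i) = (\<Oplus>\<^bsub>S\<^esub>i\<in>{..<r}. ?w \<rho> i \<otimes>\<^bsub>S\<^esub> \<iota> (z i))"
      by (rule iota_combination[OF \<rho>]) (use z(1) in auto)
    have "(\<Oplus>\<^bsub>S\<^esub>i\<in>{..<r}. ?w \<rho> i \<otimes>\<^bsub>S\<^esub> ?\<psi>g i) =
        (\<Oplus>\<^bsub>S\<^esub>i\<in>{..<r}. ?w \<rho> i \<otimes>\<^bsub>S\<^esub> (?\<psi>g i \<ominus>\<^bsub>S\<^esub> \<iota> (z i)) \<oplus>\<^bsub>S\<^esub> ?w \<rho> i \<otimes>\<^bsub>S\<^esub> \<iota> (z i))"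
    proof (rule S.finsum_cong')
      fix i assume "i \<in> {..<r}"
      then have "?\<psi>g i \<in> carrier S" "\<iota> (z i) \<in> carrier S" "?w \<rho> i \<in> carrier S"
        using \<psi>g z(1) \<rho>c by auto
      then show "?w \<rho> i \<otimes>\<^bsub>S\<^esub> ?\<psi>g i =
         ?w \<rho> i \<otimes>\<^bsub>S\<^esub> (?\<psi>g i \<ominus>\<^bsub>S\<^esub> \<iota> (z i)) \<oplus>\<^bsub>S\<^esub> ?w \<rho> i \<otimes>\<^bsub>S\<^esub> \<iota> (z i)"
        by (simp add: S.r_distr[symmetric] S.minus_add_cancel)
    qed (use \<psi>g z(1) \<rho>c in auto)
    also have "\<dots> = (\<Oplus>\<^bsub>S\<^esub>i\<in>{..<r}. ?w \<rho> i \<otimes>\<^bsub>S\<^esub> (?\<psi>g i \<ominus>\<^bsub>S\<^esub> \<iota> (z i)))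
        \<oplus>\<^bsub>S\<^esub> (\<Oplus>\<^bsub>S\<^esub>i\<in>{..<r}. ?w \<rho> i \<otimes>\<^bsub>S\<^esub> \<iota> (z i))"
      by (rule S.finsum_addf) (use \<psi>g z(1) \<rho>c in auto)
    finally have e2: "(\<Oplus>\<^bsub>S\<^esub>i\<in>{..<r}. ?w \<rho> i \<otimes>\<^bsub>S\<^esub> ?\<psi>g i)
       = (\<Oplus>\<^bsub>S\<^esub>i\<in>{..<r}. ?w \<rho> i \<otimes>\<^bsub>S\<^esub> (?\<psi>g i \<ominus>\<^bsub>S\<^esub> \<iota> (z i)))
        \<oplus>\<^bsub>S\<^esub> (\<Oplus>\<^bsub>S\<^esub>i\<in>{..<r}. ?w \<rho> i \<otimes>\<^bsub>S\<^esub> \<iota> (z i))" .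
    have k: "(\<Oplus>\<^bsub>S\<^esub>i\<in>{..<r}. ?w \<rho> i \<otimes>\<^bsub>S\<^esub> (?\<psi>g i \<ominus>\<^bsub>S\<^esub> \<iota> (z i))) \<in> K l"
      by (rule ideal.finsum_closed_ideal[OF K_ideal]) (use z(2) \<rho>c in \<open>auto intro!: K_lmult\<close>)
    have w: "(\<Oplus>\<^bsub>S\<^esub>i\<in>{..<r}. ?w \<rho> i \<otimes>\<^bsub>S\<^esub> \<iota> (z i)) \<in> carrier S"
      by (rule S.finsum_closed) (use z(1) \<rho>c in auto)
    have "x \<oplus>\<^bsub>S\<^esub> w \<ominus>\<^bsub>S\<^esub> w = x" if "x \<in> carrier S" "w \<in> carrier S" for x w
      using that S.add_minus_cancel[of w x] S.a_comm[of x w] by simp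
    then show ?thesis unfolding e1 e2 using k w subsetD[OF K_subset k] by simp
  qed
  have comb: "\<psi> (\<iota> (?h \<rho>)) = (\<Oplus>\<^bsub>S\<^esub>i\<in>{..<r}. ?w \<rho> i \<otimes>\<^bsub>S\<^esub> ?\<psi>g i)" if \<rho>: "\<rho> \<in> carrier ?L" for \<rho>
    unfolding iota_combination[OF \<rho> gR] by (rule hom_iota_combination[OF \<psi> iota_fun[OF \<rho>] gS])
  \<comment> \<open>\<psi> respects the relation \<rho>, so the combination of the true images
    vanishes, and by \<open>diff\<close> the defect of y lies in m^C.\<close>
  have "T y \<in> N"
  proof (rule C[rule_format])
    show "T y \<in> carrier ?X" by (rule module_hom_closed[OF T y])
    fix \<rho> assume \<rho>J: "\<rho> \<in> J"
    then have \<rho>: "\<rho> \<in> carrier ?L" and \<rho>0: "?h \<rho> = \<zero>" using J(1) by auto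
    have z: "\<psi> (\<iota> (?h \<rho>)) = \<zero>\<^bsub>S\<^esub>" using module_hom_zero[OF S.module_Fr S.module_Fr \<psi>] \<rho>0 by simp
    have Tc: "(\<Oplus>i\<in>{..<r}. \<rho> i [^] (p ^ e) \<otimes> y i) \<in> carrier A" by (rule A.finsum_closed) (use Lc[OF \<rho>] yc in auto)
    have "\<zero>\<^bsub>S\<^esub> \<ominus>\<^bsub>S\<^esub> \<iota> (\<Oplus>i\<in>{..<r}. \<rho> i [^] (p ^ e) \<otimes> y i) \<in> K (max C c)"
      using diff[OF \<rho> yc y\<psi>] unfolding comb[OF \<rho>, symmetric] z .
    then have "\<ominus>\<^bsub>S\<^esub> (\<zero>\<^bsub>S\<^esub> \<ominus>\<^bsub>S\<^esub> \<iota> (\<Oplus>i\<in>{..<r}. \<rho> i [^] (p ^ e) \<otimes> y i)) \<in> K C"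
      using K_neg K_mono[of C "max C c"] by auto
    then have "\<iota> (\<Oplus>i\<in>{..<r}. \<rho> i [^] (p ^ e) \<otimes> y i) \<in> K C" using Tc by (simp add: a_minus_def)
    then show "T y \<rho> \<in> I C" unfolding T_def using \<rho>J K_iota[OF Tc] by simp
  qed
  then obtain v where v: "v \<in> ?V" "T y = T v" using N(2) y by blast
  have vY: "v \<in> carrier ?Y" using v by blast
  define y' where "y' = (\<lambda>i. y i \<ominus> v i)"
  have vc: "v i \<in> carrier A" for i using v(1) I_subset by blast
  have y'_eq: "y' = y \<ominus>\<^bsub>?Y\<^esub> v" using fun_mod_minus[OF A.module_Fr y vY] yc vc by (simp add: y'_def)
  have y': "y' \<in> carrier ?Y" unfolding y'_eq by (rule Y.M.minus_closed[OF y vY])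
  have y'c: "y' i \<in> carrier A" for i unfolding y'_def using yc vc by simp
  have "T y' = \<zero>\<^bsub>?X\<^esub>"
    unfolding y'_eq module_hom_minus[OF Y.module_axioms X.module_axioms T y vY] v(2)
    using module_hom_closed[OF T vY] X.minus_eq_zero_iff by blast
  then have Ty': "T y' \<rho> = \<zero>" for \<rho> by simp
  let ?k = "\<lambda>\<rho>. \<Oplus>i\<in>{..<r}. \<rho> i [^] (p ^ e) \<otimes> y' i"
  have yy: "y' \<in> {..<r} \<rightarrow> carrier (A.Fr e)" using y'c by simp
  have k: "?k \<in> module_hom A ?L (A.Fr e)" using module_hom_combination[OF A.module_Fr finite_lessThan yy] by simp
  have "submodule {\<zero>} A (A.Fr e)" unfolding Fe.submodule_iff by auto
  from submodule_vimage[OF L.module_axioms A.module_Fr k this]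
  have "submodule {\<rho> \<in> carrier ?L. ?k \<rho> \<in> {\<zero>}} A ?L" .
  moreover have "J \<subseteq> {\<rho> \<in> carrier ?L. ?k \<rho> \<in> {\<zero>}}"
  proof
    fix \<rho> assume \<rho>: "\<rho> \<in> J"
    then have "?k \<rho> = \<zero>" using Ty'[of \<rho>] unfolding T_def by simp
    then show "\<rho> \<in> {\<rho> \<in> carrier ?L. ?k \<rho> \<in> {\<zero>}}" using J(1) \<rho> by blast
  qed
  ultimately have Relk: "?Rel \<subseteq> {\<rho> \<in> carrier ?L. ?k \<rho> \<in> {\<zero>}}" by (rule J(3))
  have surj: "?h ` carrier ?L = carrier (A.Fr E)"
  proof
    show "?h ` carrier ?L \<subseteq> carrier (A.Fr E)" using module_hom_closed[OF h] by blast
    show "carrier (A.Fr E) \<subseteq> ?h ` carrier ?L" using gE by auto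
  qed
  have kerk: "?k \<rho> = \<zero>\<^bsub>A.Fr e\<^esub>" if "\<rho> \<in> carrier ?L" "?h \<rho> = \<zero>\<^bsub>A.Fr E\<^esub>" for \<rho>
  proof -
    have "\<rho> \<in> ?Rel" using that by simp
    then show ?thesis using Relk by auto
  qed
  obtain \<psi>' where \<psi>'0: "\<psi>' \<in> module_hom A (A.Fr E) (A.Fr e)" "\<forall>\<rho>\<in>carrier ?L. \<psi>' (?h \<rho>) = ?k \<rho>"
    using module_hom_factor[OF L.module_axioms A.module_Fr A.module_Fr h surj k kerk] ..
  note \<psi>' = \<psi>'0(1) bspec[OF \<psi>'0(2)]
  show thesis
  proof (rule that[OF \<psi>'(1)])
    fix u assume "u \<in> carrier A"
    then obtain \<rho> where \<rho>: "\<rho> \<in> carrier ?L" "u = ?h \<rho>" using gE by blast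
    have "?\<psi>g i \<ominus>\<^bsub>S\<^esub> \<iota> (y' i) \<in> K c" if i: "i < r" for i
    proof -
      have "\<iota> (y' i) = \<iota> (y i) \<ominus>\<^bsub>S\<^esub> \<iota> (v i)" unfolding y'_def using yc vc by (simp add: iota_minus)
      moreover have "\<iota> (y i) \<in> carrier S" "\<iota> (v i) \<in> carrier S" using yc vc by auto
      ultimately have "?\<psi>g i \<ominus>\<^bsub>S\<^esub> \<iota> (y' i) = (?\<psi>g i \<ominus>\<^bsub>S\<^esub> \<iota> (y i)) \<oplus>\<^bsub>S\<^esub> \<iota> (v i)"
        using \<psi>g[OF i] by (simp add: a_minus_def S.minus_add S.a_assoc)
      moreover have "?\<psi>g i \<ominus>\<^bsub>S\<^esub> \<iota> (y i) \<in> K c" using y\<psi>[OF i] K_mono[of c "max C c"] by auto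
      moreover have "\<iota> (v i) \<in> K c" using v(1) K_iota[OF vc] by blast
      ultimately show ?thesis using K_add by metis
    qed
    from diff[OF \<rho>(1) y'c this] show "\<psi> (\<iota> u) \<ominus>\<^bsub>S\<^esub> \<iota> (\<psi>' u) \<in> K c"
      unfolding \<rho>(2) \<psi>'(2)[OF \<rho>(1)] comb[OF \<rho>(1)] by blast
  qed
qed

lemma approximate_homs:
  assumes \<psi>: "\<forall>k<n. \<psi> k \<in> module_hom S (S.Fr (E k)) (S.Fr (e k))"
  shows "\<exists>\<psi>'. \<forall>k<n::nat. \<psi>' k \<in> module_hom A (A.Fr (E k)) (A.Fr (e k)) \<and>
    (\<forall>u\<in>carrier A. \<psi> k (\<iota> u) \<ominus>\<^bsub>S\<^esub> \<iota> (\<psi>' k u) \<in> K (c k))"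
proof (intro choice allI)
  show "\<exists>h. k < n \<longrightarrow> h \<in> module_hom A (A.Fr (E k)) (A.Fr (e k)) \<and>
      (\<forall>u\<in>carrier A. \<psi> k (\<iota> u) \<ominus>\<^bsub>S\<^esub> \<iota> (h u) \<in> K (c k))" for k
  proof (cases "k < n")
    case True
    show ?thesis by (rule approximate_hom[OF \<psi>[rule_format, OF True], of "c k"]) blast
  qed simp
qed

end

section \<open>The splitting over A\<close>

context local_completion
begin

text \<open>The maps of the splitting over S are replaced by A-linear approximations. Their
  composite sum \<theta> differs from the identity by combinations with coefficients in m, so it is
  onto by Nakayama and bijective since the module is Noetherian. Composing \<phi>' with the inverse
  of \<theta> restores an exact splitting.\<close>

lemma A_splitting:
  assumes "FFRT p S"
  shows "\<exists>(e0::nat) (n::nat) \<epsilon> \<psi> \<phi>. (\<forall>k<n. \<epsilon> k \<le> e0 \<and> \<psi> k \<in> module_hom A (A.Fr (Suc e0)) (A.Fr (\<epsilon> k)) \<and>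
     \<phi> k \<in> module_hom A (A.Fr (\<epsilon> k)) (A.Fr (Suc e0))) \<and>
     (\<forall>x\<in>carrier A. x = (\<Oplus>k\<in>{..<n}. \<phi> k (\<psi> k x)))"
proof (rule S_splitting[OF assms])
  fix e0 n :: nat and \<epsilon> and \<psi> \<phi> :: "nat \<Rightarrow> 's \<Rightarrow> 's"
  assume \<epsilon>: "\<And>k. k < n \<Longrightarrow> \<epsilon> k \<le> e0"
    and \<psi>: "\<And>k. k < n \<Longrightarrow> \<psi> k \<in> module_hom S (S.Fr (Suc e0)) (S.Fr (\<epsilon> k))"
    and \<phi>: "\<And>k. k < n \<Longrightarrow> \<phi> k \<in> module_hom S (S.Fr (\<epsilon> k)) (S.Fr (Suc e0))"
    and id: "\<And>x. x \<in> carrier S \<Longrightarrow> x = (\<Oplus>\<^bsub>S\<^esub>k\<in>{..<n}. \<phi> k (\<psi> k x))"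
  let ?E = "Suc e0"
  interpret FE: module A "A.Fr ?E" by (rule A.module_Fr)
  obtain g r where g: "generates A (A.Fr ?E) g r" by (rule A_generates)
  have gi: "g i \<in> carrier A" if "i < r" for i using A.generates_FrD(1)[OF g] that by auto
  \<comment> \<open>j is the precision at which an error becomes a combination of the generators
    with coefficients in m, as Nakayama requires.\<close>
  obtain j where j: "\<And>b. b \<in> I j \<Longrightarrow> \<exists>\<alpha>\<in>carrier (free_mod A {..<r}). (\<forall>i. \<alpha> i \<in> I 1) \<and>
     b = (\<Oplus>i\<in>{..<r}. \<alpha> i [^] (p ^ ?E) \<otimes> g i)" by (rule I_deep_combination[OF g]) blast
  \<comment> \<open>The error of \<psi>' passes through \<phi>, so it must be small enough for
    \<phi> to map it into K j.\<close>
  have "\<forall>k. \<exists>c. k < n \<longrightarrow> (\<forall>x\<in>K c. \<phi> k x \<in> K j)"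
  proof
    fix k
    show "\<exists>c. k < n \<longrightarrow> (\<forall>x\<in>K c. \<phi> k x \<in> K j)"
    proof (cases "k < n")
      case True
      show ?thesis by (rule hom_continuous[OF \<phi>[OF True], of j]) blast
    qed simp
  qed
  then obtain c where c: "\<And>k x. k < n \<Longrightarrow> x \<in> K (c k) \<Longrightarrow> \<phi> k x \<in> K j" by (metis (no_types))
  obtain \<psi>' where \<psi>'0: "\<forall>k<n. \<psi>' k \<in> module_hom A (A.Fr ?E) (A.Fr (\<epsilon> k)) \<and>
      (\<forall>u\<in>carrier A. \<psi> k (\<iota> u) \<ominus>\<^bsub>S\<^esub> \<iota> (\<psi>' k u) \<in> K (c k))"
    using approximate_homs[of n \<psi> "\<lambda>_. ?E" \<epsilon> c] \<psi> by blast
  obtain \<phi>' where \<phi>'0: "\<forall>k<n. \<phi>' k \<in> module_hom A (A.Fr (\<epsilon> k)) (A.Fr ?E) \<and>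
      (\<forall>u\<in>carrier A. \<phi> k (\<iota> u) \<ominus>\<^bsub>S\<^esub> \<iota> (\<phi>' k u) \<in> K j)"
    using approximate_homs[of n \<phi> \<epsilon> "\<lambda>_. ?E" "\<lambda>_. j"] \<phi> by blast
  have \<psi>': "\<psi>' k \<in> module_hom A (A.Fr ?E) (A.Fr (\<epsilon> k))" "\<And>u. u \<in> carrier A \<Longrightarrow> \<psi> k (\<iota> u) \<ominus>\<^bsub>S\<^esub> \<iota> (\<psi>' k u) \<in> K (c k)"
    and \<phi>': "\<phi>' k \<in> module_hom A (A.Fr (\<epsilon> k)) (A.Fr ?E)" "\<And>u. u \<in> carrier A \<Longrightarrow> \<phi> k (\<iota> u) \<ominus>\<^bsub>S\<^esub> \<iota> (\<phi>' k u) \<in> K j"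
    if "k < n" for k using \<psi>'0 \<phi>'0 that by blast+
  have \<psi>c: "\<psi> k x \<in> carrier S" and \<phi>c: "\<phi> k x \<in> carrier S" if "k < n" "x \<in> carrier S" for k x
    using module_hom_closed[OF \<psi>[OF that(1)], of x] module_hom_closed[OF \<phi>[OF that(1)], of x] that by auto
  have \<psi>'c: "\<psi>' k x \<in> carrier A" and \<phi>'c: "\<phi>' k x \<in> carrier A" if "k < n" "x \<in> carrier A" for k x
    using module_hom_closed[OF \<psi>'(1)[OF that(1)], of x] module_hom_closed[OF \<phi>'(1)[OF that(1)], of x] that by auto
  define \<theta> where "\<theta> = (\<lambda>x. \<Oplus>k\<in>{..<n}. \<phi>' k (\<psi>' k x))"
  have hom: "(\<lambda>x. \<phi>' k (\<psi>' k x)) \<in> module_hom A (A.Fr ?E) (A.Fr ?E)" if "k \<in> {..<n}" for k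
    by (rule module_hom_comp) (use \<psi>'(1) \<phi>'(1) that in auto)
  have \<theta>: "\<theta> \<in> module_hom A (A.Fr ?E) (A.Fr ?E)"
    using module_hom_finsum_fun[OF A.module_Fr A.module_Fr finite_lessThan hom] unfolding \<theta>_def by simp
  have \<theta>c: "\<theta> u \<in> carrier A" if "u \<in> carrier A" for u using module_hom_closed[OF \<theta>, of u] that by simp
  have close: "\<iota> u \<ominus>\<^bsub>S\<^esub> \<iota> (\<theta> u) \<in> K j" if u: "u \<in> carrier A" for u
  proof -
    have \<iota>u: "\<iota> u \<in> carrier S" using u by simp
    let ?d = "\<lambda>k. \<phi> k (\<psi> k (\<iota> u)) \<ominus>\<^bsub>S\<^esub> \<iota> (\<phi>' k (\<psi>' k u))"
    have dK: "?d k \<in> K j" if k: "k < n" for k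
    proof -
      let ?a = "\<psi> k (\<iota> u)" and ?b = "\<iota> (\<psi>' k u)" and ?c = "\<iota> (\<phi>' k (\<psi>' k u))"
      have c1: "?a \<in> carrier S" "?b \<in> carrier S" "?c \<in> carrier S" "\<phi> k ?a \<in> carrier S" "\<phi> k ?b \<in> carrier S"
        using \<psi>c \<phi>c \<psi>'c \<phi>'c k u \<iota>u by auto
      have "\<phi> k (?a \<ominus>\<^bsub>S\<^esub> ?b) = \<phi> k ?a \<ominus>\<^bsub>S\<^esub> \<phi> k ?b"
        using module_hom_minus[OF S.module_Fr S.module_Fr \<phi>[OF k], of ?a ?b] c1 by simp
      moreover have "\<phi> k (?a \<ominus>\<^bsub>S\<^esub> ?b) \<in> K j" by (rule c[OF k \<psi>'(2)[OF k u]])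
      moreover have "\<phi> k ?b \<ominus>\<^bsub>S\<^esub> ?c \<in> K j" by (rule \<phi>'(2)[OF k \<psi>'c[OF k u]])
      moreover have "?d k = (\<phi> k ?a \<ominus>\<^bsub>S\<^esub> \<phi> k ?b) \<oplus>\<^bsub>S\<^esub> (\<phi> k ?b \<ominus>\<^bsub>S\<^esub> ?c)"
        using c1 by (simp add: a_minus_def S.a_assoc S.r_neg1)
      ultimately show ?thesis by (simp add: K_add)
    qed
    have e1: "\<iota> (\<theta> u) = (\<Oplus>\<^bsub>S\<^esub>k\<in>{..<n}. \<iota> (\<phi>' k (\<psi>' k u)))"
      unfolding \<theta>_def by (subst iota.hom_finsum) (use \<psi>'c \<phi>'c u in \<open>auto simp: o_def\<close>)
    have e2: "\<iota> u = (\<Oplus>\<^bsub>S\<^esub>k\<in>{..<n}. ?d k) \<oplus>\<^bsub>S\<^esub> (\<Oplus>\<^bsub>S\<^esub>k\<in>{..<n}. \<iota> (\<phi>' k (\<psi>' k u)))"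
    proof -
      have "\<iota> u = (\<Oplus>\<^bsub>S\<^esub>k\<in>{..<n}. \<phi> k (\<psi> k (\<iota> u)))" by (rule id[OF \<iota>u])
      also have "\<dots> = (\<Oplus>\<^bsub>S\<^esub>k\<in>{..<n}. ?d k \<oplus>\<^bsub>S\<^esub> \<iota> (\<phi>' k (\<psi>' k u)))"
        by (rule S.finsum_cong') (use \<psi>c \<phi>c \<psi>'c \<phi>'c u \<iota>u in \<open>auto simp: S.minus_add_cancel\<close>)
      also have "\<dots> = (\<Oplus>\<^bsub>S\<^esub>k\<in>{..<n}. ?d k) \<oplus>\<^bsub>S\<^esub> (\<Oplus>\<^bsub>S\<^esub>k\<in>{..<n}. \<iota> (\<phi>' k (\<psi>' k u)))"
        by (rule S.finsum_addf) (use \<psi>c \<phi>c \<psi>'c \<phi>'c u \<iota>u in auto)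
      finally show ?thesis .
    qed
    have d: "(\<Oplus>\<^bsub>S\<^esub>k\<in>{..<n}. ?d k) \<in> K j"
      by (rule ideal.finsum_closed_ideal[OF K_ideal]) (use dK in auto)
    have w: "(\<Oplus>\<^bsub>S\<^esub>k\<in>{..<n}. \<iota> (\<phi>' k (\<psi>' k u))) \<in> carrier S"
      by (rule S.finsum_closed) (use \<psi>'c \<phi>'c u in auto)
    have "x \<oplus>\<^bsub>S\<^esub> w \<ominus>\<^bsub>S\<^esub> w = x" if "x \<in> carrier S" "w \<in> carrier S" for x w
      using that S.add_minus_cancel[of w x] S.a_comm[of x w] by simp
    from trans[OF arg_cong2[where f = "\<lambda>a b. a \<ominus>\<^bsub>S\<^esub> b", OF e2 e1] this[OF subsetD[OF K_subset d] w]]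
    show ?thesis using d by simp
  qed
  have surj: "\<theta> ` carrier (A.Fr ?E) = carrier (A.Fr ?E)"
  proof (rule nakayama_noeth[OF A_noeth, where m = m])
    show "submodule (\<theta> ` carrier (A.Fr ?E)) A (A.Fr ?E)"
      by (rule submodule_image[OF A.module_Fr A.module_Fr \<theta> FE.carrier_is_submodule])
    show "a \<in> carrier A \<and> \<one> \<ominus> a \<in> Units A" if a: "a \<in> m" for a
    proof -
      have aA: "a \<in> carrier A" using a m.a_subset by auto
      have "\<one> \<ominus> a \<notin> m"
      proof
        assume "\<one> \<ominus> a \<in> m"
        then have "(\<one> \<ominus> a) \<oplus> a \<in> m" using a by simp
        then show False using aA m_proper by (simp add: A.minus_add_cancel)
      qed
      then show ?thesis using local aA by simp
    qed
    show "b \<otimes> a \<in> m" if "a \<in> m" "b \<in> carrier A" for a b using that by (rule m.I_l_closed)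
    fix X assume X: "submodule X A (A.Fr ?E)" and \<theta>X: "\<theta> ` carrier (A.Fr ?E) \<subseteq> X"
      and mX: "\<And>a y. a \<in> m \<Longrightarrow> y \<in> carrier (A.Fr ?E) \<Longrightarrow> a \<odot>\<^bsub>A.Fr ?E\<^esub> y \<in> X"
    have "u \<in> X" if u: "u \<in> carrier A" for u
    proof -
      have "u \<ominus> \<theta> u \<in> I j"
        using close[OF u] K_iota[of "u \<ominus> \<theta> u" j] u \<theta>c[OF u] by (simp add: iota_minus)
      then obtain \<alpha> where \<alpha>: "\<forall>i. \<alpha> i \<in> I 1" "u \<ominus> \<theta> u = (\<Oplus>i\<in>{..<r}. \<alpha> i [^] (p ^ ?E) \<otimes> g i)" using j by blast
      have "(\<Oplus>\<^bsub>A.Fr ?E\<^esub>i\<in>{..<r}. \<alpha> i [^] (p ^ ?E) \<otimes> g i) \<in> X"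
      proof (rule FE.finsum_in_submodule[OF X])
        fix i assume "i \<in> {..<r}"
        then have "\<alpha> i \<odot>\<^bsub>A.Fr ?E\<^esub> g i \<in> X"
          using mX[of "\<alpha> i" "g i"] \<alpha>(1) gi A.ideal_pow_1[OF m.ideal_axioms] by auto
        then show "\<alpha> i [^] (p ^ ?E) \<otimes> g i \<in> X" by simp
      qed simp
      then have "u \<ominus> \<theta> u \<in> X" unfolding \<alpha>(2) by simp
      moreover have "\<theta> u \<in> X" using \<theta>X u by auto
      ultimately have "(u \<ominus> \<theta> u) \<oplus> \<theta> u \<in> X" using FE.submoduleE(5)[OF X] by simp
      then show ?thesis using u \<theta>c[OF u] by (simp add: A.minus_add_cancel)
    qed
    moreover have "X \<subseteq> carrier A" using FE.submoduleE(1)[OF X] by simp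
    ultimately show "X = carrier (A.Fr ?E)" by auto
  qed
  have inj: "inj_on \<theta> (carrier (A.Fr ?E))" by (rule noeth_surj_endo_inj[OF A_noeth \<theta> surj])
  have bij: "bij_betw \<theta> (carrier (A.Fr ?E)) (carrier (A.Fr ?E))" using inj surj unfolding bij_betw_def by blast
  define \<theta>i where "\<theta>i = inv_into (carrier A) \<theta>"
  have \<theta>i: "\<theta>i \<in> module_hom A (A.Fr ?E) (A.Fr ?E)" using module_hom_inv[OF \<theta> bij A.module_Fr] unfolding \<theta>i_def by simp
  have \<theta>i\<theta>: "\<theta>i (\<theta> u) = u" if "u \<in> carrier A" for u unfolding \<theta>i_def using inj that by simp
  have f2: "u = (\<Oplus>k\<in>{..<n}. \<theta>i (\<phi>' k (\<psi>' k u)))" if u: "u \<in> carrier A" for u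
  proof -
    have "\<theta>i (finsum (A.Fr ?E) (\<lambda>k. \<phi>' k (\<psi>' k u)) {..<n}) = finsum (A.Fr ?E) (\<lambda>k. \<theta>i (\<phi>' k (\<psi>' k u))) {..<n}"
      by (rule module_hom_finsum[OF A.module_Fr A.module_Fr \<theta>i]) (use \<psi>'c \<phi>'c u in auto)
    then show ?thesis using \<theta>i\<theta>[OF u] unfolding \<theta>_def by simp
  qed
  have "(\<lambda>x. \<theta>i (\<phi>' k x)) \<in> module_hom A (A.Fr (\<epsilon> k)) (A.Fr ?E)" if "k < n" for k
    by (rule module_hom_comp[OF \<phi>'(1)[OF that] \<theta>i])
  then have f1: "\<forall>k<n. \<epsilon> k \<le> e0 \<and> \<psi>' k \<in> module_hom A (A.Fr ?E) (A.Fr (\<epsilon> k)) \<and>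
     (\<lambda>x. \<theta>i (\<phi>' k x)) \<in> module_hom A (A.Fr (\<epsilon> k)) (A.Fr ?E)"
    using \<epsilon> \<psi>'(1) by simp
  show ?thesis
    by (rule exI[of _ e0], rule exI[of _ n], rule exI[of _ \<epsilon>], rule exI[of _ \<psi>'],
        rule exI[of _ "\<lambda>k x. \<theta>i (\<phi>' k x)"], rule conjI[OF f1]) (use f2 in blast)
qed

end

section \<open>Localization at a prime\<close>

text \<open>Operations on fractions are defined as unions over all representatives; once all of
  these give the same set, the union over nonempty X and Y is that set.\<close>

lemma UN_pairs_const:
  assumes "(a, s) \<in> X" "(b, t) \<in> Y"
    and "\<And>a' s' b' t'. (a', s') \<in> X \<Longrightarrow> (b', t') \<in> Y \<Longrightarrow> f a' s' b' t' = c"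
  shows "(\<Union>(a', s')\<in>X. \<Union>(b', t')\<in>Y. f a' s' b' t') = c"
proof -
  have "(\<Union>(b', t')\<in>Y. f (fst x) (snd x) b' t') = c" if x: "x \<in> X" for x
  proof -
    have "(\<Union>y\<in>Y. f (fst x) (snd x) (fst y) (snd y)) = (\<Union>y\<in>Y. c)" by (rule SUP_cong) (use x assms(3) in auto)
    then show ?thesis using assms(2) by (auto simp: case_prod_beta)
  qed
  then have "(\<Union>x\<in>X. \<Union>(b', t')\<in>Y. f (fst x) (snd x) b' t') = (\<Union>x\<in>X. c)" by (rule SUP_cong[OF refl])
  then show ?thesis using assms(1) by (auto simp: case_prod_beta)
qed

locale prime_localization = primeideal P R for P and R (structure)
begin

abbreviation D :: "'a set" where "D \<equiv> carrier R - P"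
abbreviation A where "A \<equiv> localized_ring R P"
abbreviation frac where "frac \<equiv> fraction R P (self_module R)"
abbreviation m where "m \<equiv> localized_max_ideal R P"
abbreviation \<iota> where "\<iota> a \<equiv> frac a \<one>"

lemma D_one: "\<one> \<in> D" using I_notcarr one_imp_carrier by auto

lemma D_mult: "s \<in> D \<Longrightarrow> t \<in> D \<Longrightarrow> s \<otimes> t \<in> D" using I_prime by auto

lemma D_pow: "s \<in> D \<Longrightarrow> s [^] (n::nat) \<in> D"
proof (induction n)
  case 0 show ?case using D_one by simp
next
  case (Suc n)
  then have "s [^] n \<otimes> s \<in> D" by (intro D_mult) auto
  then show ?case by simp
qed

lemma D_carrier: "s \<in> D \<Longrightarrow> s \<in> carrier R" by blast

lemma mem_frac: "(b, t) \<in> frac a s \<longleftrightarrow> b \<in> carrier R \<and> t \<in> D \<and> (\<exists>u\<in>D. u \<otimes> (t \<otimes> a) = u \<otimes> (s \<otimes> b))"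
  by (auto simp: fraction_def)

lemma frac_eqI:
  assumes "a \<in> carrier R" "b \<in> carrier R" "s \<in> D" "t \<in> D" "u \<in> D" "u \<otimes> (t \<otimes> a) = u \<otimes> (s \<otimes> b)"
  shows "frac a s = frac b t"
proof -
  have half: "(c, w) \<in> frac b t"
    if ab: "a \<in> carrier R" "b \<in> carrier R" "s \<in> D" "t \<in> D" "u \<in> D" "u \<otimes> (t \<otimes> a) = u \<otimes> (s \<otimes> b)"
    and c: "(c, w) \<in> frac a s" for a b s t u c w
  proof -
    obtain v where v: "c \<in> carrier R" "w \<in> D" "v \<in> D" "v \<otimes> (w \<otimes> a) = v \<otimes> (s \<otimes> c)" using c unfolding mem_frac by blast
    note R = D_carrier[OF ab(3)] D_carrier[OF ab(4)] D_carrier[OF ab(5)] D_carrier[OF v(2)] D_carrier[OF v(3)] ab(1,2) v(1)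
    \<comment> \<open>The witness collects the multipliers of both equations and the denominator
      that has to be cancelled.\<close>
    let ?z = "u \<otimes> v \<otimes> s"
    have "?z \<otimes> (w \<otimes> b) = v \<otimes> w \<otimes> (u \<otimes> (s \<otimes> b))" using R by (simp add: m_ac)
    also have "\<dots> = u \<otimes> t \<otimes> (v \<otimes> (w \<otimes> a))" unfolding ab(6)[symmetric] using R by (simp add: m_ac)
    also have "\<dots> = ?z \<otimes> (t \<otimes> c)" unfolding v(4) using R by (simp add: m_ac)
    finally show ?thesis unfolding mem_frac using v D_mult ab by blast
  qed
  show ?thesis
  proof (intro equalityI subsetI)
    fix z assume "z \<in> frac a s"
    then show "z \<in> frac b t" using half[OF assms] by (cases z) blast
  next
    fix z assume "z \<in> frac b t"
    then show "z \<in> frac a s" using half[OF assms(2,1,4,3,5) assms(6)[symmetric]] by (cases z) blast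
  qed
qed

lemma frac_self: "a \<in> carrier R \<Longrightarrow> s \<in> D \<Longrightarrow> (a, s) \<in> frac a s"
  unfolding mem_frac using D_one by blast

lemma frac_eq_iff:
  assumes "a \<in> carrier R" "b \<in> carrier R" "s \<in> D" "t \<in> D"
  shows "frac a s = frac b t \<longleftrightarrow> (\<exists>u\<in>D. u \<otimes> (t \<otimes> a) = u \<otimes> (s \<otimes> b))"
proof
  assume "frac a s = frac b t"
  then have "(b, t) \<in> frac a s" using frac_self[OF assms(2,4)] by simp
  then show "\<exists>u\<in>D. u \<otimes> (t \<otimes> a) = u \<otimes> (s \<otimes> b)" unfolding mem_frac by blast
qed (use frac_eqI[OF assms] in blast)

lemma frac_cancel:
  assumes "a \<in> carrier R" "s \<in> D" "w \<in> D" shows "frac (w \<otimes> a) (w \<otimes> s) = frac a s"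
proof (rule frac_eqI[OF _ assms(1) _ assms(2) D_one])
  note R = D_carrier[OF assms(2)] D_carrier[OF assms(3)] assms(1)
  show "\<one> \<otimes> (s \<otimes> (w \<otimes> a)) = \<one> \<otimes> (w \<otimes> s \<otimes> a)" using R by (simp add: m_ac)
qed (use assms D_mult in auto)

lemma A_carrier: "carrier A = {frac a s | a s. a \<in> carrier R \<and> s \<in> D}"
  and A_one: "\<one>\<^bsub>A\<^esub> = \<iota> \<one>" and A_zero: "\<zero>\<^bsub>A\<^esub> = \<iota> \<zero>"
  by (simp_all add: localized_ring_def Let_def)

lemma frac_closed: "a \<in> carrier R \<Longrightarrow> s \<in> D \<Longrightarrow> frac a s \<in> carrier A"
  unfolding A_carrier by blast

lemma A_cases:
  assumes "X \<in> carrier A" obtains a s where "a \<in> carrier R" "s \<in> D" "X = frac a s"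
  using assms unfolding A_carrier by blast

lemma
  assumes "a \<in> carrier R" "s \<in> D" "b \<in> carrier R" "t \<in> D"
  shows frac_mult: "frac a s \<otimes>\<^bsub>A\<^esub> frac b t = frac (a \<otimes> b) (s \<otimes> t)"
    and frac_add: "frac a s \<oplus>\<^bsub>A\<^esub> frac b t = frac (t \<otimes> a \<oplus> s \<otimes> b) (s \<otimes> t)"
proof -
  have *: "frac (a' \<otimes> b') (s' \<otimes> t') = frac (a \<otimes> b) (s \<otimes> t)"
    "frac (t' \<otimes> a' \<oplus> s' \<otimes> b') (s' \<otimes> t') = frac (t \<otimes> a \<oplus> s \<otimes> b) (s \<otimes> t)"
    if ab: "(a', s') \<in> frac a s" "(b', t') \<in> frac b t" for a' s' b' t'
  proof -
    obtain u where u: "a' \<in> carrier R" "s' \<in> D" "u \<in> D" "u \<otimes> (s' \<otimes> a) = u \<otimes> (s \<otimes> a')"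
      using ab(1) unfolding mem_frac by blast
    obtain v where v: "b' \<in> carrier R" "t' \<in> D" "v \<in> D" "v \<otimes> (t' \<otimes> b) = v \<otimes> (t \<otimes> b')"
      using ab(2) unfolding mem_frac by blast
    note R = assms(1,3) u(1) v(1) D_carrier[OF assms(2)] D_carrier[OF assms(4)] u(2,3)[THEN D_carrier] v(2,3)[THEN D_carrier]
    have "(u \<otimes> v) \<otimes> ((s \<otimes> t) \<otimes> (a' \<otimes> b')) = (u \<otimes> (s \<otimes> a')) \<otimes> (v \<otimes> (t \<otimes> b'))" using R by (simp add: m_ac)
    also have "\<dots> = (u \<otimes> v) \<otimes> ((s' \<otimes> t') \<otimes> (a \<otimes> b))" unfolding u(4)[symmetric] v(4)[symmetric] using R by (simp add: m_ac)
    finally show "frac (a' \<otimes> b') (s' \<otimes> t') = frac (a \<otimes> b) (s \<otimes> t)"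
      by (intro frac_eqI[where u = "u \<otimes> v"]) (use assms u v D_mult in auto)
    have "(u \<otimes> v) \<otimes> ((s \<otimes> t) \<otimes> (t' \<otimes> a' \<oplus> s' \<otimes> b'))
        = (v \<otimes> t \<otimes> t') \<otimes> (u \<otimes> (s \<otimes> a')) \<oplus> (u \<otimes> s \<otimes> s') \<otimes> (v \<otimes> (t \<otimes> b'))" using R by (simp add: m_ac r_distr)
    also have "\<dots> = (u \<otimes> v) \<otimes> ((s' \<otimes> t') \<otimes> (t \<otimes> a \<oplus> s \<otimes> b))"
      unfolding u(4)[symmetric] v(4)[symmetric] using R by (simp add: m_ac r_distr)
    finally show "frac (t' \<otimes> a' \<oplus> s' \<otimes> b') (s' \<otimes> t') = frac (t \<otimes> a \<oplus> s \<otimes> b) (s \<otimes> t)"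
      by (intro frac_eqI[where u = "u \<otimes> v"]) (use assms u v D_mult in auto)
  qed
  note U = UN_pairs_const[OF frac_self[OF assms(1,2)] frac_self[OF assms(3,4)]]
  show "frac a s \<otimes>\<^bsub>A\<^esub> frac b t = frac (a \<otimes> b) (s \<otimes> t)"
    using U[OF *(1)] by (simp add: localized_ring_def Let_def)
  show "frac a s \<oplus>\<^bsub>A\<^esub> frac b t = frac (t \<otimes> a \<oplus> s \<otimes> b) (s \<otimes> t)"
    using U[OF *(2)] by (simp add: localized_ring_def Let_def)
qed

lemma A_cring: "cring A"
proof -
  note s = frac_add frac_mult D_mult
  have cases3: thesis if h: "X \<in> carrier A" "Y \<in> carrier A" "Z \<in> carrier A"
    "\<And>a s b t c w. a \<in> carrier R \<Longrightarrow> s \<in> D \<Longrightarrow> b \<in> carrier R \<Longrightarrow> t \<in> D \<Longrightarrow> c \<in> carrier R \<Longrightarrow> w \<in> D \<Longrightarrow>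
      s \<in> carrier R \<Longrightarrow> t \<in> carrier R \<Longrightarrow> w \<in> carrier R \<Longrightarrow> X = frac a s \<Longrightarrow> Y = frac b t \<Longrightarrow> Z = frac c w \<Longrightarrow> thesis" for X Y Z thesis
  proof -
    obtain a s where X: "a \<in> carrier R" "s \<in> D" "X = frac a s" by (rule A_cases[OF h(1)])
    obtain b t where Y: "b \<in> carrier R" "t \<in> D" "Y = frac b t" by (rule A_cases[OF h(2)])
    obtain c w where Z: "c \<in> carrier R" "w \<in> D" "Z = frac c w" by (rule A_cases[OF h(3)])
    show thesis by (rule h(4)[OF X(1,2) Y(1,2) Z(1,2) D_carrier[OF X(2)] D_carrier[OF Y(2)] D_carrier[OF Z(2)] X(3) Y(3) Z(3)])
  qed
  have add_closed: "X \<oplus>\<^bsub>A\<^esub> Y \<in> carrier A" and mult_closed: "X \<otimes>\<^bsub>A\<^esub> Y \<in> carrier A"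
    if XY: "X \<in> carrier A" "Y \<in> carrier A" for X Y
    by (rule cases3[OF XY XY(1)], simp del: Diff_iff add: s frac_closed)+
  have add_comm: "X \<oplus>\<^bsub>A\<^esub> Y = Y \<oplus>\<^bsub>A\<^esub> X" and mult_comm: "X \<otimes>\<^bsub>A\<^esub> Y = Y \<otimes>\<^bsub>A\<^esub> X"
    if XY: "X \<in> carrier A" "Y \<in> carrier A" for X Y
    by (rule cases3[OF XY XY(1)], simp del: Diff_iff add: s m_comm a_comm)+
  have zero: "\<zero>\<^bsub>A\<^esub> \<oplus>\<^bsub>A\<^esub> X = X" and one: "\<one>\<^bsub>A\<^esub> \<otimes>\<^bsub>A\<^esub> X = X" if X: "X \<in> carrier A" for X
    by (rule cases3[OF X X X], simp del: Diff_iff add: s A_zero A_one D_one)+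
  have add_assoc: "X \<oplus>\<^bsub>A\<^esub> Y \<oplus>\<^bsub>A\<^esub> Z = X \<oplus>\<^bsub>A\<^esub> (Y \<oplus>\<^bsub>A\<^esub> Z)" and mult_assoc: "X \<otimes>\<^bsub>A\<^esub> Y \<otimes>\<^bsub>A\<^esub> Z = X \<otimes>\<^bsub>A\<^esub> (Y \<otimes>\<^bsub>A\<^esub> Z)"
    if XYZ: "X \<in> carrier A" "Y \<in> carrier A" "Z \<in> carrier A" for X Y Z
    by (rule cases3[OF XYZ], simp del: Diff_iff add: s r_distr m_ac a_ac)+
  have neg: "\<exists>Y\<in>carrier A. Y \<oplus>\<^bsub>A\<^esub> X = \<zero>\<^bsub>A\<^esub>" if X: "X \<in> carrier A" for X
  proof (rule cases3[OF X X X])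
    fix a s assume as: "a \<in> carrier R" "s \<in> D" "s \<in> carrier R" "X = frac a s"
    have "frac (\<ominus> a) s \<oplus>\<^bsub>A\<^esub> X = frac \<zero> (s \<otimes> s)"
      using as by (simp del: Diff_iff add: s r_minus l_neg)
    also have "\<dots> = \<zero>\<^bsub>A\<^esub>" unfolding A_zero
      by (rule frac_eqI[where u = \<one>]) (use D_one D_mult as in auto)
    finally show ?thesis using as frac_closed[of "\<ominus> a" s] by blast
  qed
  have distr: "(X \<oplus>\<^bsub>A\<^esub> Y) \<otimes>\<^bsub>A\<^esub> Z = X \<otimes>\<^bsub>A\<^esub> Z \<oplus>\<^bsub>A\<^esub> Y \<otimes>\<^bsub>A\<^esub> Z"
    if XYZ: "X \<in> carrier A" "Y \<in> carrier A" "Z \<in> carrier A" for X Y Z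
  proof (rule cases3[OF XYZ])
    fix a s b t c w assume h: "a \<in> carrier R" "s \<in> D" "b \<in> carrier R" "t \<in> D" "c \<in> carrier R" "w \<in> D"
      "s \<in> carrier R" "t \<in> carrier R" "w \<in> carrier R" "X = frac a s" "Y = frac b t" "Z = frac c w"
    \<comment> \<open>Bringing the two products to a common denominator leaves a surplus factor w in
      numerator and denominator.\<close>
    have "X \<otimes>\<^bsub>A\<^esub> Z \<oplus>\<^bsub>A\<^esub> Y \<otimes>\<^bsub>A\<^esub> Z = frac (w \<otimes> ((t \<otimes> a \<oplus> s \<otimes> b) \<otimes> c)) (w \<otimes> (s \<otimes> t \<otimes> w))"
      using h by (simp del: Diff_iff add: s l_distr r_distr m_ac)
    also have "\<dots> = (X \<oplus>\<^bsub>A\<^esub> Y) \<otimes>\<^bsub>A\<^esub> Z"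
      using h by (simp del: Diff_iff add: s frac_cancel)
    finally show ?thesis ..
  qed
  have "\<zero>\<^bsub>A\<^esub> \<in> carrier A" "\<one>\<^bsub>A\<^esub> \<in> carrier A" using frac_closed D_one by (simp_all add: A_zero A_one)
  then show ?thesis
    by (intro cringI abelian_groupI comm_monoidI)
      (assumption | rule add_closed mult_closed add_assoc mult_assoc zero one neg distr | rule add_comm mult_comm)+
qed

sublocale A: cring A by (rule A_cring)

lemma iota_hom: "\<iota> \<in> ring_hom R A"
  by (rule ring_hom_memI) (use D_one in \<open>auto simp: frac_closed frac_add frac_mult A_one\<close>)

sublocale iota: ring_hom_cring R A \<iota>
  by unfold_locales (rule iota_hom)

lemma iota_vimage: "ideal J A \<Longrightarrow> ideal {a \<in> carrier R. \<iota> a \<in> J} R"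
  by (rule ring_hom_ring.ideal_vimage[OF ring_hom_ringI2[OF ring_axioms A.ring_axioms iota_hom]])

lemma iota_zero_iff: "a \<in> carrier R \<Longrightarrow> \<iota> a = \<zero>\<^bsub>A\<^esub> \<longleftrightarrow> (\<exists>u\<in>D. u \<otimes> a = \<zero>)"
  unfolding A_zero using frac_eq_iff[OF _ _ D_one D_one, of a \<zero>] by (auto simp: D_carrier)

lemma frac_one: "a \<in> carrier R \<Longrightarrow> s \<in> D \<Longrightarrow> frac \<one> s \<otimes>\<^bsub>A\<^esub> \<iota> a = frac a s"
  using frac_mult[OF one_closed _ _ D_one, of s a] by (auto simp: D_carrier)

lemma iota_frac: "a \<in> carrier R \<Longrightarrow> s \<in> D \<Longrightarrow> \<iota> s \<otimes>\<^bsub>A\<^esub> frac a s = \<iota> a"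
  using frac_mult[OF D_carrier D_one, of s a s] frac_cancel[OF _ D_one, of a s] by (auto simp: D_carrier)

lemma frac_in_m: "a \<in> carrier R \<Longrightarrow> s \<in> D \<Longrightarrow> frac a s \<in> m \<longleftrightarrow> a \<in> P"
proof
  assume a: "a \<in> carrier R" and s: "s \<in> D" and "frac a s \<in> m"
  then obtain b t where bt: "b \<in> P" "t \<in> D" "frac a s = frac b t" unfolding localized_max_ideal_def by auto
  then obtain u where u: "u \<in> D" "u \<otimes> (t \<otimes> a) = u \<otimes> (s \<otimes> b)"
    using frac_eq_iff[OF a _ s bt(2), of b] Icarr by auto
  have "u \<otimes> (s \<otimes> b) \<in> P" using bt u s by (simp add: I_l_closed D_carrier)
  then have "u \<otimes> (t \<otimes> a) \<in> P" using u by simp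
  then show "a \<in> P" using I_prime[of u "t \<otimes> a"] I_prime[of t a] u(1) bt(2) a by auto
next
  assume "s \<in> D" "a \<in> P"
  then show "frac a s \<in> m" unfolding localized_max_ideal_def by blast
qed

lemma m_ideal: "ideal m A"
proof -
  interpret SM: module A "self_module A" by (rule module_self_module[OF A_cring])
  have mE: "\<exists>a s. a \<in> carrier R \<and> a \<in> P \<and> s \<in> D \<and> X = frac a s" if "X \<in> m" for X
    using that Icarr unfolding localized_max_ideal_def by blast
  have "submodule m A (self_module A)" unfolding SM.submodule_iff self_module_simps
  proof (intro conjI ballI subsetI)
    show "X \<in> carrier A" if "X \<in> m" for X using mE[OF that] frac_closed by blast
    show "\<zero>\<^bsub>A\<^esub> \<in> m" unfolding A_zero by (subst frac_in_m) (use D_one in auto)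
    fix X assume "X \<in> m"
    then obtain a s where X: "a \<in> carrier R" "a \<in> P" "s \<in> D" "X = frac a s" using mE by blast
    show "X \<oplus>\<^bsub>A\<^esub> Y \<in> m" if Ym: "Y \<in> m" for Y
    proof -
      obtain b t where Y: "b \<in> carrier R" "b \<in> P" "t \<in> D" "Y = frac b t" using mE[OF Ym] by blast
      show ?thesis unfolding X(4) Y(4) frac_add[OF X(1,3) Y(1,3)]
        by (subst frac_in_m) (use X Y D_mult in \<open>auto simp: I_l_closed\<close>)
    qed
    show "Y \<otimes>\<^bsub>A\<^esub> X \<in> m" if Yc: "Y \<in> carrier A" for Y
    proof -
      obtain b t where Y: "b \<in> carrier R" "t \<in> D" "Y = frac b t" using Yc by (rule A_cases)
      show ?thesis unfolding X(4) Y(3) frac_mult[OF Y(1,2) X(1,3)]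
        by (subst frac_in_m) (use X Y D_mult in \<open>auto simp: I_l_closed\<close>)
    qed
  qed
  then show ?thesis using submodule_self_iff_ideal[OF A_cring] by blast
qed

lemma A_local: assumes "X \<in> carrier A" "X \<notin> m" shows "X \<in> Units A"
proof -
  obtain a s where X: "a \<in> carrier R" "s \<in> D" "X = frac a s" using assms(1) by (rule A_cases)
  then have a: "a \<in> D" using assms(2) frac_in_m by auto
  have "X \<otimes>\<^bsub>A\<^esub> frac s a = frac (a \<otimes> s) (s \<otimes> a)" unfolding X(3) by (rule frac_mult) (use X a in auto)
  also have "\<dots> = \<one>\<^bsub>A\<^esub>" unfolding A_one
    by (rule frac_eqI[where u = \<one>]) (use X a D_one D_mult in \<open>auto simp: m_comm\<close>)
  finally have 1: "X \<otimes>\<^bsub>A\<^esub> frac s a = \<one>\<^bsub>A\<^esub>" .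
  have c: "frac s a \<in> carrier A" using X a frac_closed by auto
  then have "frac s a \<otimes>\<^bsub>A\<^esub> X = \<one>\<^bsub>A\<^esub>" using 1 A.m_comm assms(1) by metis
  then show ?thesis unfolding Units_def using assms(1) c 1 by blast
qed

lemma m_proper: "\<one>\<^bsub>A\<^esub> \<notin> m"
  unfolding A_one using frac_in_m[OF one_closed D_one] D_one by auto

text \<open>If a/s lies in J, then \<iota> a = \<iota> s (a/s) does too; so J is generated by the
  images of generators of its contraction to R.\<close>

lemma A_noetherian: assumes nR: "noetherian_ring R" shows "noetherian_ring A"
proof (rule ring.noetherian_ringI[OF A.ring_axioms])
  fix J assume J: "ideal J A"
  interpret J: ideal J A by fact
  have Rm: "module R (self_module R)" by (rule module_self_module[OF is_cring])
  let ?J0 = "{a \<in> carrier R. \<iota> a \<in> J}"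
  have "ideal ?J0 R" by (rule iota_vimage[OF J])
  then obtain G where G: "G \<subseteq> carrier R" "finite G" "?J0 = Idl G"
    using noetherian_ring.finetely_gen[OF nR] by blast
  have \<iota>G: "\<iota> ` G \<subseteq> carrier A" using G(1) by auto
  let ?L = "Idl\<^bsub>A\<^esub> (\<iota> ` G)"
  have L: "ideal ?L A" by (rule A.genideal_ideal[OF \<iota>G])
  interpret L: ideal ?L A by (rule L)
  have "G \<subseteq> J0" if "J0 = ?J0" for J0 using G(3) genideal_self[OF G(1)] that by simp
  then have "\<iota> ` G \<subseteq> J" by blast
  then have LJ: "?L \<subseteq> J" by (rule A.genideal_minimal[OF J])
  have "G \<subseteq> {a \<in> carrier R. \<iota> a \<in> ?L}" using G(1) A.genideal_self[OF \<iota>G] by blast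
  from genideal_minimal[OF iota_vimage[OF L] this] have J0L: "?J0 \<subseteq> {a \<in> carrier R. \<iota> a \<in> ?L}"
    unfolding G(3) .
  have "J \<subseteq> ?L"
  proof
    fix X assume X: "X \<in> J"
    then have "X \<in> carrier A" using J.a_subset by blast
    then obtain a s where a: "a \<in> carrier R" "s \<in> D" "X = frac a s" by (rule A_cases)
    have "\<iota> s \<otimes>\<^bsub>A\<^esub> X \<in> J" using X a(2) by (intro J.I_l_closed) (auto simp: D_carrier)
    then have "\<iota> a \<in> J" unfolding a(3) iota_frac[OF a(1,2)] .
    then have "\<iota> a \<in> ?L" using J0L a(1) by blast
    then have "frac \<one> s \<otimes>\<^bsub>A\<^esub> \<iota> a \<in> ?L" using a(2) by (intro L.I_l_closed) (auto intro: frac_closed)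
    then show "X \<in> ?L" unfolding a(3) frac_one[OF a(1,2)] .
  qed
  then have "J = ?L" using LJ by blast
  then show "\<exists>B\<subseteq>carrier A. finite B \<and> J = Idl\<^bsub>A\<^esub> B" using \<iota>G G(2) by blast
qed

lemma iota_pow: "a \<in> carrier R \<Longrightarrow> \<iota> (a [^] (n::nat)) = \<iota> a [^]\<^bsub>A\<^esub> n"
  by (induction n) auto

lemma A_char_p: assumes "char_p R p" shows "char_p A p"
proof -
  interpret R: char_p R p by fact
  have "[k] \<cdot>\<^bsub>A\<^esub> \<one>\<^bsub>A\<^esub> = \<iota> ([k] \<cdot> \<one>)" for k :: nat
    by (induction k) auto
  then have "[p] \<cdot>\<^bsub>A\<^esub> \<one>\<^bsub>A\<^esub> = \<zero>\<^bsub>A\<^esub>" using R.char_zero by simp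
  then show ?thesis using R.prime_p by (intro char_p.intro char_p_axioms.intro A_cring) auto
qed

text \<open>With p^e = k + 1 the fraction a/s is (1/s)^(p^e) times a s^k, so the images of
  generators of F^e_*R also reach the fractions with denominators.\<close>

lemma A_fg:
  assumes "char_p R p" and fg: "fg_module R (frobenius_pushforward p e R (self_module R))"
  shows "fg_module A (frobenius_pushforward p e A (self_module A))"
proof -
  interpret R: char_p R p by fact
  interpret A: char_p A p by (rule A_char_p) fact
  interpret FA: module A "A.Fr e" by (rule A.module_Fr)
  interpret FR: module R "R.Fr e" by (rule R.module_Fr)
  obtain G where G: "G \<subseteq> carrier R" "finite G" "\<And>N. submodule N R (R.Fr e) \<Longrightarrow> G \<subseteq> N \<Longrightarrow> N = carrier R"
    using fg unfolding fg_module_def by auto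
  obtain k where k: "p ^ e = Suc k" using R.prime_p prime_gt_0_nat gr0_conv_Suc zero_less_power by metis
  have "N = carrier (A.Fr e)" if N: "submodule N A (A.Fr e)" "\<iota> ` G \<subseteq> N" for N
  proof -
    have Ns: "N \<subseteq> carrier A" "\<zero>\<^bsub>A\<^esub> \<in> N" "\<And>x y. x \<in> N \<Longrightarrow> y \<in> N \<Longrightarrow> x \<oplus>\<^bsub>A\<^esub> y \<in> N"
      "\<And>a x. a \<in> carrier A \<Longrightarrow> x \<in> N \<Longrightarrow> a [^]\<^bsub>A\<^esub> (p ^ e) \<otimes>\<^bsub>A\<^esub> x \<in> N"
      using N(1) unfolding FA.submodule_iff by auto
    have "submodule {a \<in> carrier R. \<iota> a \<in> N} R (R.Fr e)"
      unfolding FR.submodule_iff using Ns(2,3) Ns(4)[of "\<iota> _"] by (auto simp: iota_pow)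
    then have all: "{a \<in> carrier R. \<iota> a \<in> N} = carrier R" using G(1) N(2) by (intro G(3)) auto
    have "X \<in> N" if Xc: "X \<in> carrier A" for X
    proof -
      obtain a s where a: "a \<in> carrier R" "s \<in> D" "X = frac a s" using Xc by (rule A_cases)
      note Rs = D_carrier[OF a(2)]
      have fc: "frac \<one> s \<in> carrier A" by (rule frac_closed) (use a in auto)
      have "frac \<one> s \<otimes>\<^bsub>A\<^esub> \<iota> s = \<one>\<^bsub>A\<^esub>"
      proof -
        have "frac \<one> s \<otimes>\<^bsub>A\<^esub> \<iota> s = frac s s" by (rule frac_one[OF Rs a(2)])
        also have "\<dots> = \<iota> \<one>" using frac_cancel[OF one_closed D_one a(2)] Rs by simp
        finally show ?thesis by simp
      qed
      then have one: "(frac \<one> s \<otimes>\<^bsub>A\<^esub> \<iota> s) [^]\<^bsub>A\<^esub> k = \<one>\<^bsub>A\<^esub>" by simp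
      have "\<iota> (a \<otimes> s [^] k) \<in> N" using all a(1) Rs by blast
      then have "frac \<one> s [^]\<^bsub>A\<^esub> (p ^ e) \<otimes>\<^bsub>A\<^esub> \<iota> (a \<otimes> s [^] k) \<in> N" using Ns(4) fc by blast
      moreover have "frac \<one> s [^]\<^bsub>A\<^esub> (p ^ e) \<otimes>\<^bsub>A\<^esub> \<iota> (a \<otimes> s [^] k) = frac \<one> s \<otimes>\<^bsub>A\<^esub> \<iota> a \<otimes>\<^bsub>A\<^esub> (frac \<one> s \<otimes>\<^bsub>A\<^esub> \<iota> s) [^]\<^bsub>A\<^esub> k"
        unfolding k using a(1) Rs fc by (simp add: iota_pow A.nat_pow_distrib A.m_ac)
      ultimately show ?thesis unfolding one using frac_one[OF a(1,2)] frac_closed[OF a(1,2)] a(3) by simp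
    qed
    then show ?thesis using Ns(1) by auto
  qed
  moreover have "\<iota> ` G \<subseteq> carrier (A.Fr e)" "finite (\<iota> ` G)" using G(1,2) by auto
  ultimately show ?thesis unfolding fg_module_def by blast
qed

end

section \<open>Splittings near a prime\<close>

lemma (in prime_localization) local_completion_A:
  assumes "char_p R p" "noetherian_ring R" "fg_module R (frobenius_pushforward p 1 R (self_module R))"
  shows "local_completion A m (completed_local_ring R P) (\<lambda>a n. ideal_pow A m n +>\<^bsub>A\<^esub> a)
    (\<lambda>n. {x \<in> carrier (completed_local_ring R P). x n = ideal_pow A m n}) p"
  unfolding completed_local_ring_def
  by (intro local_completion.intro local_completion_axioms.intro A.completion_adic m_ideal A_char_p[OF assms(1)]
      A_local m_proper A_noetherian[OF assms(2)] A_fg[OF assms(1,3)])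

text \<open>The individual elements are multiplied together. Persistence of Q is required for both
  orders of the product, as R carries no commutativity here.\<close>

lemma finite_common_multiplier:
  assumes "finite X" and one: "\<one>\<^bsub>R\<^esub> \<in> D" and mult: "\<And>s t. s \<in> D \<Longrightarrow> t \<in> D \<Longrightarrow> s \<otimes>\<^bsub>R\<^esub> t \<in> D"
    and ex: "\<And>x. x \<in> X \<Longrightarrow> \<exists>t\<in>D. Q x t"
    and up: "\<And>x s t. x \<in> X \<Longrightarrow> s \<in> D \<Longrightarrow> t \<in> D \<Longrightarrow> Q x t \<Longrightarrow> Q x (s \<otimes>\<^bsub>R\<^esub> t) \<and> Q x (t \<otimes>\<^bsub>R\<^esub> s)"
  shows "\<exists>t\<in>D. \<forall>x\<in>X. Q x t"
  using assms(1) ex up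
proof (induction X)
  case empty then show ?case using one by blast
next
  case (insert y X)
  have "\<exists>t\<in>D. \<forall>x\<in>X. Q x t" by (rule insert.IH) (use insert.prems in auto)
  then obtain t where t: "t \<in> D" "\<And>x. x \<in> X \<Longrightarrow> Q x t" by blast
  obtain s where s: "s \<in> D" "Q y s" using insert.prems(1) by blast
  have "Q x (s \<otimes>\<^bsub>R\<^esub> t)" if "x \<in> insert y X" for x
    using insert.prems(2)[of x] t s that by auto
  then show ?case using mult[OF s(1) t(1)] by blast
qed

section \<open>Lifting homomorphisms from the localization to R\<close>

context prime_localization
begin

text \<open>The kernel of R -> R_P is finitely generated, and each of its elements is killed by an
  element outside P.\<close>

lemma ex_kernel_multiplier:
  assumes "noetherian_ring R"
  shows "\<exists>t\<in>D. \<forall>a\<in>carrier R. \<iota> a = \<zero>\<^bsub>A\<^esub> \<longrightarrow> t \<otimes> a = \<zero>"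
proof -
  have Rm: "module R (self_module R)" by (rule module_self_module[OF is_cring])
  interpret SM: module R "self_module R" by (rule Rm)
  have "ideal {a \<in> carrier R. \<iota> a \<in> {\<zero>\<^bsub>A\<^esub>}} R" by (rule iota_vimage[OF A.zeroideal])
  then have U: "submodule {a \<in> carrier R. \<iota> a \<in> {\<zero>\<^bsub>A\<^esub>}} R (self_module R)" using submodule_self_iff_ideal[OF is_cring] by blast
  have W: "submodule {\<zero>} R (self_module R)" unfolding SM.submodule_iff by auto
  have ex: "\<exists>t\<in>D. t \<odot>\<^bsub>self_module R\<^esub> u \<in> {\<zero>}" if "u \<in> {a \<in> carrier R. \<iota> a \<in> {\<zero>\<^bsub>A\<^esub>}}" for u
    using that iota_zero_iff[of u] by auto
  show ?thesis
  proof (rule noeth_uniform_multiplier[OF noeth_self_module[OF is_cring assms] U W primeideal_axioms ex])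
    fix t assume "t \<in> D" "\<And>u. u \<in> {a \<in> carrier R. \<iota> a \<in> {\<zero>\<^bsub>A\<^esub>}} \<Longrightarrow> t \<odot>\<^bsub>self_module R\<^esub> u \<in> {\<zero>}"
    then show ?thesis by auto
  qed
qed

text \<open>t is a common denominator for the values of h on the image of R.\<close>

definition clears :: "(('a \<times> 'a) set \<Rightarrow> ('a \<times> 'a) set) \<Rightarrow> 'a \<Rightarrow> bool" where
  "clears h t \<longleftrightarrow> (\<forall>u\<in>carrier R. \<iota> t \<otimes>\<^bsub>A\<^esub> h (\<iota> u) \<in> \<iota> ` carrier R)"

lemma clears_mult:
  assumes h: "\<And>u. u \<in> carrier R \<Longrightarrow> h (\<iota> u) \<in> carrier A" and "s \<in> carrier R" "t \<in> carrier R" "clears h t"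
  shows "clears h (s \<otimes> t)" "clears h (t \<otimes> s)"
proof -
  have "\<iota> (s \<otimes> t) \<otimes>\<^bsub>A\<^esub> h (\<iota> u) \<in> \<iota> ` carrier R" if u: "u \<in> carrier R" for u
  proof -
    obtain x where x: "x \<in> carrier R" "\<iota> t \<otimes>\<^bsub>A\<^esub> h (\<iota> u) = \<iota> x" using assms(4) u unfolding clears_def by blast
    have "\<iota> (s \<otimes> t) \<otimes>\<^bsub>A\<^esub> h (\<iota> u) = \<iota> s \<otimes>\<^bsub>A\<^esub> (\<iota> t \<otimes>\<^bsub>A\<^esub> h (\<iota> u))"
      using assms(2,3) h[OF u] by (simp add: A.m_assoc)
    also have "\<dots> = \<iota> (s \<otimes> x)" using x assms(2) by simp
    finally show ?thesis using x assms(2) by blast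
  qed
  then show "clears h (s \<otimes> t)" unfolding clears_def by blast
  then show "clears h (t \<otimes> s)" using m_comm[OF assms(2,3)] by simp
qed

text \<open>A common denominator t for the images of finitely many generators of F^e_*R works
  everywhere, because the u whose image is cleared by t form a submodule: scalars from R pass
  through h as powers of elements of \<iota> R.\<close>

lemma ex_clears:
  assumes "char_p R p" and fg: "fg_module R (frobenius_pushforward p e R (self_module R))"
    and h: "h \<in> module_hom A (frobenius_pushforward p e A (self_module A)) (frobenius_pushforward p e' A (self_module A))"
  shows "\<exists>t\<in>D. clears h t"
proof -
  interpret R: char_p R p by fact
  interpret A: char_p A p by (rule A_char_p) fact
  interpret FR: module R "R.Fr e" by (rule R.module_Fr)
  obtain G where G: "G \<subseteq> carrier R" "finite G" "\<And>N. submodule N R (R.Fr e) \<Longrightarrow> G \<subseteq> N \<Longrightarrow> N = carrier R"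
    using fg unfolding fg_module_def by auto
  have hc: "h (\<iota> u) \<in> carrier A" if "u \<in> carrier R" for u
    using module_hom_closed[OF h, of "\<iota> u"] that by simp
  let ?Q = "\<lambda>u t. \<iota> t \<otimes>\<^bsub>A\<^esub> h (\<iota> u) \<in> \<iota> ` carrier R"
  have "\<exists>t\<in>D. \<forall>u\<in>G. ?Q u t"
  proof (rule finite_common_multiplier[OF G(2) D_one D_mult])
    fix u assume "u \<in> G"
    then have u: "u \<in> carrier R" using G(1) by auto
    obtain b t where "b \<in> carrier R" "t \<in> D" "h (\<iota> u) = frac b t" using hc[OF u] by (rule A_cases)
    then have "\<iota> t \<otimes>\<^bsub>A\<^esub> h (\<iota> u) = \<iota> b" using iota_frac by simp
    then show "\<exists>t\<in>D. ?Q u t" using \<open>b \<in> carrier R\<close> \<open>t \<in> D\<close> by blast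
    fix s t assume st: "s \<in> D" "t \<in> D" and "?Q u t"
    then obtain x where x: "x \<in> carrier R" "\<iota> t \<otimes>\<^bsub>A\<^esub> h (\<iota> u) = \<iota> x" by blast
    have e: "\<iota> (s \<otimes> t) \<otimes>\<^bsub>A\<^esub> h (\<iota> u) = \<iota> (s \<otimes> x)"
    proof -
      have "\<iota> (s \<otimes> t) \<otimes>\<^bsub>A\<^esub> h (\<iota> u) = \<iota> s \<otimes>\<^bsub>A\<^esub> (\<iota> t \<otimes>\<^bsub>A\<^esub> h (\<iota> u))"
        using st hc[OF u] by (simp add: A.m_assoc)
      then show ?thesis using x st by simp
    qed
    have "?Q u (s \<otimes> t)" unfolding e by (rule imageI) (use x st in simp)
    moreover have "t \<otimes> s = s \<otimes> t" using st by (intro m_comm) auto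
    ultimately show "?Q u (s \<otimes> t) \<and> ?Q u (t \<otimes> s)" by metis
  qed
  then obtain t where t: "t \<in> D" "\<And>u. u \<in> G \<Longrightarrow> ?Q u t" by blast
  have tR: "t \<in> carrier R" using t by blast
  have "submodule {u \<in> carrier R. ?Q u t} R (R.Fr e)" unfolding FR.submodule_iff
  proof (intro conjI ballI)
    have "h \<zero>\<^bsub>A\<^esub> = \<zero>\<^bsub>A\<^esub>" using module_hom_zero[OF A.module_Fr A.module_Fr h] by simp
    then have e: "\<iota> t \<otimes>\<^bsub>A\<^esub> h (\<iota> \<zero>) = \<iota> \<zero>" using tR by simp
    have "?Q \<zero> t" unfolding e by (rule imageI) simp
    then show "\<zero>\<^bsub>R.Fr e\<^esub> \<in> {u \<in> carrier R. ?Q u t}" unfolding R.Fr_simps by blast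
  next
    fix u v assume uv: "u \<in> {u \<in> carrier R. ?Q u t}" "v \<in> {u \<in> carrier R. ?Q u t}"
    then obtain x y where x: "x \<in> carrier R" "\<iota> t \<otimes>\<^bsub>A\<^esub> h (\<iota> u) = \<iota> x" and y: "y \<in> carrier R" "\<iota> t \<otimes>\<^bsub>A\<^esub> h (\<iota> v) = \<iota> y" by blast
    have "h (\<iota> u \<oplus>\<^bsub>A\<^esub> \<iota> v) = h (\<iota> u) \<oplus>\<^bsub>A\<^esub> h (\<iota> v)"
      using module_hom_add[OF h, of "\<iota> u" "\<iota> v"] uv by simp
    then have e: "\<iota> t \<otimes>\<^bsub>A\<^esub> h (\<iota> (u \<oplus> v)) = \<iota> (x \<oplus> y)"
      using uv tR hc x y by (simp add: A.r_distr)
    have "?Q (u \<oplus> v) t" unfolding e by (rule imageI) (use x y in simp)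
    moreover have "u \<oplus> v \<in> carrier R" using uv by simp
    ultimately show "u \<oplus>\<^bsub>R.Fr e\<^esub> v \<in> {u \<in> carrier R. ?Q u t}" unfolding R.Fr_simps by blast
  next
    fix a u assume a: "a \<in> carrier R" and u: "u \<in> {u \<in> carrier R. ?Q u t}"
    then obtain x where x: "x \<in> carrier R" "\<iota> t \<otimes>\<^bsub>A\<^esub> h (\<iota> u) = \<iota> x" by blast
    have "h (\<iota> a [^]\<^bsub>A\<^esub> (p ^ e) \<otimes>\<^bsub>A\<^esub> \<iota> u) = \<iota> a [^]\<^bsub>A\<^esub> (p ^ e') \<otimes>\<^bsub>A\<^esub> h (\<iota> u)"
      using module_hom_smult[OF h, of "\<iota> a" "\<iota> u"] a u by simp
    then have e: "\<iota> t \<otimes>\<^bsub>A\<^esub> h (\<iota> (a [^] (p ^ e) \<otimes> u)) = \<iota> a [^]\<^bsub>A\<^esub> (p ^ e') \<otimes>\<^bsub>A\<^esub> (\<iota> t \<otimes>\<^bsub>A\<^esub> h (\<iota> u))"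
      using a u tR hc by (simp add: iota_pow A.m_lcomm)
    have e2: "\<iota> a [^]\<^bsub>A\<^esub> (p ^ e') \<otimes>\<^bsub>A\<^esub> (\<iota> t \<otimes>\<^bsub>A\<^esub> h (\<iota> u)) = \<iota> (a [^] (p ^ e') \<otimes> x)" using a x by (simp add: iota_pow)
    have "?Q (a [^] (p ^ e) \<otimes> u) t" unfolding e e2 by (rule imageI) (use a x in simp)
    moreover have "a [^] (p ^ e) \<otimes> u \<in> carrier R" using a u by simp
    ultimately show "a \<odot>\<^bsub>R.Fr e\<^esub> u \<in> {u \<in> carrier R. ?Q u t}" unfolding R.Fr_simps by blast
  qed auto
  then have "{u \<in> carrier R. ?Q u t} = carrier R" by (rule G(3)) (use G(1) t in auto)
  then have "clears h t" unfolding clears_def by blast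
  then show ?thesis using t by blast
qed

text \<open>After multiplication by \<open>w\<close>, which clears denominators and kills the kernel of
  \<open>R \<rightarrow> R\<^sub>P\<close>, a homomorphism over \<open>R\<^sub>P\<close> comes from one over \<open>R\<close>.\<close>

lemma lift_hom:
  assumes "char_p R p"
    and h: "h \<in> module_hom A (frobenius_pushforward p e A (self_module A)) (frobenius_pushforward p e' A (self_module A))"
    and t0: "t0 \<in> D" "\<And>a. a \<in> carrier R \<Longrightarrow> \<iota> a = \<zero>\<^bsub>A\<^esub> \<Longrightarrow> t0 \<otimes> a = \<zero>" and t: "t \<in> D" "clears h t"
  shows "\<exists>h'. twisted_linear R (p ^ e) (p ^ e') h' \<and> (\<forall>u\<in>carrier R. \<iota> (h' u) = \<iota> (t0 \<otimes> t) [^]\<^bsub>A\<^esub> (p ^ e') \<otimes>\<^bsub>A\<^esub> h (\<iota> u))"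
proof -
  interpret R: char_p R p by fact
  interpret A: char_p A p by (rule A_char_p) fact
  obtain k where k: "p ^ e' = Suc k" using R.prime_p prime_gt_0_nat gr0_conv_Suc zero_less_power by metis
  define x where "x = (\<lambda>u. SOME y. y \<in> carrier R \<and> \<iota> t \<otimes>\<^bsub>A\<^esub> h (\<iota> u) = \<iota> y)"
  have x: "x u \<in> carrier R" "\<iota> (x u) = \<iota> t \<otimes>\<^bsub>A\<^esub> h (\<iota> u)" if "u \<in> carrier R" for u
  proof -
    have "\<exists>y. y \<in> carrier R \<and> \<iota> t \<otimes>\<^bsub>A\<^esub> h (\<iota> u) = \<iota> y" using t(2) that unfolding clears_def by blast
    from someI_ex[OF this] show "x u \<in> carrier R" "\<iota> (x u) = \<iota> t \<otimes>\<^bsub>A\<^esub> h (\<iota> u)" unfolding x_def by auto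
  qed
  have eqI: "t0 \<otimes> a = t0 \<otimes> b" if "a \<in> carrier R" "b \<in> carrier R" "\<iota> a = \<iota> b" for a b
  proof -
    have "\<iota> (a \<ominus> b) = \<zero>\<^bsub>A\<^esub>" using that by (simp add: a_minus_def A.r_neg)
    then have "t0 \<otimes> (a \<ominus> b) = \<zero>" using t0(2) that by simp
    then have "t0 \<otimes> a \<ominus> t0 \<otimes> b = \<zero>" using that t0(1) by (simp add: a_minus_def r_distr r_minus)
    then show ?thesis using that t0(1) by (simp add: minus_eq_zero_iff)
  qed
  have hc: "h (\<iota> u) \<in> carrier A" if "u \<in> carrier R" for u
    using module_hom_closed[OF h, of "\<iota> u"] that by simp
  have tR: "t0 \<in> carrier R" "t \<in> carrier R" using t0 t by auto
  define w where "w = t0 \<otimes> t"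
  have wR: "w \<in> carrier R" unfolding w_def using tR by simp
  \<comment> \<open>The image of x u in R_P is t times the value of h at u, which fixes x u up to
    the kernel that t0 kills. The padding w^k completes t0 t to w^(p^e'), the action of w on
    F^e'_*R, so that it can later be moved through further maps.\<close>
  let ?h = "\<lambda>u. w [^] k \<otimes> (t0 \<otimes> x u)"
  have "twisted_linear R (p ^ e) (p ^ e') ?h"
    unfolding twisted_linear_def
  proof (intro conjI ballI)
    show "?h \<in> carrier R \<rightarrow> carrier R" using x(1) tR wR by simp
    fix u v assume uv: "u \<in> carrier R" "v \<in> carrier R"
    have "h (\<iota> u \<oplus>\<^bsub>A\<^esub> \<iota> v) = h (\<iota> u) \<oplus>\<^bsub>A\<^esub> h (\<iota> v)"
      using module_hom_add[OF h, of "\<iota> u" "\<iota> v"] uv by simp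
    then have "t0 \<otimes> x (u \<oplus> v) = t0 \<otimes> (x u \<oplus> x v)"
      using uv x hc tR by (intro eqI) (auto simp: A.r_distr)
    then show "?h (u \<oplus> v) = ?h u \<oplus> ?h v" using uv x(1) tR wR by (simp add: r_distr)
  next
    fix a u assume a: "a \<in> carrier R" and u: "u \<in> carrier R"
    have "h (\<iota> a [^]\<^bsub>A\<^esub> (p ^ e) \<otimes>\<^bsub>A\<^esub> \<iota> u) = \<iota> a [^]\<^bsub>A\<^esub> (p ^ e') \<otimes>\<^bsub>A\<^esub> h (\<iota> u)"
      using module_hom_smult[OF h, of "\<iota> a" "\<iota> u"] a u by simp
    then have "t0 \<otimes> x (a [^] (p ^ e) \<otimes> u) = t0 \<otimes> (a [^] (p ^ e') \<otimes> x u)"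
      using a u x hc tR by (intro eqI) (auto simp: iota_pow A.m_lcomm)
    then show "?h (a [^] (p ^ e) \<otimes> u) = a [^] (p ^ e') \<otimes> ?h u" using a u x(1) tR wR by (simp add: m_ac)
  qed
  moreover have "\<iota> (?h u) = \<iota> w [^]\<^bsub>A\<^esub> (p ^ e') \<otimes>\<^bsub>A\<^esub> h (\<iota> u)" if u: "u \<in> carrier R" for u
  proof -
    have "\<iota> (?h u) = \<iota> w [^]\<^bsub>A\<^esub> k \<otimes>\<^bsub>A\<^esub> (\<iota> t0 \<otimes>\<^bsub>A\<^esub> (\<iota> t \<otimes>\<^bsub>A\<^esub> h (\<iota> u)))"
      using x[OF u] tR wR by (simp add: iota_pow)
    also have "\<dots> = \<iota> w [^]\<^bsub>A\<^esub> k \<otimes>\<^bsub>A\<^esub> \<iota> w \<otimes>\<^bsub>A\<^esub> h (\<iota> u)"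
      using hc[OF u] tR unfolding w_def by (simp add: A.m_assoc)
    finally show ?thesis unfolding k by simp
  qed
  ultimately show ?thesis unfolding w_def by blast
qed

text \<open>The splitting over R_P is multiplied by elements outside P until its maps are defined
  over R and its identity holds there. The multiplier is kept in the form s^(p^(e0+1)), that is, as
  s acting on F^(e0+1)_*R.\<close>

lemma R_splitting:
  assumes "char_p R p" "noetherian_ring R" "fg_module R (frobenius_pushforward p 1 R (self_module R))"
    and "FFRT p (completed_local_ring R P)"
  shows "\<exists>(e0::nat) (n::nat) \<epsilon> \<psi> \<phi> s. s \<in> D \<and> (\<forall>k<n. \<epsilon> k \<le> e0 \<and> twisted_linear R (p ^ Suc e0) (p ^ \<epsilon> k) (\<psi> k) \<and>
     twisted_linear R (p ^ \<epsilon> k) (p ^ Suc e0) (\<phi> k)) \<and>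
     (\<forall>x\<in>carrier R. (\<Oplus>k\<in>{..<n}. \<phi> k (\<psi> k x)) = s [^] (p ^ Suc e0) \<otimes> x)"
proof -
  interpret R: char_p R p by fact
  interpret A: char_p A p by (rule A_char_p) fact
  note lc = local_completion_A[OF assms(1-3)]
  obtain e0 n :: nat and \<epsilon> \<psi> \<phi> where hyp: "(\<forall>k<n. \<epsilon> k \<le> e0 \<and> \<psi> k \<in> module_hom A (A.Fr (Suc e0)) (A.Fr (\<epsilon> k)) \<and>
     \<phi> k \<in> module_hom A (A.Fr (\<epsilon> k)) (A.Fr (Suc e0))) \<and>
     (\<forall>x\<in>carrier A. x = (\<Oplus>\<^bsub>A\<^esub>k\<in>{..<n}. \<phi> k (\<psi> k x)))"
    using local_completion.A_splitting[OF lc assms(4)] by (elim exE)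
  then have \<epsilon>: "\<epsilon> k \<le> e0" and \<psi>: "\<psi> k \<in> module_hom A (A.Fr (Suc e0)) (A.Fr (\<epsilon> k))"
    and \<phi>: "\<phi> k \<in> module_hom A (A.Fr (\<epsilon> k)) (A.Fr (Suc e0))" if "k < n" for k using that by blast+
  have id: "x = (\<Oplus>\<^bsub>A\<^esub>k\<in>{..<n}. \<phi> k (\<psi> k x))" if "x \<in> carrier A" for x using hyp that by blast
  let ?E = "Suc e0"
  note fg = R.fg_Fr[OF assms(3)]
  have \<psi>c: "\<psi> k x \<in> carrier A" and \<phi>c: "\<phi> k x \<in> carrier A" if "k < n" "x \<in> carrier A" for k x
    using module_hom_closed[OF \<psi>[OF that(1)], of x] module_hom_closed[OF \<phi>[OF that(1)], of x] that by auto
  obtain t0 where t0: "t0 \<in> D" "\<And>a. a \<in> carrier R \<Longrightarrow> \<iota> a = \<zero>\<^bsub>A\<^esub> \<Longrightarrow> t0 \<otimes> a = \<zero>"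
    using ex_kernel_multiplier[OF assms(2)] by blast
  have "\<exists>t\<in>D. \<forall>k\<in>{..<n}. clears (\<psi> k) t \<and> clears (\<phi> k) t"
  proof (rule finite_common_multiplier[OF finite_lessThan D_one D_mult])
    fix k assume "k \<in> {..<n}"
    then have k: "k < n" by simp
    obtain t1 t2 where t12: "t1 \<in> D" "clears (\<psi> k) t1" "t2 \<in> D" "clears (\<phi> k) t2"
      using ex_clears[OF assms(1) fg \<psi>[OF k]] ex_clears[OF assms(1) fg \<phi>[OF k]] by blast
    have "clears (\<psi> k) (t1 \<otimes> t2)" "clears (\<phi> k) (t1 \<otimes> t2)"
      using clears_mult(2)[OF _ _ _ t12(2), of t2] clears_mult(1)[OF _ _ _ t12(4), of t1] t12(1,3) \<psi>c[OF k] \<phi>c[OF k] by auto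
    then show "\<exists>t\<in>D. clears (\<psi> k) t \<and> clears (\<phi> k) t" using D_mult t12 by blast
    fix s t assume st: "s \<in> D" "t \<in> D" "clears (\<psi> k) t \<and> clears (\<phi> k) t"
    show "(clears (\<psi> k) (s \<otimes> t) \<and> clears (\<phi> k) (s \<otimes> t)) \<and> (clears (\<psi> k) (t \<otimes> s) \<and> clears (\<phi> k) (t \<otimes> s))"
      using clears_mult[of "\<psi> k" s t] clears_mult[of "\<phi> k" s t] st \<psi>c[OF k] \<phi>c[OF k] by auto
  qed
  then obtain t where t: "t \<in> D" "\<And>k. k < n \<Longrightarrow> clears (\<psi> k) t" "\<And>k. k < n \<Longrightarrow> clears (\<phi> k) t" by blast
  define w where "w = t0 \<otimes> t"
  have wD: "w \<in> D" unfolding w_def using D_mult t0 t by blast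
  then have wR: "w \<in> carrier R" by blast
  have "\<forall>k. \<exists>h'. k < n \<longrightarrow> twisted_linear R (p ^ ?E) (p ^ \<epsilon> k) h' \<and> (\<forall>u\<in>carrier R. \<iota> (h' u) = \<iota> w [^]\<^bsub>A\<^esub> (p ^ \<epsilon> k) \<otimes>\<^bsub>A\<^esub> \<psi> k (\<iota> u))"
    unfolding w_def using lift_hom[OF assms(1) \<psi> t0 t(1,2)] by blast
  from choice[OF this] obtain \<psi>' where \<psi>': "\<forall>k. k < n \<longrightarrow> twisted_linear R (p ^ ?E) (p ^ \<epsilon> k) (\<psi>' k) \<and>
    (\<forall>u\<in>carrier R. \<iota> (\<psi>' k u) = \<iota> w [^]\<^bsub>A\<^esub> (p ^ \<epsilon> k) \<otimes>\<^bsub>A\<^esub> \<psi> k (\<iota> u))" ..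
  have "\<forall>k. \<exists>h'. k < n \<longrightarrow> twisted_linear R (p ^ \<epsilon> k) (p ^ ?E) h' \<and> (\<forall>u\<in>carrier R. \<iota> (h' u) = \<iota> w [^]\<^bsub>A\<^esub> (p ^ ?E) \<otimes>\<^bsub>A\<^esub> \<phi> k (\<iota> u))"
    unfolding w_def using lift_hom[OF assms(1) \<phi> t0 t(1,3)] by blast
  from choice[OF this] obtain \<phi>' where \<phi>': "\<forall>k. k < n \<longrightarrow> twisted_linear R (p ^ \<epsilon> k) (p ^ ?E) (\<phi>' k) \<and>
    (\<forall>u\<in>carrier R. \<iota> (\<phi>' k u) = \<iota> w [^]\<^bsub>A\<^esub> (p ^ ?E) \<otimes>\<^bsub>A\<^esub> \<phi> k (\<iota> u))" ..
  let ?W = "w [^] (p ^ ?E)"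
  have WR: "?W \<in> carrier R" using wR by simp
  have \<psi>'c: "\<psi>' k u \<in> carrier R" and \<phi>'c: "\<phi>' k u \<in> carrier R" if "k < n" "u \<in> carrier R" for k u
    using that \<psi>' \<phi>' unfolding twisted_linear_def by blast+
  have comp: "\<iota> (\<phi>' k (\<psi>' k u)) = \<iota> (?W \<otimes> ?W) \<otimes>\<^bsub>A\<^esub> \<phi> k (\<psi> k (\<iota> u))" if k: "k < n" and u: "u \<in> carrier R" for k u
  proof -
    have \<iota>u: "\<iota> u \<in> carrier A" using u by simp
    have "\<iota> (\<phi>' k (\<psi>' k u)) = \<iota> w [^]\<^bsub>A\<^esub> (p ^ ?E) \<otimes>\<^bsub>A\<^esub> \<phi> k (\<iota> (\<psi>' k u))" using \<phi>' k \<psi>'c[OF k u] by blast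
    also have "\<iota> (\<psi>' k u) = \<iota> w [^]\<^bsub>A\<^esub> (p ^ \<epsilon> k) \<otimes>\<^bsub>A\<^esub> \<psi> k (\<iota> u)" using \<psi>' k u by blast
    also have "\<phi> k (\<iota> w [^]\<^bsub>A\<^esub> (p ^ \<epsilon> k) \<otimes>\<^bsub>A\<^esub> \<psi> k (\<iota> u)) = \<iota> w [^]\<^bsub>A\<^esub> (p ^ ?E) \<otimes>\<^bsub>A\<^esub> \<phi> k (\<psi> k (\<iota> u))"
      using module_hom_smult[OF \<phi>[OF k], of "\<iota> w" "\<psi> k (\<iota> u)"] wR \<psi>c[OF k \<iota>u] by simp
    finally show ?thesis using wR \<phi>c[OF k \<psi>c[OF k \<iota>u]] by (simp add: iota_pow A.m_assoc)
  qed
  \<comment> \<open>The identity holds in R_P, hence in R up to the kernel; the additional factor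
    \<open>?W\<close> is a multiple of t0 and kills the difference.\<close>
  have total: "?W \<otimes> (\<Oplus>k\<in>{..<n}. \<phi>' k (\<psi>' k u)) = ?W \<otimes> (?W \<otimes> ?W \<otimes> u)" if u: "u \<in> carrier R" for u
  proof -
    let ?T = "\<Oplus>k\<in>{..<n}. \<phi>' k (\<psi>' k u)"
    have T: "?T \<in> carrier R" by (rule finsum_closed) (use \<psi>'c \<phi>'c u in auto)
    have \<iota>u: "\<iota> u \<in> carrier A" using u by simp
    have cc: "\<phi> k (\<psi> k (\<iota> u)) \<in> carrier A" if "k < n" for k using \<phi>c[OF that \<psi>c[OF that \<iota>u]] .
    have "\<iota> ?T = (\<Oplus>\<^bsub>A\<^esub>k\<in>{..<n}. \<iota> (\<phi>' k (\<psi>' k u)))"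
      by (subst iota.hom_finsum) (use \<psi>'c \<phi>'c u in \<open>auto simp: o_def\<close>)
    also have "\<dots> = (\<Oplus>\<^bsub>A\<^esub>k\<in>{..<n}. \<iota> (?W \<otimes> ?W) \<otimes>\<^bsub>A\<^esub> \<phi> k (\<psi> k (\<iota> u)))"
      by (rule A.finsum_cong') (use comp u cc WR in auto)
    also have "\<dots> = \<iota> (?W \<otimes> ?W) \<otimes>\<^bsub>A\<^esub> (\<Oplus>\<^bsub>A\<^esub>k\<in>{..<n}. \<phi> k (\<psi> k (\<iota> u)))"
      by (rule A.finsum_rdistr[symmetric]) (use cc WR in auto)
    also have "(\<Oplus>\<^bsub>A\<^esub>k\<in>{..<n}. \<phi> k (\<psi> k (\<iota> u))) = \<iota> u" using id[OF \<iota>u] by simp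
    finally have "\<iota> (?T \<ominus> ?W \<otimes> ?W \<otimes> u) = \<zero>\<^bsub>A\<^esub>" using T WR u by (simp add: a_minus_def A.r_neg)
    then have z: "t0 \<otimes> (?T \<ominus> ?W \<otimes> ?W \<otimes> u) = \<zero>" using t0(2) T WR u by simp
    obtain k where k: "p ^ ?E = Suc k" using R.prime_p prime_gt_0_nat gr0_conv_Suc zero_less_power by metis
    have tR: "t0 \<in> carrier R" "t \<in> carrier R" using t0 t by auto
    have "?W = w [^] k \<otimes> t \<otimes> t0" unfolding k using tR unfolding w_def by (simp add: m_ac)
    then have "?W \<otimes> (?T \<ominus> ?W \<otimes> ?W \<otimes> u) = w [^] k \<otimes> t \<otimes> (t0 \<otimes> (?T \<ominus> ?W \<otimes> ?W \<otimes> u))"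
      using tR wR T WR u m_assoc[of "w [^] k \<otimes> t" t0 "?T \<ominus> ?W \<otimes> ?W \<otimes> u"] by simp
    then have "?W \<otimes> (?T \<ominus> ?W \<otimes> ?W \<otimes> u) = \<zero>" unfolding z using tR wR by simp
    then have "?W \<otimes> ?T \<ominus> ?W \<otimes> (?W \<otimes> ?W \<otimes> u) = \<zero>" using T WR u by (simp add: a_minus_def r_distr r_minus)
    then show ?thesis using T WR u by (simp add: minus_eq_zero_iff)
  qed
  \<comment> \<open>One factor w each comes from lifting \<psi> and \<phi>, the third from killing
    the kernel.\<close>
  let ?s = "w \<otimes> w \<otimes> w" and ?f = "\<lambda>k x. ?W \<otimes> \<phi>' k x"
  have sD: "?s \<in> D" using D_mult wD by blast
  have tw: "twisted_linear R (p ^ \<epsilon> k) (p ^ ?E) (?f k)" if "k < n" for k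
  proof -
    have "twisted_linear R (p ^ \<epsilon> k) (p ^ ?E) (\<phi>' k)" using \<phi>' that by blast
    then show ?thesis unfolding twisted_linear_def using WR by (auto simp: Pi_def r_distr m_lcomm)
  qed
  have fin: "(\<Oplus>k\<in>{..<n}. ?f k (\<psi>' k x)) = ?s [^] (p ^ ?E) \<otimes> x" if x: "x \<in> carrier R" for x
  proof -
    have "(\<Oplus>k\<in>{..<n}. ?f k (\<psi>' k x)) = ?W \<otimes> (\<Oplus>k\<in>{..<n}. \<phi>' k (\<psi>' k x))"
      by (rule finsum_rdistr[symmetric]) (use \<psi>'c \<phi>'c x WR in auto)
    also have "\<dots> = ?W \<otimes> (?W \<otimes> ?W \<otimes> x)" by (rule total[OF x])
    also have "\<dots> = ?s [^] (p ^ ?E) \<otimes> x" using wR x by (simp add: nat_pow_distrib m_ac)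
    finally show ?thesis .
  qed
  have f1: "\<forall>k<n. \<epsilon> k \<le> e0 \<and> twisted_linear R (p ^ ?E) (p ^ \<epsilon> k) (\<psi>' k) \<and> twisted_linear R (p ^ \<epsilon> k) (p ^ ?E) (?f k)"
    using \<epsilon> \<psi>' tw by blast
  show ?thesis
    by (rule exI[of _ e0], rule exI[of _ n], rule exI[of _ \<epsilon>], rule exI[of _ \<psi>'],
        rule exI[of _ ?f], rule exI[of _ ?s], rule conjI[OF sD], rule conjI[OF f1]) (use fin in blast)
qed

end

section \<open>Koszul complexes\<close>

text \<open>
  A cochain on $x_1,\dots,x_n$ is a function on words of length $n$; the letter \<open>True\<close> at position $j$
  stands for the presence of the $j$-th generator of the exterior algebra. The index $k$ is the degree
  plus one, so that the cochains of index $0$, the sources of the coboundaries in degree $0$, vanish.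
\<close>

definition cochains :: "('a, 'b, 'm) module_scheme \<Rightarrow> 'a list \<Rightarrow> nat \<Rightarrow> (bool list \<Rightarrow> 'b) set" where
  "cochains M xs k = carrier (fun_mod M {l. length l = length xs \<and> Suc (count_list l True) = k})"

text \<open>The differential of the Koszul complex on $x_1^N,\dots,x_n^N$.\<close>

primrec kdiff :: "('a, 'r) ring_scheme \<Rightarrow> ('a, 'b, 'm) module_scheme \<Rightarrow> nat \<Rightarrow> 'a list \<Rightarrow>
    (bool list \<Rightarrow> 'b) \<Rightarrow> bool list \<Rightarrow> 'b" where
  "kdiff R M N [] c = (\<lambda>_. \<zero>\<^bsub>M\<^esub>)"
| "kdiff R M N (x # xs) c = (\<lambda>l. case l of [] \<Rightarrow> \<zero>\<^bsub>M\<^esub> | v # l' \<Rightarrow>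
     if v then (x [^]\<^bsub>R\<^esub> N) \<odot>\<^bsub>M\<^esub> c (False # l') \<ominus>\<^bsub>M\<^esub> kdiff R M N xs (\<lambda>l. c (True # l)) l'
     else kdiff R M N xs (\<lambda>l. c (False # l)) l')"

text \<open>Sending each exterior generator e_j to x_j^d e_j multiplies the basis element belonging
  to the word l by this weight.\<close>

primrec kweight :: "('a, 'r) ring_scheme \<Rightarrow> nat \<Rightarrow> 'a list \<Rightarrow> bool list \<Rightarrow> 'a" where
  "kweight R d [] l = \<one>\<^bsub>R\<^esub>"
| "kweight R d (x # xs) l = (case l of [] \<Rightarrow> \<one>\<^bsub>R\<^esub> | v # l' \<Rightarrow>
     if v then x [^]\<^bsub>R\<^esub> d \<otimes>\<^bsub>R\<^esub> kweight R d xs l' else kweight R d xs l')"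

text \<open>The transition map from level $N$ to level $N+d$, followed by multiplication by $t$.\<close>

definition ktrans :: "('a, 'r) ring_scheme \<Rightarrow> ('a, 'b, 'm) module_scheme \<Rightarrow> 'a list \<Rightarrow> nat \<Rightarrow> 'a \<Rightarrow>
    (bool list \<Rightarrow> 'b) \<Rightarrow> bool list \<Rightarrow> 'b" where
  "ktrans R M xs d t c = (\<lambda>l. (kweight R d xs l \<otimes>\<^bsub>R\<^esub> t) \<odot>\<^bsub>M\<^esub> c l)"

definition kcocycles :: "('a, 'r) ring_scheme \<Rightarrow> ('a, 'b, 'm) module_scheme \<Rightarrow> 'a list \<Rightarrow> nat \<Rightarrow> nat \<Rightarrow>
    (bool list \<Rightarrow> 'b) set" where
  "kcocycles R M xs N k = {c \<in> cochains M xs k. kdiff R M N xs c = (\<lambda>_. \<zero>\<^bsub>M\<^esub>)}"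

text \<open>Exponents 1, 1 give the R-linear maps, exponents p^e, p^e' the linear maps between
  Frobenius pushforwards of R; both share one proof of compatibility with differentials and
  transition maps.\<close>

definition semilinear :: "('a, 'r) ring_scheme \<Rightarrow> ('a, 'b, 'm) module_scheme \<Rightarrow> ('a, 'c, 'n) module_scheme \<Rightarrow>
    nat \<Rightarrow> nat \<Rightarrow> ('b \<Rightarrow> 'c) \<Rightarrow> bool" where
  "semilinear R M L a b h \<longleftrightarrow> h \<in> carrier M \<rightarrow> carrier L \<and>
     (\<forall>x\<in>carrier M. \<forall>y\<in>carrier M. h (x \<oplus>\<^bsub>M\<^esub> y) = h x \<oplus>\<^bsub>L\<^esub> h y) \<and>
     (\<forall>x\<in>carrier R. \<forall>u\<in>carrier M. h ((x [^]\<^bsub>R\<^esub> a) \<odot>\<^bsub>M\<^esub> u) = (x [^]\<^bsub>R\<^esub> b) \<odot>\<^bsub>L\<^esub> h u)"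

lemma twisted_linear_semilinear:
  "twisted_linear R a b h \<Longrightarrow> semilinear R (self_module R) (self_module R) a b h"
  by (simp add: twisted_linear_def semilinear_def)

lemma module_hom_semilinear:
  assumes "module R M" "h \<in> module_hom R M L" shows "semilinear R M L (Suc 0) (Suc 0) h"
proof -
  interpret module R M by fact
  show ?thesis using assms(2) by (auto simp: semilinear_def module_hom_def)
qed

lemma semilinear_zero:
  assumes "module R M" "module R L" "semilinear R M L a b h" shows "h \<zero>\<^bsub>M\<^esub> = \<zero>\<^bsub>L\<^esub>"
proof -
  interpret M: module R M by fact
  interpret L: module R L by fact
  have "h \<zero>\<^bsub>M\<^esub> \<oplus>\<^bsub>L\<^esub> h \<zero>\<^bsub>M\<^esub> = h (\<zero>\<^bsub>M\<^esub> \<oplus>\<^bsub>M\<^esub> \<zero>\<^bsub>M\<^esub>)"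
    using assms(3) unfolding semilinear_def by (metis M.M.zero_closed)
  then have "h \<zero>\<^bsub>M\<^esub> \<oplus>\<^bsub>L\<^esub> h \<zero>\<^bsub>M\<^esub> = h \<zero>\<^bsub>M\<^esub>" by simp
  moreover have "h \<zero>\<^bsub>M\<^esub> \<in> carrier L" using assms(3) unfolding semilinear_def by auto
  ultimately show ?thesis using L.M.add.r_cancel_one' by metis
qed

lemma semilinear_minus:
  assumes "module R M" "module R L" "semilinear R M L a b h" "x \<in> carrier M" "y \<in> carrier M"
  shows "h (x \<ominus>\<^bsub>M\<^esub> y) = h x \<ominus>\<^bsub>L\<^esub> h y"
proof -
  interpret M: module R M by fact
  interpret L: module R L by fact
  have cl: "h x \<in> carrier L" "h y \<in> carrier L" "h (\<ominus>\<^bsub>M\<^esub> y) \<in> carrier L"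
    using assms(3-5) unfolding semilinear_def by auto
  have "h (\<ominus>\<^bsub>M\<^esub> y) \<oplus>\<^bsub>L\<^esub> h y = h (\<ominus>\<^bsub>M\<^esub> y \<oplus>\<^bsub>M\<^esub> y)"
    using assms(3-5) unfolding semilinear_def by auto
  also have "\<dots> = \<zero>\<^bsub>L\<^esub>" using assms by (simp add: M.M.l_neg semilinear_zero[OF assms(1-3)])
  finally have "\<ominus>\<^bsub>L\<^esub> h y = h (\<ominus>\<^bsub>M\<^esub> y)" using cl L.M.minus_equality by blast
  moreover have "h (x \<oplus>\<^bsub>M\<^esub> \<ominus>\<^bsub>M\<^esub> y) = h x \<oplus>\<^bsub>L\<^esub> h (\<ominus>\<^bsub>M\<^esub> y)"
    using assms(3-5) unfolding semilinear_def by auto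
  ultimately show ?thesis by (simp add: a_minus_def)
qed

lemma (in abelian_group) neg_zero: "\<ominus> \<zero> = \<zero>"
  by (rule minus_equality) auto

section \<open>Differentials and transition maps for arbitrary coefficients\<close>

context module
begin

lemma kdiff_closed: "set xs \<subseteq> carrier R \<Longrightarrow> (\<And>l. c l \<in> carrier M) \<Longrightarrow> kdiff R M N xs c l \<in> carrier M"
proof (induction xs arbitrary: c l)
  case (Cons x xs)
  then show ?case by (cases l) auto
qed simp

lemma kdiff_zero [simp]: "set xs \<subseteq> carrier R \<Longrightarrow> kdiff R M N xs (\<lambda>_. \<zero>\<^bsub>M\<^esub>) = (\<lambda>_. \<zero>\<^bsub>M\<^esub>)"
  by (induction xs) (auto split: list.split simp: M.minus_eq)

lemma kdiff_minus:
  assumes "set xs \<subseteq> carrier R" "\<And>l. c l \<in> carrier M" "\<And>l. c' l \<in> carrier M"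
  shows "kdiff R M N xs (\<lambda>l. c l \<ominus>\<^bsub>M\<^esub> c' l) l = kdiff R M N xs c l \<ominus>\<^bsub>M\<^esub> kdiff R M N xs c' l"
  using assms
proof (induction xs arbitrary: c c' l)
  case Nil then show ?case by (simp add: M.minus_eq M.neg_zero)
next
  case (Cons x xs)
  then show ?case
    by (cases l) (simp_all add: kdiff_closed smult_minus M.minus_eq_zero_iff,
        simp_all add: M.minus_eq M.minus_add M.a_ac M.neg_zero kdiff_closed)
qed

lemma kdiff_add:
  assumes "set xs \<subseteq> carrier R" "\<And>l. c l \<in> carrier M" "\<And>l. c' l \<in> carrier M"
  shows "kdiff R M N xs (\<lambda>l. c l \<oplus>\<^bsub>M\<^esub> c' l) l = kdiff R M N xs c l \<oplus>\<^bsub>M\<^esub> kdiff R M N xs c' l"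
  using assms
proof (induction xs arbitrary: c c' l)
  case (Cons x xs)
  then show ?case
    by (cases l) (auto simp: kdiff_closed smult_r_distr M.minus_eq M.minus_add M.a_ac)
qed simp

lemma kdiff_smult:
  assumes "set xs \<subseteq> carrier R" "\<And>l. c l \<in> carrier M" "t \<in> carrier R"
  shows "kdiff R M N xs (\<lambda>l. t \<odot>\<^bsub>M\<^esub> c l) l = t \<odot>\<^bsub>M\<^esub> kdiff R M N xs c l"
  using assms
proof (induction xs arbitrary: c l)
  case (Cons x xs)
  have "t \<odot>\<^bsub>M\<^esub> (x [^] N \<odot>\<^bsub>M\<^esub> u) = x [^] N \<odot>\<^bsub>M\<^esub> (t \<odot>\<^bsub>M\<^esub> u)" if "u \<in> carrier M" for u
    using Cons.prems that by (simp add: smult_assoc1[symmetric] m_comm)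
  then show ?case using Cons
    by (cases l) (auto simp: kdiff_closed smult_minus)
qed simp

lemma kdiff_kdiff:
  assumes "set xs \<subseteq> carrier R" "\<And>l. c l \<in> carrier M"
  shows "kdiff R M N xs (kdiff R M N xs c) = (\<lambda>_. \<zero>\<^bsub>M\<^esub>)"
  using assms
proof (induction xs arbitrary: c)
  case (Cons x xs)
  have "kdiff R M N (x # xs) (kdiff R M N (x # xs) c) l = \<zero>\<^bsub>M\<^esub>" for l
  proof (cases l)
    case (Cons v l')
    then show ?thesis
      using Cons.prems Cons.IH[of "\<lambda>l. c (False # l)"] Cons.IH[of "\<lambda>l. c (True # l)"]
      by (cases v) (simp_all add: kdiff_closed kdiff_minus kdiff_smult M.minus_eq_zero_iff,
          simp add: M.minus_eq M.neg_zero kdiff_closed)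
  qed simp
  then show ?case by blast
qed simp

lemma cochains_iff: "c \<in> cochains M xs k \<longleftrightarrow> (\<forall>l. c l \<in> carrier M) \<and>
    (\<forall>l. length l = length xs \<and> Suc (count_list l True) = k \<or> c l = \<zero>\<^bsub>M\<^esub>)"
  unfolding cochains_def fun_mod_simps(1) using M.zero_closed by (simp, metis)

text \<open>The truncated subtraction is right also at k = 0, where the cochains on either side have
  index 0 and vanish.\<close>

lemma cochains_Cons: "c \<in> cochains M (x # xs) k \<longleftrightarrow> c [] = \<zero>\<^bsub>M\<^esub> \<and>
    (\<lambda>l. c (False # l)) \<in> cochains M xs k \<and> (\<lambda>l. c (True # l)) \<in> cochains M xs (k - 1)"
  (is "?L \<longleftrightarrow> ?R")
proof
  assume ?L
  then have L: "c l \<in> carrier M" "length l = length (x # xs) \<and> Suc (count_list l True) = k \<or> c l = \<zero>\<^bsub>M\<^esub>" for l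
    unfolding cochains_iff by auto
  show ?R unfolding cochains_iff using L(1) L(2)[of "[]"] L(2)[of "False # l" for l] L(2)[of "True # l" for l]
    by fastforce
next
  assume R: ?R
  have "c l \<in> carrier M \<and> (length l = length (x # xs) \<and> Suc (count_list l True) = k \<or> c l = \<zero>\<^bsub>M\<^esub>)" for l
    by (cases l; cases "hd l") (use R in \<open>force simp: cochains_iff\<close>)+
  then show ?L unfolding cochains_iff by blast
qed

lemma cochains_0: "c \<in> cochains M xs 0 \<longleftrightarrow> c = (\<lambda>_. \<zero>\<^bsub>M\<^esub>)"
  unfolding cochains_iff by auto

lemma cochains_minus:
  "c \<in> cochains M xs k \<Longrightarrow> c' \<in> cochains M xs k \<Longrightarrow> (\<lambda>l. c l \<ominus>\<^bsub>M\<^esub> c' l) \<in> cochains M xs k"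
  unfolding cochains_iff by (metis M.minus_closed M.r_neg M.zero_closed a_minus_def)

lemma cochains_add:
  "c \<in> cochains M xs k \<Longrightarrow> c' \<in> cochains M xs k \<Longrightarrow> (\<lambda>l. c l \<oplus>\<^bsub>M\<^esub> c' l) \<in> cochains M xs k"
  unfolding cochains_iff by (metis M.add.m_closed M.l_zero M.zero_closed)

lemma cochains_smult:
  "c \<in> cochains M xs k \<Longrightarrow> (\<And>l. a l \<in> carrier R) \<Longrightarrow> (\<lambda>l. a l \<odot>\<^bsub>M\<^esub> c l) \<in> cochains M xs k"
  unfolding cochains_iff by (metis smult_closed smult_r_null)

lemma kdiff_cochains:
  "set xs \<subseteq> carrier R \<Longrightarrow> c \<in> cochains M xs k \<Longrightarrow> kdiff R M N xs c \<in> cochains M xs (Suc k)"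
proof (induction xs arbitrary: c k)
  case Nil then show ?case by (simp add: cochains_iff)
next
  case (Cons x xs)
  note c = Cons.prems(2)[unfolded cochains_Cons]
  have 1: "kdiff R M N xs (\<lambda>l. c (False # l)) \<in> cochains M xs (Suc k)"
    using Cons c by auto
  \<comment> \<open>The True part has index k - 1, so its coboundary has index k; for k = 0 it is
    zero.\<close>
  have 2: "kdiff R M N xs (\<lambda>l. c (True # l)) \<in> cochains M xs k"
  proof (cases k)
    case 0
    then have "(\<lambda>l. c (True # l)) = (\<lambda>_. \<zero>\<^bsub>M\<^esub>)" using c by (simp add: cochains_0)
    then show ?thesis using Cons.prems 0 by (simp add: cochains_0)
  next
    case (Suc j)
    then show ?thesis using Cons.IH[of "\<lambda>l. c (True # l)" j] Cons.prems c by auto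
  qed
  have "(\<lambda>l. x [^] N \<odot>\<^bsub>M\<^esub> c (False # l)) \<in> cochains M xs k"
    using c Cons.prems by (intro cochains_smult) auto
  from cochains_minus[OF this 2] show ?case using 1 by (simp add: cochains_Cons)
qed

lemma kweight_closed: "set xs \<subseteq> carrier R \<Longrightarrow> kweight R d xs l \<in> carrier R"
  by (induction xs arbitrary: l) (auto split: list.split)

lemma kweight_add:
  "set xs \<subseteq> carrier R \<Longrightarrow> kweight R (d + d') xs l = kweight R d xs l \<otimes> kweight R d' xs l"
  by (induction xs arbitrary: l) (auto split: list.split simp: kweight_closed nat_pow_mult[symmetric] m_ac)

lemma kweight_0: "set xs \<subseteq> carrier R \<Longrightarrow> kweight R 0 xs l = \<one>"
  by (induction xs arbitrary: l) (auto split: list.split)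

lemma kweight_pow: "set xs \<subseteq> carrier R \<Longrightarrow> kweight R (d * a) xs l = kweight R d xs l [^] a"
  by (induction xs arbitrary: l) (auto split: list.split simp: kweight_closed nat_pow_pow nat_pow_distrib)

text \<open>The scalar t is carried along for the sake of the induction: behind a letter True the
  factor x^d is absorbed into it.\<close>

lemma kdiff_weight:
  assumes "set xs \<subseteq> carrier R" "\<And>l. c l \<in> carrier M" "t \<in> carrier R"
  shows "kdiff R M (N + d) xs (\<lambda>l. (kweight R d xs l \<otimes> t) \<odot>\<^bsub>M\<^esub> c l) l =
    (kweight R d xs l \<otimes> t) \<odot>\<^bsub>M\<^esub> kdiff R M N xs c l"
  using assms
proof (induction xs arbitrary: c t l)
  case (Cons x xs)
  have x: "x \<in> carrier R" using Cons.prems by auto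
  show ?case
  proof (cases l)
    case (Cons v l')
    note l = this
    show ?thesis
    proof (cases v)
      case False
      then show ?thesis using l Cons.IH[of "\<lambda>l. c (False # l)" t l'] Cons.prems by simp
    next
      case True
      let ?w = "kweight R d xs l'"
      have w: "?w \<in> carrier R" using Cons.prems by (simp add: kweight_closed)
      have e: "x [^] d \<otimes> kweight R d xs l \<otimes> t = kweight R d xs l \<otimes> (x [^] d \<otimes> t)" for l
        using Cons.prems by (simp add: kweight_closed m_ac)
      have "kdiff R M (N + d) xs (\<lambda>l. (kweight R d xs l \<otimes> (x [^] d \<otimes> t)) \<odot>\<^bsub>M\<^esub> c (True # l)) l' =
          (?w \<otimes> (x [^] d \<otimes> t)) \<odot>\<^bsub>M\<^esub> kdiff R M N xs (\<lambda>l. c (True # l)) l'"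
        using Cons.IH[of "\<lambda>l. c (True # l)" "x [^] d \<otimes> t" l'] Cons.prems by simp
      moreover have "x [^] (N + d) \<otimes> (?w \<otimes> t) = ?w \<otimes> (x [^] d \<otimes> t) \<otimes> x [^] N"
        using x w Cons.prems by (simp add: nat_pow_mult[symmetric] m_ac)
      then have "x [^] (N + d) \<odot>\<^bsub>M\<^esub> ((?w \<otimes> t) \<odot>\<^bsub>M\<^esub> c (False # l')) =
          (?w \<otimes> (x [^] d \<otimes> t)) \<odot>\<^bsub>M\<^esub> (x [^] N \<odot>\<^bsub>M\<^esub> c (False # l'))"
        using x w Cons.prems by (simp add: smult_assoc1[symmetric])
      ultimately show ?thesis
        using l True w x Cons.prems by (simp add: e smult_minus kdiff_closed)
    qed
  qed (use Cons.prems in simp)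
qed simp

end

text \<open>Here Frobenius meets the levels: the differential at level N a multiplies by x^(N a) =
  (x^N)^a, which h turns into (x^N)^b, the coefficient at level N b.\<close>

lemma kdiff_semilinear:
  assumes "module R M" "module R L" "semilinear R M L a b h" "set xs \<subseteq> carrier R" "\<And>l. c l \<in> carrier M"
  shows "kdiff R L (N * b) xs (\<lambda>l. h (c l)) l = h (kdiff R M (N * a) xs c l)"
proof -
  interpret M: module R M by fact
  interpret L: module R L by fact
  have h: "h ((x [^]\<^bsub>R\<^esub> (N * a)) \<odot>\<^bsub>M\<^esub> u) = (x [^]\<^bsub>R\<^esub> (N * b)) \<odot>\<^bsub>L\<^esub> h u"
    if "x \<in> carrier R" "u \<in> carrier M" for x u
    using assms(3) that unfolding semilinear_def by (simp add: M.nat_pow_pow[symmetric])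
  show ?thesis using assms(4,5)
  proof (induction xs arbitrary: c l)
    case Nil then show ?case by (simp add: semilinear_zero[OF assms(1-3)])
  next
    case (Cons x xs)
    then show ?case
      by (cases l) (auto simp: semilinear_zero[OF assms(1-3)] semilinear_minus[OF assms(1-3)] h M.kdiff_closed)
  qed
qed

lemma ktrans_semilinear:
  assumes "module R M" "module R L" "semilinear R M L a b h" "set xs \<subseteq> carrier R" "\<And>l. c l \<in> carrier M"
    and t: "t \<in> carrier R"
  shows "ktrans R L xs (d * b) (t [^]\<^bsub>R\<^esub> b) (\<lambda>l. h (c l)) = (\<lambda>l. h (ktrans R M xs (d * a) (t [^]\<^bsub>R\<^esub> a) c l))"
proof -
  interpret M: module R M by fact
  have "h ((kweight R (d * a) xs l \<otimes>\<^bsub>R\<^esub> t [^]\<^bsub>R\<^esub> a) \<odot>\<^bsub>M\<^esub> c l) =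
      (kweight R (d * b) xs l \<otimes>\<^bsub>R\<^esub> t [^]\<^bsub>R\<^esub> b) \<odot>\<^bsub>L\<^esub> h (c l)" for l
    using assms(3) unfolding semilinear_def
    by (simp add: M.kweight_pow[OF assms(4)] M.nat_pow_distrib[symmetric] M.kweight_closed[OF assms(4)] assms(5) t)
  then show ?thesis by (simp add: ktrans_def)
qed

locale koszul = cring R for R :: "('a, 'r) ring_scheme" (structure) +
  fixes xs :: "'a list"
  assumes xs: "set xs \<subseteq> carrier R"
begin

abbreviation Co :: "('a, 'b, 'm) module_scheme \<Rightarrow> nat \<Rightarrow> (bool list \<Rightarrow> 'b) set" where
  "Co M k \<equiv> cochains M xs k"

abbreviation D :: "('a, 'b, 'm) module_scheme \<Rightarrow> nat \<Rightarrow> (bool list \<Rightarrow> 'b) \<Rightarrow> bool list \<Rightarrow> 'b" where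
  "D M N \<equiv> kdiff R M N xs"

abbreviation T :: "('a, 'b, 'm) module_scheme \<Rightarrow> nat \<Rightarrow> 'a \<Rightarrow> (bool list \<Rightarrow> 'b) \<Rightarrow> bool list \<Rightarrow> 'b" where
  "T M d t \<equiv> ktrans R M xs d t"

abbreviation Z :: "('a, 'b, 'm) module_scheme \<Rightarrow> nat \<Rightarrow> nat \<Rightarrow> (bool list \<Rightarrow> 'b) set" where
  "Z M N k \<equiv> kcocycles R M xs N k"

lemma Z_iff: "c \<in> Z M N k \<longleftrightarrow> c \<in> Co M k \<and> D M N c = (\<lambda>_. \<zero>\<^bsub>M\<^esub>)"
  by (simp add: kcocycles_def)

lemma Co_closed: "module R M \<Longrightarrow> c \<in> Co M k \<Longrightarrow> c l \<in> carrier M"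
  by (simp add: module.cochains_iff)

lemma D_Co: "module R M \<Longrightarrow> c \<in> Co M k \<Longrightarrow> D M N c \<in> Co M (Suc k)"
  by (simp add: module.kdiff_cochains xs)

lemma T_Co: "module R M \<Longrightarrow> c \<in> Co M k \<Longrightarrow> t \<in> carrier R \<Longrightarrow> T M d t c \<in> Co M k"
  unfolding ktrans_def by (simp add: module.cochains_smult module.kweight_closed xs)

lemma D_T: "module R M \<Longrightarrow> c \<in> Co M k \<Longrightarrow> t \<in> carrier R \<Longrightarrow> D M (N + d) (T M d t c) = T M d t (D M N c)"
  unfolding ktrans_def by (intro ext module.kdiff_weight) (auto simp: xs Co_closed)

lemma T_zero: "module R M \<Longrightarrow> t \<in> carrier R \<Longrightarrow> T M d t (\<lambda>_. \<zero>\<^bsub>M\<^esub>) = (\<lambda>_. \<zero>\<^bsub>M\<^esub>)"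
  unfolding ktrans_def by (simp add: module.smult_r_null module.kweight_closed xs)

lemma T_Z: "module R M \<Longrightarrow> c \<in> Z M N k \<Longrightarrow> t \<in> carrier R \<Longrightarrow> T M d t c \<in> Z M (N + d) k"
  unfolding Z_iff by (auto simp: T_Co D_T T_zero)

lemma T_T: "module R M \<Longrightarrow> c \<in> Co M k \<Longrightarrow> t \<in> carrier R \<Longrightarrow> t' \<in> carrier R \<Longrightarrow>
    T M d' t' (T M d t c) = T M (d + d') (t \<otimes> t') c"
  unfolding ktrans_def
  by (simp add: module.smult_assoc1[symmetric] module.kweight_closed xs Co_closed module.kweight_add m_ac)

lemma T_0: "module R M \<Longrightarrow> c \<in> Co M k \<Longrightarrow> T M 0 \<one> c = c"
  unfolding ktrans_def by (simp add: module.kweight_0 xs Co_closed module.smult_one)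

lemma D_minus: "module R M \<Longrightarrow> c \<in> Co M k \<Longrightarrow> c' \<in> Co M k \<Longrightarrow>
    D M N (\<lambda>l. c l \<ominus>\<^bsub>M\<^esub> c' l) = (\<lambda>l. D M N c l \<ominus>\<^bsub>M\<^esub> D M N c' l)"
  by (intro ext module.kdiff_minus) (auto simp: xs Co_closed)

lemma D_add: "module R M \<Longrightarrow> c \<in> Co M k \<Longrightarrow> c' \<in> Co M k \<Longrightarrow>
    D M N (\<lambda>l. c l \<oplus>\<^bsub>M\<^esub> c' l) = (\<lambda>l. D M N c l \<oplus>\<^bsub>M\<^esub> D M N c' l)"
  by (intro ext module.kdiff_add) (auto simp: xs Co_closed)

lemma D_smult: "module R M \<Longrightarrow> c \<in> Co M k \<Longrightarrow> t \<in> carrier R \<Longrightarrow>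
    D M N (\<lambda>l. t \<odot>\<^bsub>M\<^esub> c l) = (\<lambda>l. t \<odot>\<^bsub>M\<^esub> D M N c l)"
  by (intro ext module.kdiff_smult) (auto simp: xs Co_closed)

lemma D_D: "module R M \<Longrightarrow> c \<in> Co M k \<Longrightarrow> D M N (D M N c) = (\<lambda>_. \<zero>\<^bsub>M\<^esub>)"
  by (intro module.kdiff_kdiff) (auto simp: xs Co_closed)

lemma D_zero: "module R M \<Longrightarrow> D M N (\<lambda>_. \<zero>\<^bsub>M\<^esub>) = (\<lambda>_. \<zero>\<^bsub>M\<^esub>)"
  by (simp add: module.kdiff_zero xs)

lemma T_minus: "module R M \<Longrightarrow> c \<in> Co M k \<Longrightarrow> c' \<in> Co M k \<Longrightarrow> t \<in> carrier R \<Longrightarrow>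
    T M d t (\<lambda>l. c l \<ominus>\<^bsub>M\<^esub> c' l) = (\<lambda>l. T M d t c l \<ominus>\<^bsub>M\<^esub> T M d t c' l)"
  unfolding ktrans_def by (simp add: module.smult_minus module.kweight_closed xs Co_closed)

lemma T_add: "module R M \<Longrightarrow> c \<in> Co M k \<Longrightarrow> c' \<in> Co M k \<Longrightarrow> t \<in> carrier R \<Longrightarrow>
    T M d t (\<lambda>l. c l \<oplus>\<^bsub>M\<^esub> c' l) = (\<lambda>l. T M d t c l \<oplus>\<^bsub>M\<^esub> T M d t c' l)"
  unfolding ktrans_def by (simp add: module.smult_r_distr module.kweight_closed xs Co_closed)

lemma T_smult: "module R M \<Longrightarrow> c \<in> Co M k \<Longrightarrow> s \<in> carrier R \<Longrightarrow> t \<in> carrier R \<Longrightarrow>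
    T M d t (\<lambda>l. s \<odot>\<^bsub>M\<^esub> c l) = (\<lambda>l. s \<odot>\<^bsub>M\<^esub> T M d t c l)"
  unfolding ktrans_def by (simp add: module.smult_assoc1[symmetric] module.kweight_closed xs Co_closed m_ac)

lemma T_scalar: "module R M \<Longrightarrow> c \<in> Co M k \<Longrightarrow> t \<in> carrier R \<Longrightarrow> T M d t c = (\<lambda>l. t \<odot>\<^bsub>M\<^esub> T M d \<one> c l)"
  unfolding ktrans_def by (simp add: module.smult_assoc1[symmetric] module.kweight_closed xs Co_closed m_ac)

section \<open>Functoriality in the coefficients\<close>

lemma Co_hom:
  assumes "module R M" "module R L" "h \<in> module_hom R M L" "c \<in> Co M k"
  shows "(\<lambda>l. h (c l)) \<in> Co L k"
  using assms(4) module_hom_zero[OF assms(1-3)] module_hom_closed[OF assms(3)]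
  unfolding module.cochains_iff[OF assms(1)] module.cochains_iff[OF assms(2)] by metis

lemma D_hom:
  assumes "module R M" "module R L" "h \<in> module_hom R M L" "c \<in> Co M k"
  shows "D L N (\<lambda>l. h (c l)) = (\<lambda>l. h (D M N c l))"
  using kdiff_semilinear[OF assms(1,2) module_hom_semilinear[OF assms(1,3)] xs, of c N] Co_closed[OF assms(1,4)]
  by auto

lemma T_hom:
  assumes "module R M" "module R L" "h \<in> module_hom R M L" "c \<in> Co M k" "t \<in> carrier R"
  shows "T L d t (\<lambda>l. h (c l)) = (\<lambda>l. h (T M d t c l))"
  using ktrans_semilinear[OF assms(1,2) module_hom_semilinear[OF assms(1,3)] xs, of c t d] Co_closed[OF assms(1,4)]
    assms(5) by simp

text \<open>Zero is lifted to zero, so the lift keeps the conditions on length and degree.\<close>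

lemma Co_lift:
  assumes "module R M" "module R L" "h \<in> module_hom R M L" "c \<in> Co L k" "\<And>l. c l \<in> h ` carrier M"
  obtains c' where "c' \<in> Co M k" "c = (\<lambda>l. h (c' l))"
proof -
  interpret M: module R M by fact
  have "\<forall>l. \<exists>y\<in>carrier M. c l = h y \<and> (c l = \<zero>\<^bsub>L\<^esub> \<longrightarrow> y = \<zero>\<^bsub>M\<^esub>)"
    using assms(5) module_hom_zero[OF assms(1-3)] M.M.zero_closed by (metis imageE)
  then obtain c' where c': "\<And>l. c' l \<in> carrier M \<and> c l = h (c' l) \<and> (c l = \<zero>\<^bsub>L\<^esub> \<longrightarrow> c' l = \<zero>\<^bsub>M\<^esub>)"
    by metis
  show thesis
  proof (rule that[of c'])
    show "c' \<in> Co M k" using assms(4) c' unfolding M.cochains_iff module.cochains_iff[OF assms(2)] by metis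
    show "c = (\<lambda>l. h (c' l))" using c' by blast
  qed
qed

text \<open>
  Vanishing of $\mathop{\rm colim}_N H^k(x_1^N,\dots,x_n^N;M)$ at $P$, and surjectivity and injectivity
  at $P$ of the map that a homomorphism induces on it.
\<close>

definition vanishes_at :: "'a set \<Rightarrow> ('a, 'b, 'm) module_scheme \<Rightarrow> nat \<Rightarrow> bool" where
  "vanishes_at P M k \<longleftrightarrow> (\<forall>N. \<forall>c\<in>Z M N (Suc k). \<exists>t\<in>carrier R - P. \<exists>d. \<exists>b\<in>Co M k. T M d t c = D M (N + d) b)"

definition surj_at :: "'a set \<Rightarrow> ('a, 'b, 'm) module_scheme \<Rightarrow> ('a, 'c, 'n) module_scheme \<Rightarrow> ('b \<Rightarrow> 'c) \<Rightarrow> nat \<Rightarrow> bool" where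
  "surj_at P A B h k \<longleftrightarrow> (\<forall>N. \<forall>c\<in>Z B N (Suc k). \<exists>t\<in>carrier R - P. \<exists>d. \<exists>z\<in>Z A (N + d) (Suc k). \<exists>b\<in>Co B k.
     T B d t c = (\<lambda>l. h (z l) \<oplus>\<^bsub>B\<^esub> D B (N + d) b l))"

definition inj_at :: "'a set \<Rightarrow> ('a, 'b, 'm) module_scheme \<Rightarrow> ('a, 'c, 'n) module_scheme \<Rightarrow> ('b \<Rightarrow> 'c) \<Rightarrow> nat \<Rightarrow> bool" where
  "inj_at P A B h k \<longleftrightarrow> (\<forall>N. \<forall>z\<in>Z A N (Suc k). \<forall>b\<in>Co B k. (\<lambda>l. h (z l)) = D B N b \<longrightarrow>
     (\<exists>t\<in>carrier R - P. \<exists>d. \<exists>y\<in>Co A k. T A d t z = D A (N + d) y))"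

end

text \<open>The lemmas of this locale are pieces of the long exact sequence of colimits at P, taken
  elementwise: instead of localizing, one works up to a transition map and a multiplier outside
  P.\<close>

locale koszul_exact = koszul R xs for R :: "('a, 'r) ring_scheme" (structure) and xs +
  fixes A :: "('a, 'c, 'm) module_scheme" and B :: "('a, 'd, 'n) module_scheme" and C :: "('a, 'e, 'o) module_scheme"
    and \<alpha> \<beta> P
  assumes mA: "module R A" and mB: "module R B" and mC: "module R C"
    and \<alpha>: "\<alpha> \<in> module_hom R A B" and \<beta>: "\<beta> \<in> module_hom R B C"
    and inj: "inj_on \<alpha> (carrier A)" and surj: "\<beta> ` carrier B = carrier C"
    and exact: "{x \<in> carrier B. \<beta> x = \<zero>\<^bsub>C\<^esub>} = \<alpha> ` carrier A"
    and P: "primeideal P R"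
begin

sublocale mA: module R A by (rule mA)
sublocale mB: module R B by (rule mB)
sublocale mC: module R C by (rule mC)
sublocale P: primeideal P R by (rule P)

lemmas \<alpha>_rules = Co_hom[OF mA mB \<alpha>] D_hom[OF mA mB \<alpha>] T_hom[OF mA mB \<alpha>]
lemmas \<beta>_rules = Co_hom[OF mB mC \<beta>] D_hom[OF mB mC \<beta>] T_hom[OF mB mC \<beta>]
lemmas A_rules = D_Co[OF mA] T_Co[OF mA] D_T[OF mA] Co_closed[OF mA]
lemmas B_rules = D_Co[OF mB] T_Co[OF mB] D_T[OF mB] Co_closed[OF mB]
lemmas C_rules = D_Co[OF mC] T_Co[OF mC] D_T[OF mC] Co_closed[OF mC]

lemma off_P_mult: "s \<in> carrier R - P \<Longrightarrow> t \<in> carrier R - P \<Longrightarrow> s \<otimes> t \<in> carrier R - P"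
  using P.I_prime by auto

lemma \<beta>\<alpha>: "x \<in> carrier A \<Longrightarrow> \<beta> (\<alpha> x) = \<zero>\<^bsub>C\<^esub>"
  using exact by blast

lemma \<alpha>_eqD:
  assumes "c \<in> Co A k" "c' \<in> Co A j" "\<And>l. \<alpha> (c l) = \<alpha> (c' l)" shows "c = c'"
  using assms(3) Co_closed[OF mA assms(1)] Co_closed[OF mA assms(2)] inj_onD[OF inj] by (intro ext) metis

lemma lift_kernel:
  assumes "b \<in> Co B k" "\<And>l. \<beta> (b l) = \<zero>\<^bsub>C\<^esub>"
  obtains z where "z \<in> Co A k" "b = (\<lambda>l. \<alpha> (z l))"
proof (rule Co_lift[OF mA mB \<alpha> assms(1)])
  show "b l \<in> \<alpha> ` carrier A" for l using exact assms Co_closed[OF mB assms(1)] by blast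
qed (rule that)

lemma lift_\<beta>:
  assumes "c \<in> Co C k" obtains b where "b \<in> Co B k" "c = (\<lambda>l. \<beta> (b l))"
proof (rule Co_lift[OF mB mC \<beta> assms])
  show "c l \<in> \<beta> ` carrier B" for l using surj Co_closed[OF mC assms] by simp
qed (rule that)

text \<open>This is the connecting homomorphism: z represents the image of the class of c. It is a
  cocycle because D b is one and \<alpha> is injective.\<close>

lemma connecting:
  assumes "c \<in> Z C N k"
  obtains b z where "b \<in> Co B k" "c = (\<lambda>l. \<beta> (b l))" "z \<in> Z A N (Suc k)" "D B N b = (\<lambda>l. \<alpha> (z l))"
proof -
  have c: "c \<in> Co C k" "D C N c = (\<lambda>_. \<zero>\<^bsub>C\<^esub>)" using assms by (auto simp: Z_iff)
  obtain b where b: "b \<in> Co B k" "c = (\<lambda>l. \<beta> (b l))" using lift_\<beta>[OF c(1)] by blast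
  have "\<beta> (D B N b l) = \<zero>\<^bsub>C\<^esub>" for l
    using c(2) unfolding b(2) \<beta>_rules(2)[OF b(1)] by (rule fun_cong)
  then obtain z where z: "z \<in> Co A (Suc k)" "D B N b = (\<lambda>l. \<alpha> (z l))"
    using lift_kernel[OF D_Co[OF mB b(1)]] by blast
  have "D B N (\<lambda>l. \<alpha> (z l)) = (\<lambda>_. \<zero>\<^bsub>B\<^esub>)" unfolding z(2)[symmetric] by (rule D_D[OF mB b(1)])
  then have "\<alpha> (D A N z l) = \<alpha> \<zero>\<^bsub>A\<^esub>" for l
    unfolding \<alpha>_rules(2)[OF z(1)] module_hom_zero[OF mA mB \<alpha>] by (rule fun_cong)
  then have "D A N z = (\<lambda>_. \<zero>\<^bsub>A\<^esub>)"
    using \<alpha>_eqD[OF D_Co[OF mA z(1)], of "\<lambda>_. \<zero>\<^bsub>A\<^esub>" 0] by (simp add: mA.cochains_0)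
  then show thesis using that[OF b _ z(2)] z(1) by (simp add: Z_iff)
qed

text \<open>Exactness at the cohomology of C: if the class of z dies, as witnessed by y, the
  transition of b is corrected by \<alpha> y to a cocycle, and \<beta> does not notice the
  correction.\<close>

lemma connecting_correct:
  assumes b: "b \<in> Co B k" and z: "z \<in> Co A (Suc k)" "D B N b = (\<lambda>l. \<alpha> (z l))"
    and y: "y \<in> Co A k" "T A d t z = D A (N + d) y" and t: "t \<in> carrier R"
  shows "(\<lambda>l. T B d t b l \<ominus>\<^bsub>B\<^esub> \<alpha> (y l)) \<in> Z B (N + d) k"
    and "(\<lambda>l. \<beta> (T B d t b l \<ominus>\<^bsub>B\<^esub> \<alpha> (y l))) = T C d t (\<lambda>l. \<beta> (b l))"
proof -
  let ?b = "\<lambda>l. T B d t b l \<ominus>\<^bsub>B\<^esub> \<alpha> (y l)"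
  note Tb = T_Co[OF mB b t] and \<alpha>y = \<alpha>_rules(1)[OF y(1)]
  have bC: "?b \<in> Co B k" by (rule mB.cochains_minus[OF Tb \<alpha>y])
  have "D B (N + d) ?b = (\<lambda>l. T B d t (\<lambda>l. \<alpha> (z l)) l \<ominus>\<^bsub>B\<^esub> \<alpha> (D A (N + d) y l))"
    unfolding D_minus[OF mB Tb \<alpha>y] D_T[OF mB b t] z(2) \<alpha>_rules(2)[OF y(1)] ..
  also have "\<dots> = (\<lambda>_. \<zero>\<^bsub>B\<^esub>)"
    unfolding \<alpha>_rules(3)[OF z(1) t] y(2)
    using Co_closed[OF mA D_Co[OF mA y(1)]] module_hom_closed[OF \<alpha>] by (simp add: mB.M.minus_eq mB.M.r_neg)
  finally show "?b \<in> Z B (N + d) k" using bC by (simp add: Z_iff)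
  have "(\<lambda>l. \<beta> (?b l)) = (\<lambda>l. \<beta> (T B d t b l))"
    using B_rules(4)[OF Tb] module_hom_closed[OF \<alpha>] module_hom_closed[OF \<beta>] Co_closed[OF mA y(1)]
    by (simp add: module_hom_minus[OF mB mC \<beta>] \<beta>\<alpha> mC.M.minus_eq mC.M.neg_zero)
  also have "\<dots> = T C d t (\<lambda>l. \<beta> (b l))" by (rule \<beta>_rules(3)[OF b t, symmetric])
  finally show "(\<lambda>l. \<beta> (?b l)) = T C d t (\<lambda>l. \<beta> (b l))" .
qed

text \<open>Injectivity of \<alpha> kills the image under the connecting map, so the class lifts to
  B. Surjectivity of \<alpha> then writes the lift as a cocycle from A, which \<beta> annihilates,
  plus a coboundary.\<close>

lemma vanishes_quotient:
  assumes "surj_at P A B \<alpha> k" "inj_at P A B \<alpha> (Suc k)" shows "vanishes_at P C k"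
  unfolding vanishes_at_def
proof (intro allI ballI)
  fix N c assume c: "c \<in> Z C N (Suc k)"
  obtain b z where b: "b \<in> Co B (Suc k)" "c = (\<lambda>l. \<beta> (b l))"
    and z: "z \<in> Z A N (Suc (Suc k))" "D B N b = (\<lambda>l. \<alpha> (z l))" by (rule connecting[OF c])
  obtain t d y where t: "t \<in> carrier R - P" and y: "y \<in> Co A (Suc k)" "T A d t z = D A (N + d) y"
    using assms(2)[unfolded inj_at_def] z(1) b(1) z(2)[symmetric] by blast
  have tR: "t \<in> carrier R" using t by blast
  have zC: "z \<in> Co A (Suc (Suc k))" using z(1) by (simp add: Z_iff)
  let ?b = "\<lambda>l. T B d t b l \<ominus>\<^bsub>B\<^esub> \<alpha> (y l)"
  note cc = connecting_correct[OF b(1) zC z(2) y tR]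
  have bC: "?b \<in> Co B (Suc k)" using cc(1) by (simp add: Z_iff)
  obtain t' d' z' b' where t': "t' \<in> carrier R - P" and z': "z' \<in> Z A (N + d + d') (Suc k)"
    and b': "b' \<in> Co B k" "T B d' t' ?b = (\<lambda>l. \<alpha> (z' l) \<oplus>\<^bsub>B\<^esub> D B (N + d + d') b' l)"
    using assms(1)[unfolded surj_at_def] cc(1) by blast
  have t'R: "t' \<in> carrier R" using t' by blast
  have "T C d' t' (T C d t c) = (\<lambda>l. \<beta> (T B d' t' ?b l))"
    using \<beta>_rules(3)[OF bC t'R] cc(2) b(2) by metis
  also have "\<dots> = (\<lambda>l. \<beta> (D B (N + d + d') b' l))"
    unfolding b'(2) using z'[unfolded Z_iff] Co_closed[OF mA, of z' "Suc k"] B_rules(4)[OF D_Co[OF mB b'(1)]]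
      module_hom_closed[OF \<alpha>] module_hom_closed[OF \<beta>]
    by (simp add: module_hom_add[OF \<beta>] \<beta>\<alpha>)
  also have "\<dots> = D C (N + d + d') (\<lambda>l. \<beta> (b' l))" using \<beta>_rules(2)[OF b'(1)] by simp
  finally have "T C (d + d') (t \<otimes> t') c = D C (N + (d + d')) (\<lambda>l. \<beta> (b' l))"
    using T_T[OF mC _ tR t'R] c by (auto simp: Z_iff add.assoc)
  then show "\<exists>t\<in>carrier R - P. \<exists>d. \<exists>b\<in>Co C k. T C d t c = D C (N + d) b"
    using off_P_mult[OF t t'] \<beta>_rules(1)[OF b'(1)] by blast
qed

text \<open>Exactness in the middle: c is lifted to c', and subtracting the coboundary of c' from b
  leaves values in the kernel of \<beta>.\<close>

lemma from_A:
  assumes b: "b \<in> Co B (Suc k)" and c: "c \<in> Co C k" "(\<lambda>l. \<beta> (b l)) = D C N c"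
  obtains c' z where "c' \<in> Co B k" "z \<in> Co A (Suc k)" "b = (\<lambda>l. \<alpha> (z l) \<oplus>\<^bsub>B\<^esub> D B N c' l)" "c = (\<lambda>l. \<beta> (c' l))"
    "D B N b = (\<lambda>l. \<alpha> (D A N z l))"
proof -
  obtain c' where c': "c' \<in> Co B k" "c = (\<lambda>l. \<beta> (c' l))" using lift_\<beta>[OF c(1)] by blast
  note Dc' = D_Co[OF mB c'(1), of N]
  have "(\<lambda>l. b l \<ominus>\<^bsub>B\<^esub> D B N c' l) \<in> Co B (Suc k)" by (rule mB.cochains_minus[OF b Dc'])
  moreover have "\<beta> (b l \<ominus>\<^bsub>B\<^esub> D B N c' l) = \<zero>\<^bsub>C\<^esub>" for l
    using fun_cong[OF c(2), of l] unfolding c'(2) \<beta>_rules(2)[OF c'(1)]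
    by (simp add: module_hom_minus[OF mB mC \<beta>] Co_closed[OF mB b] Co_closed[OF mB Dc'] mC.M.minus_eq_zero_iff
        module_hom_closed[OF \<beta>])
  ultimately obtain z where z: "z \<in> Co A (Suc k)" "(\<lambda>l. b l \<ominus>\<^bsub>B\<^esub> D B N c' l) = (\<lambda>l. \<alpha> (z l))"
    using lift_kernel by blast
  have eq: "b = (\<lambda>l. \<alpha> (z l) \<oplus>\<^bsub>B\<^esub> D B N c' l)"
  proof
    fix l
    show "b l = \<alpha> (z l) \<oplus>\<^bsub>B\<^esub> D B N c' l"
      using fun_cong[OF z(2), of l, symmetric]
      by (simp add: Co_closed[OF mB b] Co_closed[OF mB Dc'] mB.M.minus_add_cancel)
  qed
  have "D B N b = (\<lambda>l. D B N (\<lambda>l. \<alpha> (z l)) l \<oplus>\<^bsub>B\<^esub> D B N (D B N c') l)"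
    by (subst eq) (rule D_add[OF mB \<alpha>_rules(1)[OF z(1)] Dc'])
  then have "D B N b = (\<lambda>l. \<alpha> (D A N z l))"
    unfolding D_D[OF mB c'(1)] \<alpha>_rules(2)[OF z(1)]
    using A_rules(4)[OF D_Co[OF mA z(1)]] module_hom_closed[OF \<alpha>] by simp
  then show thesis by (rule that[OF c'(1) z(1) eq c'(2)])
qed

text \<open>The image of the cocycle in C becomes a coboundary, so \<open>from_A\<close> gives a
  representative from A; it is a cocycle because \<alpha> is injective.\<close>

lemma surj_of_vanishes:
  assumes "vanishes_at P C k" shows "surj_at P A B \<alpha> k"
  unfolding surj_at_def
proof (intro allI ballI)
  fix N c assume c: "c \<in> Z B N (Suc k)"
  then have cC: "c \<in> Co B (Suc k)" and c0: "D B N c = (\<lambda>_. \<zero>\<^bsub>B\<^esub>)" by (auto simp: Z_iff)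
  have "(\<lambda>l. \<beta> (c l)) \<in> Z C N (Suc k)"
    using \<beta>_rules(1,2)[OF cC] c0 by (simp add: Z_iff module_hom_zero[OF mB mC \<beta>])
  then obtain t d b where t: "t \<in> carrier R - P" and b: "b \<in> Co C k" "T C d t (\<lambda>l. \<beta> (c l)) = D C (N + d) b"
    using assms[unfolded vanishes_at_def] by blast
  have tR: "t \<in> carrier R" using t by blast
  note Tc = T_Z[OF mB c tR, of d, unfolded Z_iff]
  have "(\<lambda>l. \<beta> (T B d t c l)) = D C (N + d) b" using b(2) unfolding \<beta>_rules(3)[OF cC tR] .
  then obtain c' z where cz: "c' \<in> Co B k" "z \<in> Co A (Suc k)" "T B d t c = (\<lambda>l. \<alpha> (z l) \<oplus>\<^bsub>B\<^esub> D B (N + d) c' l)"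
    "D B (N + d) (T B d t c) = (\<lambda>l. \<alpha> (D A (N + d) z l))" by (rule from_A[OF conjunct1[OF Tc] b(1)]) (rule that)
  have "D A (N + d) z = (\<lambda>_. \<zero>\<^bsub>A\<^esub>)"
  proof (rule \<alpha>_eqD[OF D_Co[OF mA cz(2)]])
    show "(\<lambda>_. \<zero>\<^bsub>A\<^esub>) \<in> Co A 0" by (simp add: mA.cochains_0)
    show "\<alpha> (D A (N + d) z l) = \<alpha> \<zero>\<^bsub>A\<^esub>" for l
      using fun_cong[OF cz(4), of l] Tc by (simp add: module_hom_zero[OF mA mB \<alpha>])
  qed
  then have "z \<in> Z A (N + d) (Suc k)" using cz(2) by (simp add: Z_iff)
  then show "\<exists>t\<in>carrier R - P. \<exists>d. \<exists>z\<in>Z A (N + d) (Suc k). \<exists>b\<in>Co B k.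
      T B d t c = (\<lambda>l. \<alpha> (z l) \<oplus>\<^bsub>B\<^esub> D B (N + d) b l)"
    using t cz(1,3) by blast
qed

text \<open>Surjectivity of \<beta> makes the connecting map vanish: after transition and
  multiplier, \<beta> b is \<beta> y plus a coboundary with a cocycle y of B. Then b - y comes from
  A up to a coboundary, and its differential shows that z bounds in A.\<close>

lemma inj_of_surj:
  assumes "surj_at P B C \<beta> k" shows "inj_at P A B \<alpha> (Suc k)"
  unfolding inj_at_def
proof (intro allI ballI impI)
  fix N z b assume z: "z \<in> Z A N (Suc (Suc k))" and b: "b \<in> Co B (Suc k)" and zb: "(\<lambda>l. \<alpha> (z l)) = D B N b"
  have zC: "z \<in> Co A (Suc (Suc k))" using z by (simp add: Z_iff)
  have "D C N (\<lambda>l. \<beta> (b l)) = (\<lambda>_. \<zero>\<^bsub>C\<^esub>)"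
    unfolding \<beta>_rules(2)[OF b] zb[symmetric] using \<beta>\<alpha> Co_closed[OF mA zC] by blast
  then have "(\<lambda>l. \<beta> (b l)) \<in> Z C N (Suc k)" using \<beta>_rules(1)[OF b] by (simp add: Z_iff)
  then obtain t d y b' where t: "t \<in> carrier R - P" and y: "y \<in> Z B (N + d) (Suc k)" and b': "b' \<in> Co C k"
    "T C d t (\<lambda>l. \<beta> (b l)) = (\<lambda>l. \<beta> (y l) \<oplus>\<^bsub>C\<^esub> D C (N + d) b' l)"
    using assms[unfolded surj_at_def] by blast
  have tR: "t \<in> carrier R" using t by blast
  have yC: "y \<in> Co B (Suc k)" and y0: "D B (N + d) y = (\<lambda>_. \<zero>\<^bsub>B\<^esub>)" using y by (auto simp: Z_iff)
  note Tb = T_Co[OF mB b tR, of d]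
  let ?b = "\<lambda>l. T B d t b l \<ominus>\<^bsub>B\<^esub> y l"
  have bC: "?b \<in> Co B (Suc k)" by (rule mB.cochains_minus[OF Tb yC])
  have "(\<lambda>l. \<beta> (?b l)) = D C (N + d) b'"
  proof
    fix l
    have "\<beta> (T B d t b l) = \<beta> (y l) \<oplus>\<^bsub>C\<^esub> D C (N + d) b' l"
      using fun_cong[OF b'(2), of l] unfolding \<beta>_rules(3)[OF b tR] .
    then show "\<beta> (?b l) = D C (N + d) b' l"
      using C_rules(4)[OF D_Co[OF mC b'(1)]] module_hom_closed[OF \<beta>] Co_closed[OF mB yC] Co_closed[OF mB Tb]
      by (simp add: module_hom_minus[OF mB mC \<beta>] mC.M.add_minus_cancel)
  qed
  then obtain w where w: "w \<in> Co A (Suc k)" "D B (N + d) ?b = (\<lambda>l. \<alpha> (D A (N + d) w l))"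
    by (rule from_A[OF bC b'(1)]) (rule that)
  have "D B (N + d) ?b = (\<lambda>l. T B d t (\<lambda>l. \<alpha> (z l)) l)"
    unfolding D_minus[OF mB Tb yC] D_T[OF mB b tR] y0 zb
    by (rule ext) (simp add: mB.M.minus_eq mB.M.neg_zero Co_closed[OF mB T_Co[OF mB D_Co[OF mB b] tR]])
  then have "T A d t z = D A (N + d) w"
    using w(2) unfolding \<alpha>_rules(3)[OF zC tR]
    by (intro \<alpha>_eqD[OF T_Co[OF mA zC tR] D_Co[OF mA w(1)]]) metis
  then show "\<exists>t\<in>carrier R - P. \<exists>d. \<exists>y\<in>Co A (Suc k). T A d t z = D A (N + d) y"
    using t w(1) by blast
qed

lemma surj_at_vanishes: assumes "vanishes_at P C k" shows "surj_at P B C \<beta> k"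
  unfolding surj_at_def
proof (intro allI ballI)
  fix N c assume "c \<in> Z C N (Suc k)"
  then obtain t d b where t: "t \<in> carrier R - P" and b: "b \<in> Co C k" "T C d t c = D C (N + d) b"
    using assms[unfolded vanishes_at_def] by blast
  have z: "(\<lambda>_. \<zero>\<^bsub>B\<^esub>) \<in> Z B (N + d) (Suc k)"
    by (simp add: Z_iff D_zero[OF mB] mB.cochains_iff)
  have eq: "T C d t c = (\<lambda>l. \<beta> \<zero>\<^bsub>B\<^esub> \<oplus>\<^bsub>C\<^esub> D C (N + d) b l)"
    using C_rules(4)[OF D_Co[OF mC b(1)]] by (simp add: module_hom_zero[OF mB mC \<beta>] b(2))
  show "\<exists>t\<in>carrier R - P. \<exists>d. \<exists>z\<in>Z B (N + d) (Suc k). \<exists>b\<in>Co C k.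
      T C d t c = (\<lambda>l. \<beta> (z l) \<oplus>\<^bsub>C\<^esub> D C (N + d) b l)"
    by (rule bexI[OF _ t], rule exI[of _ d], rule bexI[OF _ z], rule bexI[OF _ b(1)], rule eq)
qed

lemma quotient_vanishes_iff: "vanishes_at P C k \<longleftrightarrow> surj_at P A B \<alpha> k \<and> inj_at P A B \<alpha> (Suc k)"
  using vanishes_quotient surj_of_vanishes inj_of_surj surj_at_vanishes by blast

text \<open>Dimension shift: where the cohomology of B vanishes in degree k + 1, that of A is the
  cokernel of \<beta> in degree k.\<close>

lemma submodule_vanishes_iff:
  assumes B: "\<And>N c. c \<in> Z B N (Suc (Suc k)) \<Longrightarrow> \<exists>d. \<exists>b\<in>Co B (Suc k). T B d \<one> c = D B (N + d) b"
  shows "vanishes_at P A (Suc k) \<longleftrightarrow> surj_at P B C \<beta> k"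
proof
  assume van: "vanishes_at P A (Suc k)"
  show "surj_at P B C \<beta> k" unfolding surj_at_def
  proof (intro allI ballI)
    fix N c assume c: "c \<in> Z C N (Suc k)"
    obtain b z where b: "b \<in> Co B (Suc k)" "c = (\<lambda>l. \<beta> (b l))"
      and z: "z \<in> Z A N (Suc (Suc k))" "D B N b = (\<lambda>l. \<alpha> (z l))" by (rule connecting[OF c])
    obtain t d y where t: "t \<in> carrier R - P" and y: "y \<in> Co A (Suc k)" "T A d t z = D A (N + d) y"
      using van[unfolded vanishes_at_def] z(1) by blast
    have tR: "t \<in> carrier R" using t by blast
    have zC: "z \<in> Co A (Suc (Suc k))" using z(1) by (simp add: Z_iff)
    let ?b = "\<lambda>l. T B d t b l \<ominus>\<^bsub>B\<^esub> \<alpha> (y l)"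
    note cc = connecting_correct[OF b(1) zC z(2) y tR]
    have zero: "(\<lambda>_. \<zero>\<^bsub>C\<^esub>) \<in> Co C k" by (simp add: mC.cochains_iff)
    have cC: "c \<in> Co C (Suc k)" using c by (simp add: Z_iff)
    have eq: "T C d t c = (\<lambda>l. \<beta> (?b l) \<oplus>\<^bsub>C\<^esub> D C (N + d) (\<lambda>_. \<zero>\<^bsub>C\<^esub>) l)"
      using fun_cong[OF cc(2)] Co_closed[OF mC T_Co[OF mC cC tR]] by (simp add: D_zero[OF mC] b(2))
    show "\<exists>t\<in>carrier R - P. \<exists>d. \<exists>z\<in>Z B (N + d) (Suc k). \<exists>b\<in>Co C k.
        T C d t c = (\<lambda>l. \<beta> (z l) \<oplus>\<^bsub>C\<^esub> D C (N + d) b l)"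
      by (rule bexI[OF _ t], rule exI[of _ d], rule bexI[OF _ cc(1)], rule bexI[OF _ zero], rule eq)
  qed
next
  assume surj: "surj_at P B C \<beta> k"
  show "vanishes_at P A (Suc k)" unfolding vanishes_at_def
  proof (intro allI ballI)
    fix N z assume z: "z \<in> Z A N (Suc (Suc k))"
    then have zC: "z \<in> Co A (Suc (Suc k))" by (simp add: Z_iff)
    have "(\<lambda>l. \<alpha> (z l)) \<in> Z B N (Suc (Suc k))"
      using z \<alpha>_rules(1,2)[OF zC] by (simp add: Z_iff module_hom_zero[OF mA mB \<alpha>])
    then obtain d b where b: "b \<in> Co B (Suc k)" "T B d \<one> (\<lambda>l. \<alpha> (z l)) = D B (N + d) b"
      using B by blast
    then have "(\<lambda>l. \<alpha> (T A d \<one> z l)) = D B (N + d) b" using \<alpha>_rules(3)[OF zC] by simp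
    moreover have "T A d \<one> z \<in> Z A (N + d) (Suc (Suc k))" by (rule T_Z[OF mA z]) simp
    ultimately obtain t' d' y where t': "t' \<in> carrier R - P" and y: "y \<in> Co A (Suc k)"
      "T A d' t' (T A d \<one> z) = D A (N + d + d') y"
      using inj_of_surj[OF surj, unfolded inj_at_def] b(1) by blast
    then have "T A (d + d') t' z = D A (N + (d + d')) y" using T_T[OF mA zC, of \<one> t'] by (simp add: add.assoc)
    then show "\<exists>t\<in>carrier R - P. \<exists>d. \<exists>b\<in>Co A (Suc k). T A d t z = D A (N + d) b"
      using t' y(1) by blast
  qed
qed

end

section \<open>Frobenius descent\<close>

lemma (in koszul) Co_semilinear:
  assumes "module R M" "module R L" "semilinear R M L a b h" "c \<in> Co M k"
  shows "(\<lambda>l. h (c l)) \<in> Co L k"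
proof -
  have "h (c l) \<in> carrier L" for l
    using assms(3) Co_closed[OF assms(1,4)] by (auto simp: semilinear_def)
  then show ?thesis using assms(4) semilinear_zero[OF assms(1-3)]
    unfolding module.cochains_iff[OF assms(1)] module.cochains_iff[OF assms(2)] by metis
qed

lemma (in koszul) Z_semilinear:
  assumes "module R M" "module R L" "semilinear R M L a b h" "c \<in> Z M (N * a) k"
  shows "(\<lambda>l. h (c l)) \<in> Z L (N * b) k"
  using Co_semilinear[OF assms(1-3)] kdiff_semilinear[OF assms(1-3) xs, of c N] assms(4) Co_closed[OF assms(1)]
    semilinear_zero[OF assms(1-3)]
  by (fastforce simp: Z_iff)

section \<open>Cochains over R whose class is divisible\<close>

context koszul
begin

abbreviation S :: "('a, 'a) module" where "S \<equiv> self_module R"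

lemma S_module: "module R S" by (rule module_self_module[OF is_cring])

sublocale S: module R S by (rule S_module)

lemma Co_fun_mod: "Co M k = carrier (fun_mod M {l. length l = length xs \<and> Suc (count_list l True) = k})"
  by (simp add: cochains_def)

abbreviation F :: "nat \<Rightarrow> ('a, bool list \<Rightarrow> 'a) module" where
  "F k \<equiv> fun_mod S {l. length l = length xs \<and> Suc (count_list l True) = k}"

lemma submodule_F_iff: "submodule U R (F k) \<longleftrightarrow> U \<subseteq> Co S k \<and> (\<lambda>_. \<zero>) \<in> U \<and>
    (\<forall>c\<in>U. \<forall>c'\<in>U. (\<lambda>l. c l \<oplus> c' l) \<in> U) \<and> (\<forall>a\<in>carrier R. \<forall>c\<in>U. (\<lambda>l. a \<otimes> c l) \<in> U)"
  unfolding module.submodule_iff[OF module_fun_mod[OF S_module]] Co_fun_mod fun_mod_simps(2-4) by simp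

lemma noeth_F: "noetherian_ring R \<Longrightarrow> noeth R (F k)"
  by (intro noeth_fun_mod noeth_self_module is_cring, assumption)
    (rule finite_subset[OF _ finite_lists_length_eq[of "UNIV :: bool set" "length xs"]], auto)

lemma Z_add: "c \<in> Z S N k \<Longrightarrow> c' \<in> Z S N k \<Longrightarrow> (\<lambda>l. c l \<oplus> c' l) \<in> Z S N k"
  using S.cochains_add[of c xs k c'] D_add[OF S_module, of c k c' N] by (simp add: Z_iff)

lemma Z_smult: "c \<in> Z S N k \<Longrightarrow> a \<in> carrier R \<Longrightarrow> (\<lambda>l. a \<otimes> c l) \<in> Z S N k"
  using S.cochains_smult[of c xs k "\<lambda>_. a"] D_smult[OF S_module, of c k a N] by (simp add: Z_iff)

lemma Z_zero: "(\<lambda>_. \<zero>) \<in> Z S N k"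
  using D_zero[OF S_module, of N] by (simp add: Z_iff S.cochains_iff)

lemma Z_submodule: "submodule (Z S N k) R (F k)"
  unfolding submodule_F_iff using Z_add Z_smult Z_zero by (auto simp: Z_iff)

text \<open>Divisibility by g in the colimit over the levels. For g = 0 these are the cochains that
  become coboundaries at a later level, so surjectivity and injectivity of a multiplication are
  handled by one notion.\<close>

definition divisible_classes :: "'a \<Rightarrow> nat \<Rightarrow> nat \<Rightarrow> (bool list \<Rightarrow> 'a) set" where
  "divisible_classes g k N = {c \<in> Co S (Suc k). \<exists>d. \<exists>z\<in>Z S (N + d) (Suc k). \<exists>b\<in>Co S k.
     T S d \<one> c = (\<lambda>l. g \<otimes> z l \<oplus> D S (N + d) b l)}"

lemma divisibleI:
  assumes "T S d \<one> c = (\<lambda>l. g \<otimes> z l \<oplus> D S (N + d) b l)" "z \<in> Z S (N + d) (Suc k)" "b \<in> Co S k" "c \<in> Co S (Suc k)"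
  shows "c \<in> divisible_classes g k N"
  unfolding divisible_classes_def
  by (rule CollectI, rule conjI[OF assms(4)], rule exI[of _ d], rule bexI[OF _ assms(2)], rule bexI[OF _ assms(3)],
      rule assms(1))

text \<open>Witnesses are moved to a later level, so that two of them can be added at a common
  one.\<close>

lemma divisible_raise:
  assumes "g \<in> carrier R" "c \<in> Co S (Suc k)" "z \<in> Z S (N + d) (Suc k)" "b \<in> Co S k"
    and "T S d t c = (\<lambda>l. g \<otimes> z l \<oplus> D S (N + d) b l)" "t \<in> carrier R" "s \<in> carrier R" "d' \<ge> d"
  shows "\<exists>z'\<in>Z S (N + d') (Suc k). \<exists>b'\<in>Co S k. T S d' (t \<otimes> s) c = (\<lambda>l. g \<otimes> z' l \<oplus> D S (N + d') b' l)"
proof -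
  obtain j where j: "d' = d + j" using assms(8) le_Suc_ex by blast
  have z: "z \<in> Co S (Suc k)" using assms(3) by (simp add: Z_iff)
  have gz: "(\<lambda>l. g \<otimes> z l) \<in> Co S (Suc k)" using S.cochains_smult[OF z, of "\<lambda>_. g"] assms(1) by simp
  have "T S j s (T S d t c) = (\<lambda>l. T S j s (\<lambda>l. g \<otimes> z l) l \<oplus> T S j s (D S (N + d) b) l)"
    unfolding assms(5) using T_add[OF S_module gz D_Co[OF S_module assms(4)] assms(7)] by simp
  also have "\<dots> = (\<lambda>l. g \<otimes> T S j s z l \<oplus> D S (N + d') (T S j s b) l)"
    using T_smult[OF S_module z assms(1,7), of j] D_T[OF S_module assms(4,7), of "N + d" j] by (simp add: j add.assoc)
  finally have "T S d' (t \<otimes> s) c = (\<lambda>l. g \<otimes> T S j s z l \<oplus> D S (N + d') (T S j s b) l)"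
    unfolding T_T[OF S_module assms(2,6,7)] j .
  moreover have "T S j s z \<in> Z S (N + d') (Suc k)" using T_Z[OF S_module assms(3,7)] by (simp add: j add.assoc)
  ultimately show ?thesis using T_Co[OF S_module assms(4,7)] by blast
qed

lemma divisible_submodule:
  assumes g: "g \<in> carrier R" shows "submodule (divisible_classes g k N) R (F (Suc k))"
  unfolding submodule_F_iff
proof (intro conjI ballI)
  show "divisible_classes g k N \<subseteq> Co S (Suc k)" by (auto simp: divisible_classes_def)
  have z: "(\<lambda>_. \<zero>) \<in> Z S (N + 0) (Suc k)" "(\<lambda>_. \<zero>) \<in> Co S k" for k
    by (rule Z_zero) (simp add: S.cochains_iff)
  have eq: "T S 0 \<one> (\<lambda>_. \<zero>) = (\<lambda>l. g \<otimes> \<zero> \<oplus> D S (N + 0) (\<lambda>_. \<zero>) l)"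
    using T_zero[OF S_module one_closed, of 0] D_zero[OF S_module, of "N + 0"] g by simp
  show "(\<lambda>_. \<zero>) \<in> divisible_classes g k N"
    by (rule divisibleI[OF eq z z(2)])
next
  fix a c assume a: "a \<in> carrier R" and "c \<in> divisible_classes g k N"
  then obtain d z b where c: "c \<in> Co S (Suc k)" and z: "z \<in> Z S (N + d) (Suc k)" and b: "b \<in> Co S k"
    "T S d \<one> c = (\<lambda>l. g \<otimes> z l \<oplus> D S (N + d) b l)" unfolding divisible_classes_def by blast
  have zC: "z \<in> Co S (Suc k)" using z by (simp add: Z_iff)
  have "T S d \<one> (\<lambda>l. a \<otimes> c l) = (\<lambda>l. g \<otimes> (a \<otimes> z l) \<oplus> D S (N + d) (\<lambda>l. a \<otimes> b l) l)"
    using T_smult[OF S_module c a one_closed, of d] D_smult[OF S_module b(1) a, of "N + d"]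
      Co_closed[OF S_module zC] Co_closed[OF S_module D_Co[OF S_module b(1)]] a g
    by (simp add: b(2) r_distr m_lcomm)
  moreover have "(\<lambda>l. a \<otimes> z l) \<in> Z S (N + d) (Suc k)" by (rule Z_smult[OF z a])
  moreover have "(\<lambda>l. a \<otimes> b l) \<in> Co S k" "(\<lambda>l. a \<otimes> c l) \<in> Co S (Suc k)"
    using S.cochains_smult[OF b(1), of "\<lambda>_. a"] S.cochains_smult[OF c, of "\<lambda>_. a"] a by auto
  ultimately show "(\<lambda>l. a \<otimes> c l) \<in> divisible_classes g k N" by (rule divisibleI)
next
  fix c c' assume "c \<in> divisible_classes g k N" "c' \<in> divisible_classes g k N"
  then obtain d z b d' z' b' where c: "c \<in> Co S (Suc k)" and z: "z \<in> Z S (N + d) (Suc k)" and b: "b \<in> Co S k"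
    "T S d \<one> c = (\<lambda>l. g \<otimes> z l \<oplus> D S (N + d) b l)"
    and c': "c' \<in> Co S (Suc k)" and z': "z' \<in> Z S (N + d') (Suc k)" and b': "b' \<in> Co S k"
    "T S d' \<one> c' = (\<lambda>l. g \<otimes> z' l \<oplus> D S (N + d') b' l)" unfolding divisible_classes_def by blast
  let ?d = "d + d'"
  obtain y e where y: "y \<in> Z S (N + ?d) (Suc k)" and e: "e \<in> Co S k"
    "T S ?d \<one> c = (\<lambda>l. g \<otimes> y l \<oplus> D S (N + ?d) e l)"
    using divisible_raise[OF g c z b one_closed one_closed, of ?d] by auto
  obtain y' e' where y': "y' \<in> Z S (N + ?d) (Suc k)" and e': "e' \<in> Co S k"
    "T S ?d \<one> c' = (\<lambda>l. g \<otimes> y' l \<oplus> D S (N + ?d) e' l)"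
    using divisible_raise[OF g c' z' b' one_closed one_closed, of ?d] by auto
  have yC: "y \<in> Co S (Suc k)" "y' \<in> Co S (Suc k)" using y y' by (auto simp: Z_iff)
  have "T S ?d \<one> (\<lambda>l. c l \<oplus> c' l) = (\<lambda>l. g \<otimes> (y l \<oplus> y' l) \<oplus> D S (N + ?d) (\<lambda>l. e l \<oplus> e' l) l)"
    using T_add[OF S_module c c' one_closed, of ?d] D_add[OF S_module e(1) e'(1), of "N + ?d"] g
      Co_closed[OF S_module yC(1)] Co_closed[OF S_module yC(2)]
      Co_closed[OF S_module D_Co[OF S_module e(1)]] Co_closed[OF S_module D_Co[OF S_module e'(1)]]
    by (simp add: e(2) e'(2) r_distr a_ac)
  moreover have "(\<lambda>l. y l \<oplus> y' l) \<in> Z S (N + ?d) (Suc k)" by (rule Z_add[OF y y'])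
  moreover have "(\<lambda>l. e l \<oplus> e' l) \<in> Co S k" "(\<lambda>l. c l \<oplus> c' l) \<in> Co S (Suc k)"
    using S.cochains_add[OF e(1) e'(1)] S.cochains_add[OF c c'] by auto
  ultimately show "(\<lambda>l. c l \<oplus> c' l) \<in> divisible_classes g k N" by (rule divisibleI)
qed

text \<open>A multiple g z = g1^a z is sent to g1^b h z, again a multiple of g. Level M a
  corresponds to level M b under h, and so do the cocycles and coboundaries there.\<close>

lemma divisible_semilinear:
  assumes h: "semilinear R S S a b h" and pos: "a > 0" and g1: "g1 \<in> carrier R" and g2: "g2 \<in> carrier R"
    and ga: "g = g1 [^] a" and gb: "g1 [^] b = g \<otimes> g2"
    and c: "c \<in> divisible_classes g k (M * a)"
  shows "(\<lambda>l. h (c l)) \<in> divisible_classes g k (M * b)"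
proof -
  have g: "g \<in> carrier R" using ga g1 by simp
  obtain d z b0 where c: "c \<in> Co S (Suc k)" and z: "z \<in> Z S (M * a + d) (Suc k)" and b0: "b0 \<in> Co S k"
    "T S d \<one> c = (\<lambda>l. g \<otimes> z l \<oplus> D S (M * a + d) b0 l)" using c unfolding divisible_classes_def by blast
  \<comment> \<open>The witness is raised to level M a + d a = (M + d) a, since h relates multiples
    of a to multiples of b.\<close>
  have "d \<le> d * a" using pos by simp
  then obtain z' b' where z': "z' \<in> Z S (M * a + d * a) (Suc k)" and b': "b' \<in> Co S k"
    "T S (d * a) \<one> c = (\<lambda>l. g \<otimes> z' l \<oplus> D S (M * a + d * a) b' l)"
    using divisible_raise[OF g c z b0 one_closed one_closed, of "d * a"] by auto
  have m: "M * a + d * a = (M + d) * a" "M * b + d * b = (M + d) * b" by (simp_all add: add_mult_distrib)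
  have zC: "z' \<in> Co S (Suc k)" using z' by (simp add: Z_iff)
  have hc: "h x \<in> carrier R" if "x \<in> carrier R" for x using h that by (auto simp: semilinear_def)
  have hadd: "h (x \<oplus> y) = h x \<oplus> h y" if "x \<in> carrier R" "y \<in> carrier R" for x y
    using h that by (auto simp: semilinear_def)
  have hg: "h (g \<otimes> x) = g \<otimes> (g2 \<otimes> h x)" if "x \<in> carrier R" for x
  proof -
    have "h (g \<otimes> x) = g1 [^] b \<otimes> h x" using h g1 that unfolding semilinear_def ga by simp
    then show ?thesis using gb g g2 hc[OF that] by (simp add: m_assoc)
  qed
  note cl = Co_closed[OF S_module zC, simplified] Co_closed[OF S_module b'(1), simplified]
    Co_closed[OF S_module D_Co[OF S_module b'(1)], simplified] Co_closed[OF S_module c, simplified]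
  have "T S (d * b) \<one> (\<lambda>l. h (c l)) = (\<lambda>l. h (T S (d * a) \<one> c l))"
    using ktrans_semilinear[OF S_module S_module h xs Co_closed[OF S_module c] one_closed, of d] by simp
  also have "\<dots> = (\<lambda>l. g \<otimes> (g2 \<otimes> h (z' l)) \<oplus> h (D S ((M + d) * a) b' l))"
    unfolding b'(2) m using g cl by (simp add: hadd hg)
  also have "\<dots> = (\<lambda>l. g \<otimes> (g2 \<otimes> h (z' l)) \<oplus> D S (M * b + d * b) (\<lambda>l. h (b' l)) l)"
    unfolding m kdiff_semilinear[OF S_module S_module h xs Co_closed[OF S_module b'(1)]] ..
  finally have "T S (d * b) \<one> (\<lambda>l. h (c l)) = (\<lambda>l. g \<otimes> (g2 \<otimes> h (z' l)) \<oplus> D S (M * b + d * b) (\<lambda>l. h (b' l)) l)" .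
  moreover have hz: "(\<lambda>l. h (z' l)) \<in> Z S (M * b + d * b) (Suc k)"
    using z' unfolding m by (rule Z_semilinear[OF S_module S_module h])
  have "(\<lambda>l. g2 \<otimes> h (z' l)) \<in> Z S (M * b + d * b) (Suc k)" by (rule Z_smult[OF hz g2])
  moreover have "(\<lambda>l. h (b' l)) \<in> Co S k" "(\<lambda>l. h (c l)) \<in> Co S (Suc k)"
    by (rule Co_semilinear[OF S_module S_module h], fact)+
  ultimately show ?thesis by (rule divisibleI)
qed

lemma divisible_unraise:
  assumes c: "c \<in> Co S (Suc k)" and "T S d \<one> c \<in> divisible_classes g k (N + d)"
  shows "c \<in> divisible_classes g k N"
proof -
  obtain d' z b where zb: "z \<in> Z S (N + d + d') (Suc k)" "b \<in> Co S k"
    "T S d' \<one> (T S d \<one> c) = (\<lambda>l. g \<otimes> z l \<oplus> D S (N + d + d') b l)"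
    using assms(2) unfolding divisible_classes_def by blast
  then have "T S (d + d') \<one> c = (\<lambda>l. g \<otimes> z l \<oplus> D S (N + (d + d')) b l)"
    using T_T[OF S_module c one_closed one_closed, of d' d] by (simp add: add.assoc)
  then show ?thesis by (rule divisibleI) (use zb c in \<open>simp_all add: add.assoc\<close>)
qed

end

lemma (in koszul) finsum_in_F_submodule:
  assumes U: "submodule U R (F j)" and u: "\<And>k. k < (n::nat) \<Longrightarrow> u k \<in> U"
  shows "(\<lambda>l. \<Oplus>k\<in>{..<n}. u k l) \<in> U"
  using u
proof (induction n)
  case 0 then show ?case using U by (simp add: submodule_F_iff)
next
  case (Suc n)
  have cl: "u k l \<in> carrier R" if "k < Suc n" for k l
    using Suc.prems[OF that] U Co_closed[OF S_module, of "u k" j] by (auto simp: submodule_F_iff)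
  have "(\<lambda>l. \<Oplus>k\<in>{..<Suc n}. u k l) = (\<lambda>l. u n l \<oplus> (\<Oplus>k\<in>{..<n}. u k l))"
    using cl by (simp add: lessThan_Suc finsum_insert)
  moreover have "(\<lambda>l. \<Oplus>k\<in>{..<n}. u k l) \<in> U" using Suc by auto
  ultimately show ?case using U Suc.prems[of n] unfolding submodule_F_iff by simp
qed

lemma (in koszul) submodule_F_pow_mono:
  assumes "submodule U R (F j)" "\<And>l. c l \<in> carrier R" "t \<in> carrier R" "(\<lambda>l. t [^] (m::nat) \<otimes> c l) \<in> U" "m \<le> m'"
  shows "(\<lambda>l. t [^] m' \<otimes> c l) \<in> U"
proof -
  obtain i where i: "m' = m + i" using assms(5) le_Suc_ex by blast
  have "(\<lambda>l. t [^] i \<otimes> (t [^] m \<otimes> c l)) \<in> U"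
    using assms(1,3,4) unfolding submodule_F_iff by simp
  moreover have "t [^] i \<otimes> (t [^] m \<otimes> c l) = t [^] m' \<otimes> c l" for l
    using assms(2,3) by (simp add: i nat_pow_mult[symmetric] m_ac)
  ultimately show ?thesis by simp
qed

text \<open>
  Since $\sum_k \varphi_k \circ \psi_k = s^{p^{e_0+1}}$, an element of level $p^e$ is controlled by its
  images under the $\psi_k$, which are of lower level. Hence a multiplier for the finitely many levels
  up to $p^{e_0}$ yields one for all levels.
\<close>

lemma (in koszul) frobenius_descent:
  assumes p: "p > (1::nat)"
    and tw: "\<And>k. k < (n::nat) \<Longrightarrow> \<epsilon> k \<le> e0 \<and> twisted_linear R (p ^ Suc e0) (p ^ \<epsilon> k) (\<psi> k) \<and>
      twisted_linear R (p ^ \<epsilon> k) (p ^ Suc e0) (\<phi> k)"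
    and id: "\<And>x. x \<in> carrier R \<Longrightarrow> (\<Oplus>k\<in>{..<n}. \<phi> k (\<psi> k x)) = s [^] (p ^ Suc e0) \<otimes> x"
    and s: "s \<in> carrier R" and t: "t \<in> carrier R"
    and subG: "\<And>N. submodule (G N) R (F j)" and subH: "\<And>N. H N \<subseteq> Co S j"
    and H: "\<And>\<epsilon> h M c. \<epsilon> \<le> e0 \<Longrightarrow> twisted_linear R (p ^ Suc e0) (p ^ \<epsilon>) h \<Longrightarrow> c \<in> H (M * p ^ Suc e0) \<Longrightarrow>
      (\<lambda>l. h (c l)) \<in> H (M * p ^ \<epsilon>)"
    and G: "\<And>\<epsilon> h M c. \<epsilon> \<le> e0 \<Longrightarrow> twisted_linear R (p ^ \<epsilon>) (p ^ Suc e0) h \<Longrightarrow> c \<in> G (M * p ^ \<epsilon>) \<Longrightarrow>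
      (\<lambda>l. h (c l)) \<in> G (M * p ^ Suc e0)"
    and base: "\<And>e c. e \<le> e0 \<Longrightarrow> c \<in> H (p ^ e) \<Longrightarrow> (\<lambda>l. t \<otimes> c l) \<in> G (p ^ e)"
    and c: "c \<in> H (p ^ e)"
  shows "\<exists>m::nat. (\<lambda>l. (t \<otimes> s) [^] m \<otimes> c l) \<in> G (p ^ e)"
  using c
proof (induction e arbitrary: c rule: less_induct)
  case (less e)
  have cl: "c l \<in> carrier R" for l using less.prems subH Co_closed[OF S_module, of c j] by auto
  have ts: "t \<otimes> s \<in> carrier R" using t s by simp
  show ?case
  proof (cases "e \<le> e0")
    case True
    \<comment> \<open>At the low levels t alone works; s is multiplied in to obtain a power of t
      s.\<close>
    have "(\<lambda>l. s \<otimes> (t \<otimes> c l)) \<in> G (p ^ e)"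
      using base[OF True less.prems] subG s by (simp add: submodule_F_iff)
    moreover have "s \<otimes> (t \<otimes> c l) = (t \<otimes> s) [^] (1::nat) \<otimes> c l" for l
      using s t cl by (simp add: m_ac)
    ultimately show ?thesis by (intro exI[of _ 1]) simp
  next
    case False
    define q where "q = p ^ Suc e0"
    \<comment> \<open>p^e is M times p^(e0+1), so \<psi> k lowers the level to M p^(\<epsilon> k), a
      smaller power of p.\<close>
    define M where "M = p ^ (e - Suc e0)"
    have pe: "p ^ e = M * q" using False by (simp add: M_def q_def power_add[symmetric] del: power_Suc)
    have pk: "M * p ^ \<epsilon> k = p ^ (e - Suc e0 + \<epsilon> k)" for k by (simp add: M_def power_add)
    have \<psi>: "\<psi> k x \<in> carrier R" and \<phi>: "\<phi> k x \<in> carrier R" if "k < n" "x \<in> carrier R" for k x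
      using tw[OF that(1)] that(2) by (auto simp: twisted_linear_def)
    have "\<exists>m::nat. (\<lambda>l. (t \<otimes> s) [^] m \<otimes> \<psi> k (c l)) \<in> G (M * p ^ \<epsilon> k)" if k: "k < n" for k
    proof -
      have "(\<lambda>l. \<psi> k (c l)) \<in> H (M * p ^ \<epsilon> k)"
        using H[of "\<epsilon> k" "\<psi> k" c M] tw[OF k] less.prems by (simp add: pe q_def)
      moreover have "e - Suc e0 + \<epsilon> k < e" using tw[OF k] False by auto
      ultimately show ?thesis using less.IH unfolding pk by blast
    qed
    then obtain m :: "nat \<Rightarrow> nat" where m: "\<And>k. k < n \<Longrightarrow> (\<lambda>l. (t \<otimes> s) [^] m k \<otimes> \<psi> k (c l)) \<in> G (M * p ^ \<epsilon> k)"
      by metis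
    \<comment> \<open>One exponent serves all k: entering \<phi> k as m0 p^(\<epsilon> k), it leaves
      as m0 q, independent of k, and can be pulled out of the sum.\<close>
    define m0 where "m0 = (\<Sum>k<n. m k)"
    define u where "u k l = \<phi> k ((t \<otimes> s) [^] (m0 * p ^ \<epsilon> k) \<otimes> \<psi> k (c l))" for k l
    have u: "u k \<in> G (p ^ e)" if k: "k < n" for k
    proof -
      have "m k \<le> m0" unfolding m0_def using k by (intro member_le_sum) auto
      also have "m0 \<le> m0 * p ^ \<epsilon> k" using p by simp
      finally have "(\<lambda>l. (t \<otimes> s) [^] (m0 * p ^ \<epsilon> k) \<otimes> \<psi> k (c l)) \<in> G (M * p ^ \<epsilon> k)"
        by (rule submodule_F_pow_mono[OF subG \<psi>[OF k cl] ts m[OF k]])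
      from G[OF _ _ this, of "\<phi> k"] show ?thesis using tw[OF k] unfolding u_def pe q_def by simp
    qed
    have uk: "u k l = (t \<otimes> s) [^] (m0 * q) \<otimes> \<phi> k (\<psi> k (c l))" if k: "k < n" for k l
    proof -
      have "u k l = \<phi> k (((t \<otimes> s) [^] m0) [^] (p ^ \<epsilon> k) \<otimes> \<psi> k (c l))"
        using ts by (simp add: u_def nat_pow_pow)
      also have "\<dots> = ((t \<otimes> s) [^] m0) [^] q \<otimes> \<phi> k (\<psi> k (c l))"
        using tw[OF k] ts \<psi>[OF k cl] unfolding twisted_linear_def q_def by blast
      finally show ?thesis using ts by (simp add: nat_pow_pow)
    qed
    have "(\<lambda>l. \<Oplus>k\<in>{..<n}. u k l) \<in> G (p ^ e)" by (rule finsum_in_F_submodule[OF subG u])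
    moreover have "(\<Oplus>k\<in>{..<n}. u k l) = (t \<otimes> s) [^] (m0 * q) \<otimes> (s [^] q \<otimes> c l)" for l
    proof -
      have "(\<Oplus>k\<in>{..<n}. u k l) = (\<Oplus>k\<in>{..<n}. (t \<otimes> s) [^] (m0 * q) \<otimes> \<phi> k (\<psi> k (c l)))"
        by (rule finsum_cong') (use uk ts \<phi> \<psi> cl in auto)
      also have "\<dots> = (t \<otimes> s) [^] (m0 * q) \<otimes> (\<Oplus>k\<in>{..<n}. \<phi> k (\<psi> k (c l)))"
        by (rule finsum_rdistr[symmetric]) (use ts \<phi> \<psi> cl in auto)
      finally show ?thesis using id[OF cl] by (simp add: q_def)
    qed
    \<comment> \<open>The splitting contributes s^q; t^q is multiplied in to complete a power of t
      s.\<close>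
    ultimately have "(\<lambda>l. t [^] q \<otimes> ((t \<otimes> s) [^] (m0 * q) \<otimes> (s [^] q \<otimes> c l))) \<in> G (p ^ e)"
      using subG t by (simp add: submodule_F_iff)
    moreover have "t [^] q \<otimes> ((t \<otimes> s) [^] (m0 * q) \<otimes> (s [^] q \<otimes> c l)) = (t \<otimes> s) [^] (m0 * q + q) \<otimes> c l" for l
      using t s ts cl by (simp add: nat_pow_mult[symmetric] nat_pow_distrib m_ac)
    ultimately show ?thesis by (intro exI[of _ "m0 * q + q"]) simp
  qed
qed

section \<open>Surjectivity and injectivity in terms of divisible classes\<close>

context koszul
begin

lemma T_one_smult: "c \<in> Co S k \<Longrightarrow> t \<in> carrier R \<Longrightarrow> T S d \<one> (\<lambda>l. t \<otimes> c l) = T S d t c"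
  using T_smult[OF S_module, of c k t \<one> d] T_scalar[OF S_module, of c k t d] by simp

lemma divisible_closed: "c \<in> divisible_classes g k N \<Longrightarrow> c \<in> Co S (Suc k)"
  by (simp add: divisible_classes_def)

lemma divisible_smult: "g \<in> carrier R \<Longrightarrow> c \<in> divisible_classes g k N \<Longrightarrow> a \<in> carrier R \<Longrightarrow>
    (\<lambda>l. a \<otimes> c l) \<in> divisible_classes g k N"
  using divisible_submodule[of g k N, unfolded submodule_F_iff] by simp

lemma divisible_add: "g \<in> carrier R \<Longrightarrow> c \<in> divisible_classes g k N \<Longrightarrow> c' \<in> divisible_classes g k N \<Longrightarrow>
    (\<lambda>l. c l \<oplus> c' l) \<in> divisible_classes g k N"
  using divisible_submodule[of g k N, unfolded submodule_F_iff] by simp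

lemma divisible_boundary: 
  assumes "g \<in> carrier R" "b \<in> Co S k" shows "D S N b \<in> divisible_classes g k N"
proof (rule divisibleI[where d = 0, OF _ Z_zero assms(2) D_Co[OF S_module assms(2)]])
  show "T S 0 \<one> (D S N b) = (\<lambda>l. g \<otimes> \<zero> \<oplus> D S (N + 0) b l)"
    using T_0[OF S_module D_Co[OF S_module assms(2)], of N] assms(1)
      Co_closed[OF S_module D_Co[OF S_module assms(2)]] by simp
qed

lemma divisible_cocycle:
  assumes "g \<in> carrier R" "z \<in> Z S N (Suc k)" shows "(\<lambda>l. g \<otimes> z l) \<in> divisible_classes g k N"
proof -
  have z: "z \<in> Co S (Suc k)" "(\<lambda>_. \<zero>) \<in> Co S k" using assms(2) by (auto simp: Z_iff S.cochains_iff)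
  have gz: "(\<lambda>l. g \<otimes> z l) \<in> Co S (Suc k)" using Z_smult[OF assms(2,1)] by (simp add: Z_iff)
  show ?thesis
  proof (rule divisibleI[where d = 0 and z = z, OF _ _ z(2) gz])
    show "T S 0 \<one> (\<lambda>l. g \<otimes> z l) = (\<lambda>l. g \<otimes> z l \<oplus> D S (N + 0) (\<lambda>_. \<zero>) l)"
      using T_0[OF S_module gz] D_zero[OF S_module, of N] assms(1) Co_closed[OF S_module z(1)] by simp
  qed (use assms in simp)
qed

lemma divisible_mult:
  assumes "f \<in> carrier R" "g \<in> carrier R" "c \<in> divisible_classes g k N"
  shows "(\<lambda>l. f \<otimes> c l) \<in> divisible_classes (f \<otimes> g) k N"
proof -
  obtain d z b where c: "c \<in> Co S (Suc k)" and z: "z \<in> Z S (N + d) (Suc k)" and b: "b \<in> Co S k"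
    "T S d \<one> c = (\<lambda>l. g \<otimes> z l \<oplus> D S (N + d) b l)" using assms(3) unfolding divisible_classes_def by blast
  have zC: "z \<in> Co S (Suc k)" using z by (simp add: Z_iff)
  have fc: "(\<lambda>l. f \<otimes> c l) \<in> Co S (Suc k)" "(\<lambda>l. f \<otimes> b l) \<in> Co S k"
    using S.cochains_smult[OF c, of "\<lambda>_. f"] S.cochains_smult[OF b(1), of "\<lambda>_. f"] assms(1) by auto
  have "T S d \<one> (\<lambda>l. f \<otimes> c l) = (\<lambda>l. f \<otimes> g \<otimes> z l \<oplus> D S (N + d) (\<lambda>l. f \<otimes> b l) l)"
    using T_smult[OF S_module c assms(1) one_closed, of d] D_smult[OF S_module b(1) assms(1), of "N + d"]
      Co_closed[OF S_module zC] Co_closed[OF S_module D_Co[OF S_module b(1)]] assms(1,2)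
    by (simp add: b(2) r_distr m_assoc)
  then show ?thesis by (rule divisibleI[OF _ z fc(2) fc(1)])
qed

lemma divisible_weaken:
  assumes "f \<in> carrier R" "g \<in> carrier R" "c \<in> divisible_classes (f \<otimes> g) k N"
  shows "c \<in> divisible_classes f k N"
proof -
  obtain d z b where c: "c \<in> Co S (Suc k)" and z: "z \<in> Z S (N + d) (Suc k)" and b: "b \<in> Co S k"
    "T S d \<one> c = (\<lambda>l. f \<otimes> g \<otimes> z l \<oplus> D S (N + d) b l)" using assms(3) unfolding divisible_classes_def by blast
  have "z l \<in> carrier R" for l using z Co_closed[OF S_module, of z "Suc k"] by (simp add: Z_iff)
  then have "T S d \<one> c = (\<lambda>l. f \<otimes> (g \<otimes> z l) \<oplus> D S (N + d) b l)" using b(2) assms(1,2) by (simp add: m_assoc)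
  then show ?thesis by (rule divisibleI[OF _ Z_smult[OF z assms(2)] b(1) c])
qed

lemma divisible_T:
  assumes "g \<in> carrier R" "c \<in> divisible_classes g k N" shows "T S j \<one> c \<in> divisible_classes g k (N + j)"
proof -
  obtain d z b where c: "c \<in> Co S (Suc k)" and z: "z \<in> Z S (N + d) (Suc k)" and b: "b \<in> Co S k"
    "T S d \<one> c = (\<lambda>l. g \<otimes> z l \<oplus> D S (N + d) b l)" using assms(2) unfolding divisible_classes_def by blast
  obtain z' b' where z': "z' \<in> Z S (N + (j + d)) (Suc k)" and b': "b' \<in> Co S k"
    "T S (j + d) \<one> c = (\<lambda>l. g \<otimes> z' l \<oplus> D S (N + (j + d)) b' l)"
    using divisible_raise[OF assms(1) c z b one_closed one_closed, of "j + d"] by auto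
  have "T S d \<one> (T S j \<one> c) = (\<lambda>l. g \<otimes> z' l \<oplus> D S (N + j + d) b' l)"
    using T_T[OF S_module c one_closed one_closed, of d j] b'(2) by (simp add: add.assoc)
  then show ?thesis
    by (rule divisibleI) (use z' b' T_Co[OF S_module c] in \<open>simp_all add: add.assoc\<close>)
qed

lemma surj_at_iff:
  "surj_at P S S (\<lambda>x. f \<otimes> x) k \<longleftrightarrow>
    (\<forall>N. \<forall>c\<in>Z S N (Suc k). \<exists>t\<in>carrier R - P. (\<lambda>l. t \<otimes> c l) \<in> divisible_classes f k N)"
proof -
  have "(\<exists>d. \<exists>z\<in>Z S (N + d) (Suc k). \<exists>b\<in>Co S k. T S d t c = (\<lambda>l. f \<otimes> z l \<oplus> D S (N + d) b l)) \<longleftrightarrow>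
      (\<lambda>l. t \<otimes> c l) \<in> divisible_classes f k N" if c: "c \<in> Z S N (Suc k)" and t: "t \<in> carrier R - P" for N c t
  proof -
    have "c \<in> Co S (Suc k)" "(\<lambda>l. t \<otimes> c l) \<in> Co S (Suc k)" using c t Z_smult[OF c, of t] by (auto simp: Z_iff)
    then show ?thesis using t by (simp add: divisible_classes_def T_one_smult)
  qed
  then show ?thesis unfolding surj_at_def self_module_simps by (intro iff_allI ball_cong bex_cong refl)
qed

end

context koszul
begin

lemma inj_at_iff:
  assumes f: "f \<in> carrier R"
  shows "inj_at P S S (\<lambda>x. f \<otimes> x) k \<longleftrightarrow> (\<forall>N. \<forall>z\<in>Z S N (Suc k). (\<lambda>l. f \<otimes> z l) \<in> divisible_classes \<zero> k N \<longrightarrow>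
    (\<exists>t\<in>carrier R - P. (\<lambda>l. t \<otimes> z l) \<in> divisible_classes \<zero> k N))" (is "?L \<longleftrightarrow> ?R")
proof -
  have null_iff: "c \<in> divisible_classes \<zero> k N \<longleftrightarrow> (\<exists>d. \<exists>b\<in>Co S k. T S d \<one> c = D S (N + d) b)"
    if c: "c \<in> Co S (Suc k)" for c N
  proof
    assume "c \<in> divisible_classes \<zero> k N"
    then obtain d z b where z: "z \<in> Z S (N + d) (Suc k)" and b: "b \<in> Co S k"
      "T S d \<one> c = (\<lambda>l. \<zero> \<otimes> z l \<oplus> D S (N + d) b l)" unfolding divisible_classes_def by blast
    have "z \<in> Co S (Suc k)" using z by (simp add: Z_iff)
    then have "T S d \<one> c = D S (N + d) b"
      using b(2) Co_closed[OF S_module, of z "Suc k"] Co_closed[OF S_module D_Co[OF S_module b(1)]] by simp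
    then show "\<exists>d. \<exists>b\<in>Co S k. T S d \<one> c = D S (N + d) b" using b(1) by blast
  next
    assume "\<exists>d. \<exists>b\<in>Co S k. T S d \<one> c = D S (N + d) b"
    then obtain d b where b: "b \<in> Co S k" "T S d \<one> c = D S (N + d) b" by blast
    then have "T S d \<one> c = (\<lambda>l. \<zero> \<otimes> \<zero> \<oplus> D S (N + d) b l)"
      using Co_closed[OF S_module D_Co[OF S_module b(1)]] by simp
    then show "c \<in> divisible_classes \<zero> k N" by (rule divisibleI[OF _ Z_zero b(1) c])
  qed
  show ?thesis
  proof
    assume L: ?L
    show ?R
    proof (intro allI ballI impI)
      fix N z assume z: "z \<in> Z S N (Suc k)" and fz: "(\<lambda>l. f \<otimes> z l) \<in> divisible_classes \<zero> k N"
      have zC: "z \<in> Co S (Suc k)" using z by (simp add: Z_iff)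
      obtain d b where b: "b \<in> Co S k" "T S d \<one> (\<lambda>l. f \<otimes> z l) = D S (N + d) b"
        using iffD1[OF null_iff[OF divisible_closed[OF fz]] fz] by blast
      \<comment> \<open>\<open>inj_at\<close> speaks of a coboundary at the level of the cocycle
        itself, so z is first raised to the level where f z bounds.\<close>
      have eq: "(\<lambda>l. f \<otimes> T S d \<one> z l) = D S (N + d) b" using b(2) T_smult[OF S_module zC f one_closed, of d] by simp
      obtain t d' y where t: "t \<in> carrier R - P" and y: "y \<in> Co S k" "T S d' t (T S d \<one> z) = D S (N + d + d') y"
        using L[unfolded inj_at_def, rule_format, OF T_Z[OF S_module z one_closed] b(1) eq] by blast
      have tz: "(\<lambda>l. t \<otimes> z l) \<in> Co S (Suc k)" using Z_smult[OF z, of t] t by (simp add: Z_iff)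
      have "T S (d + d') \<one> (\<lambda>l. t \<otimes> z l) = D S (N + (d + d')) y"
        using y(2) T_T[OF S_module zC one_closed, of t d' d] t by (simp add: T_one_smult[OF zC] add.assoc)
      then have "(\<lambda>l. t \<otimes> z l) \<in> divisible_classes \<zero> k N"
        by (intro iffD2[OF null_iff[OF tz]] exI bexI[OF _ y(1)])
      then show "\<exists>t\<in>carrier R - P. (\<lambda>l. t \<otimes> z l) \<in> divisible_classes \<zero> k N" using t by (rule bexI)
    qed
  next
    assume R: ?R
    show ?L unfolding inj_at_def
    proof (intro allI ballI impI)
      fix N z b assume z: "z \<in> Z S N (Suc k)" and b: "b \<in> Co S k" "(\<lambda>l. f \<otimes> z l) = D S N b"
      have zC: "z \<in> Co S (Suc k)" using z by (simp add: Z_iff)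
      have "(\<lambda>l. f \<otimes> z l) \<in> divisible_classes \<zero> k N" unfolding b(2) by (rule divisible_boundary[OF zero_closed b(1)])
      then obtain t where t: "t \<in> carrier R - P" "(\<lambda>l. t \<otimes> z l) \<in> divisible_classes \<zero> k N" using R z by blast
      obtain d y where y: "y \<in> Co S k" "T S d \<one> (\<lambda>l. t \<otimes> z l) = D S (N + d) y"
        using iffD1[OF null_iff[OF divisible_closed[OF t(2)]] t(2)] by blast
      then have "T S d t z = D S (N + d) y" using T_one_smult[OF zC, of t d] t(1) by simp
      then show "\<exists>t\<in>carrier R - P. \<exists>d. \<exists>y\<in>Co S k. T S d t z = D S (N + d) y"
        using t(1) y(1) by blast
    qed
  qed
qed

text \<open>Once t c is f z plus a coboundary, at a later level, the induction hypothesis applies to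
  z; the multipliers accumulate outside P.\<close>

lemma surj_at_power:
  assumes f: "f \<in> carrier R" and P: "primeideal P R"
    and surj: "\<And>N c. c \<in> Z S N (Suc k) \<Longrightarrow> \<exists>t\<in>carrier R - P. (\<lambda>l. t \<otimes> c l) \<in> divisible_classes f k N"
    and c: "c \<in> Z S N (Suc k)"
  shows "\<exists>t\<in>carrier R - P. (\<lambda>l. t \<otimes> c l) \<in> divisible_classes (f [^] (n::nat)) k N"
  using c
proof (induction n arbitrary: N c)
  case 0
  interpret P: primeideal P R by (rule P)
  have "\<one> \<in> carrier R - P" using P.I_notcarr P.one_imp_carrier by auto
  then show ?case using divisible_cocycle[OF one_closed 0] by auto
next
  case (Suc n)
  interpret P: primeideal P R by (rule P)
  obtain t where t: "t \<in> carrier R - P" "(\<lambda>l. t \<otimes> c l) \<in> divisible_classes f k N" using surj[OF Suc.prems] by blast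
  then obtain d z b where z: "z \<in> Z S (N + d) (Suc k)" and b: "b \<in> Co S k"
    "T S d \<one> (\<lambda>l. t \<otimes> c l) = (\<lambda>l. f \<otimes> z l \<oplus> D S (N + d) b l)" unfolding divisible_classes_def by blast
  obtain t' where t': "t' \<in> carrier R - P" "(\<lambda>l. t' \<otimes> z l) \<in> divisible_classes (f [^] n) k (N + d)"
    using Suc.IH[OF z] by blast
  have R: "t \<in> carrier R" "t' \<in> carrier R" "f [^] Suc n \<in> carrier R" using t t' f by auto
  have cC: "c \<in> Co S (Suc k)" "(\<lambda>l. t \<otimes> c l) \<in> Co S (Suc k)" "z \<in> Co S (Suc k)"
    using Suc.prems Z_smult[OF Suc.prems R(1)] z by (auto simp: Z_iff)
  note cl = Co_closed[OF S_module cC(1), simplified] Co_closed[OF S_module cC(3), simplified]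
    Co_closed[OF S_module D_Co[OF S_module b(1)], simplified]
  have eq: "(\<lambda>l. t' \<otimes> t \<otimes> c l) = (\<lambda>l. t' \<otimes> (t \<otimes> c l))" using R cl by (simp add: m_assoc)
  have tc: "(\<lambda>l. t' \<otimes> t \<otimes> c l) \<in> Co S (Suc k)" using Z_smult[OF Suc.prems, of "t' \<otimes> t"] R by (simp add: Z_iff)
  have Tc: "T S d \<one> (\<lambda>l. t' \<otimes> t \<otimes> c l) = (\<lambda>l. f \<otimes> (t' \<otimes> z l) \<oplus> t' \<otimes> D S (N + d) b l)"
    unfolding eq using T_smult[OF S_module cC(2) R(2) one_closed, of d] R cl f by (simp add: b(2) r_distr m_lcomm)
  have "f \<otimes> f [^] n = f [^] Suc n" using f by (simp add: m_comm)
  then have 1: "(\<lambda>l. f \<otimes> (t' \<otimes> z l)) \<in> divisible_classes (f [^] Suc n) k (N + d)"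
    using divisible_mult[OF f nat_pow_closed[OF f] t'(2)] by simp
  have 2: "(\<lambda>l. t' \<otimes> D S (N + d) b l) \<in> divisible_classes (f [^] Suc n) k (N + d)"
    by (rule divisible_smult[OF R(3) divisible_boundary[OF R(3) b(1)] R(2)])
  have "T S d \<one> (\<lambda>l. t' \<otimes> t \<otimes> c l) \<in> divisible_classes (f [^] Suc n) k (N + d)"
    unfolding Tc by (rule divisible_add[OF R(3) 1 2])
  then have "(\<lambda>l. t' \<otimes> t \<otimes> c l) \<in> divisible_classes (f [^] Suc n) k N" by (rule divisible_unraise[OF tc])
  moreover have "t' \<otimes> t \<in> carrier R - P" using t t' P.I_prime by auto
  ultimately show ?case by (rule bexI[where x = "t' \<otimes> t"])
qed

text \<open>Factors f are cancelled one at a time, each at the cost of a multiplier outside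
  P.\<close>

lemma inj_at_power:
  assumes f: "f \<in> carrier R" and P: "primeideal P R"
    and inj: "\<And>N c. c \<in> Z S N (Suc k) \<Longrightarrow> (\<lambda>l. f \<otimes> c l) \<in> divisible_classes \<zero> k N \<Longrightarrow>
      \<exists>t\<in>carrier R - P. (\<lambda>l. t \<otimes> c l) \<in> divisible_classes \<zero> k N"
    and c: "c \<in> Z S N (Suc k)" "(\<lambda>l. f [^] (n::nat) \<otimes> c l) \<in> divisible_classes \<zero> k N"
  shows "\<exists>t\<in>carrier R - P. (\<lambda>l. t \<otimes> c l) \<in> divisible_classes \<zero> k N"
  using c
proof (induction n arbitrary: c)
  case 0
  interpret P: primeideal P R by (rule P)
  have "\<one> \<in> carrier R - P" using P.I_notcarr P.one_imp_carrier by auto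
  then show ?case using 0 by auto
next
  case (Suc n)
  interpret P: primeideal P R by (rule P)
  have cl: "c l \<in> carrier R" for l using Suc.prems(1) Co_closed[OF S_module, of c "Suc k"] by (simp add: Z_iff)
  have "(\<lambda>l. f \<otimes> (f [^] n \<otimes> c l)) \<in> divisible_classes \<zero> k N"
    using Suc.prems(2) f cl by (simp add: m_ac)
  then obtain t where t: "t \<in> carrier R - P" "(\<lambda>l. t \<otimes> (f [^] n \<otimes> c l)) \<in> divisible_classes \<zero> k N"
    using inj[OF Z_smult[OF Suc.prems(1), of "f [^] n"]] f by auto
  then have "(\<lambda>l. f [^] n \<otimes> (t \<otimes> c l)) \<in> divisible_classes \<zero> k N"
    using f cl m_lcomm[of t "f [^] n"] by auto
  then obtain t' where t': "t' \<in> carrier R - P" "(\<lambda>l. t' \<otimes> (t \<otimes> c l)) \<in> divisible_classes \<zero> k N"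
    using Suc.IH[OF Z_smult[OF Suc.prems(1), of t]] t(1) by auto
  have "t' \<otimes> t \<in> carrier R - P" using t t' P.I_prime by auto
  moreover have "(\<lambda>l. t' \<otimes> t \<otimes> c l) \<in> divisible_classes \<zero> k N"
    using t t' cl by (simp add: m_assoc)
  ultimately show ?case by (intro bexI[where x = "t' \<otimes> t"])
qed


section \<open>Openness of surjectivity and injectivity\<close>

lemma off_prime_pow: "primeideal Q R \<Longrightarrow> g \<in> carrier R - Q \<Longrightarrow> g [^] (m::nat) \<in> carrier R - Q"
  by (rule prime_localization.D_pow[OF prime_localization.intro])

text \<open>The exponent p^e0 is chosen because f^(p^e0) has the p^\<epsilon>-th root
  f^(p^(e0-\<epsilon>)) for every \<epsilon> up to e0, and the p^(e0+1)-th power of this root is a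
  multiple of f^(p^e0).\<close>

lemma divisible_power_semilinear:
  assumes p: "p > (1::nat)" and f: "f \<in> carrier R" and \<epsilon>: "\<epsilon> \<le> e0"
    and h: "twisted_linear R (p ^ \<epsilon>) (p ^ Suc e0) h" and c: "c \<in> divisible_classes (f [^] (p ^ e0)) k (M * p ^ \<epsilon>)"
  shows "(\<lambda>l. h (c l)) \<in> divisible_classes (f [^] (p ^ e0)) k (M * p ^ Suc e0)"
proof (rule divisible_semilinear[OF twisted_linear_semilinear[OF h], where ?g1.0 = "f [^] (p ^ (e0 - \<epsilon>))"
      and ?g2.0 = "f [^] (p ^ (e0 - \<epsilon> + Suc e0) - p ^ e0)"])
  have "p ^ (e0 - \<epsilon>) * p ^ \<epsilon> = p ^ e0" using \<epsilon> by (simp add: power_add[symmetric])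
  then show "f [^] (p ^ e0) = (f [^] (p ^ (e0 - \<epsilon>))) [^] (p ^ \<epsilon>)" using f by (simp add: nat_pow_pow)
  have "p ^ e0 \<le> p ^ (e0 - \<epsilon> + Suc e0)" using p by (intro power_increasing) auto
  then show "(f [^] (p ^ (e0 - \<epsilon>))) [^] (p ^ Suc e0) = f [^] (p ^ e0) \<otimes> f [^] (p ^ (e0 - \<epsilon> + Suc e0) - p ^ e0)"
    using f by (simp add: nat_pow_pow nat_pow_mult power_add mult.left_commute)
qed (use p f c in auto)

text \<open>With g = 0 the root g1 is 0 as well, and so are its powers, the exponents being
  positive.\<close>

lemma null_semilinear:
  assumes "p > (1::nat)" "twisted_linear R (p ^ a) (p ^ b) h" "c \<in> divisible_classes \<zero> k (M * p ^ a)"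
  shows "(\<lambda>l. h (c l)) \<in> divisible_classes \<zero> k (M * p ^ b)"
  by (rule divisible_semilinear[OF twisted_linear_semilinear[OF assms(2)] _ zero_closed zero_closed _ _ assms(3)])
    (use assms(1) in \<open>simp_all add: nat_pow_zero\<close>)

text \<open>
  For surjectivity of the multiplication by \<open>y\<close>, \<open>H\<close> consists of all cocycles; for injectivity, of those
  whose class is killed by a power of \<open>y\<close>.
\<close>

lemma CL_FFRT_open:
  assumes p: "Factorial_Ring.prime p" and CL: "CL_FFRT p R" and P: "primeideal P R" and y: "y \<in> carrier R"
    and HZ: "\<And>N. H N \<subseteq> Z S N (Suc k)" and subH: "\<And>N. submodule (H N) R (F (Suc k))"
    and H: "\<And>a b h M c. twisted_linear R (p ^ a) (p ^ b) h \<Longrightarrow> c \<in> H (M * p ^ a) \<Longrightarrow> (\<lambda>l. h (c l)) \<in> H (M * p ^ b)"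
    and T: "\<And>N d c. c \<in> H N \<Longrightarrow> T S d \<one> c \<in> H (N + d)"
    and loc: "\<And>n N c. c \<in> H N \<Longrightarrow> \<exists>t\<in>carrier R - P. (\<lambda>l. t \<otimes> c l) \<in> divisible_classes (y [^] (p ^ n)) k N"
  shows "\<exists>g\<in>carrier R - P. \<forall>N. \<forall>c\<in>H N. \<exists>m::nat. (\<lambda>l. g [^] m \<otimes> c l) \<in> divisible_classes y k N"
proof -
  interpret PL: prime_localization P R by (rule prime_localization.intro[OF P])
  have ff: "F_finite p R" "noetherian_ring R" "fg_module R (frobenius_pushforward p 1 R (self_module R))"
    "FFRT p (completed_local_ring R P)"
    using CL P by (auto simp: CL_FFRT_def F_finite_def spec_def)
  obtain e0 n :: nat and \<epsilon> \<psi> \<phi> s where s: "s \<in> carrier R - P"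
    and tw: "\<forall>k<n. \<epsilon> k \<le> e0 \<and> twisted_linear R (p ^ Suc e0) (p ^ \<epsilon> k) (\<psi> k) \<and> twisted_linear R (p ^ \<epsilon> k) (p ^ Suc e0) (\<phi> k)"
    and id: "\<forall>x\<in>carrier R. (\<Oplus>k\<in>{..<n}. \<phi> k (\<psi> k x)) = s [^] (p ^ Suc e0) \<otimes> x"
    using PL.R_splitting[OF F_finite_char_p[OF p ff(1)] ff(2-4)] by blast
  have p1: "p > 1" using p by (rule prime_gt_1_nat)
  \<comment> \<open>Divisibility by y itself need not survive the maps \<phi> k; divisibility by
    y^(p^e0) does, and it implies the former.\<close>
  let ?G = "divisible_classes (y [^] (p ^ e0)) k"
  have subG: "submodule (?G N) R (F (Suc k))" for N using y by (intro divisible_submodule) simp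
  have HC: "H N \<subseteq> Co S (Suc k)" for N
    using subH[of N] unfolding submodule_F_iff by blast
  let ?Q = "\<lambda>e t. \<forall>c\<in>H (p ^ e). (\<lambda>l. t \<otimes> c l) \<in> ?G (p ^ e)"
  have up: "?Q e (a \<otimes> b)" if "?Q e b" "a \<in> carrier R" "b \<in> carrier R" for e a b
  proof
    fix c assume c: "c \<in> H (p ^ e)"
    then have cl: "c l \<in> carrier R" for l using HC Co_closed[OF S_module, of c "Suc k"] by auto
    have "(\<lambda>l. a \<otimes> (b \<otimes> c l)) \<in> ?G (p ^ e)" by (rule divisible_smult) (use that c y in auto)
    then show "(\<lambda>l. a \<otimes> b \<otimes> c l) \<in> ?G (p ^ e)" using that cl by (simp add: m_assoc)
  qed
  \<comment> \<open>At each of the finitely many low levels H is a submodule of a Noetherian module,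
    which gives one multiplier per level and then one for all of them.\<close>
  have "\<exists>t\<in>carrier R - P. \<forall>e\<in>{..e0}. ?Q e t"
  proof (rule finite_common_multiplier[OF finite_atMost PL.D_one PL.D_mult])
    fix e
    obtain t where "t \<in> carrier R - P" "\<And>c. c \<in> H (p ^ e) \<Longrightarrow> t \<odot>\<^bsub>F (Suc k)\<^esub> c \<in> ?G (p ^ e)"
    proof (rule noeth_uniform_multiplier[OF noeth_F[OF ff(2)] subH[of "p ^ e"] subG[of "p ^ e"] P])
      fix c assume "c \<in> H (p ^ e)"
      then show "\<exists>t\<in>carrier R - P. t \<odot>\<^bsub>F (Suc k)\<^esub> c \<in> ?G (p ^ e)" using loc by simp
    qed blast
    then show "\<exists>t\<in>carrier R - P. ?Q e t" by auto
  next
    fix e a b assume "a \<in> carrier R - P" "b \<in> carrier R - P" "?Q e b"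
    then show "?Q e (a \<otimes> b) \<and> ?Q e (b \<otimes> a)" using up[of e b a] by (simp add: m_comm)
  qed
  then obtain t where t: "t \<in> carrier R - P" "\<And>e c. e \<le> e0 \<Longrightarrow> c \<in> H (p ^ e) \<Longrightarrow> (\<lambda>l. t \<otimes> c l) \<in> ?G (p ^ e)" by auto
  let ?g = "t \<otimes> s"
  have gP: "?g \<in> carrier R - P" by (rule PL.D_mult[OF t(1) s])
  have "\<exists>m::nat. (\<lambda>l. ?g [^] m \<otimes> c l) \<in> divisible_classes y k N" if c: "c \<in> H N" for N c
  proof -
    \<comment> \<open>Since p^N is at least N, every level can be raised to a power of p, where the
      descent applies; \<open>divisible_unraise\<close> then returns to level N.\<close>
    have N: "N + (p ^ N - N) = p ^ N" using p1 less_imp_le[OF power_gt_expt] by auto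
    have Tc: "T S (p ^ N - N) \<one> c \<in> H (p ^ N)" using T[OF c, of "p ^ N - N"] by (simp add: N)
    obtain m :: nat where m: "(\<lambda>l. ?g [^] m \<otimes> T S (p ^ N - N) \<one> c l) \<in> ?G (p ^ N)"
    proof (rule exE[OF frobenius_descent[of p n \<epsilon> e0 \<psi> \<phi> s t ?G "Suc k" H]])
      show "\<epsilon> k \<le> e0 \<and> twisted_linear R (p ^ Suc e0) (p ^ \<epsilon> k) (\<psi> k) \<and>
          twisted_linear R (p ^ \<epsilon> k) (p ^ Suc e0) (\<phi> k)" if "k < n" for k using tw that by blast
      show "(\<lambda>l. h (d l)) \<in> H (M * p ^ \<epsilon>)"
        if "twisted_linear R (p ^ Suc e0) (p ^ \<epsilon>) h" "d \<in> H (M * p ^ Suc e0)" for \<epsilon> h M d using H[OF that] .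
      show "(\<lambda>l. h (d l)) \<in> ?G (M * p ^ Suc e0)"
        if "\<epsilon> \<le> e0" "twisted_linear R (p ^ \<epsilon>) (p ^ Suc e0) h" "d \<in> ?G (M * p ^ \<epsilon>)" for \<epsilon> h M d
        by (rule divisible_power_semilinear[OF p1 y that])
    qed (use p1 id s HC t subG Tc in auto)
    have gm: "?g [^] m \<in> carrier R" using gP by simp
    have cC: "c \<in> Co S (Suc k)" "(\<lambda>l. ?g [^] m \<otimes> c l) \<in> Co S (Suc k)"
      using HC c Z_smult[OF subsetD[OF HZ c] gm] by (auto simp: Z_iff)
    have "T S (p ^ N - N) \<one> (\<lambda>l. ?g [^] m \<otimes> c l) \<in> ?G (N + (p ^ N - N))"
      using m T_smult[OF S_module cC(1) gm one_closed, of "p ^ N - N"] by (simp add: N)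
    from divisible_unraise[OF cC(2) this] have 1: "(\<lambda>l. ?g [^] m \<otimes> c l) \<in> ?G N" .
    obtain i where "p ^ e0 = Suc i" using p1 not0_implies_Suc by fastforce
    then have "y [^] (p ^ e0) = y \<otimes> y [^] i" using y by (simp add: m_comm)
    then show ?thesis using divisible_weaken[OF y _, of "y [^] i"] 1 y by auto
  qed
  then show ?thesis using gP by blast
qed

lemma surj_at_open:
  assumes p: "Factorial_Ring.prime p" and CL: "CL_FFRT p R" and P: "primeideal P R" and f: "f \<in> carrier R"
    and surj: "surj_at P S S (\<lambda>x. f \<otimes> x) k"
  shows "\<exists>g\<in>carrier R - P. \<forall>Q. primeideal Q R \<longrightarrow> g \<notin> Q \<longrightarrow> surj_at Q S S (\<lambda>x. f \<otimes> x) k"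
proof -
  have "\<exists>g\<in>carrier R - P. \<forall>N. \<forall>c\<in>Z S N (Suc k). \<exists>m::nat. (\<lambda>l. g [^] m \<otimes> c l) \<in> divisible_classes f k N"
  proof (rule CL_FFRT_open[of p P f "\<lambda>N. Z S N (Suc k)", OF p CL P f subset_refl Z_submodule])
    show "(\<lambda>l. h (c l)) \<in> Z S (M * p ^ b) (Suc k)"
      if "twisted_linear R (p ^ a) (p ^ b) h" "c \<in> Z S (M * p ^ a) (Suc k)" for a b h M c
      by (rule Z_semilinear[OF S_module S_module twisted_linear_semilinear[OF that(1)] that(2)])
    show "\<exists>t\<in>carrier R - P. (\<lambda>l. t \<otimes> c l) \<in> divisible_classes (f [^] (p ^ n)) k N"
      if "c \<in> Z S N (Suc k)" for n N c
      by (rule surj_at_power[OF f P _ that]) (use surj[unfolded surj_at_iff] in blast)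
  qed (rule T_Z[OF S_module _ one_closed])
  then obtain g where g: "g \<in> carrier R - P" "\<And>N c. c \<in> Z S N (Suc k) \<Longrightarrow>
      \<exists>m::nat. (\<lambda>l. g [^] m \<otimes> c l) \<in> divisible_classes f k N" by blast
  have "surj_at Q S S (\<lambda>x. f \<otimes> x) k" if Q: "primeideal Q R" "g \<notin> Q" for Q
    unfolding surj_at_iff
  proof (intro allI ballI)
    fix N c assume "c \<in> Z S N (Suc k)"
    then obtain m :: nat where "(\<lambda>l. g [^] m \<otimes> c l) \<in> divisible_classes f k N" using g(2) by blast
    then show "\<exists>t\<in>carrier R - Q. (\<lambda>l. t \<otimes> c l) \<in> divisible_classes f k N"
      using off_prime_pow[OF Q(1), of g m] g(1) Q(2) by (intro bexI[where x = "g [^] m"]) auto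
  qed
  then show ?thesis using g(1) by blast
qed

lemma inj_at_open:
  assumes p: "Factorial_Ring.prime p" and CL: "CL_FFRT p R" and P: "primeideal P R" and f: "f \<in> carrier R"
    and inj: "inj_at P S S (\<lambda>x. f \<otimes> x) k"
  shows "\<exists>g\<in>carrier R - P. \<forall>Q. primeideal Q R \<longrightarrow> g \<notin> Q \<longrightarrow> inj_at Q S S (\<lambda>x. f \<otimes> x) k"
proof -
  have p1: "p > 1" using p by (rule prime_gt_1_nat)
  \<comment> \<open>Being killed by f itself need not survive twisted maps, which turn f^(j p^a)
    into f^(j p^b); being killed by some power of f does.\<close>
  let ?H = "\<lambda>N. {c \<in> Z S N (Suc k). \<exists>j::nat. (\<lambda>l. f [^] j \<otimes> c l) \<in> divisible_classes \<zero> k N}"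
  have cl: "c l \<in> carrier R" if "c \<in> Z S N (Suc k)" for N c l
    using that Co_closed[OF S_module, of c "Suc k"] by (simp add: Z_iff)
  have up: "(\<lambda>l. f [^] i \<otimes> c l) \<in> divisible_classes \<zero> k N"
    if "c \<in> Z S N (Suc k)" "(\<lambda>l. f [^] j \<otimes> c l) \<in> divisible_classes \<zero> k N" "j \<le> i" for i j :: nat and N c
    by (rule submodule_F_pow_mono[OF divisible_submodule[OF zero_closed] _ f that(2,3)]) (use cl[OF that(1)] in auto)
  have "\<exists>g\<in>carrier R - P. \<forall>N. \<forall>c\<in>?H N. \<exists>m::nat. (\<lambda>l. g [^] m \<otimes> c l) \<in> divisible_classes \<zero> k N"
  proof (rule CL_FFRT_open[of p P \<zero> ?H, OF p CL P zero_closed])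
    show "submodule (?H N) R (F (Suc k))" for N
      unfolding submodule_F_iff
    proof (intro conjI ballI)
      show "?H N \<subseteq> Co S (Suc k)" by (auto simp: Z_iff)
      have "(\<lambda>_. \<zero>) \<in> divisible_classes \<zero> k N"
        using divisible_cocycle[OF zero_closed Z_zero] by simp
      then show "(\<lambda>_. \<zero>) \<in> ?H N" using Z_zero by (intro CollectI conjI exI[of _ 0]) auto
    next
      fix a c assume a: "a \<in> carrier R" and c: "c \<in> ?H N"
      then obtain j :: nat where j: "(\<lambda>l. f [^] j \<otimes> c l) \<in> divisible_classes \<zero> k N" by blast
      have "(\<lambda>l. f [^] j \<otimes> (a \<otimes> c l)) \<in> divisible_classes \<zero> k N"
        using divisible_smult[OF zero_closed j a] cl[of c N] c a f m_lcomm[of a "f [^] j"] by auto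
      then show "(\<lambda>l. a \<otimes> c l) \<in> ?H N" using Z_smult[OF _ a, of c] c by blast
    next
      fix c c' assume c: "c \<in> ?H N" and c': "c' \<in> ?H N"
      obtain j j' :: nat where j: "(\<lambda>l. f [^] j \<otimes> c l) \<in> divisible_classes \<zero> k N" "(\<lambda>l. f [^] j' \<otimes> c' l) \<in> divisible_classes \<zero> k N"
        using c c' by blast
      have "(\<lambda>l. f [^] (j + j') \<otimes> c l \<oplus> f [^] (j + j') \<otimes> c' l) \<in> divisible_classes \<zero> k N"
        by (rule divisible_add[OF zero_closed up[OF _ j(1)] up[OF _ j(2)]]) (use c c' in auto)
      then have "(\<lambda>l. f [^] (j + j') \<otimes> (c l \<oplus> c' l)) \<in> divisible_classes \<zero> k N"
        using cl[of c N] cl[of c' N] c c' f r_distr by auto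
      then show "(\<lambda>l. c l \<oplus> c' l) \<in> ?H N" using Z_add[of c N "Suc k" c'] c c' by blast
    qed
    show "(\<lambda>l. h (c l)) \<in> ?H (M * p ^ b)"
      if h: "twisted_linear R (p ^ a) (p ^ b) h" and c: "c \<in> ?H (M * p ^ a)" for a b h M c
    proof -
      obtain j :: nat where j: "(\<lambda>l. f [^] j \<otimes> c l) \<in> divisible_classes \<zero> k (M * p ^ a)" using c by blast
      have cZ: "c \<in> Z S (M * p ^ a) (Suc k)" using c by blast
      have "(\<lambda>l. f [^] (j * p ^ a) \<otimes> c l) \<in> divisible_classes \<zero> k (M * p ^ a)"
        by (rule up[OF cZ j]) (use p1 in simp)
      from null_semilinear[OF p1 h this]
      have "(\<lambda>l. h ((f [^] j) [^] (p ^ a) \<otimes> c l)) \<in> divisible_classes \<zero> k (M * p ^ b)"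
        using f by (simp add: nat_pow_pow)
      moreover have "h ((f [^] j) [^] (p ^ a) \<otimes> c l) = (f [^] j) [^] (p ^ b) \<otimes> h (c l)" for l
        using h cl[OF cZ] f unfolding twisted_linear_def by simp
      ultimately have "(\<lambda>l. f [^] (j * p ^ b) \<otimes> h (c l)) \<in> divisible_classes \<zero> k (M * p ^ b)"
        using f by (simp add: nat_pow_pow)
      then show ?thesis
        using Z_semilinear[OF S_module S_module twisted_linear_semilinear[OF h] cZ] by blast
    qed
    show "T S d \<one> c \<in> ?H (N + d)" if c: "c \<in> ?H N" for N d c
    proof -
      obtain j :: nat where j: "(\<lambda>l. f [^] j \<otimes> c l) \<in> divisible_classes \<zero> k N" using c by blast
      have "(\<lambda>l. f [^] j \<otimes> T S d \<one> c l) \<in> divisible_classes \<zero> k (N + d)"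
        using divisible_T[OF zero_closed j, of d] T_smult[OF S_module _ _ one_closed, of c "Suc k" "f [^] j"] c f by (simp add: Z_iff)
      then show ?thesis using T_Z[OF S_module _ one_closed, of c] c by blast
    qed
    \<comment> \<open>Injectivity of f gives injectivity of its powers. Here y = 0, so y^(p^n) is 0
      again and plain vanishing of the class is asked for.\<close>
    show "\<exists>t\<in>carrier R - P. (\<lambda>l. t \<otimes> c l) \<in> divisible_classes (\<zero> [^] (p ^ n)) k N" if "c \<in> ?H N" for n N c
      using inj_at_power[OF f P, of k c N] inj[unfolded inj_at_iff[OF f]] that p1 by (auto simp: nat_pow_zero)
  qed blast
  then obtain g where g: "g \<in> carrier R - P" "\<And>N c. c \<in> ?H N \<Longrightarrow>
      \<exists>m::nat. (\<lambda>l. g [^] m \<otimes> c l) \<in> divisible_classes \<zero> k N" by blast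
  have "inj_at Q S S (\<lambda>x. f \<otimes> x) k" if Q: "primeideal Q R" "g \<notin> Q" for Q
    unfolding inj_at_iff[OF f]
  proof (intro allI ballI impI)
    fix N c assume c: "c \<in> Z S N (Suc k)" and "(\<lambda>l. f \<otimes> c l) \<in> divisible_classes \<zero> k N"
    then have "(\<lambda>l. f [^] (1::nat) \<otimes> c l) \<in> divisible_classes \<zero> k N" using f by simp
    then obtain m :: nat where "(\<lambda>l. g [^] m \<otimes> c l) \<in> divisible_classes \<zero> k N" using g(2) c by blast
    then show "\<exists>t\<in>carrier R - Q. (\<lambda>l. t \<otimes> c l) \<in> divisible_classes \<zero> k N"
      using off_prime_pow[OF Q(1), of g m] g(1) Q(2) by (intro bexI[where x = "g [^] m"]) auto
  qed
  then show ?thesis using g(1) by blast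
qed

end

section \<open>Injective modules and local cohomology\<close>

lemma (in cring) residue_identities:
  assumes "x \<in> carrier R" "x' \<in> carrier R" "r \<in> carrier R" "r' \<in> carrier R" "q \<in> carrier R"
  shows "(x \<ominus> r \<otimes> q) \<ominus> (x \<ominus> r' \<otimes> q) = q \<otimes> (r' \<ominus> r)"
    and "q \<otimes> (r \<ominus> r') \<oplus> q \<otimes> r' = q \<otimes> r"
    and "(x \<oplus> x') \<ominus> (r \<oplus> r') \<otimes> q = (x \<ominus> r \<otimes> q) \<oplus> (x' \<ominus> r' \<otimes> q)"
    and "r' \<otimes> x \<ominus> (r' \<otimes> r) \<otimes> q = r' \<otimes> (x \<ominus> r \<otimes> q)"
  using assms by algebra+

text \<open>
  Baer's extension property for the ideal $J+(y^{m+n})$, where $m$ is so large that $J : y^m$ is stable.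
\<close>

lemma injective_divisible:
  fixes R :: "('a, 'r) ring_scheme" (structure) and E :: "('a, 'b) module"
  assumes R: "cring R" "noetherian_ring R" and E: "injective_module R E" and J: "ideal J R"
    and e: "e \<in> carrier E" "\<And>a. a \<in> J \<Longrightarrow> a \<odot>\<^bsub>E\<^esub> e = \<zero>\<^bsub>E\<^esub>" and y: "y \<in> carrier R"
  obtains m e' where "e' \<in> carrier E" "\<And>a. a \<in> J \<Longrightarrow> a \<odot>\<^bsub>E\<^esub> e' = \<zero>\<^bsub>E\<^esub>"
    "y [^] (m::nat) \<odot>\<^bsub>E\<^esub> e = y [^] (m + n) \<odot>\<^bsub>E\<^esub> e'"
proof -
  interpret cring R by fact
  interpret J: ideal J R by fact
  interpret S: module R "self_module R" by (rule module_self_module) fact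
  have Em: "module R E" using E by (simp add: injective_module_def)
  interpret E: module R E by (rule Em)
  have Js: "submodule J R (self_module R)" using J submodule_self_iff_ideal[OF R(1)] by blast
  let ?J = "\<lambda>m::nat. {r \<in> carrier R. y [^] m \<otimes> r \<in> J}"
  have sub: "submodule (?J m) R (self_module R)" for m
    using S.submodule_colon[OF Js, of "y [^] m"] y by simp
  \<comment> \<open>A maximal member of the ascending chain J : y^m; from there on
    \<open>stable\<close> allows y^n to be cancelled.\<close>
  obtain U where U: "U \<in> range ?J" "\<And>V. V \<in> range ?J \<Longrightarrow> U \<subseteq> V \<Longrightarrow> V = U"
    by (rule noeth_maximal[OF noeth_self_module[OF R], of "range ?J"]) (use sub in auto)
  then obtain m where "U = ?J m" by blast
  then have m: "?J m \<subseteq> ?J k \<Longrightarrow> ?J k = ?J m" for k using U(2)[of "?J k"] by simp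
  have stable: "y [^] m \<otimes> r \<in> J" if r: "r \<in> carrier R" "y [^] (m + n) \<otimes> r \<in> J" for r
  proof -
    have "?J m \<subseteq> ?J (m + n)"
    proof
      fix x assume x: "x \<in> ?J m"
      then have "y [^] n \<otimes> (y [^] m \<otimes> x) \<in> J" using y J.I_l_closed by simp
      then show "x \<in> ?J (m + n)" using x y by (simp add: nat_pow_mult[symmetric] m_ac)
    qed
    from m[OF this] show ?thesis using r by blast
  qed
  let ?y = "y [^] (m + n)" and ?Y = "y [^] m"
  have yy: "?y \<in> carrier R" "?Y \<in> carrier R" using y by auto
  \<comment> \<open>On K the map a + r y^(m+n) -> r y^m e is to be defined. \<rho> picks a
    coefficient r; by \<open>stable\<close>, two coefficients of the same x differ by an element
    whose product with y^m lies in J and so kills e.\<close>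
  define K where "K = {a \<oplus> v | a v. a \<in> J \<and> v \<in> {r \<otimes> ?y | r. r \<in> carrier R}}"
  have Ks: "submodule K R (self_module R)"
    using S.submodule_sum[OF Js S.submodule_cyclic[of ?y]] yy unfolding K_def by simp
  have K_I: "a \<oplus> r \<otimes> ?y \<in> K" if "a \<in> J" "r \<in> carrier R" for a r using that unfolding K_def by blast
  let ?A = "self_module R\<lparr>carrier := K\<rparr>"
  have Am: "module R ?A" by (rule submodule.submodule_is_module[OF Ks S.module_axioms])
  define \<rho> where "\<rho> x = (SOME r. r \<in> carrier R \<and> x \<ominus> r \<otimes> ?y \<in> J)" for x
  let ?h = "\<lambda>x. (?Y \<otimes> \<rho> x) \<odot>\<^bsub>E\<^esub> e"
  have KR: "x \<in> carrier R" if "x \<in> K" for x using that yy J.Icarr by (auto simp: K_def)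
  have \<rho>: "\<rho> x \<in> carrier R \<and> x \<ominus> \<rho> x \<otimes> ?y \<in> J" if "x \<in> K" for x
  proof -
    obtain a r where a: "a \<in> J" "r \<in> carrier R" "x = a \<oplus> r \<otimes> ?y" using \<open>x \<in> K\<close> unfolding K_def by blast
    have "x \<ominus> r \<otimes> ?y = a" using a J.Icarr yy by (simp add: a_minus_def a_assoc r_neg)
    then show ?thesis unfolding \<rho>_def using a by (intro someI[of "\<lambda>r. r \<in> carrier R \<and> x \<ominus> r \<otimes> ?y \<in> J" r]) simp
  qed
  have h: "?h x = (?Y \<otimes> r) \<odot>\<^bsub>E\<^esub> e" if x: "x \<in> K" and r: "r \<in> carrier R" "x \<ominus> r \<otimes> ?y \<in> J" for x r
  proof -
    note \<rho>x = \<rho>[OF x] and xR = KR[OF x]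
    have "(x \<ominus> r \<otimes> ?y) \<ominus> (x \<ominus> \<rho> x \<otimes> ?y) = ?y \<otimes> (\<rho> x \<ominus> r)"
      using residue_identities(1)[OF xR xR r(1) conjunct1[OF \<rho>x] yy(1)] .
    moreover have "(x \<ominus> r \<otimes> ?y) \<ominus> (x \<ominus> \<rho> x \<otimes> ?y) \<in> J"
      using J.a_closed[OF r(2) J.a_inv_closed[OF conjunct2[OF \<rho>x]]] unfolding a_minus_def .
    ultimately have "?Y \<otimes> (\<rho> x \<ominus> r) \<in> J" using stable[of "\<rho> x \<ominus> r"] \<rho>x r(1) by simp
    then have "(?Y \<otimes> (\<rho> x \<ominus> r)) \<odot>\<^bsub>E\<^esub> e = \<zero>\<^bsub>E\<^esub>" by (rule e(2))
    moreover have "?Y \<otimes> (\<rho> x \<ominus> r) \<oplus> ?Y \<otimes> r = ?Y \<otimes> \<rho> x" using residue_identities(2)[OF xR xR conjunct1[OF \<rho>x] r(1) yy(2)] .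
    ultimately show ?thesis
      using E.smult_l_distr[of "?Y \<otimes> (\<rho> x \<ominus> r)" "?Y \<otimes> r" e] \<rho>x r(1) yy e(1) by simp
  qed
  have K_add: "x \<oplus> x' \<in> K" if "x \<in> K" "x' \<in> K" for x x'
    using Ks[unfolded S.submodule_iff self_module_simps] that by blast
  have K_mult: "b \<otimes> x \<in> K" if "b \<in> carrier R" "x \<in> K" for b x
    using Ks[unfolded S.submodule_iff self_module_simps] that by blast
  have hhom: "?h \<in> module_hom R ?A E"
  proof (rule module_homI)
    fix x assume "x \<in> carrier ?A"
    then have x: "x \<in> K" by simp
    note \<rho>x = \<rho>[OF x] and xR = KR[OF x]
    show "?h x \<in> carrier E" using \<rho>x yy e(1) by simp
    {
      fix x' assume "x' \<in> carrier ?A"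
      then have x': "x' \<in> K" by simp
      note \<rho>x' = \<rho>[OF x'] and x'R = KR[OF x']
      have "(x \<oplus> x') \<ominus> (\<rho> x \<oplus> \<rho> x') \<otimes> ?y = (x \<ominus> \<rho> x \<otimes> ?y) \<oplus> (x' \<ominus> \<rho> x' \<otimes> ?y)"
        using residue_identities(3)[OF xR x'R conjunct1[OF \<rho>x] conjunct1[OF \<rho>x'] yy(1)] .
      then have "(x \<oplus> x') \<ominus> (\<rho> x \<oplus> \<rho> x') \<otimes> ?y \<in> J" using \<rho>x \<rho>x' by simp
      then have "?h (x \<oplus> x') = (?Y \<otimes> (\<rho> x \<oplus> \<rho> x')) \<odot>\<^bsub>E\<^esub> e" using h[OF K_add[OF x x']] \<rho>x \<rho>x' by simp
      then show "?h (x \<oplus>\<^bsub>?A\<^esub> x') = ?h x \<oplus>\<^bsub>E\<^esub> ?h x'" using \<rho>x \<rho>x' yy e(1) by (simp add: r_distr E.smult_l_distr)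
    }
    fix b assume b: "b \<in> carrier R"
    have "b \<otimes> x \<ominus> (b \<otimes> \<rho> x) \<otimes> ?y = b \<otimes> (x \<ominus> \<rho> x \<otimes> ?y)" using residue_identities(4)[OF xR xR conjunct1[OF \<rho>x] b yy(1)] .
    then have "b \<otimes> x \<ominus> (b \<otimes> \<rho> x) \<otimes> ?y \<in> J" using \<rho>x b J.I_l_closed by simp
    then have "?h (b \<otimes> x) = (?Y \<otimes> (b \<otimes> \<rho> x)) \<odot>\<^bsub>E\<^esub> e" using h[OF K_mult[OF b x]] \<rho>x b by simp
    then show "?h (b \<odot>\<^bsub>?A\<^esub> x) = b \<odot>\<^bsub>E\<^esub> ?h x"
      using \<rho>x yy e(1) b by (simp add: E.smult_assoc1[symmetric] m_lcomm)
  qed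
  have idhom: "id \<in> module_hom R ?A (self_module R)" by (rule module_homI) (use KR in auto)
  \<comment> \<open>The extension to R is multiplication of scalars with e' = k 1; its values on J
    and at y^(m+n) give the two claims.\<close>
  have "\<exists>k\<in>module_hom R (self_module R) E. \<forall>x\<in>carrier ?A. k (id x) = ?h x"
    by (rule conjunct2[OF E[unfolded injective_module_def], rule_format,
          OF conjI[OF Am conjI[OF S.module_axioms conjI[OF idhom conjI[OF inj_on_id hhom]]]]])
  then obtain k where k: "k \<in> module_hom R (self_module R) E" "\<And>x. x \<in> K \<Longrightarrow> k x = ?h x" by auto
  have k1: "k x = x \<odot>\<^bsub>E\<^esub> k \<one>" if "x \<in> carrier R" for x
    using module_hom_smult[OF k(1) that, of \<one>] that by simp
  have k1c: "k \<one> \<in> carrier E" using module_hom_closed[OF k(1), of \<one>] by simp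
  show thesis
  proof (rule that[OF k1c])
    fix a assume a: "a \<in> J"
    have aK: "a \<in> K" using K_I[OF a zero_closed] J.Icarr[OF a] yy by simp
    have "?h a = (?Y \<otimes> \<zero>) \<odot>\<^bsub>E\<^esub> e" by (rule h[OF aK]) (use a J.Icarr yy in \<open>auto simp: a_minus_def\<close>)
    then show "a \<odot>\<^bsub>E\<^esub> k \<one> = \<zero>\<^bsub>E\<^esub>" using k(2)[OF aK] k1[of a] a J.Icarr yy e(1) by (simp add: E.smult_l_null)
  next
    have yK: "?y \<in> K" using K_I[OF J.zero_closed one_closed] yy by simp
    have "?h ?y = (?Y \<otimes> \<one>) \<odot>\<^bsub>E\<^esub> e" by (rule h[OF yK]) (use yy in \<open>auto simp: a_minus_def r_neg\<close>)
    then show "?Y \<odot>\<^bsub>E\<^esub> e = ?y \<odot>\<^bsub>E\<^esub> k \<one>" using k(2)[OF yK] k1[of ?y] yy by simp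
  qed
qed

text \<open>The word without True is the unit of the exterior algebra, so in degree 0 the Koszul
  complex is the module itself.\<close>

definition degree0 :: "('a, 'b, 'm) module_scheme \<Rightarrow> 'a list \<Rightarrow> 'b \<Rightarrow> bool list \<Rightarrow> 'b" where
  "degree0 M xs e l = (if l = replicate (length xs) False then e else \<zero>\<^bsub>M\<^esub>)"

section \<open>Cochains of degree zero\<close>

context module
begin

lemma degree0_cochains: "e \<in> carrier M \<Longrightarrow> degree0 M xs e \<in> cochains M xs (Suc 0)"
  by (simp add: cochains_iff degree0_def count_list_0_iff)

lemma cochains_degree0:
  assumes "u \<in> cochains M xs (Suc 0)"
  obtains e where "e \<in> carrier M" "u = degree0 M xs e"
proof
  show "u (replicate (length xs) False) \<in> carrier M" using assms by (simp add: cochains_iff)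
  have "l = replicate (length xs) False \<or> u l = \<zero>\<^bsub>M\<^esub>" for l
    using assms unfolding cochains_iff by (simp add: count_list_0_iff) (metis (full_types) replicate_eqI)
  then show "u = degree0 M xs (u (replicate (length xs) False))" by (intro ext) (auto simp: degree0_def)
qed

lemma kweight_degree0: "set xs \<subseteq> carrier R \<Longrightarrow> kweight R d xs (replicate (length xs) False) = \<one>"
  by (induction xs) auto

lemma ktrans_degree0:
  "set xs \<subseteq> carrier R \<Longrightarrow> e \<in> carrier M \<Longrightarrow> t \<in> carrier R \<Longrightarrow> ktrans R M xs d t (degree0 M xs e) = degree0 M xs (t \<odot>\<^bsub>M\<^esub> e)"
  by (rule ext) (simp add: ktrans_def degree0_def kweight_degree0 kweight_closed)

lemma kdiff_degree0:
  assumes "e \<in> carrier M" "set xs \<subseteq> carrier R"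
  shows "kdiff R M N xs (degree0 M xs e) = (\<lambda>_. \<zero>\<^bsub>M\<^esub>) \<longleftrightarrow> (\<forall>y\<in>set xs. y [^] N \<odot>\<^bsub>M\<^esub> e = \<zero>\<^bsub>M\<^esub>)"
  using assms(2)
proof (induction xs)
  case (Cons y xs)
  have y: "y [^] N \<in> carrier R" "set xs \<subseteq> carrier R" using Cons.prems by auto
  have F: "(\<lambda>l. degree0 M (y # xs) e (False # l)) = degree0 M xs e" by (rule ext) (simp add: degree0_def)
  have T: "(\<lambda>l. degree0 M (y # xs) e (True # l)) = (\<lambda>_. \<zero>\<^bsub>M\<^esub>)" by (rule ext) (simp add: degree0_def)
  have dl: "degree0 M xs e l \<in> carrier M" for l using assms(1) by (simp add: degree0_def)
  have "kdiff R M N (y # xs) (degree0 M (y # xs) e) = (\<lambda>_. \<zero>\<^bsub>M\<^esub>) \<longleftrightarrow>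
      kdiff R M N xs (degree0 M xs e) = (\<lambda>_. \<zero>\<^bsub>M\<^esub>) \<and> (\<forall>l. y [^] N \<odot>\<^bsub>M\<^esub> degree0 M xs e l = \<zero>\<^bsub>M\<^esub>)" (is "?f = _ \<longleftrightarrow> ?R")
  proof
    assume "?f = (\<lambda>_. \<zero>\<^bsub>M\<^esub>)"
    then have "?f (False # l) = \<zero>\<^bsub>M\<^esub> \<and> ?f (True # l) = \<zero>\<^bsub>M\<^esub>" for l by simp
    then show ?R using y fun_cong[OF F] dl by (auto simp: F T M.minus_eq M.neg_zero)
  next
    assume R: ?R
    have "?f l = \<zero>\<^bsub>M\<^esub>" for l
      using R y fun_cong[OF F] dl by (cases l) (auto simp: F T M.minus_eq M.neg_zero)
    then show "?f = (\<lambda>_. \<zero>\<^bsub>M\<^esub>)" by blast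
  qed
  moreover have "(\<forall>l. y [^] N \<odot>\<^bsub>M\<^esub> degree0 M xs e l = \<zero>\<^bsub>M\<^esub>) \<longleftrightarrow> y [^] N \<odot>\<^bsub>M\<^esub> e = \<zero>\<^bsub>M\<^esub>"
    using y by (auto simp: degree0_def)
  ultimately show ?case using Cons.IH[OF y(2)] by auto
qed simp

end

text \<open>
  Adjoining $x$ to the sequence: for a cocycle $(c_0,c_1)$, the part $c_0$ bounds by induction, which leaves
  a cocycle $u$ of degree one less. It bounds by induction unless its degree is $0$, where
  divisibility of \<open>E\<close> applies.
\<close>

theorem injective_acyclic:
  fixes R :: "('a, 'r) ring_scheme" (structure) and E :: "('a, 'b) module"
  assumes R: "cring R" "noetherian_ring R" and E: "injective_module R E" and "set xs \<subseteq> carrier R"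
    and "c \<in> kcocycles R E xs N (Suc (Suc k))"
  shows "\<exists>d. \<exists>b\<in>cochains E xs (Suc k). ktrans R E xs d \<one> c = kdiff R E (N + d) xs b"
  using assms(4,5)
proof (induction xs arbitrary: c N k)
  case Nil
  have Em: "module R E" using E by (simp add: injective_module_def)
  interpret E: module R E by (rule Em)
  have "c l = \<zero>\<^bsub>E\<^esub>" for l using Nil by (auto simp: kcocycles_def E.cochains_iff dest!: spec[of _ l])
  then have "c = (\<lambda>_. \<zero>\<^bsub>E\<^esub>)" by blast
  then show ?case
    by (intro exI[of _ 0] bexI[of _ "\<lambda>_. \<zero>\<^bsub>E\<^esub>"]) (auto simp: ktrans_def E.cochains_iff)
next
  case (Cons x xs)
  have Em: "module R E" using E by (simp add: injective_module_def)
  interpret E: module R E by (rule Em)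
  interpret K: koszul R xs using Cons.prems(1) by unfold_locales auto
  have x: "x [^] i \<in> carrier R" for i :: nat using Cons.prems(1) by simp
  let ?c0 = "\<lambda>l. c (False # l)" and ?c1 = "\<lambda>l. c (True # l)"
  have c: "c \<in> cochains E (x # xs) (Suc (Suc k))" and dc: "kdiff R E N (x # xs) c l = \<zero>\<^bsub>E\<^esub>" for l
    using Cons.prems(2) by (auto simp: kcocycles_def)
  have c01: "c [] = \<zero>\<^bsub>E\<^esub>" "?c0 \<in> K.Co E (Suc (Suc k))" "?c1 \<in> K.Co E (Suc k)"
    using c by (auto simp: E.cochains_Cons)
  note cl = K.Co_closed[OF Em c01(2)] K.Co_closed[OF Em c01(3)]
  have dc0: "K.D E N ?c0 = (\<lambda>_. \<zero>\<^bsub>E\<^esub>)" using dc[of "False # l" for l] by auto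
  have dc1: "K.D E N ?c1 l = x [^] N \<odot>\<^bsub>E\<^esub> ?c0 l" for l
    using dc[of "True # l"] x[of N] K.Co_closed[OF Em K.D_Co[OF Em c01(3)]] cl by (simp add: E.M.minus_eq_zero_iff)
  obtain d b0 where b0: "b0 \<in> K.Co E (Suc k)" "K.T E d \<one> ?c0 = K.D E (N + d) b0"
    using Cons.IH[of ?c0 N k] K.xs c01(2) dc0 by (auto simp: kcocycles_def)
  let ?N = "N + d"
  have xcomm: "x [^] i \<odot>\<^bsub>E\<^esub> (x [^] j \<odot>\<^bsub>E\<^esub> v) = x [^] (i + j) \<odot>\<^bsub>E\<^esub> v" if "v \<in> carrier E" for i j :: nat and v
    using Cons.prems(1) that by (simp add: E.smult_assoc1[symmetric] E.nat_pow_mult)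
  \<comment> \<open>Once b0 makes the False part a coboundary, u is what remains of the True part;
    the factor x^d is the weight of the letter True.\<close>
  define u where "u = (\<lambda>l. x [^] d \<odot>\<^bsub>E\<^esub> K.T E d \<one> ?c1 l \<ominus>\<^bsub>E\<^esub> x [^] ?N \<odot>\<^bsub>E\<^esub> b0 l)"
  note Tc1 = K.T_Co[OF Em c01(3) E.one_closed, of d]
  have p1: "(\<lambda>l. x [^] d \<odot>\<^bsub>E\<^esub> K.T E d \<one> ?c1 l) \<in> K.Co E (Suc k)" "(\<lambda>l. x [^] ?N \<odot>\<^bsub>E\<^esub> b0 l) \<in> K.Co E (Suc k)"
    using E.cochains_smult[OF Tc1, of "\<lambda>_. x [^] d"] E.cochains_smult[OF b0(1), of "\<lambda>_. x [^] ?N"] x by auto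
  have uC: "u \<in> K.Co E (Suc k)" unfolding u_def by (rule E.cochains_minus[OF p1])
  have "K.D E ?N u = (\<lambda>l. x [^] d \<odot>\<^bsub>E\<^esub> K.T E d \<one> (K.D E N ?c1) l \<ominus>\<^bsub>E\<^esub> x [^] ?N \<odot>\<^bsub>E\<^esub> K.T E d \<one> ?c0 l)"
    unfolding u_def K.D_minus[OF Em p1] K.D_smult[OF Em Tc1 x] K.D_smult[OF Em b0(1) x]
      K.D_T[OF Em c01(3) E.one_closed] b0(2) ..
  also have "K.D E N ?c1 = (\<lambda>l. x [^] N \<odot>\<^bsub>E\<^esub> ?c0 l)" using dc1 by blast
  also have "K.T E d \<one> \<dots> = (\<lambda>l. x [^] N \<odot>\<^bsub>E\<^esub> K.T E d \<one> ?c0 l)"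
    by (rule K.T_smult[OF Em c01(2) x E.one_closed])
  finally have uZ: "K.D E ?N u = (\<lambda>_. \<zero>\<^bsub>E\<^esub>)"
    using K.Co_closed[OF Em K.T_Co[OF Em c01(2) E.one_closed]] x
    by (simp add: xcomm E.M.minus_eq E.M.r_neg add.commute)
  \<comment> \<open>A form common to both cases: the cocycle \<beta> will be added to b0, and
    \<gamma> corrects the True part.\<close>
  have "\<exists>d'. \<exists>\<beta>\<in>K.Co E (Suc k). \<exists>\<gamma>\<in>K.Co E k. K.D E (?N + d') \<beta> = (\<lambda>_. \<zero>\<^bsub>E\<^esub>) \<and>
      (\<forall>l. x [^] d' \<odot>\<^bsub>E\<^esub> K.T E d' \<one> u l = x [^] (?N + d') \<odot>\<^bsub>E\<^esub> \<beta> l \<oplus>\<^bsub>E\<^esub> K.D E (?N + d') \<gamma> l)"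
  proof (cases k)
    \<comment> \<open>In positive degree the induction hypothesis makes u a coboundary after a
      transition, so \<beta> = 0 works.\<close>
    case (Suc j)
    obtain d' b1 where b1: "b1 \<in> K.Co E (Suc j)" "K.T E d' \<one> u = K.D E (?N + d') b1"
      using Cons.IH[of u ?N j] K.xs uC uZ Suc by (auto simp: kcocycles_def)
    have z: "(\<lambda>_. \<zero>\<^bsub>E\<^esub>) \<in> K.Co E (Suc k)" by (simp add: E.cochains_iff)
    have g: "(\<lambda>l. x [^] d' \<odot>\<^bsub>E\<^esub> b1 l) \<in> K.Co E k" using E.cochains_smult[OF b1(1), of "\<lambda>_. x [^] d'"] x Suc by simp
    show ?thesis
      by (rule exI[of _ d'], rule bexI[OF _ z], rule bexI[OF _ g])
        (use x K.Co_closed[OF Em K.D_Co[OF Em b1(1)]] in \<open>simp add: K.D_zero[OF Em] K.D_smult[OF Em b1(1)] b1(2)\<close>)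
  next
    case 0
    then obtain e where e: "e \<in> carrier E" "u = degree0 E xs e" using E.cochains_degree0 uC by metis
    have ye: "\<forall>y\<in>set xs. y [^] ?N \<odot>\<^bsub>E\<^esub> e = \<zero>\<^bsub>E\<^esub>" using uZ E.kdiff_degree0[OF e(1) K.xs] e(2) by simp
    \<comment> \<open>The annihilator of e contains y^(N+d) for all y in xs. As e' is killed by it
      too, e' gives a cocycle of degree 0.\<close>
    let ?J = "{a \<in> carrier R. a \<odot>\<^bsub>E\<^esub> e \<in> {\<zero>\<^bsub>E\<^esub>}}"
    have "(\<lambda>a. a \<odot>\<^bsub>E\<^esub> e) \<in> module_hom R (self_module R) E"
      by (rule module_homI) (use e(1) in \<open>auto simp: E.smult_l_distr E.smult_assoc1\<close>)
    moreover have "submodule {\<zero>\<^bsub>E\<^esub>} R E" by (auto simp: E.submodule_iff)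
    ultimately have "submodule {a \<in> carrier (self_module R). a \<odot>\<^bsub>E\<^esub> e \<in> {\<zero>\<^bsub>E\<^esub>}} R (self_module R)"
      by (intro submodule_vimage[OF module_self_module[OF R(1)] Em])
    then have J: "ideal ?J R" using submodule_self_iff_ideal[OF R(1)] by simp
    have xR: "x \<in> carrier R" using Cons.prems(1) by simp
    obtain m e' where e': "e' \<in> carrier E" "\<And>a. a \<in> ?J \<Longrightarrow> a \<odot>\<^bsub>E\<^esub> e' = \<zero>\<^bsub>E\<^esub>"
      and m: "x [^] (m::nat) \<odot>\<^bsub>E\<^esub> e = x [^] (m + ?N) \<odot>\<^bsub>E\<^esub> e'"
      by (rule injective_divisible[OF R E J e(1) _ xR, where n = ?N]) auto
    have ye': "y [^] (?N + m) \<odot>\<^bsub>E\<^esub> e' = \<zero>\<^bsub>E\<^esub>" if "y \<in> set xs" for y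
    proof -
      have y: "y \<in> carrier R" using that K.xs by auto
      have "y [^] ?N \<odot>\<^bsub>E\<^esub> e' = \<zero>\<^bsub>E\<^esub>" by (rule e'(2)) (use ye that y in simp)
      then have "y [^] m \<odot>\<^bsub>E\<^esub> (y [^] ?N \<odot>\<^bsub>E\<^esub> e') = \<zero>\<^bsub>E\<^esub>" using y by (simp add: E.smult_r_null)
      then show ?thesis using y e'(1) by (simp add: E.smult_assoc1[symmetric] E.nat_pow_mult add.commute)
    qed
    have \<beta>: "degree0 E xs e' \<in> K.Co E (Suc k)" using E.degree0_cochains[OF e'(1)] 0 by simp
    have \<gamma>: "(\<lambda>_. \<zero>\<^bsub>E\<^esub>) \<in> K.Co E k" by (simp add: E.cochains_iff)
    have D\<beta>: "K.D E (?N + m) (degree0 E xs e') = (\<lambda>_. \<zero>\<^bsub>E\<^esub>)"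
      using ye' by (simp add: E.kdiff_degree0[OF e'(1) K.xs])
    have eq: "x [^] m \<odot>\<^bsub>E\<^esub> K.T E m \<one> u l = x [^] (?N + m) \<odot>\<^bsub>E\<^esub> degree0 E xs e' l \<oplus>\<^bsub>E\<^esub> K.D E (?N + m) (\<lambda>_. \<zero>\<^bsub>E\<^esub>) l" for l
      unfolding e(2) E.ktrans_degree0[OF K.xs e(1) E.one_closed] K.D_zero[OF Em]
      using e(1) e'(1) x m by (simp add: degree0_def add.commute)
    show ?thesis
      by (rule exI[of _ m], rule bexI[OF _ \<beta>], rule bexI[OF _ \<gamma>]) (use D\<beta> eq in blast)
  qed
  then obtain d' \<beta> \<gamma> where \<beta>: "\<beta> \<in> K.Co E (Suc k)" "K.D E (?N + d') \<beta> = (\<lambda>_. \<zero>\<^bsub>E\<^esub>)" and \<gamma>: "\<gamma> \<in> K.Co E k"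
    and \<beta>\<gamma>: "\<And>l. x [^] d' \<odot>\<^bsub>E\<^esub> K.T E d' \<one> u l = x [^] (?N + d') \<odot>\<^bsub>E\<^esub> \<beta> l \<oplus>\<^bsub>E\<^esub> K.D E (?N + d') \<gamma> l" by blast
  let ?d = "d + d'"
  let ?B0 = "\<lambda>l. K.T E d' \<one> b0 l \<oplus>\<^bsub>E\<^esub> \<beta> l" and ?B1 = "\<lambda>l. \<zero>\<^bsub>E\<^esub> \<ominus>\<^bsub>E\<^esub> \<gamma> l"
  define b where "b l = (case l of [] \<Rightarrow> \<zero>\<^bsub>E\<^esub> | v # l' \<Rightarrow> if v then ?B1 l' else ?B0 l')" for l
  note Tb0 = K.T_Co[OF Em b0(1) E.one_closed, of d']
  have z: "(\<lambda>_. \<zero>\<^bsub>E\<^esub>) \<in> K.Co E k" by (simp add: E.cochains_iff)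
  have B: "?B0 \<in> K.Co E (Suc k)" "?B1 \<in> K.Co E k"
    using E.cochains_add[OF Tb0 \<beta>(1)] E.cochains_minus[OF z \<gamma>] by auto
  have bC: "b \<in> cochains E (x # xs) (Suc k)" using B by (simp add: E.cochains_Cons b_def)
  note cl2 = K.Co_closed[OF Em Tb0] K.Co_closed[OF Em \<beta>(1)] K.Co_closed[OF Em K.D_Co[OF Em \<gamma>]]
    K.Co_closed[OF Em K.T_Co[OF Em c01(3) E.one_closed]] K.Co_closed[OF Em K.D_Co[OF Em Tb0]]
  have False_part: "K.T E ?d \<one> ?c0 = K.D E (N + ?d) ?B0"
  proof -
    have "K.T E d' \<one> (K.T E d \<one> ?c0) = K.D E (?N + d') (K.T E d' \<one> b0)"
      unfolding b0(2) K.D_T[OF Em b0(1) E.one_closed] ..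
    then show ?thesis
      using K.T_T[OF Em c01(2) E.one_closed E.one_closed, of d' d] K.D_add[OF Em Tb0 \<beta>(1), of "?N + d'"] \<beta>(2) cl2
      by (simp add: add.assoc)
  qed
  have True_part: "x [^] ?d \<odot>\<^bsub>E\<^esub> K.T E ?d \<one> ?c1 l = x [^] (N + ?d) \<odot>\<^bsub>E\<^esub> ?B0 l \<ominus>\<^bsub>E\<^esub> K.D E (N + ?d) ?B1 l" for l
  proof -
    have "K.T E d' \<one> u l = x [^] d \<odot>\<^bsub>E\<^esub> K.T E ?d \<one> ?c1 l \<ominus>\<^bsub>E\<^esub> x [^] ?N \<odot>\<^bsub>E\<^esub> K.T E d' \<one> b0 l"
      unfolding u_def K.T_minus[OF Em p1 E.one_closed] K.T_smult[OF Em Tc1 x E.one_closed] K.T_smult[OF Em b0(1) x E.one_closed]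
      using K.T_T[OF Em c01(3) E.one_closed E.one_closed, of d' d] by simp
    then have "x [^] ?d \<odot>\<^bsub>E\<^esub> K.T E ?d \<one> ?c1 l \<ominus>\<^bsub>E\<^esub> x [^] (N + ?d) \<odot>\<^bsub>E\<^esub> K.T E d' \<one> b0 l =
        x [^] (N + ?d) \<odot>\<^bsub>E\<^esub> \<beta> l \<oplus>\<^bsub>E\<^esub> K.D E (N + ?d) \<gamma> l"
      using \<beta>\<gamma>[of l] x cl2 by (simp add: E.smult_minus xcomm add.commute add.left_commute)
    then have "x [^] ?d \<odot>\<^bsub>E\<^esub> K.T E ?d \<one> ?c1 l =
        (x [^] (N + ?d) \<odot>\<^bsub>E\<^esub> \<beta> l \<oplus>\<^bsub>E\<^esub> K.D E (N + ?d) \<gamma> l) \<oplus>\<^bsub>E\<^esub> x [^] (N + ?d) \<odot>\<^bsub>E\<^esub> K.T E d' \<one> b0 l"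
      using E.M.minus_add_cancel[of "x [^] ?d \<odot>\<^bsub>E\<^esub> K.T E ?d \<one> ?c1 l" "x [^] (N + ?d) \<odot>\<^bsub>E\<^esub> K.T E d' \<one> b0 l"] x cl2 by simp
    moreover have "K.D E (N + ?d) ?B1 l = \<ominus>\<^bsub>E\<^esub> K.D E (N + ?d) \<gamma> l"
      using cl2 unfolding K.D_minus[OF Em z \<gamma>] K.D_zero[OF Em] by (simp add: E.M.minus_eq)
    ultimately show ?thesis
      using x cl2 by (simp add: E.smult_r_distr E.M.minus_eq E.M.a_ac)
  qed
  have "ktrans R E (x # xs) ?d \<one> c l = kdiff R E (N + ?d) (x # xs) b l" for l
  proof (cases l)
    case Nil then show ?thesis using x by (simp add: ktrans_def c01(1) E.smult_r_null)
  next
    case (Cons v l')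
    show ?thesis
    proof (cases v)
      case True
      have "ktrans R E (x # xs) ?d \<one> c (True # l') = x [^] ?d \<odot>\<^bsub>E\<^esub> K.T E ?d \<one> ?c1 l'"
        using x cl E.kweight_closed[OF K.xs] by (simp add: ktrans_def E.smult_assoc1 E.m_assoc)
      then show ?thesis using True_part[of l'] Cons True by (simp add: b_def)
    next
      case False
      have "ktrans R E (x # xs) ?d \<one> c (False # l') = K.T E ?d \<one> ?c0 l'" by (simp add: ktrans_def)
      then show ?thesis using fun_cong[OF False_part, of l'] Cons False by (simp add: b_def)
    qed
  qed
  then show ?case using bC by blast
qed

section \<open>Quotients, supports and torsion\<close>

context module
begin

context
  fixes N assumes N: "submodule N R M"
begin

lemma submodule_abelian_subgroup: "abelian_subgroup N M"
proof (rule abelian_subgroupI3)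
  have "subgroup N (add_monoid M)"
    using N M.abelian_group_axioms by (simp add: submodule_def)
  then show "additive_subgroup N M" by (rule additive_subgroup.intro)
qed (rule M.abelian_group_axioms)

interpretation N: abelian_subgroup N M by (rule submodule_abelian_subgroup)

lemma coset_eq_iff:
  assumes "x \<in> carrier M" "y \<in> carrier M" shows "N +>\<^bsub>M\<^esub> x = N +>\<^bsub>M\<^esub> y \<longleftrightarrow> x \<ominus>\<^bsub>M\<^esub> y \<in> N"
proof
  assume "N +>\<^bsub>M\<^esub> x = N +>\<^bsub>M\<^esub> y"
  then have "x \<in> N +>\<^bsub>M\<^esub> y" using N.a_rcos_self[OF assms(1)] by simp
  then show "x \<ominus>\<^bsub>M\<^esub> y \<in> N" using N.a_rcos_module_imp[OF assms(2)] by (simp add: a_minus_def)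
next
  assume "x \<ominus>\<^bsub>M\<^esub> y \<in> N"
  then have "x \<in> N +>\<^bsub>M\<^esub> y" using N.a_rcos_module_rev[OF assms(2,1)] by (simp add: a_minus_def)
  then show "N +>\<^bsub>M\<^esub> x = N +>\<^bsub>M\<^esub> y" using M.a_repr_independence[OF _ assms(2) N.a_subgroup] by simp
qed

text \<open>The union in \<open>quotient_module\<close> runs over the representatives of a coset,
  all of which give the same coset.\<close>

lemma smult_coset:
  assumes "a \<in> carrier R" "x \<in> carrier M"
  shows "a \<odot>\<^bsub>quotient_module M N\<^esub> (N +>\<^bsub>M\<^esub> x) = N +>\<^bsub>M\<^esub> (a \<odot>\<^bsub>M\<^esub> x)"
proof -
  have "N +>\<^bsub>M\<^esub> (a \<odot>\<^bsub>M\<^esub> y) = N +>\<^bsub>M\<^esub> (a \<odot>\<^bsub>M\<^esub> x)" if y: "y \<in> N +>\<^bsub>M\<^esub> x" for y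
  proof -
    have yM: "y \<in> carrier M" by (rule N.a_elemrcos_carrier[OF assms(2) y])
    then have "y \<ominus>\<^bsub>M\<^esub> x \<in> N" using y N.a_rcos_module_imp[OF assms(2)] by (simp add: a_minus_def)
    then have "a \<odot>\<^bsub>M\<^esub> (y \<ominus>\<^bsub>M\<^esub> x) \<in> N" using N assms(1) by (simp add: submodule_iff)
    then show ?thesis using assms yM by (simp add: coset_eq_iff smult_minus)
  qed
  then have "(\<Union>y\<in>N +>\<^bsub>M\<^esub> x. N +>\<^bsub>M\<^esub> (a \<odot>\<^bsub>M\<^esub> y)) = (\<Union>y\<in>N +>\<^bsub>M\<^esub> x. N +>\<^bsub>M\<^esub> (a \<odot>\<^bsub>M\<^esub> x))"
    by (intro SUP_cong refl)
  moreover have "N +>\<^bsub>M\<^esub> x \<noteq> {}" using N.a_rcos_self[OF assms(2)] by blast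
  ultimately show ?thesis by (simp add: quotient_module_def)
qed

lemma quotient_module_carrier: "carrier (quotient_module M N) = (\<lambda>x. N +>\<^bsub>M\<^esub> x) ` carrier M"
  by (auto simp: quotient_module_def A_RCOSETS_def' )

lemma quotient_hom: "(\<lambda>x. N +>\<^bsub>M\<^esub> x) \<in> module_hom R M (quotient_module M N)"
proof (rule module_homI)
  show "N +>\<^bsub>M\<^esub> (x \<oplus>\<^bsub>M\<^esub> y) = (N +>\<^bsub>M\<^esub> x) \<oplus>\<^bsub>quotient_module M N\<^esub> (N +>\<^bsub>M\<^esub> y)"
    if "x \<in> carrier M" "y \<in> carrier M" for x y using that by (simp add: quotient_module_def N.a_rcos_sum)
qed (simp_all add: quotient_module_carrier smult_coset)

lemma coset_zero_iff: "x \<in> carrier M \<Longrightarrow> N +>\<^bsub>M\<^esub> x = N \<longleftrightarrow> x \<in> N"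
  using coset_eq_iff[of x "\<zero>\<^bsub>M\<^esub>"] M.a_coset_add_zero[OF N.a_subset] by (simp add: M.minus_eq M.neg_zero)

text \<open>Fractions are compared as sets of pairs. If every x is multiplied into N, each fraction
  is the set of all pairs, so there is only one; otherwise some x/1 misses the pair formed by the
  zero coset and 1.\<close>

lemma supp_quotient_iff:
  assumes P: "primeideal P R"
  shows "P \<in> supp R (quotient_module M N) \<longleftrightarrow> \<not> (\<forall>x\<in>carrier M. \<exists>t\<in>carrier R - P. t \<odot>\<^bsub>M\<^esub> x \<in> N)"
proof -
  interpret P: primeideal P R by (rule P)
  let ?Q = "quotient_module M N" and ?D = "carrier R - P"
  have one: "\<one> \<in> ?D" using P.I_notcarr P.one_imp_carrier by auto
  have Dm: "s \<otimes> t \<in> ?D" if "s \<in> ?D" "t \<in> ?D" for s t using that P.I_prime by auto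
  have zero: "\<zero>\<^bsub>?Q\<^esub> = N +>\<^bsub>M\<^esub> \<zero>\<^bsub>M\<^esub>" using coset_zero_iff[of "\<zero>\<^bsub>M\<^esub>"] N by (simp add: quotient_module_def submodule_iff)
  have zQ: "\<zero>\<^bsub>?Q\<^esub> \<in> carrier ?Q" unfolding zero quotient_module_carrier by blast
  have fr: "(N +>\<^bsub>M\<^esub> y, s') \<in> fraction R P ?Q (N +>\<^bsub>M\<^esub> x) s \<longleftrightarrow> (\<exists>t\<in>?D. t \<odot>\<^bsub>M\<^esub> (s' \<odot>\<^bsub>M\<^esub> x \<ominus>\<^bsub>M\<^esub> s \<odot>\<^bsub>M\<^esub> y) \<in> N)"
    if "x \<in> carrier M" "y \<in> carrier M" "s \<in> ?D" "s' \<in> ?D" for x y s s'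
    using that by (auto simp: fraction_def quotient_module_carrier smult_coset coset_eq_iff smult_minus)
  let ?U = "carrier ?Q \<times> ?D"
  have sub: "fraction R P ?Q m s \<subseteq> ?U" for m s by (auto simp: fraction_def)
  show ?thesis
  proof
    assume "P \<in> supp R ?Q"
    then have ne: "{fraction R P ?Q m s | m s. m \<in> carrier ?Q \<and> s \<in> ?D} \<noteq> {fraction R P ?Q \<zero>\<^bsub>?Q\<^esub> \<one>}"
      by (simp add: supp_def localized_module_def Let_def)
    show "\<not> (\<forall>x\<in>carrier M. \<exists>t\<in>?D. t \<odot>\<^bsub>M\<^esub> x \<in> N)"
    proof
      assume kill: "\<forall>x\<in>carrier M. \<exists>t\<in>?D. t \<odot>\<^bsub>M\<^esub> x \<in> N"
      have "fraction R P ?Q m s = ?U" if ms: "m \<in> carrier ?Q" "s \<in> ?D" for m s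
      proof
        obtain x where x: "x \<in> carrier M" "m = N +>\<^bsub>M\<^esub> x" using ms(1) unfolding quotient_module_carrier by blast
        show "?U \<subseteq> fraction R P ?Q m s"
        proof
          fix q assume "q \<in> ?U"
          then obtain y s' where y: "y \<in> carrier M" "s' \<in> ?D" "q = (N +>\<^bsub>M\<^esub> y, s')"
            unfolding quotient_module_carrier by blast
          have "s' \<odot>\<^bsub>M\<^esub> x \<ominus>\<^bsub>M\<^esub> s \<odot>\<^bsub>M\<^esub> y \<in> carrier M" using x y ms(2) by simp
          then show "q \<in> fraction R P ?Q m s" unfolding x(2) y(3) fr[OF x(1) y(1) ms(2) y(2)] using kill by blast
        qed
      qed (rule sub)
      then have "{fraction R P ?Q m s | m s. m \<in> carrier ?Q \<and> s \<in> ?D} = {fraction R P ?Q \<zero>\<^bsub>?Q\<^esub> \<one>}"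
        using zQ one by (intro equalityI subsetI) (simp, blast)+
      then show False using ne by blast
    qed
  next
    assume nk: "\<not> (\<forall>x\<in>carrier M. \<exists>t\<in>?D. t \<odot>\<^bsub>M\<^esub> x \<in> N)"
    then obtain x where x: "x \<in> carrier M" "\<And>t. t \<in> ?D \<Longrightarrow> t \<odot>\<^bsub>M\<^esub> x \<notin> N" by blast
    have "(N +>\<^bsub>M\<^esub> \<zero>\<^bsub>M\<^esub>, \<one>) \<in> fraction R P ?Q \<zero>\<^bsub>?Q\<^esub> \<one>"
      unfolding zero using fr[of "\<zero>\<^bsub>M\<^esub>" "\<zero>\<^bsub>M\<^esub>" \<one> \<one>] one N by (auto simp: submodule_iff smult_r_null M.minus_eq M.neg_zero)
    moreover have "(N +>\<^bsub>M\<^esub> \<zero>\<^bsub>M\<^esub>, \<one>) \<notin> fraction R P ?Q (N +>\<^bsub>M\<^esub> x) \<one>"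
      using fr[of x "\<zero>\<^bsub>M\<^esub>" \<one> \<one>] one x by (simp add: M.minus_eq M.neg_zero smult_r_null)
    ultimately have "fraction R P ?Q (N +>\<^bsub>M\<^esub> x) \<one> \<noteq> fraction R P ?Q \<zero>\<^bsub>?Q\<^esub> \<one>" by blast
    moreover have "N +>\<^bsub>M\<^esub> x \<in> carrier ?Q" using x(1) unfolding quotient_module_carrier by blast
    ultimately have "{fraction R P ?Q m s | m s. m \<in> carrier ?Q \<and> s \<in> ?D} \<noteq> {fraction R P ?Q \<zero>\<^bsub>?Q\<^esub> \<one>}"
      using one by blast
    then show "P \<in> supp R ?Q" using P by (simp add: supp_def localized_module_def Let_def spec_def)
  qed
qed

end

lemma torsion_submodule:
  assumes I: "ideal I R" shows "submodule (torsion_part R I M) R M"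
  unfolding submodule_iff
proof (intro conjI ballI)
  have car: "a \<in> carrier R" if "a \<in> ideal_pow R I n" for a n
    using ideal.Icarr[OF ideal_ideal_pow[OF I] that] .
  show "torsion_part R I M \<subseteq> carrier M" by (auto simp: torsion_part_def)
  show "\<zero>\<^bsub>M\<^esub> \<in> torsion_part R I M" using car by (auto simp: torsion_part_def smult_r_null)
  fix x y assume "x \<in> torsion_part R I M" "y \<in> torsion_part R I M"
  then obtain n k where nk: "x \<in> carrier M" "\<forall>a\<in>ideal_pow R I n. a \<odot>\<^bsub>M\<^esub> x = \<zero>\<^bsub>M\<^esub>"
    "y \<in> carrier M" "\<forall>a\<in>ideal_pow R I k. a \<odot>\<^bsub>M\<^esub> y = \<zero>\<^bsub>M\<^esub>" by (auto simp: torsion_part_def)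
  have "a \<odot>\<^bsub>M\<^esub> (x \<oplus>\<^bsub>M\<^esub> y) = \<zero>\<^bsub>M\<^esub>" if a: "a \<in> ideal_pow R I (n + k)" for a
  proof -
    have "a \<odot>\<^bsub>M\<^esub> x = \<zero>\<^bsub>M\<^esub>" "a \<odot>\<^bsub>M\<^esub> y = \<zero>\<^bsub>M\<^esub>"
      using a nk ideal_pow_antimono[OF I, of n "n + k"] ideal_pow_antimono[OF I, of k "n + k"] by auto
    then show ?thesis using nk car[OF a] by (simp add: smult_r_distr)
  qed
  then show "x \<oplus>\<^bsub>M\<^esub> y \<in> torsion_part R I M" using nk by (auto simp: torsion_part_def)
next
  fix b x assume b: "b \<in> carrier R" and "x \<in> torsion_part R I M"
  then obtain n where x: "x \<in> carrier M" "\<forall>a\<in>ideal_pow R I n. a \<odot>\<^bsub>M\<^esub> x = \<zero>\<^bsub>M\<^esub>" by (auto simp: torsion_part_def)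
  have "a \<odot>\<^bsub>M\<^esub> (b \<odot>\<^bsub>M\<^esub> x) = \<zero>\<^bsub>M\<^esub>" if a: "a \<in> ideal_pow R I n" for a
  proof -
    have "a \<odot>\<^bsub>M\<^esub> (b \<odot>\<^bsub>M\<^esub> x) = b \<odot>\<^bsub>M\<^esub> (a \<odot>\<^bsub>M\<^esub> x)"
      using b x ideal.Icarr[OF ideal_ideal_pow[OF I] a] by (simp add: smult_assoc1[symmetric] m_comm)
    then show ?thesis using x a b by (simp add: smult_r_null)
  qed
  then show "b \<odot>\<^bsub>M\<^esub> x \<in> torsion_part R I M" using x b by (auto simp: torsion_part_def)
qed

end

lemma torsion_part_hom:
  assumes "module R M" "module R L" "h \<in> module_hom R M L" "ideal I R" "x \<in> torsion_part R I M"
  shows "h x \<in> torsion_part R I L"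
proof -
  interpret M: module R M by fact
  obtain n where x: "x \<in> carrier M" "\<forall>a\<in>ideal_pow R I n. a \<odot>\<^bsub>M\<^esub> x = \<zero>\<^bsub>M\<^esub>"
    using assms(5) by (auto simp: torsion_part_def)
  have "a \<odot>\<^bsub>L\<^esub> h x = \<zero>\<^bsub>L\<^esub>" if a: "a \<in> ideal_pow R I n" for a
    using module_hom_smult[OF assms(3) ideal.Icarr[OF M.ideal_ideal_pow[OF assms(4)] a] x(1)] x(2) a
      module_hom_zero[OF assms(1-3)] by simp
  then show ?thesis using module_hom_closed[OF assms(3) x(1)] by (auto simp: torsion_part_def)
qed

text \<open>In characteristic p the a with a^(p^j) e = 0 form an ideal. For j = N it contains the
  generators of I because p^N is at least N. So the p^N-th powers of all elements of I kill e, and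
  \<open>ideal_pow_subset\<close> turns this into a power of I.\<close>

lemma (in koszul) torsion_part_iff:
  assumes M: "module R M" and p: "char_p R p" and nR: "noetherian_ring R" and I: "I = Idl (set xs)"
  shows "e \<in> torsion_part R I M \<longleftrightarrow> e \<in> carrier M \<and> (\<exists>N::nat. degree0 M xs e \<in> Z M N (Suc 0))"
proof -
  interpret M: module R M by fact
  interpret p: char_p R p by fact
  have Ii: "ideal I R" unfolding I by (rule genideal_ideal[OF xs])
  have Z0: "degree0 M xs e \<in> Z M N (Suc 0) \<longleftrightarrow> (\<forall>y\<in>set xs. y [^] N \<odot>\<^bsub>M\<^esub> e = \<zero>\<^bsub>M\<^esub>)" if "e \<in> carrier M" for N
    using that M.degree0_cochains M.kdiff_degree0[OF _ xs] by (simp add: Z_iff)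
  show ?thesis
  proof
    assume "e \<in> torsion_part R I M"
    then obtain n where e: "e \<in> carrier M" "\<forall>a\<in>ideal_pow R I n. a \<odot>\<^bsub>M\<^esub> e = \<zero>\<^bsub>M\<^esub>" by (auto simp: torsion_part_def)
    have "y [^] n \<odot>\<^bsub>M\<^esub> e = \<zero>\<^bsub>M\<^esub>" if "y \<in> set xs" for y
    proof -
      have "y \<in> I" using genideal_self[OF xs] that unfolding I by (rule subsetD)
      then show ?thesis using e(2) ideal_pow_elem[OF Ii] by simp
    qed
    then show "e \<in> carrier M \<and> (\<exists>N. degree0 M xs e \<in> Z M N (Suc 0))" using e(1) Z0 by blast
  next
    assume "e \<in> carrier M \<and> (\<exists>N. degree0 M xs e \<in> Z M N (Suc 0))"
    then obtain N :: nat where e: "e \<in> carrier M" "\<And>y. y \<in> set xs \<Longrightarrow> y [^] N \<odot>\<^bsub>M\<^esub> e = \<zero>\<^bsub>M\<^esub>" using Z0 by blast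
    let ?q = "p ^ N"
    have "N < ?q" using prime_gt_1_nat[OF p.prime_p] by (simp add: power_gt_expt)
    then obtain i where i: "?q = i + N" by (metis add.commute less_imp_add_positive)
    have ann: "ideal {a \<in> carrier R. a [^] (p ^ j) \<odot>\<^bsub>M\<^esub> e = \<zero>\<^bsub>M\<^esub>} R" for j
      unfolding submodule_self_iff_ideal[OF is_cring, symmetric] S.submodule_iff
    proof (intro conjI ballI)
      show "\<zero>\<^bsub>S\<^esub> \<in> {a \<in> carrier R. a [^] (p ^ j) \<odot>\<^bsub>M\<^esub> e = \<zero>\<^bsub>M\<^esub>}"
        using prime_gt_0_nat[OF p.prime_p] e(1) by (simp add: nat_pow_zero)
    next
      fix a b assume "b \<in> {a \<in> carrier R. a [^] (p ^ j) \<odot>\<^bsub>M\<^esub> e = \<zero>\<^bsub>M\<^esub>}" "a \<in> carrier R"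
      then show "a \<odot>\<^bsub>S\<^esub> b \<in> {a \<in> carrier R. a [^] (p ^ j) \<odot>\<^bsub>M\<^esub> e = \<zero>\<^bsub>M\<^esub>}"
        using e(1) by (simp add: nat_pow_distrib M.smult_assoc1 M.smult_r_null)
    qed (use e(1) in \<open>auto simp: p.frob_add M.smult_l_distr\<close>)
    have "set xs \<subseteq> {a \<in> carrier R. a [^] ?q \<odot>\<^bsub>M\<^esub> e = \<zero>\<^bsub>M\<^esub>}"
    proof
      fix y assume y: "y \<in> set xs"
      then have "y \<in> carrier R" using xs by blast
      then show "y \<in> {a \<in> carrier R. a [^] ?q \<odot>\<^bsub>M\<^esub> e = \<zero>\<^bsub>M\<^esub>}"
        using e(2)[OF y] e(1) unfolding i by (simp add: nat_pow_mult[symmetric] M.smult_assoc1 M.smult_r_null)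
    qed
    then have "I \<subseteq> {a \<in> carrier R. a [^] ?q \<odot>\<^bsub>M\<^esub> e = \<zero>\<^bsub>M\<^esub>}" unfolding I by (rule genideal_minimal[OF ann])
    \<comment> \<open>At j = 0 the ideal of \<open>ann\<close> is the annihilator of e
      itself.\<close>
    then have rad: "\<exists>n::nat. x [^] n \<in> {a \<in> carrier R. a [^] (p ^ 0) \<odot>\<^bsub>M\<^esub> e = \<zero>\<^bsub>M\<^esub>}" if "x \<in> I" for x
      using that by (intro exI[of _ ?q]) auto
    obtain c where "ideal_pow R I c \<subseteq> {a \<in> carrier R. a [^] (p ^ 0) \<odot>\<^bsub>M\<^esub> e = \<zero>\<^bsub>M\<^esub>}"
      by (rule ideal_pow_subset[OF nR Ii ann rad])
    then have "\<forall>a\<in>ideal_pow R I c. a \<odot>\<^bsub>M\<^esub> e = \<zero>\<^bsub>M\<^esub>" by auto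
    then show "e \<in> torsion_part R I M" using e(1) by (auto simp: torsion_part_def)
  qed
qed

text \<open>As the cohomology of B vanishes in degree k, \<alpha> is trivially onto there, and
  \<open>vanishes_quotient\<close> applies.\<close>

lemma (in koszul_exact) surj_at_iff_vanishes:
  assumes B: "\<And>N c. c \<in> Z B N (Suc k) \<Longrightarrow> \<exists>d. \<exists>b\<in>Co B k. T B d \<one> c = D B (N + d) b"
  shows "surj_at P B C \<beta> k \<longleftrightarrow> vanishes_at P C k"
proof
  assume surj: "surj_at P B C \<beta> k"
  have "surj_at P A B \<alpha> k" unfolding surj_at_def
  proof (intro allI ballI)
    fix N c assume "c \<in> Z B N (Suc k)"
    then obtain d b where b: "b \<in> Co B k" "T B d \<one> c = D B (N + d) b" using B by blast
    have z: "(\<lambda>_. \<zero>\<^bsub>A\<^esub>) \<in> Z A (N + d) (Suc k)" by (simp add: Z_iff D_zero[OF mA] mA.cochains_iff)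
    have t: "\<one> \<in> carrier R - P" using P.I_notcarr P.one_imp_carrier by auto
    have eq: "T B d \<one> c = (\<lambda>l. \<alpha> \<zero>\<^bsub>A\<^esub> \<oplus>\<^bsub>B\<^esub> D B (N + d) b l)"
      using B_rules(4)[OF D_Co[OF mB b(1)]] by (simp add: module_hom_zero[OF mA mB \<alpha>] b(2))
    show "\<exists>t\<in>carrier R - P. \<exists>d. \<exists>z\<in>Z A (N + d) (Suc k). \<exists>b\<in>Co B k. T B d t c = (\<lambda>l. \<alpha> (z l) \<oplus>\<^bsub>B\<^esub> D B (N + d) b l)"
      by (rule bexI[OF _ t], rule exI[of _ d], rule bexI[OF _ z], rule bexI[OF _ b(1)], rule eq)
  qed
  then show "vanishes_at P C k" by (rule vanishes_quotient[OF _ inj_of_surj[OF surj]])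
qed (rule surj_at_vanishes)

context koszul
begin

text \<open>In this form \<open>surj_at_0_iff\<close> also covers local cohomology in degree 0,
  where the coboundaries are zero.\<close>

lemma vanishes_at_iff_surj:
  assumes M: "module R M" shows "vanishes_at P M k \<longleftrightarrow> surj_at P M M (\<lambda>_. \<zero>\<^bsub>M\<^esub>) k"
proof -
  interpret M: module R M by fact
  have z: "(\<lambda>_. \<zero>\<^bsub>M\<^esub>) \<in> Z M N (Suc k)" for N by (simp add: Z_iff D_zero[OF M] M.cochains_iff)
  have "(\<exists>b\<in>Co M k. T M d t c = D M (N + d) b) \<longleftrightarrow> (\<exists>z\<in>Z M (N + d) (Suc k). \<exists>b\<in>Co M k.
      T M d t c = (\<lambda>l. \<zero>\<^bsub>M\<^esub> \<oplus>\<^bsub>M\<^esub> D M (N + d) b l))" for t d N c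
    using z[of "N + d"] Co_closed[OF M D_Co[OF M]] by (auto cong: bex_cong)
  then show ?thesis by (simp add: vanishes_at_def surj_at_def)
qed

text \<open>In degree 0 there are no coboundaries, and by \<open>torsion_part_iff\<close> the
  colimit of the cocycles is the I-torsion.\<close>

lemma surj_at_0_iff:
  assumes A: "module R A" and B: "module R B" and h: "h \<in> module_hom R A B"
    and p: "char_p R p" and nR: "noetherian_ring R" and I: "I = Idl (set xs)"
  shows "surj_at P A B h 0 \<longleftrightarrow>
    (\<forall>z\<in>torsion_part R I B. \<exists>t\<in>carrier R - P. \<exists>y\<in>torsion_part R I A. t \<odot>\<^bsub>B\<^esub> z = h y)"
proof -
  interpret A: module R A by fact
  interpret B: module R B by fact
  note torA = torsion_part_iff[OF A p nR I] and torB = torsion_part_iff[OF B p nR I]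
  have hdeg: "(\<lambda>l. h (degree0 A xs y l) \<oplus>\<^bsub>B\<^esub> D B N (\<lambda>_. \<zero>\<^bsub>B\<^esub>) l) = degree0 B xs (h y)" if "y \<in> carrier A" for y N
    using that module_hom_zero[OF A B h] module_hom_closed[OF h] by (auto simp: degree0_def D_zero[OF B])
  have deg_inj: "degree0 B xs u = degree0 B xs v \<longleftrightarrow> u = v" for u v
    by (metis degree0_def)
  show ?thesis
  proof (intro iffI ballI)
    fix z assume surj: "surj_at P A B h 0" and "z \<in> torsion_part R I B"
    then obtain N :: nat where z: "z \<in> carrier B" "degree0 B xs z \<in> Z B N (Suc 0)" using torB by blast
    then obtain t d y b where t: "t \<in> carrier R - P" and y: "y \<in> Z A (N + d) (Suc 0)" and b: "b \<in> Co B 0"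
      "T B d t (degree0 B xs z) = (\<lambda>l. h (y l) \<oplus>\<^bsub>B\<^esub> D B (N + d) b l)"
      using surj[unfolded surj_at_def] by blast
    obtain y' where y': "y' \<in> carrier A" "y = degree0 A xs y'" using y A.cochains_degree0 by (auto simp: Z_iff)
    have "degree0 B xs (t \<odot>\<^bsub>B\<^esub> z) = degree0 B xs (h y')"
      using b(2) b(1)[unfolded B.cochains_0] hdeg[OF y'(1), of "N + d"] B.ktrans_degree0[OF xs z(1), of t d] t y'(2) by auto
    then have "t \<odot>\<^bsub>B\<^esub> z = h y'" by (simp add: deg_inj)
    moreover have "y' \<in> torsion_part R I A" using torA y y' by blast
    ultimately show "\<exists>t\<in>carrier R - P. \<exists>y\<in>torsion_part R I A. t \<odot>\<^bsub>B\<^esub> z = h y" using t by blast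
  next
    assume R: "\<forall>z\<in>torsion_part R I B. \<exists>t\<in>carrier R - P. \<exists>y\<in>torsion_part R I A. t \<odot>\<^bsub>B\<^esub> z = h y"
    show "surj_at P A B h 0" unfolding surj_at_def
    proof (intro allI ballI)
      fix N c assume c: "c \<in> Z B N (Suc 0)"
      then obtain z where z: "z \<in> carrier B" "c = degree0 B xs z" using B.cochains_degree0 by (auto simp: Z_iff)
      then have "z \<in> torsion_part R I B" using torB c by blast
      then obtain t y where t: "t \<in> carrier R - P" and y: "y \<in> torsion_part R I A" "t \<odot>\<^bsub>B\<^esub> z = h y" using R by blast
      obtain N' :: nat where y': "y \<in> carrier A" "degree0 A xs y \<in> Z A N' (Suc 0)" using torA y(1) by blast
      \<comment> \<open>The two cocycles live at levels N and N'; the sum of the levels serves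
        both.\<close>
      have yZ: "degree0 A xs y \<in> Z A (N + N') (Suc 0)"
        using T_Z[OF A y'(2) one_closed, of N] A.ktrans_degree0[OF xs y'(1) one_closed, of N] y'(1) by (simp add: add.commute)
      have zero: "(\<lambda>_. \<zero>\<^bsub>B\<^esub>) \<in> Co B 0" by (simp add: B.cochains_0)
      have eq: "T B N' t c = (\<lambda>l. h (degree0 A xs y l) \<oplus>\<^bsub>B\<^esub> D B (N + N') (\<lambda>_. \<zero>\<^bsub>B\<^esub>) l)"
        using B.ktrans_degree0[OF xs z(1), of t N'] t y(2) z(2) hdeg[OF y'(1), of "N + N'"] by simp
      show "\<exists>t\<in>carrier R - P. \<exists>d. \<exists>z\<in>Z A (N + d) (Suc 0). \<exists>b\<in>Co B 0. T B d t c = (\<lambda>l. h (z l) \<oplus>\<^bsub>B\<^esub> D B (N + d) b l)"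
        by (rule bexI[OF _ t], rule exI[of _ N'], rule bexI[OF _ yZ], rule bexI[OF _ zero], rule eq)
    qed
  qed
qed

end

section \<open>Local cohomology of R/fR from an injective resolution\<close>

lemma submodule_restrict:
  assumes "module R M" "submodule K R M" "submodule H R M" "H \<subseteq> K"
  shows "submodule H R (M\<lparr>carrier := K\<rparr>)"
  using assms(3,4) unfolding module.submodule_iff[OF assms(1)]
    module.submodule_iff[OF submodule.submodule_is_module[OF assms(2,1)]] by simp

locale koszul_resolution = koszul R xs for R :: "('a, 'r) ring_scheme" (structure) and xs +
  fixes p I f P \<epsilon> and E :: "nat \<Rightarrow> ('a, 'b) module" and d
  assumes p: "char_p R p" and nR: "noetherian_ring R" and I: "I = Idl (set xs)"
    and f: "f \<in> carrier R" "\<forall>x\<in>carrier R. f \<otimes> x = \<zero> \<longrightarrow> x = \<zero>" and P: "primeideal P R"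
    and res: "injective_resolution R (quotient_module (self_module R) (PIdl f)) \<epsilon> E d"
begin

text \<open>The cosyzygies: the kernel of d b is also the image of the preceding differential for b
  > 0, and the image of R/fR under \<epsilon> for b = 0.\<close>

abbreviation C :: "nat \<Rightarrow> ('a, 'b) module" where
  "C b \<equiv> E b\<lparr>carrier := {x \<in> carrier (E b). d b x = \<zero>\<^bsub>E (Suc b)\<^esub>}\<rparr>"

lemma E_injective: "injective_module R (E b)" and E_module: "module R (E b)" and d_hom: "d b \<in> module_hom R (E b) (E (Suc b))"
  and d_image: "d b ` carrier (E b) = carrier (C (Suc b))"
  using res by (auto simp: injective_resolution_def injective_module_def)

lemma I_ideal: "ideal I R" unfolding I by (rule genideal_ideal[OF xs])

lemma C_module: "module R (C b)"
proof -
  interpret L: module R "E (Suc b)" by (rule E_module)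
  have "submodule {\<zero>\<^bsub>E (Suc b)\<^esub>} R (E (Suc b))" by (auto simp: L.submodule_iff)
  from submodule_vimage[OF E_module E_module d_hom this]
  show ?thesis using submodule.submodule_is_module[OF _ E_module] by simp
qed

lemma d_hom_C: "d b \<in> module_hom R (E b) (C (Suc b))"
  by (rule module_homI) (use d_image[of b] module_hom_add[OF d_hom] module_hom_smult[OF d_hom] in auto)

lemma exact_E: "koszul_exact R xs (C b) (E b) (C (Suc b)) (\<lambda>x. x) (d b) P"
proof (intro koszul_exact.intro koszul_axioms koszul_exact_axioms.intro C_module E_module d_hom_C P)
  show "(\<lambda>x. x) \<in> module_hom R (C b) (E b)" by (rule module_homI) auto
  show "{x \<in> carrier (E b). d b x = \<zero>\<^bsub>C (Suc b)\<^esub>} = (\<lambda>x. x) ` carrier (C b)" by simp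
qed (use d_image[of b] in simp_all)

lemma E_acyclic: "c \<in> Z (E b) N (Suc (Suc k)) \<Longrightarrow> \<exists>d. \<exists>b'\<in>Co (E b) (Suc k). T (E b) d \<one> c = D (E b) (N + d) b'"
  by (rule injective_acyclic[OF is_cring nR E_injective xs])

text \<open>The sequences 0 -> C b -> E b -> C (b + 1) -> 0 have middle terms that are acyclic in
  positive degrees, so each lowers the degree by one. From degree 1 to degree 0 only surjectivity of
  d j remains of the vanishing, since E j may have cohomology in degree 0.\<close>

lemma vanishes_shift: "vanishes_at P (C 0) (Suc j) \<longleftrightarrow> surj_at P (E j) (C (Suc j)) (d j) 0"
proof -
  have sub: "vanishes_at P (C b) (Suc k) \<longleftrightarrow> surj_at P (E b) (C (Suc b)) (d b) k" for b k
    by (rule koszul_exact.submodule_vanishes_iff[OF exact_E E_acyclic])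
  have step: "vanishes_at P (C b) (Suc (Suc k)) \<longleftrightarrow> vanishes_at P (C (Suc b)) (Suc k)" for b k
    unfolding sub[of b] by (rule koszul_exact.surj_at_iff_vanishes[OF exact_E E_acyclic])
  have "vanishes_at P (C b) (Suc j) \<longleftrightarrow> vanishes_at P (C (b + j)) (Suc 0)" for b j
    by (induction j arbitrary: b) (simp_all add: step)
  from this[of 0 j] show ?thesis using sub[of j 0] by simp
qed

lemma torsion_cocycles_eq: "torsion_cocycles R I E d i = torsion_part R I (C i)"
  by (auto simp: torsion_cocycles_def torsion_part_def)

text \<open>The torsion cocycles are the torsion of C i, since C i is the kernel of d i. For i > 0
  the coboundaries are the image of the torsion of E (i - 1), so local cohomology is the cokernel to
  which \<open>vanishes_shift\<close> reduces.\<close>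

lemma supp_iff_vanishes: "P \<in> supp R (local_cohomology R I i E d) \<longleftrightarrow> \<not> vanishes_at P (C 0) i"
proof -
  interpret Ci: module R "C i" by (rule C_module)
  note tor = Ci.torsion_submodule[OF I_ideal]
  let ?N = "torsion_coboundaries R I E d i" and ?M = "C i\<lparr>carrier := torsion_part R I (C i)\<rparr>"
  have Mm: "module R ?M" by (rule submodule.submodule_is_module[OF tor C_module])
  have "submodule ?N R (C i) \<and> ?N \<subseteq> torsion_part R I (C i) \<and>
      (vanishes_at P (C 0) i \<longleftrightarrow> (\<forall>z\<in>torsion_part R I (C i). \<exists>t\<in>carrier R - P. t \<odot>\<^bsub>E i\<^esub> z \<in> ?N))"
  proof (cases i)
    case 0
    have zero: "submodule {\<zero>\<^bsub>E i\<^esub>} R (C i)" "\<zero>\<^bsub>E i\<^esub> \<in> torsion_part R I (C i)"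
      using tor Ci.smult_r_null Ci.M.zero_closed Ci.M.l_zero[OF Ci.M.zero_closed] unfolding Ci.submodule_iff by auto
    have "(\<lambda>_. \<zero>\<^bsub>C 0\<^esub>) \<in> module_hom R (C 0) (C 0)"
      by (rule module_homI) (use Ci.smult_r_null Ci.M.zero_closed Ci.M.l_zero[OF Ci.M.zero_closed] 0 in auto)
    from surj_at_0_iff[OF C_module C_module this p nR I, of P]
    have "vanishes_at P (C 0) 0 \<longleftrightarrow> (\<forall>z\<in>torsion_part R I (C 0). \<exists>t\<in>carrier R - P. t \<odot>\<^bsub>E 0\<^esub> z = \<zero>\<^bsub>E 0\<^esub>)"
      using zero(2) unfolding vanishes_at_iff_surj[OF C_module] 0 by auto
    then show ?thesis using zero unfolding 0 by simp
  next
    case (Suc j)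
    have "submodule ?N R (C i)" unfolding Suc torsion_coboundaries.simps
      by (rule submodule_image[OF E_module C_module d_hom_C module.torsion_submodule[OF E_module I_ideal]])
    moreover have "?N \<subseteq> torsion_part R I (C i)"
      unfolding Suc torsion_coboundaries.simps using torsion_part_hom[OF E_module C_module d_hom_C I_ideal] by blast
    moreover have "vanishes_at P (C 0) i \<longleftrightarrow> (\<forall>z\<in>torsion_part R I (C i). \<exists>t\<in>carrier R - P. t \<odot>\<^bsub>E i\<^esub> z \<in> ?N)"
      unfolding Suc vanishes_shift surj_at_0_iff[OF E_module C_module d_hom_C p nR I] by (auto simp: image_iff)
    ultimately show ?thesis by blast
  qed
  then have N: "submodule ?N R ?M"
    and van: "vanishes_at P (C 0) i \<longleftrightarrow> (\<forall>z\<in>torsion_part R I (C i). \<exists>t\<in>carrier R - P. t \<odot>\<^bsub>E i\<^esub> z \<in> ?N)"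
    using submodule_restrict[OF C_module tor] by auto
  have "local_cohomology R I i E d = quotient_module ?M ?N"
    by (simp add: local_cohomology_def torsion_cocycles_eq)
  then show ?thesis using module.supp_quotient_iff[OF Mm N P] van by simp
qed

text \<open>Multiplication by f is injective because f is a nonzerodivisor, and \<epsilon>
  identifies its cokernel R/fR with C 0.\<close>

lemma exact_R: "koszul_exact R xs S S (C 0) (\<lambda>x. f \<otimes> x) (\<lambda>x. \<epsilon> (PIdl f +>\<^bsub>S\<^esub> x)) P"
proof -
  let ?N = "PIdl f"
  let ?Q = "quotient_module S ?N"
  have N: "submodule ?N R S" using cgenideal_ideal[OF f(1)] submodule_self_iff_ideal[OF is_cring] by blast
  have Qm: "module R ?Q" and \<epsilon>: "\<epsilon> \<in> module_hom R ?Q (E 0)" and inj: "inj_on \<epsilon> (carrier ?Q)"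
    and im: "\<epsilon> ` carrier ?Q = carrier (C 0)" using res by (auto simp: injective_resolution_def)
  have \<epsilon>C: "\<epsilon> \<in> module_hom R ?Q (C 0)"
    by (rule module_homI) (use im module_hom_add[OF \<epsilon>] module_hom_smult[OF \<epsilon>] in auto)
  have zQ: "\<zero>\<^bsub>?Q\<^esub> = ?N" by (simp add: quotient_module_def)
  interpret Q: module R ?Q by (rule Qm)
  have cosets: "(\<lambda>x. ?N +>\<^bsub>S\<^esub> x) ` carrier R = carrier ?Q" using S.quotient_module_carrier[OF N] by simp
  have ker: "\<epsilon> (?N +>\<^bsub>S\<^esub> x) = \<zero>\<^bsub>E 0\<^esub> \<longleftrightarrow> x \<in> ?N" if x: "x \<in> carrier R" for x
  proof -
    have "?N +>\<^bsub>S\<^esub> x \<in> carrier ?Q" using cosets x by blast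
    then have "\<epsilon> (?N +>\<^bsub>S\<^esub> x) = \<epsilon> \<zero>\<^bsub>?Q\<^esub> \<longleftrightarrow> ?N +>\<^bsub>S\<^esub> x = ?N"
      using inj_on_eq_iff[OF inj _ Q.M.zero_closed] by (simp add: zQ)
    then show ?thesis using module_hom_zero[OF Qm E_module \<epsilon>] S.coset_zero_iff[OF N, of x] x by simp
  qed
  show ?thesis
  proof (intro koszul_exact.intro koszul_axioms koszul_exact_axioms.intro S_module C_module P)
    show "(\<lambda>x. f \<otimes> x) \<in> module_hom R S S" by (rule module_homI) (use f in \<open>auto simp: r_distr m_lcomm\<close>)
    show "(\<lambda>x. \<epsilon> (?N +>\<^bsub>S\<^esub> x)) \<in> module_hom R S (C 0)" by (rule module_hom_comp[OF S.quotient_hom[OF N] \<epsilon>C])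
    show "inj_on (\<lambda>x. f \<otimes> x) (carrier S)"
    proof (rule inj_onI)
      fix x y assume xy: "x \<in> carrier S" "y \<in> carrier S" "f \<otimes> x = f \<otimes> y"
      then have "f \<otimes> (x \<ominus> y) = \<zero>" using f(1) by (simp add: a_minus_def r_distr r_minus r_neg)
      then have "x \<ominus> y = \<zero>" using f(2) xy by simp
      then show "x = y" using minus_eq_zero_iff[of x y] xy by simp
    qed
    show "(\<lambda>x. \<epsilon> (?N +>\<^bsub>S\<^esub> x)) ` carrier S = carrier (C 0)" using im cosets by (simp add: image_image[symmetric])
    show "{x \<in> carrier S. \<epsilon> (?N +>\<^bsub>S\<^esub> x) = \<zero>\<^bsub>C 0\<^esub>} = (\<lambda>x. f \<otimes> x) ` carrier S"
      using ker f(1) by (auto simp: cgenideal_def m_comm)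
  qed
qed

lemma supp_iff: "P \<in> supp R (local_cohomology R I i E d) \<longleftrightarrow>
    \<not> (surj_at P S S (\<lambda>x. f \<otimes> x) i \<and> inj_at P S S (\<lambda>x. f \<otimes> x) (Suc i))"
  unfolding supp_iff_vanishes koszul_exact.quotient_vanishes_iff[OF exact_R] ..

end

theorem theorem6p11:
  fixes R :: "('a, 'r) ring_scheme" and p i :: nat and f :: 'a and I :: "'a set"
    and \<epsilon> :: "'a set \<Rightarrow> 'b" and E :: "nat \<Rightarrow> ('a, 'b) module" and d :: "nat \<Rightarrow> 'b \<Rightarrow> 'b"
  assumes "prime p"
    and "CL_FFRT p R"
    and "f \<in> carrier R"
    and "\<forall>x\<in>carrier R. f \<otimes>\<^bsub>R\<^esub> x = \<zero>\<^bsub>R\<^esub> \<longrightarrow> x = \<zero>\<^bsub>R\<^esub>"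
    and "ideal I R"
    and "injective_resolution R (quotient_module (self_module R) (PIdl\<^bsub>R\<^esub> f)) \<epsilon> E d"
  shows "closedin (zariski R) (supp R (local_cohomology R I i E d))"
proof -
  have ff: "F_finite p R" "noetherian_ring R" using assms(2) by (auto simp: CL_FFRT_def F_finite_def)
  interpret cring R using ff(1) by (simp add: F_finite_def)
  obtain A where "A \<subseteq> carrier R" "finite A" "I = Idl\<^bsub>R\<^esub> A"
    using noetherian_ring.finetely_gen[OF ff(2) assms(5)] by blast
  then obtain xs where xs: "set xs \<subseteq> carrier R" "I = Idl\<^bsub>R\<^esub> (set xs)" using finite_list by metis
  interpret K: koszul R xs by unfold_locales (rule xs)
  \<comment> \<open>The primes outside the support, in terms that involve only R and f.\<close>
  define good where "good P \<longleftrightarrow> K.surj_at P K.S K.S (\<lambda>x. f \<otimes>\<^bsub>R\<^esub> x) i \<and> K.inj_at P K.S K.S (\<lambda>x. f \<otimes>\<^bsub>R\<^esub> x) (Suc i)" for P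
  have supp: "P \<in> supp R (local_cohomology R I i E d) \<longleftrightarrow> primeideal P R \<and> \<not> good P" for P
  proof (cases "primeideal P R")
    case True
    have "koszul_resolution R xs p I f P \<epsilon> E d"
      by (intro koszul_resolution.intro K.koszul_axioms koszul_resolution_axioms.intro F_finite_char_p ff assms xs(2) True)
    from koszul_resolution.supp_iff[OF this] show ?thesis using True by (simp add: good_def)
  qed (simp add: supp_def spec_def)
  have open_good: "\<exists>g\<in>carrier R - P. \<forall>Q. primeideal Q R \<longrightarrow> g \<notin> Q \<longrightarrow> good Q" if P: "primeideal P R" "good P" for P
  proof -
    interpret P: primeideal P R by (rule P)
    obtain g g' where g: "g \<in> carrier R - P" "\<And>Q. primeideal Q R \<Longrightarrow> g \<notin> Q \<Longrightarrow> K.surj_at Q K.S K.S (\<lambda>x. f \<otimes>\<^bsub>R\<^esub> x) i"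
      and g': "g' \<in> carrier R - P" "\<And>Q. primeideal Q R \<Longrightarrow> g' \<notin> Q \<Longrightarrow> K.inj_at Q K.S K.S (\<lambda>x. f \<otimes>\<^bsub>R\<^esub> x) (Suc i)"
      using K.surj_at_open[OF assms(1,2) P(1) assms(3), of i] K.inj_at_open[OF assms(1,2) P(1) assms(3), of "Suc i"] P(2)
      unfolding good_def by metis
    have "good Q" if Q: "primeideal Q R" "g \<otimes>\<^bsub>R\<^esub> g' \<notin> Q" for Q
    proof -
      interpret Q: ideal Q R by (rule primeideal.axioms(1)[OF Q(1)])
      have "g \<notin> Q" "g' \<notin> Q" using Q(2) g(1) g'(1) Q.I_l_closed Q.I_r_closed by auto
      then show ?thesis using g(2) g'(2) Q(1) by (simp add: good_def)
    qed
    moreover have "g \<otimes>\<^bsub>R\<^esub> g' \<in> carrier R - P" using g(1) g'(1) P.I_prime by auto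
    ultimately show ?thesis by blast
  qed
  \<comment> \<open>The g whose basic open set misses the support. By \<open>open_good\<close> these
    sets cover its complement, so the support is the zero locus of \<open>?E\<close>.\<close>
  let ?E = "{g \<in> carrier R. \<forall>Q. primeideal Q R \<longrightarrow> g \<notin> Q \<longrightarrow> good Q}"
  have "P \<in> supp R (local_cohomology R I i E d) \<longleftrightarrow> P \<in> zero_locus R ?E" for P
    unfolding supp zero_locus_def spec_def using open_good[of P] by auto
  then have "supp R (local_cohomology R I i E d) = zero_locus R ?E" by blast
  then show ?thesis unfolding closedin_zariski_iff[OF is_cring] by (intro exI[of _ ?E]) auto
qed

end
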